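(* Consider partial differential equations for a real function $u(x,t)$ of the form $$u_t-u_{xxt}=\lambda u u_{xxx}+G(u,u_x,u_{xx}),\qquad \lambda\in\mathbb{R},\qquad (T)$$ which describe pseudospherical surfaces with associated 1-forms $\omega_i=f_{i1}dx+f_{i2}dt$, $1\le i\le 3$, satisfying $$f_{p1}=\mu_p f_{11}+\eta_p,\qquad \mu_p,\eta_p\in\mathbb{R},\qquad p=2,3. \qquad (C)$$ Except for the two families of third order equations of the form $$u_t-u_{xxt}=\frac{1}{h'}(m\psi+\psi_x),\qquad m\in\mathbb{R}\setminus\{0\}, \qquad (A)$$ where $\psi(u,u_x)\neq 0$ and $h(u-u_{xx})$ are differentiable functions with $h'\neq0$, and $$u_t-u_{xxt}=\lambda u u_{xxx}+\frac{1}{h'}\bigl[m_1\psi+\psi_x-\lambda u u_x h'-(\lambda u_x+\lambda m_1 u+m_2)h\bigr], \qquad (B)$$ where $\lambda,m_1,m_2\in\mathbb{R}$, $(\lambda m_1)^2+m_2^2\neq0$, and $\psi(u,u_x)$, $h(u-u_{xx})$ are differentiable functions with $h'\neq0$, there exists no third order equation of type (T) describing pseudospherical surfaces under condition (C) with the property that the coefficients $a,b,c$ of the second fundamental forms of the local isometric immersions into $\mathbf{E}^3$ of the surfaces associated to the solutions $u$ of the equation depend on a jet of finite order of $u$. Moreover, the coefficients (depending on a jet of finite order of $u$) of the second fundamental forms of the local isometric immersions of the surfaces determined by the solutions $u$ of (A) or (B) are universal, i.e., they are functions of $x$ and $t$ only, independent of $u$.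
   Context: Subscripts on $u$ denote partial derivatives; $\psi_x=\psi_u u_x+\psi_{u_x}u_{xx}$ is the total $x$-derivative of $\psi(u,u_x)$, and $h'$ is the derivative of $h$ with respect to its single argument $u-u_{xx}$. An equation for $u(x,t)$ describes pseudospherical surfaces, with associated 1-forms $\omega_i=f_{i1}dx+f_{i2}dt$ ($1\le i\le3$), if the structure equations $d\omega_1=\omega_3\wedge\omega_2$, $d\omega_2=\omega_1\wedge\omega_3$, $d\omega_3=\omega_1\wedge\omega_2$ are satisfied if and only if $u$ is a smooth solution of the equation with $\omega_1\wedge\omega_2\neq0$. Here the $f_{ij}$ are smooth real functions of $u$ and finitely many of its $x$-derivatives, and $G$ is not identically zero. Each such solution determines the metric $(\omega_1)^2+(\omega_2)^2$ of Gaussian curvature $-1$, with Levi-Civita connection form $\omega_{12}=\omega_3$ (and $\omega_{21}=-\omega_3$). The coefficients $a,b,c$ of the second fundamental form of a local isometric immersion of this surface into Euclidean space $\mathbf{E}^3$ are defined by $\omega_{13}=a\omega_1+b\omega_2$, $\omega_{23}=b\omega_1+c\omega_2$, where $d\omega_{13}=\omega_{12}\wedge\omega_{23}$, $d\omega_{23}=\omega_{21}\wedge\omega_{13}$. Equivalently, with $\Delta_{ij}=f_{i1}f_{j2}-f_{j1}f_{i2}$ and total derivatives $D_x,D_t$, they satisfy the Gauss equation $ac-b^2=-1$ and the Codazzi equations $$f_{11}D_ta+f_{21}D_tb-f_{12}D_xa-f_{22}D_xb-2b\Delta_{13}+(a-c)\Delta_{23}=0,$$ $$f_{11}D_tb+f_{21}D_tc-f_{12}D_xb-f_{22}D_xc+(a-c)\Delta_{13}+2b\Delta_{23}=0.$$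 It is assumed throughout that $\Delta_{13}^2+\Delta_{23}^2\neq0$. "The coefficients depend on a jet of finite order of $u$" means that $a,b,c$ are smooth functions of $x,t,u$ and finitely many partial derivatives of $u$; concretely, functions of $x,t,z_0,\dots,z_l,w_1,\dots,w_p,v_1,\dots,v_q$ with $z_i=\partial_x^iu$, $w_j=\partial_t^ju$, $v_k=\partial_t^ku_x$ and $l,p,q$ finite but arbitrary. The Gauss and Codazzi equations are understood as identities in $x,t$ and the independent jet variables $z_i,w_j,v_k$, after $u_{xxt}$ and its derivatives have been eliminated by means of the equation (T) and its differential consequences. *)

theory Defs
  imports "HOL-Analysis.Analysis"
begin

text \<open>
  Coordinates of the jet space: \<open>jX\<close>, \<open>jT\<close> are the independent variables,
  \<open>jZ i\<close> is \<open>z_i\<close>, the \<open>i\<close>-th \<open>x\<close>-derivative of \<open>u\<close>.  The other two families are indexed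
  from \<open>0\<close>: \<open>jW j\<close> is \<open>w_(j+1)\<close>, the \<open>(j+1)\<close>-st \<open>t\<close>-derivative of \<open>u\<close>, and \<open>jV k\<close> is
  \<open>v_(k+1)\<close>, the \<open>(k+1)\<close>-st \<open>t\<close>-derivative of \<open>u_x\<close>.
\<close>

datatype jvar = jX | jT | jZ nat | jW nat | jV nat

type_synonym jet = "jvar \<Rightarrow> real"

definition depends_on :: "jvar set \<Rightarrow> jet set \<Rightarrow> (jet \<Rightarrow> real) \<Rightarrow> bool" where
  "depends_on K S F \<longleftrightarrow> (\<forall>p\<in>S. \<forall>q\<in>S. (\<forall>y\<in>K. p y = q y) \<longrightarrow> F p = F q)"

definition pd :: "jvar \<Rightarrow> (jet \<Rightarrow> real) \<Rightarrow> jet \<Rightarrow> real" where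
  "pd y F p = deriv (\<lambda>s. F (p(y := s))) (p y)"

text \<open>
  Infinite differentiability on an open set \<open>S\<close> (product topology): every iterated partial
  derivative exists and is continuous.
\<close>

definition smooth_on :: "jet set \<Rightarrow> (jet \<Rightarrow> real) \<Rightarrow> bool" where
  "smooth_on S F \<longleftrightarrow>
     (\<forall>ys. continuous_on S (fold pd ys F) \<and>
       (\<forall>p\<in>S. \<forall>y. (\<lambda>s. fold pd ys F (p(y := s))) differentiable (at (p y))))"

text \<open>
  All functions of the theory live over an open set \<open>U\<close> of values of \<open>(u, u_x, u_xx)\<close>; the
  remaining jet coordinates are unrestricted.
\<close>

definition jets_over :: "(real \<times> real \<times> real) set \<Rightarrow> jet set" where
  "jets_over U = {p. (p (jZ 0), p (jZ 1), p (jZ 2)) \<in> U}"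

definition rhs :: "real \<Rightarrow> (real \<Rightarrow> real \<Rightarrow> real \<Rightarrow> real) \<Rightarrow> jet \<Rightarrow> real" where
  "rhs lam G p = lam * p (jZ 0) * p (jZ 3) + G (p (jZ 0)) (p (jZ 1)) (p (jZ 2))"


subsection \<open>Total derivatives on the equation\<close>

text \<open>
  The derivation acting on coordinates by \<open>c\<close>.  A function of finitely many coordinates has only
  finitely many nonzero partial derivatives, so the sum is finite where it is used.
\<close>

definition derivation :: "(jvar \<Rightarrow> jet \<Rightarrow> real) \<Rightarrow> (jet \<Rightarrow> real) \<Rightarrow> jet \<Rightarrow> real" where
  "derivation c F p = (\<Sum>y | pd y F p \<noteq> 0. c y p * pd y F p)"

text \<open>The total \<open>x\<close>-derivative of functions of \<open>x\<close>, \<open>t\<close> and the \<open>z_i\<close> only.\<close>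

definition Dx_z :: "(jet \<Rightarrow> real) \<Rightarrow> jet \<Rightarrow> real" where
  "Dx_z = derivation (\<lambda>y p. case y of jX \<Rightarrow> 1 | jZ i \<Rightarrow> p (jZ (Suc i)) | _ \<Rightarrow> 0)"

text \<open>
  \<open>z_t lam G i\<close> is the \<open>t\<close>-derivative of \<open>z_i\<close>, with \<open>u_xxt\<close> and its \<open>x\<close>-derivatives eliminated
  by means of \<open>u_xxt = u_t - rhs\<close>.
\<close>

fun z_t :: "real \<Rightarrow> (real \<Rightarrow> real \<Rightarrow> real \<Rightarrow> real) \<Rightarrow> nat \<Rightarrow> jet \<Rightarrow> real" where
  "z_t lam G 0 p = p (jW 0)"
| "z_t lam G (Suc 0) p = p (jV 0)"
| "z_t lam G (Suc (Suc i)) p = z_t lam G i p - (Dx_z ^^ i) (rhs lam G) p"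

definition Dt :: "real \<Rightarrow> (real \<Rightarrow> real \<Rightarrow> real \<Rightarrow> real) \<Rightarrow> (jet \<Rightarrow> real) \<Rightarrow> jet \<Rightarrow> real" where
  "Dt lam G = derivation (\<lambda>y p. case y of
      jX \<Rightarrow> 0
    | jT \<Rightarrow> 1
    | jZ i \<Rightarrow> z_t lam G i p
    | jW j \<Rightarrow> p (jW (Suc j))
    | jV k \<Rightarrow> p (jV (Suc k)))"

text \<open>
  The \<open>x\<close>-derivative of \<open>v_(k+1)\<close> is the \<open>k\<close>-th \<open>t\<close>-derivative of \<open>u_xxt = u_t - rhs\<close>.
\<close>

definition Dx :: "real \<Rightarrow> (real \<Rightarrow> real \<Rightarrow> real \<Rightarrow> real) \<Rightarrow> (jet \<Rightarrow> real) \<Rightarrow> jet \<Rightarrow> real" where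
  "Dx lam G = derivation (\<lambda>y p. case y of
      jX \<Rightarrow> 1
    | jT \<Rightarrow> 0
    | jZ i \<Rightarrow> p (jZ (Suc i))
    | jW j \<Rightarrow> p (jV j)
    | jV k \<Rightarrow> p (jW k) - (Dt lam G ^^ k) (rhs lam G) p)"


subsection \<open>Equations describing pseudospherical surfaces\<close>

definition dx :: "(real \<Rightarrow> real \<Rightarrow> real) \<Rightarrow> real \<Rightarrow> real \<Rightarrow> real" where
  "dx u = (\<lambda>x t. deriv (\<lambda>s. u s t) x)"

definition dt :: "(real \<Rightarrow> real \<Rightarrow> real) \<Rightarrow> real \<Rightarrow> real \<Rightarrow> real" where
  "dt u = (\<lambda>x t. deriv (\<lambda>s. u x s) t)"

definition jet_of :: "(real \<Rightarrow> real \<Rightarrow> real) \<Rightarrow> real \<Rightarrow> real \<Rightarrow> jet" where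
  "jet_of u x t y = (case y of
      jX \<Rightarrow> x
    | jT \<Rightarrow> t
    | jZ i \<Rightarrow> (dx ^^ i) u x t
    | jW j \<Rightarrow> (dt ^^ Suc j) u x t
    | jV k \<Rightarrow> (dt ^^ Suc k) (dx u) x t)"

text \<open>\<open>Delta f i j\<close> is the coefficient of \<open>dx \<and> dt\<close> in \<open>\<omega>_i \<and> \<omega>_j\<close>.\<close>

definition Delta :: "(nat \<Rightarrow> nat \<Rightarrow> jet \<Rightarrow> real) \<Rightarrow> nat \<Rightarrow> nat \<Rightarrow> jet \<Rightarrow> real" where
  "Delta f i j p = f i 1 p * f j 2 p - f j 1 p * f i 2 p"

text \<open>The coefficient of \<open>dx \<and> dt\<close> in \<open>d \<omega>_i\<close>, for \<open>\<omega>_i\<close> evaluated on \<open>u\<close>.\<close>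

definition d_omega ::
    "(nat \<Rightarrow> nat \<Rightarrow> jet \<Rightarrow> real) \<Rightarrow> nat \<Rightarrow> (real \<Rightarrow> real \<Rightarrow> real) \<Rightarrow> real \<Rightarrow> real \<Rightarrow> real" where
  "d_omega f i u x t =
     dx (\<lambda>x t. f i 2 (jet_of u x t)) x t - dt (\<lambda>x t. f i 1 (jet_of u x t)) x t"

definition structure_eqs ::
    "(nat \<Rightarrow> nat \<Rightarrow> jet \<Rightarrow> real) \<Rightarrow> (real \<Rightarrow> real \<Rightarrow> real) \<Rightarrow> real \<Rightarrow> real \<Rightarrow> bool" where
  "structure_eqs f u x t \<longleftrightarrow>
     d_omega f 1 u x t = Delta f 3 2 (jet_of u x t) \<and>
     d_omega f 2 u x t = Delta f 1 3 (jet_of u x t) \<and>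
     d_omega f 3 u x t = Delta f 1 2 (jet_of u x t)"

definition equation_T ::
    "real \<Rightarrow> (real \<Rightarrow> real \<Rightarrow> real \<Rightarrow> real) \<Rightarrow> (real \<Rightarrow> real \<Rightarrow> real) \<Rightarrow> real \<Rightarrow> real \<Rightarrow> bool" where
  "equation_T lam G u x t \<longleftrightarrow>
     dt u x t - dt (dx (dx u)) x t =
       lam * u x t * dx (dx (dx u)) x t + G (u x t) (dx u x t) (dx (dx u) x t)"

text \<open>
  \<open>u\<close> ranges over the smooth functions on arbitrary open sets \<open>D\<close> of the \<open>(x,t)\<close>-plane with
  values of \<open>(u, u_x, u_xx)\<close> in \<open>U\<close>.  The condition \<open>\<omega>_1 \<and> \<omega>_2 \<noteq> 0\<close> is also imposed on the
  jet space over \<open>U\<close>: otherwise forms with \<open>\<omega>_1 \<and> \<omega>_2 = 0\<close> identically could satisfy the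
  equivalence vacuously.
\<close>

definition describes_pss ::
    "(real \<times> real \<times> real) set \<Rightarrow> real \<Rightarrow> (real \<Rightarrow> real \<Rightarrow> real \<Rightarrow> real) \<Rightarrow>
     (nat \<Rightarrow> nat \<Rightarrow> jet \<Rightarrow> real) \<Rightarrow> bool" where
  "describes_pss U lam G f \<longleftrightarrow>
     (\<forall>i\<in>{1,2,3}. \<forall>j\<in>{1,2}. smooth_on (jets_over U) (f i j) \<and>
        (\<exists>l. depends_on (jZ ` {..l}) (jets_over U) (f i j))) \<and>
     (\<forall>p\<in>jets_over U. Delta f 1 2 p \<noteq> 0) \<and>
     (\<forall>D u. open D \<and> smooth_on {p. (p jX, p jT) \<in> D} (\<lambda>p. u (p jX) (p jT)) \<and>
        (\<forall>(x,t)\<in>D. (u x t, dx u x t, dx (dx u) x t) \<in> U) \<longrightarrow>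
        ((\<forall>(x,t)\<in>D. structure_eqs f u x t) \<longleftrightarrow>
         (\<forall>(x,t)\<in>D. equation_T lam G u x t \<and> Delta f 1 2 (jet_of u x t) \<noteq> 0)))"


subsection \<open>Second fundamental forms depending on a jet of finite order\<close>

definition finite_jet_function :: "jet set \<Rightarrow> (jet \<Rightarrow> real) \<Rightarrow> bool" where
  "finite_jet_function \<Omega> a \<longleftrightarrow> smooth_on \<Omega> a \<and>
     (\<exists>l m n. depends_on ({jX, jT} \<union> jZ ` {..l} \<union> jW ` {..<m} \<union> jV ` {..<n}) \<Omega> a)"

definition second_fundamental_form ::
    "jet set \<Rightarrow> real \<Rightarrow> (real \<Rightarrow> real \<Rightarrow> real \<Rightarrow> real) \<Rightarrow> (nat \<Rightarrow> nat \<Rightarrow> jet \<Rightarrow> real) \<Rightarrow>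
     (jet \<Rightarrow> real) \<Rightarrow> (jet \<Rightarrow> real) \<Rightarrow> (jet \<Rightarrow> real) \<Rightarrow> bool" where
  "second_fundamental_form \<Omega> lam G f a b c \<longleftrightarrow> (\<forall>p\<in>\<Omega>.
     a p * c p - (b p)\<^sup>2 = -1 \<and>
     f 1 1 p * Dt lam G a p + f 2 1 p * Dt lam G b p
       - f 1 2 p * Dx lam G a p - f 2 2 p * Dx lam G b p
       - 2 * b p * Delta f 1 3 p + (a p - c p) * Delta f 2 3 p = 0 \<and>
     f 1 1 p * Dt lam G b p + f 2 1 p * Dt lam G c p
       - f 1 2 p * Dx lam G b p - f 2 2 p * Dx lam G c p
       + (a p - c p) * Delta f 1 3 p + 2 * b p * Delta f 2 3 p = 0)"

definition function_of_xt :: "jet set \<Rightarrow> (jet \<Rightarrow> real) \<Rightarrow> bool" where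
  "function_of_xt \<Omega> a \<longleftrightarrow> (\<exists>\<alpha>. \<forall>p\<in>\<Omega>. a p = \<alpha> (p jX) (p jT))"


subsection \<open>The two exceptional families\<close>

definition admissible_h :: "(real \<times> real \<times> real) set \<Rightarrow> (real \<Rightarrow> real) \<Rightarrow> bool" where
  "admissible_h U h \<longleftrightarrow>
     (\<forall>(z0,z1,z2)\<in>U. h differentiable (at (z0 - z2)) \<and> deriv h (z0 - z2) \<noteq> 0)"

definition admissible_psi :: "(real \<times> real \<times> real) set \<Rightarrow> (real \<Rightarrow> real \<Rightarrow> real) \<Rightarrow> bool" where
  "admissible_psi U \<psi> \<longleftrightarrow>
     (\<forall>(z0,z1,z2)\<in>U. (\<lambda>(r,s). \<psi> r s) differentiable (at (z0, z1)))"

text \<open>The total \<open>x\<close>-derivative of \<open>\<psi>(u,u_x)\<close>.\<close>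

definition psi_x :: "(real \<Rightarrow> real \<Rightarrow> real) \<Rightarrow> real \<Rightarrow> real \<Rightarrow> real \<Rightarrow> real" where
  "psi_x \<psi> z0 z1 z2 = deriv (\<lambda>r. \<psi> r z1) z0 * z1 + deriv (\<lambda>s. \<psi> z0 s) z1 * z2"

definition family_A ::
    "(real \<times> real \<times> real) set \<Rightarrow> real \<Rightarrow> (real \<Rightarrow> real \<Rightarrow> real \<Rightarrow> real) \<Rightarrow> bool" where
  "family_A U lam G \<longleftrightarrow> (\<exists>m h \<psi>. m \<noteq> 0 \<and> admissible_h U h \<and> admissible_psi U \<psi> \<and>
     (\<forall>(z0,z1,z2)\<in>U. \<psi> z0 z1 \<noteq> 0) \<and>
     (\<forall>(z0,z1,z2)\<in>U. \<forall>z3.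
        lam * z0 * z3 + G z0 z1 z2 =
          1 / deriv h (z0 - z2) * (m * \<psi> z0 z1 + psi_x \<psi> z0 z1 z2)))"

definition family_B ::
    "(real \<times> real \<times> real) set \<Rightarrow> real \<Rightarrow> (real \<Rightarrow> real \<Rightarrow> real \<Rightarrow> real) \<Rightarrow> bool" where
  "family_B U lam G \<longleftrightarrow> (\<exists>m1 m2 h \<psi>. (lam * m1)\<^sup>2 + m2\<^sup>2 \<noteq> 0 \<and>
     admissible_h U h \<and> admissible_psi U \<psi> \<and>
     (\<forall>(z0,z1,z2)\<in>U. \<forall>z3.
        lam * z0 * z3 + G z0 z1 z2 =
          lam * z0 * z3 + 1 / deriv h (z0 - z2) *
            (m1 * \<psi> z0 z1 + psi_x \<psi> z0 z1 z2 - lam * z0 * z1 * deriv h (z0 - z2)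
              - (lam * z1 + lam * m1 * z0 + m2) * h (z0 - z2))))"

end

theory Submission
 imports Defs
begin

text \<open>
Local solutions of (T) with prescribed finite jets exist: along the characteristics \<open>dx = lam u dt\<close>
the equation is a semilinear Goursat problem. Hence the structure equations hold formally on jets, so the
\<open>f\<^sub>i\<^sub>1\<close> are functions of \<open>u - u_xx\<close> and \<open>\<phi>\<^sub>i = f\<^sub>i\<^sub>2 + lam u f\<^sub>i\<^sub>1\<close> are functions of \<open>u, u_x\<close>; travelling waves exclude
higher order. Comparing coefficients of the highest jet variables in the Codazzi equations shows that
\<open>a, b, c\<close> depend on \<open>x, t\<close> only, unless the second fundamental form is isotropic on
\<open>(f\<^sub>1\<^sub>1, f\<^sub>2\<^sub>1)\<close> or on \<open>(\<phi>\<^sub>1, \<phi>\<^sub>2)\<close>. In these cases the Codazzi equations rotate a vector with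
angular velocity \<open>f\<^sub>3\<^sub>1\<close> or \<open>\<phi>\<^sub>3\<close>, which contradicts \<open>\<omega>\<^sub>1 \<and> \<omega>\<^sub>2 \<noteq> 0\<close>. If \<open>a, b, c\<close> do not depend on \<open>u\<close>, splitting
the Codazzi equations in powers of \<open>f\<^sub>1\<^sub>1\<close> gives \<open>1 + \<mu>\<^sub>2\<^sup>2 = \<mu>\<^sub>3\<^sup>2\<close> and \<open>\<mu>\<^sub>2 \<eta>\<^sub>2 = \<mu>\<^sub>3 \<eta>\<^sub>3\<close>; a constant
rotation of the coframe then brings the equation to the form (A) or (B).
\<close>

section \<open>Calculus of jet functions\<close>

text \<open>\<open>describes_pss\<close> speaks of actual functions \<open>u\<close>, while the
  Codazzi equations are identities on jets. The other half of the equivalence is used as well: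
  functions built to satisfy the structure equations are forced to solve (T), which limits the order
  of the forms and keeps the derivative of \<open>f_11\<close> away from zero. On the geometric
  side, moving a jet variable that occurs only in total derivatives turns the Codazzi equations into
  two linear equations for derivatives of \<open>a, b, c\<close>. The differentiated Gauss equation
  is a third, and the determinant is the second fundamental form on a frame vector. Since
  \<open>a c - b^2 = -1\<close>, that form is indefinite and isotropic vectors exist; this is why
  the two isotropic cases need separate arguments. All conclusions hold first on some box inside any
  open subset of \<Omega>; continuity of partial derivatives and connectedness of the fibres over
  \<open>(x, t)\<close> carry them to \<Omega>.\<close>

lemma continuous_on_fun_upd [continuous_intros]:
 fixes f :: "'a::topological_space \<Rightarrow> 'i \<Rightarrow> 'b::topological_space"
 assumes "continuous_on A f" "continuous_on A g"
 shows "continuous_on A (\<lambda>x. (f x)(y := g x))"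
proof (rule continuous_on_coordinatewise_then_product)
 fix i
 show "continuous_on A (\<lambda>x. ((f x)(y := g x)) i)"
  using assms continuous_on_product_then_coordinatewise[OF assms(1), of i] by (cases "i = y") auto
qed

lemma continuous_on_slice: "continuous_on A (\<lambda>s. p(y := s))" for p :: jet
 by (intro continuous_intros)

lemma open_slice: "open S ==> open {s. (p(y := s)) \<in> S}" for S :: "jet set"
proof -
 assume "open S"
 have "continuous_on UNIV (\<lambda>s. p(y := s))" by (intro continuous_intros)
 from open_vimage[OF \<open>open S\<close> this] show ?thesis by (simp add: vimage_def)
qed

lemma eventually_slice:
 fixes S :: "jet set"
 assumes "open S" "p \<in> S"
 shows "\<forall>\<^sub>F s in nhds (p y). p(y := s) \<in> S"
 using open_slice[OF assms(1), of p y] assms(2) eventually_nhds[of _ "p y"] by force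

text \<open>A basic open set of the product topology restricts only finitely many coordinates, and
  the least of finitely many radii serves for all of them. This finiteness lets calculus with
  infinitely many jet variables proceed as with finitely many.\<close>

lemma open_jet_box:
 fixes S :: "jet set"
 assumes "open S" "p \<in> S"
 obtains K \<epsilon> where "finite K" "\<epsilon> > 0" "\<And>q. (\<And>y. y \<in> K ==> \<bar>q y - p y\<bar> < \<epsilon>) ==> q \<in> S"
proof -
 obtain X where X: "p \<in> (\<Pi>\<^sub>E i\<in>UNIV. X i)" "\<And>i. open (X i)" "finite {i. X i \<noteq> UNIV}" "(\<Pi>\<^sub>E i\<in>UNIV. X i) \<subseteq> S"
  using product_topology_open_contains_basis[of "\<lambda>_. euclidean" UNIV S p] assms
  unfolding open_fun_def topspace_euclidean open_openin[symmetric] by blast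
 let ?K = "{i. X i \<noteq> UNIV}"
 have "\<forall>i. \<exists>e>0. \<forall>s. \<bar>s - p i\<bar> < e \<longrightarrow> s \<in> X i"
  using X(1,2) by (auto simp: PiE_iff open_dist dist_real_def)
 then obtain e where e: "\<And>i. e i > 0" "\<And>i s. \<bar>s - p i\<bar> < e i ==> s \<in> X i" by metis
 define \<epsilon> where "\<epsilon> = Min (insert 1 (e ` ?K))"
 have "\<epsilon> > 0" unfolding \<epsilon>_def using X(3) e(1) by (subst Min_gr_iff) auto
 moreover have "\<epsilon> \<le> e i" if "i \<in> ?K" for i unfolding \<epsilon>_def using X(3) that by (intro Min_le) auto
 then have "q \<in> S" if q: "\<And>y. y \<in> ?K ==> \<bar>q y - p y\<bar> < \<epsilon>" for q
 proof -
  have "q i \<in> X i" for i using q[of i] e(2)[of "q i" i] \<open>\<And>i. i \<in> ?K ==> \<epsilon> \<le> e i\<close>[of i] by fastforce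
  then show ?thesis using X(4) by (auto simp: PiE_iff)
 qed
 ultimately show ?thesis using that[OF X(3)] by blast
qed

lemma mvt_segment:
 fixes f :: "real \<Rightarrow> real"
 assumes "\<And>\<xi>. \<bar>\<xi> - a\<bar> \<le> \<bar>b - a\<bar> ==> (f has_field_derivative f' \<xi>) (at \<xi>)"
 obtains \<xi> where "\<bar>\<xi> - a\<bar> \<le> \<bar>b - a\<bar>" "f b - f a = (b - a) * f' \<xi>"
proof -
 consider "a < b" | "a = b" | "b < a" by linarith
 then show ?thesis
 proof cases
  case 1
  from MVT2[OF 1, of f f'] assms 1 obtain z where "z > a" "z < b" "f b - f a = (b - a) * f' z" by force
  then show ?thesis using that[of z] by auto
 next
  case 2 then show ?thesis using that[of a] by auto
 next
  case 3
  from MVT2[OF 3, of f f'] assms 3 obtain z where "z > b" "z < a" "f a - f b = (a - b) * f' z" by force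
  then show ?thesis using that[of z] by (auto simp: algebra_simps)
 qed
qed

lemma pd_eqI: "((\<lambda>s. F (p(y := s))) has_field_derivative D) (at (p y)) ==> pd y F p = D"
 unfolding pd_def by (rule DERIV_imp_deriv)

lemma pd_cong:
 assumes "open S" "p \<in> S" "\<And>q. q \<in> S ==> F q = G q"
 shows "pd y F p = pd y G p"
 unfolding pd_def
 by (rule deriv_cong_ev) (use eventually_slice[OF assms(1,2), of y] assms(3) in \<open>auto elim: eventually_mono\<close>)

lemma pd_DERIV:
 assumes "(\<lambda>s. F (p(y := s))) differentiable (at (p y))"
 shows "((\<lambda>s. F (p(y := s))) has_field_derivative pd y F p) (at (p y))"
 unfolding pd_def using assms DERIV_deriv_iff_real_differentiable by blast

lemma depends_onD: "depends_on K S F ==> p \<in> S ==> q \<in> S ==> (\<And>y. y \<in> K ==> p y = q y) ==> F p = F q"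
 unfolding depends_on_def by blast

lemma depends_on_mono: "depends_on K S F ==> K \<subseteq> K' ==> S' \<subseteq> S ==> depends_on K' S' F"
 unfolding depends_on_def by blast

lemma depends_on_pd:
 assumes "open S" "depends_on K S F"
 shows "depends_on K S (pd y F)"
 unfolding depends_on_def
proof (intro ballI impI)
 fix p q assume pq: "p \<in> S" "q \<in> S" "\<forall>z\<in>K. p z = q z"
 show "pd y F p = pd y F q"
 proof (cases "y \<in> K")
  case True
  then have eq: "p y = q y" using pq by auto
  have "\<forall>\<^sub>F s in nhds (p y). F (p(y := s)) = F (q(y := s))"
   using eventually_slice[OF assms(1) pq(1), of y] eventually_slice[OF assms(1) pq(2), of y] unfolding eq
   by eventually_elim (rule depends_onD[OF assms(2)], use pq in auto)
  then show ?thesis unfolding pd_def using eq by (intro deriv_cong_ev) auto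
 next
  case False
  have *: "pd y F r = 0" if "r \<in> S" for r
  proof (rule pd_eqI)
   have "\<forall>\<^sub>F s in nhds (r y). F (r(y := s)) = F r"
    using eventually_slice[OF assms(1) that, of y]
    by eventually_elim (rule depends_onD[OF assms(2)], use False that in auto)
   then show "((\<lambda>s. F (r(y := s))) has_real_derivative 0) (at (r y))"
    by (subst DERIV_cong_ev[OF refl _ refl]) auto
  qed
  show ?thesis using *[OF pq(1)] *[OF pq(2)] by simp
 qed
qed

lemma pd_zero_outside:
 assumes "open S" "depends_on K S F" "p \<in> S" "y \<notin> K"
 shows "pd y F p = 0"
proof (rule pd_eqI)
 have "\<forall>\<^sub>F s in nhds (p y). F (p(y := s)) = F p"
  using eventually_slice[OF assms(1,3), of y]
  by eventually_elim (rule depends_onD[OF assms(2)], use assms in auto)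
 then show "((\<lambda>s. F (p(y := s))) has_real_derivative 0) (at (p y))"
  by (subst DERIV_cong_ev[OF refl _ refl]) auto
qed

lemma derivation_eq_sum:
 assumes "open S" "depends_on K S F" "finite K" "p \<in> S"
 shows "derivation c F p = (\<Sum>y\<in>K. c y p * pd y F p)"
 unfolding derivation_def
 by (rule sum.mono_neutral_left) (use assms pd_zero_outside[OF assms(1,2,4)] in auto)

section \<open>Differentiability classes of finite order\<close>

primrec Ck :: "nat \<Rightarrow> jet set \<Rightarrow> (jet \<Rightarrow> real) \<Rightarrow> bool" where
 "Ck 0 S F \<longleftrightarrow> continuous_on S F"
| "Ck (Suc k) S F \<longleftrightarrow> continuous_on S F \<and>
   (\<forall>p\<in>S. \<forall>y. (\<lambda>s. F (p(y := s))) differentiable (at (p y))) \<and> (\<forall>y. Ck k S (pd y F))"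

lemma Ck_continuous: "Ck k S F ==> continuous_on S F"
 by (cases k) auto

lemma Ck_Suc_pd: "Ck (Suc k) S F ==> Ck k S (pd y F)"
 by auto

lemma Ck_DERIV: "Ck (Suc k) S F ==> p \<in> S ==> ((\<lambda>s. F (p(y := s))) has_field_derivative pd y F p) (at (p y))"
 by (rule pd_DERIV) auto

lemma Ck_DERIV': "Ck (Suc k) S F ==> p(y := s) \<in> S ==>
  ((\<lambda>s. F (p(y := s))) has_field_derivative pd y F (p(y := s))) (at s)"
 using Ck_DERIV[of k S F "p(y := s)" y] by simp

lemma Ck_Suc_imp: "Ck (Suc k) S F ==> Ck k S F"
proof (induction k arbitrary: F)
 case (Suc k)
 then show ?case by (subst Ck.simps(2)) (auto simp del: Ck.simps(2) simp: Ck.simps(2)[of "Suc k"])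
qed simp

lemma Ck_mono: "Ck l S F ==> k \<le> l ==> Ck k S F"
 by (induction l) (auto simp: le_Suc_eq simp del: Ck.simps(2) dest: Ck_Suc_imp)

lemma Ck_subset: "Ck k S F ==> T \<subseteq> S ==> Ck k T F"
 by (induction k arbitrary: F) (auto intro: continuous_on_subset)

lemma Ck_cong:
 assumes "open S" "\<And>q. q \<in> S ==> F q = G q" "Ck k S F"
 shows "Ck k S G"
 using assms(2,3)
proof (induction k arbitrary: F G)
 case 0
 then show ?case by (simp cong: continuous_on_cong)
next
 case (Suc k)
 have c: "continuous_on S G" using Suc.prems by (simp cong: continuous_on_cong)
 have p: "pd y F q = pd y G q" if "q \<in> S" for q y using pd_cong[OF assms(1) that Suc.prems(1)] .
 have "Ck k S (pd y G)" for y using Suc.IH[of "pd y F" "pd y G"] p Suc.prems(2) by auto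
 moreover have "(\<lambda>s. G (p(y := s))) differentiable (at (p y))" if "p \<in> S" for p y
 proof -
  have "((\<lambda>s. F (p(y := s))) has_field_derivative pd y F p) (at (p y))"
   using Ck_DERIV[OF Suc.prems(2) that] .
  then have "((\<lambda>s. G (p(y := s))) has_field_derivative pd y F p) (at (p y))"
   by (subst DERIV_cong_ev[OF refl _ refl, of _ "\<lambda>s. F (p(y := s))"])
    (rule eventually_mono[OF eventually_slice[OF assms(1) that, of y]], simp only: Suc.prems(1))
  then show ?thesis using real_differentiable_def by blast
 qed
 ultimately show ?case using c by simp
qed

text \<open>The partial derivatives are supplied as explicit functions \<open>D\<close>, so each
  closure property reduces to one differentiation rule and an induction on the order.\<close>

lemma Ck_SucI:
 assumes "open S" "continuous_on S F"
  and "\<And>p y. p \<in> S ==> ((\<lambda>s. F (p(y := s))) has_field_derivative D y p) (at (p y))"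
  and "\<And>y. Ck k S (D y)"
 shows "Ck (Suc k) S F"
proof -
 have "Ck k S (pd y F)" for y
  by (rule Ck_cong[OF assms(1) _ assms(4)[of y]]) (use assms(3) pd_eqI in metis)
 then show ?thesis using assms(2,3) real_differentiable_def by (auto simp: real_differentiable_def; blast)
qed

text \<open>\<open>Ck\<close> grades infinite differentiability by order. The grading matters
  because the regularity of solutions is gained one order at a time.\<close>

lemma smooth_on_iff_Ck: "smooth_on S F \<longleftrightarrow> (\<forall>k. Ck k S F)"
proof
 assume "smooth_on S F"
 then have "Ck k S F" for k
 proof (induction k arbitrary: F)
  case 0
  then show ?case unfolding smooth_on_def by (auto dest: spec[of _ "[]"])
 next
  case (Suc k)
  have "smooth_on S (pd y F)" for y
   unfolding smooth_on_def
  proof (intro allI)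
   fix ys
   show "continuous_on S (fold pd ys (pd y F)) \<and> (\<forall>p\<in>S. \<forall>ya. (\<lambda>s. fold pd ys (pd y F) (p(ya := s))) differentiable at (p ya))"
    using Suc.prems[unfolded smooth_on_def, rule_format, of "y # ys"] by simp
  qed
  then show ?case using Suc.IH Suc.prems[unfolded smooth_on_def, rule_format, of "[]"] by auto
 qed
 then show "\<forall>k. Ck k S F" by blast
next
 assume "\<forall>k. Ck k S F"
 then have "continuous_on S (fold pd ys F) \<and> (\<forall>p\<in>S. \<forall>y. (\<lambda>s. fold pd ys F (p(y := s))) differentiable at (p y))" for ys
 proof (induction ys arbitrary: F)
  case Nil
  from Nil[rule_format, of "Suc 0"] show ?case by (simp only: Ck.simps fold.simps id_apply) blast
 next
  case (Cons y ys)
  have "\<forall>k. Ck k S (pd y F)" using Cons.prems Ck_Suc_pd by blast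
  from Cons.IH[OF this] show ?case by simp
 qed
 then show "smooth_on S F" unfolding smooth_on_def by blast
qed

lemma Ck_const [simp]: "open S ==> Ck k S (\<lambda>p. c)"
proof (induction k arbitrary: c)
 case (Suc k)
 show ?case by (rule Ck_SucI[where D = "\<lambda>y p. 0"]) (use Suc in \<open>auto intro: continuous_on_const\<close>)
qed auto

lemma continuous_on_jet_proj: "continuous_on S (\<lambda>p::jet. p y)"
 by (rule continuous_on_subset[OF continuous_on_product_coordinates]) auto

lemma Ck_proj [simp]: "open S ==> Ck k S (\<lambda>p. p y)"
proof (cases k)
 case (Suc l)
 assume S: "open S"
 show ?thesis unfolding Suc
  by (rule Ck_SucI[where D = "\<lambda>z p. if z = y then 1 else 0"])
   (use S in \<open>auto intro: continuous_on_jet_proj\<close>)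
qed (auto intro: continuous_on_jet_proj)

lemma Ck_add:
 assumes "open S" "Ck k S F" "Ck k S G"
 shows "Ck k S (\<lambda>p. F p + G p)"
 using assms(2,3)
proof (induction k arbitrary: F G)
 case 0 then show ?case by (auto intro: continuous_intros)
next
 case (Suc k)
 show ?case
  by (rule Ck_SucI[where D = "\<lambda>y p. pd y F p + pd y G p"], rule assms(1), use Suc in \<open>force intro: continuous_on_add\<close>,
   rule DERIV_add[OF Ck_DERIV[OF Suc.prems(1)] Ck_DERIV[OF Suc.prems(2)]], assumption, assumption, use Suc in auto)
qed

lemma Ck_mult:
 assumes "open S" "Ck k S F" "Ck k S G"
 shows "Ck k S (\<lambda>p. F p * G p)"
 using assms(2,3)
proof (induction k arbitrary: F G)
 case 0 then show ?case by (auto intro: continuous_intros)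
next
 case (Suc k)
 show ?case
 proof (rule Ck_SucI[where D = "\<lambda>y p. F p * pd y G p + pd y F p * G p"])
  show "Ck k S (\<lambda>p. F p * pd y G p + pd y F p * G p)" for y
   using Suc assms(1) Ck_Suc_pd Ck_Suc_imp by (metis Ck_add)
  show "((\<lambda>s. F (p(y := s)) * G (p(y := s))) has_real_derivative F p * pd y G p + pd y F p * G p) (at (p y))"
   if "p \<in> S" for p y
   using DERIV_mult[OF Ck_DERIV[OF Suc.prems(1) that, of y] Ck_DERIV[OF Suc.prems(2) that, of y]]
   by (simp only: fun_upd_triv mult.commute add.commute)
 qed (use Suc assms(1) in \<open>auto intro!: continuous_on_mult\<close>)
qed

lemma Ck_cmult: "open S ==> Ck k S F ==> Ck k S (\<lambda>p. c * F p)"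
 by (intro Ck_mult Ck_const)

lemma Ck_minus: "open S ==> Ck k S F ==> Ck k S (\<lambda>p. - F p)"
 using Ck_cmult[of S k F "-1"] by simp

lemma Ck_diff: "open S ==> Ck k S F ==> Ck k S G ==> Ck k S (\<lambda>p. F p - G p)"
 using Ck_add[of S k F "\<lambda>p. - G p"] Ck_minus[of S k G] by simp

lemma Ck_sum: "open S ==> (\<And>i. i \<in> I ==> Ck k S (F i)) ==> Ck k S (\<lambda>p. \<Sum>i\<in>I. F i p)"
 by (induction I rule: infinite_finite_induct) (auto intro: Ck_add)

lemma Ck_power: "open S ==> Ck k S F ==> Ck k S (\<lambda>p. F p ^ n)"
 by (induction n) (auto intro: Ck_mult)

lemma Ck_inverse:
 assumes "open S" "Ck k S F" "\<And>p. p \<in> S ==> F p \<noteq> 0"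
 shows "Ck k S (\<lambda>p. inverse (F p))"
 using assms(2)
proof (induction k)
 case 0 then show ?case using assms(3) by (auto intro!: continuous_intros)
next
 case (Suc k)
 have "Ck k S (\<lambda>p. - (pd y F p * (inverse (F p) * inverse (F p))))" for y
  using Suc assms(1) Ck_Suc_imp by (intro Ck_minus Ck_mult) auto
 then show ?case
 proof (rule Ck_SucI[where D = "\<lambda>y p. - (pd y F p * (inverse (F p) * inverse (F p)))", rotated 3])
  show "((\<lambda>s. inverse (F (p(y := s)))) has_real_derivative - (pd y F p * (inverse (F p) * inverse (F p)))) (at (p y))"
   if "p \<in> S" for p y
   using DERIV_inverse'[OF Ck_DERIV[OF Suc.prems that, of y]] assms(3)[OF that]
   by (simp only: fun_upd_triv not_False_eq_True simp_thms mult.assoc mult.commute mult.left_commute)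
 qed (use Suc assms(1,3) in \<open>auto intro!: continuous_on_inverse simp: Ck_continuous\<close>)
qed

lemma Ck_divide: "open S ==> Ck k S F ==> Ck k S G ==> (\<And>p. p \<in> S ==> G p \<noteq> 0) ==> Ck k S (\<lambda>p. F p / G p)"
 unfolding divide_inverse by (intro Ck_mult Ck_inverse)

lemma Ck_exp:
 assumes "open S" "Ck k S F"
 shows "Ck k S (\<lambda>p. exp (F p))"
 using assms(2)
proof (induction k)
 case 0 then show ?case by (auto intro!: continuous_intros)
next
 case (Suc k)
 have "Ck k S (\<lambda>p. exp (F p) * pd y F p)" for y
  using Suc assms(1) Ck_Suc_imp by (intro Ck_mult) auto
 then show ?case
 proof (rule Ck_SucI[where D = "\<lambda>y p. exp (F p) * pd y F p", rotated 3])
  show "((\<lambda>s. exp (F (p(y := s)))) has_real_derivative exp (F p) * pd y F p) (at (p y))" if "p \<in> S" for p y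
   using DERIV_chain2[OF DERIV_exp Ck_DERIV[OF Suc.prems that, of y]] by (simp only: fun_upd_triv)
 qed (use Suc assms(1) in \<open>auto intro!: continuous_on_exp\<close>)
qed

lemma Ck_arctan:
 assumes "open S" "Ck k S F"
 shows "Ck k S (\<lambda>p. arctan (F p))"
proof (cases k)
 case 0 then show ?thesis using assms by (auto intro!: continuous_intros)
next
 case (Suc l)
 note F = assms(2)[unfolded Suc]
 have "Ck l S (\<lambda>p. pd y F p / (1 + F p * F p))" for y
  using F assms(1) Ck_Suc_imp[OF F] by (intro Ck_divide Ck_add Ck_mult Ck_const) (auto simp: add_nonneg_eq_0_iff)
 then show ?thesis unfolding Suc
 proof (rule Ck_SucI[where D = "\<lambda>y p. pd y F p / (1 + F p * F p)", rotated 3])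
  show "((\<lambda>s. arctan (F (p(y := s)))) has_real_derivative pd y F p / (1 + F p * F p)) (at (p y))" if "p \<in> S" for p y
   using DERIV_chain2[OF DERIV_arctan Ck_DERIV[OF F that, of y]]
   by (simp only: fun_upd_triv power2_eq_square divide_inverse mult.commute)
 qed (use F assms(1) in \<open>auto intro!: continuous_on_arctan\<close>)
qed

text \<open>Coordinates are switched from the constant \<open>p\<close> to the curve one at a time.
  Each switch moves a single coordinate, so the mean value theorem expresses the increment by the
  partial derivative at an intermediate jet, and continuity of that derivative gives the
  limit.\<close>

lemma chain_hybrid:
 fixes \<gamma> :: "jvar \<Rightarrow> real \<Rightarrow> real"
 assumes "open S" "Ck 1 S \<Phi>" "finite K" "p \<in> S"
  and "\<And>y. y \<in> K ==> (\<gamma> y has_field_derivative \<gamma>' y) (at s0)"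
  and "\<And>y. y \<in> K ==> \<gamma> y s0 = p y"
 shows "((\<lambda>s. \<Phi> (\<lambda>y. if y \<in> K then \<gamma> y s else p y)) has_field_derivative (\<Sum>y\<in>K. pd y \<Phi> p * \<gamma>' y)) (at s0)"
 using assms(3,5,6)
proof (induction K rule: finite_induct)
 case empty
 then show ?case by simp
next
 case (insert y K)
 define H where "H s = (\<lambda>z. if z \<in> K then \<gamma> z s else p z)" for s
 have hyb: "(\<lambda>z. if z \<in> insert y K then \<gamma> z s else p z) = (H s)(y := \<gamma> y s)" for s
  by (auto simp: H_def)
 have Hy: "H s y = p y" for s using insert by (simp add: H_def)
 have Hs0: "H s0 = p" using insert by (auto simp: H_def)
 \<comment> \<open>Difference quotient in the coordinate \<open>y\<close>, completed by the partial
   derivative where the increment of \<open>\<gamma> y\<close> vanishes. The increment of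
   \<open>\<Phi>\<close> is then \<open>c s\<close> times that of \<open>\<gamma> y\<close> for
   every \<open>s\<close>.\<close>
 define c where "c s = (if \<gamma> y s = p y then pd y \<Phi> p else (\<Phi> ((H s)(y := \<gamma> y s)) - \<Phi> (H s)) / (\<gamma> y s - p y))" for s
 have IH: "((\<lambda>s. \<Phi> (H s)) has_field_derivative (\<Sum>y\<in>K. pd y \<Phi> p * \<gamma>' y)) (at s0)"
  unfolding H_def using insert by auto
 have c: "(c \<longlongrightarrow> pd y \<Phi> p) (at s0)"
 proof (rule tendstoI)
  fix e :: real assume "e > 0"
  have cont: "continuous_on S (pd y \<Phi>)" using assms(2) by simp
  define N where "N = S \<inter> pd y \<Phi> -` ball (pd y \<Phi> p) e"
  have "open N" unfolding N_def using continuous_open_preimage[OF cont assms(1)] by auto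
  moreover have "p \<in> N" using assms(4) \<open>e > 0\<close> by (simp add: N_def)
  ultimately obtain K0 \<epsilon> where K0: "finite K0" "\<epsilon> > 0" "\<And>q. (\<And>z. z \<in> K0 ==> \<bar>q z - p z\<bar> < \<epsilon>) ==> q \<in> N"
   using open_jet_box by metis
  have "\<forall>\<^sub>F s in at s0. \<forall>z\<in>insert y K. \<bar>\<gamma> z s - p z\<bar> < \<epsilon>"
  proof (rule eventually_ball_finite)
   show "\<forall>z\<in>insert y K. \<forall>\<^sub>F s in at s0. \<bar>\<gamma> z s - p z\<bar> < \<epsilon>"
   proof
    fix z assume z: "z \<in> insert y K"
    have "isCont (\<gamma> z) s0" using insert.prems(1)[OF z] DERIV_isCont by blast
    then have "(\<gamma> z \<longlongrightarrow> p z) (at s0)" using insert.prems(2)[OF z] by (simp add: isCont_def)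
    from tendstoD[OF this K0(2)] show "\<forall>\<^sub>F s in at s0. \<bar>\<gamma> z s - p z\<bar> < \<epsilon>" by (simp add: dist_real_def)
   qed
  qed (use insert in auto)
  then show "\<forall>\<^sub>F s in at s0. dist (c s) (pd y \<Phi> p) < e"
  proof eventually_elim
   case (elim s)
   show ?case
   proof (cases "\<gamma> y s = p y")
    case True then show ?thesis using \<open>e > 0\<close> by (simp add: c_def)
   next
    case False
    have inN: "(H s)(y := \<xi>) \<in> N" if "\<bar>\<xi> - p y\<bar> \<le> \<bar>\<gamma> y s - p y\<bar>" for \<xi>
     by (rule K0(3)) (use elim that K0(2) in \<open>auto simp: H_def\<close>)
    obtain \<xi> where \<xi>: "\<bar>\<xi> - p y\<bar> \<le> \<bar>\<gamma> y s - p y\<bar>"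
     "\<Phi> ((H s)(y := \<gamma> y s)) - \<Phi> ((H s)(y := p y)) = (\<gamma> y s - p y) * pd y \<Phi> ((H s)(y := \<xi>))"
    proof (rule mvt_segment)
     show "((\<lambda>s'. \<Phi> ((H s)(y := s'))) has_field_derivative pd y \<Phi> ((H s)(y := \<xi>))) (at \<xi>)"
      if "\<bar>\<xi> - p y\<bar> \<le> \<bar>\<gamma> y s - p y\<bar>" for \<xi>
      using Ck_DERIV'[of 0 S \<Phi> "H s" y \<xi>] assms(2) inN[OF that] by (auto simp: N_def)
    qed auto
    have "(H s)(y := p y) = H s" using Hy by (metis fun_upd_triv)
    then have "c s = pd y \<Phi> ((H s)(y := \<xi>))" using \<xi>(2) False by (simp add: c_def)
    then show ?thesis using inN[OF \<xi>(1)] by (simp add: N_def dist_commute)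
   qed
  qed
 qed
 have "((\<lambda>s. c s * ((\<gamma> y s - p y) / (s - s0))) \<longlongrightarrow> pd y \<Phi> p * \<gamma>' y) (at s0)"
  using insert.prems by (intro tendsto_mult[OF c]) (metis (no_types) has_field_derivative_iff insertI1)
 then have "((\<lambda>s. \<Phi> ((H s)(y := \<gamma> y s)) - \<Phi> (H s)) has_field_derivative pd y \<Phi> p * \<gamma>' y) (at s0)"
  unfolding has_field_derivative_iff
  by (rule Lim_transform_eventually)
   (use Hs0 insert.prems(2)[of y] Hy in \<open>auto intro!: always_eventually simp: c_def fun_upd_idem\<close>)
 from DERIV_add[OF IH this] insert.hyps show ?case unfolding hyb by (simp add: add.commute)
qed

lemma chain_rule:
 fixes \<gamma> :: "real \<Rightarrow> jet"
 assumes "open S" "Ck 1 S \<Phi>" "finite K" "depends_on K S \<Phi>" "\<forall>\<^sub>F s in nhds s0. \<gamma> s \<in> S"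
  and "\<And>y. y \<in> K ==> ((\<lambda>s. \<gamma> s y) has_field_derivative \<gamma>' y) (at s0)"
 shows "((\<lambda>s. \<Phi> (\<gamma> s)) has_field_derivative (\<Sum>y\<in>K. pd y \<Phi> (\<gamma> s0) * \<gamma>' y)) (at s0)"
proof -
 have p: "\<gamma> s0 \<in> S" using assms(5) eventually_nhds_x_imp_x by blast
 define h where "h s = (\<lambda>y. if y \<in> K then \<gamma> s y else \<gamma> s0 y)" for s
 have d: "((\<lambda>s. \<Phi> (h s)) has_field_derivative (\<Sum>y\<in>K. pd y \<Phi> (\<gamma> s0) * \<gamma>' y)) (at s0)"
  unfolding h_def using chain_hybrid[OF assms(1-3) p, of "\<lambda>y s. \<gamma> s y" \<gamma>' s0] assms(6) by simp
 obtain K0 \<epsilon> where K0: "finite K0" "\<epsilon> > 0" "\<And>q. (\<And>z. z \<in> K0 ==> \<bar>q z - \<gamma> s0 z\<bar> < \<epsilon>) ==> q \<in> S"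
  using open_jet_box[OF assms(1) p] by metis
 have "\<forall>\<^sub>F s in nhds s0. \<forall>z\<in>K. \<bar>\<gamma> s z - \<gamma> s0 z\<bar> < \<epsilon>"
 proof (rule eventually_ball_finite)
  show "\<forall>z\<in>K. \<forall>\<^sub>F s in nhds s0. \<bar>\<gamma> s z - \<gamma> s0 z\<bar> < \<epsilon>"
  proof
   fix z assume z: "z \<in> K"
   have "isCont (\<lambda>s. \<gamma> s z) s0" using assms(6)[OF z] DERIV_isCont by blast
   then have "((\<lambda>s. \<gamma> s z) \<longlongrightarrow> \<gamma> s0 z) (nhds s0)"
    using tendsto_at_iff_tendsto_nhds[of "\<lambda>s. \<gamma> s z" s0] by (simp add: isCont_def)
   from tendstoD[OF this K0(2)] show "\<forall>\<^sub>F s in nhds s0. \<bar>\<gamma> s z - \<gamma> s0 z\<bar> < \<epsilon>" by (simp add: dist_real_def)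
  qed
 qed (use assms in auto)
 then have "\<forall>\<^sub>F s in nhds s0. \<Phi> (\<gamma> s) = \<Phi> (h s)"
  using assms(5)
 proof eventually_elim
  case (elim s)
  have "h s \<in> S" by (rule K0(3)) (use elim K0(2) in \<open>auto simp: h_def\<close>)
  then show ?case by (intro depends_onD[OF assms(4)]) (use elim in \<open>auto simp: h_def\<close>)
 qed
 then show ?thesis using d by (subst DERIV_cong_ev[OF refl _ refl])
qed

lemma continuous_on_jetI: "(\<And>y. continuous_on S (\<lambda>p. \<sigma> p y)) ==> continuous_on S (\<sigma> :: 'a::topological_space \<Rightarrow> jet)"
 by (rule continuous_on_coordinatewise_then_product)

lemma Ck_compose:
 fixes \<sigma> :: "jet \<Rightarrow> jet"
 assumes "open S" "open T" "Ck k T \<Phi>" "finite K" "depends_on K T \<Phi>"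
  and "\<And>p. p \<in> S ==> \<sigma> p \<in> T" "continuous_on S \<sigma>" "\<And>y. y \<in> K ==> Ck k S (\<lambda>p. \<sigma> p y)"
 shows "Ck k S (\<lambda>p. \<Phi> (\<sigma> p))"
 using assms(3,5,8)
proof (induction k arbitrary: \<Phi>)
 case 0
 then show ?case using continuous_on_compose2[of T \<Phi> S \<sigma>] assms(6,7) by auto
next
 case (Suc k)
 show ?case
 proof (rule Ck_SucI[where D = "\<lambda>z p. \<Sum>y\<in>K. pd y \<Phi> (\<sigma> p) * pd z (\<lambda>q. \<sigma> q y) p", OF assms(1)])
  show "continuous_on S (\<lambda>p. \<Phi> (\<sigma> p))"
   using continuous_on_compose2[OF Ck_continuous[OF Suc.prems(1)] assms(7)] assms(6) by auto
  show "Ck k S (\<lambda>p. \<Sum>y\<in>K. pd y \<Phi> (\<sigma> p) * pd z (\<lambda>q. \<sigma> q y) p)" for z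
  proof (intro Ck_sum Ck_mult assms(1))
   fix y assume y: "y \<in> K"
   show "Ck k S (\<lambda>p. pd y \<Phi> (\<sigma> p))"
    by (rule Suc.IH) (use Suc.prems y depends_on_pd[OF assms(2)] Ck_Suc_imp in \<open>auto\<close>)
   show "Ck k S (pd z (\<lambda>q. \<sigma> q y))" using Suc.prems(3)[OF y] Ck_Suc_pd by blast
  qed
  fix p z assume p: "p \<in> S"
  have cont: "continuous_on {s. p(z := s) \<in> S} (\<lambda>s. \<sigma> (p(z := s)))"
   by (rule continuous_on_compose2[OF assms(7) continuous_on_slice]) auto
  have "open ((\<lambda>s. \<sigma> (p(z := s))) -` T \<inter> {s. p(z := s) \<in> S})"
   using continuous_open_preimage[OF cont open_slice[OF assms(1)] assms(2)] by (simp add: Int_commute)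
  then have "\<forall>\<^sub>F s in nhds (p z). \<sigma> (p(z := s)) \<in> T"
   using p assms(6) by (subst eventually_nhds) (auto intro!: exI[of _ "(\<lambda>s. \<sigma> (p(z := s))) -` T \<inter> {s. p(z := s) \<in> S}"])
  from chain_rule[OF assms(2) _ assms(4) Suc.prems(2) this, of "\<lambda>y. pd z (\<lambda>q. \<sigma> q y) p"]
  show "((\<lambda>s. \<Phi> (\<sigma> (p(z := s)))) has_real_derivative (\<Sum>y\<in>K. pd y \<Phi> (\<sigma> p) * pd z (\<lambda>q. \<sigma> q y) p)) (at (p z))"
   using Ck_mono[OF Suc.prems(1), of 1] Ck_DERIV[OF Suc.prems(3) p] by simp
 qed
qed

lemma local_lipschitz:
 assumes "open S" "Ck 1 S \<Phi>" "finite K" "p \<in> S"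
 obtains \<epsilon> C where "\<epsilon> > 0" "C \<ge> 0"
  "\<And>q. (\<And>y. y \<in> K ==> \<bar>q y - p y\<bar> < \<epsilon>) ==> (\<And>y. y \<notin> K ==> q y = p y) ==> q \<in> S"
  "\<And>q q'. (\<And>y. y \<in> K ==> \<bar>q y - p y\<bar> < \<epsilon> \<and> \<bar>q' y - p y\<bar> < \<epsilon>) ==> (\<And>y. y \<notin> K ==> q y = p y \<and> q' y = p y) ==>
    \<bar>\<Phi> q - \<Phi> q'\<bar> \<le> C * (\<Sum>y\<in>K. \<bar>q y - q' y\<bar>)"
proof -
 \<comment> \<open>Near \<open>p\<close> each partial derivative differs from its value at
   \<open>p\<close> by less than 1, so this constant bounds all of them.\<close>
 define C where "C = (\<Sum>y\<in>K. \<bar>pd y \<Phi> p\<bar> + 1)"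
 define N where "N = S \<inter> (\<Inter>y\<in>K. S \<inter> pd y \<Phi> -` ball (pd y \<Phi> p) 1)"
 have "open N" unfolding N_def using assms
  by (intro open_Int open_INT ballI continuous_open_preimage) auto
 moreover have "p \<in> N" using assms(4) by (simp add: N_def)
 ultimately obtain K0 \<epsilon> where K0: "finite K0" "\<epsilon> > 0" "\<And>q. (\<And>z. z \<in> K0 ==> \<bar>q z - p z\<bar> < \<epsilon>) ==> q \<in> N"
  using open_jet_box by metis
 have C0: "C \<ge> 0" unfolding C_def by (intro sum_nonneg) auto
 have C: "\<bar>pd y \<Phi> q\<bar> \<le> C" if "y \<in> K" "q \<in> N" for y q
 proof -
  have "\<bar>pd y \<Phi> q - pd y \<Phi> p\<bar> < 1" using that by (auto simp: N_def dist_real_def abs_minus_commute split: if_splits)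
  then have "\<bar>pd y \<Phi> q\<bar> \<le> \<bar>pd y \<Phi> p\<bar> + 1" by linarith
  also have "\<dots> \<le> C" unfolding C_def by (rule member_le_sum) (use that assms in auto)
  finally show ?thesis .
 qed
 have main: "\<bar>\<Phi> q - \<Phi> q'\<bar> \<le> C * (\<Sum>y\<in>K'. \<bar>q y - q' y\<bar>)"
  if "finite K'" "K' \<subseteq> K" "\<And>y. y \<notin> K' ==> q y = q' y" "\<And>y. \<bar>q y - p y\<bar> < \<epsilon>" "\<And>y. \<bar>q' y - p y\<bar> < \<epsilon>" for K' q q'
  using that
 proof (induction K' arbitrary: q' rule: finite_induct)
  case empty
  then have "q = q'" by auto
  then show ?case by simp
 next
  case (insert y K')
  define r where "r = q'(y := q y)"
  have rN: "q'(y := \<xi>) \<in> N" if "\<bar>\<xi> - p y\<bar> < \<epsilon>" for \<xi>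
   by (rule K0(3)) (use insert.prems that in auto)
  have 1: "\<bar>\<Phi> q - \<Phi> r\<bar> \<le> C * (\<Sum>y\<in>K'. \<bar>q y - r y\<bar>)"
   by (rule insert.IH) (use insert in \<open>auto simp: r_def\<close>)
  have 11: "(\<Sum>y\<in>K'. \<bar>q y - r y\<bar>) = (\<Sum>y\<in>K'. \<bar>q y - q' y\<bar>)"
   by (rule sum.cong) (use insert in \<open>auto simp: r_def\<close>)
  have seg: "\<bar>\<xi> - p y\<bar> < \<epsilon>" if "min (q' y) (q y) \<le> \<xi>" "\<xi> \<le> max (q' y) (q y)" for \<xi>
   using insert.prems(3)[of y] insert.prems(4)[of y] that by (auto simp: min_def max_def abs_less_iff split: if_splits)
  have D: "((\<lambda>s. \<Phi> (q'(y := s))) has_field_derivative pd y \<Phi> (q'(y := \<xi>))) (at \<xi>)"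
   if "min (q' y) (q y) \<le> \<xi>" "\<xi> \<le> max (q' y) (q y)" for \<xi>
   using Ck_DERIV'[of 0 S \<Phi> q' y \<xi>] assms(2) rN[OF seg[OF that]] by (auto simp: N_def)
  have "norm (\<Phi> (q'(y := q y)) - \<Phi> (q'(y := q' y))) \<le> C * norm (q y - q' y)"
  proof (rule field_differentiable_bound[of "{min (q' y) (q y)..max (q' y) (q y)}"])
   show "((\<lambda>s. \<Phi> (q'(y := s))) has_field_derivative pd y \<Phi> (q'(y := \<xi>))) (at \<xi> within {min (q' y) (q y)..max (q' y) (q y)})"
    if "\<xi> \<in> {min (q' y) (q y)..max (q' y) (q y)}" for \<xi> using D[of \<xi>] that by (auto intro: DERIV_subset)
   show "norm (pd y \<Phi> (q'(y := \<xi>))) \<le> C" if "\<xi> \<in> {min (q' y) (q y)..max (q' y) (q y)}" for \<xi>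
    using C[OF _ rN[OF seg, of \<xi>]] insert.prems(1) that by auto
  qed auto
  then have 2: "\<bar>\<Phi> r - \<Phi> q'\<bar> \<le> C * \<bar>q y - q' y\<bar>" by (simp add: r_def)
  have "\<bar>\<Phi> q - \<Phi> q'\<bar> \<le> \<bar>\<Phi> q - \<Phi> r\<bar> + \<bar>\<Phi> r - \<Phi> q'\<bar>" by linarith
  then show ?case using 1 2 11 insert.hyps by (simp add: algebra_simps)
 qed
 show ?thesis
 proof (rule that[OF K0(2) C0])
  show "q \<in> S" if "\<And>y. y \<in> K ==> \<bar>q y - p y\<bar> < \<epsilon>" "\<And>y. y \<notin> K ==> q y = p y" for q
  proof -
   have "q \<in> N" by (rule K0(3)) (use that K0(2) in \<open>metis abs_zero diff_self\<close>)
   then show ?thesis by (simp add: N_def)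
  qed
  show "\<bar>\<Phi> q - \<Phi> q'\<bar> \<le> C * (\<Sum>y\<in>K. \<bar>q y - q' y\<bar>)"
   if "\<And>y. y \<in> K ==> \<bar>q y - p y\<bar> < \<epsilon> \<and> \<bar>q' y - p y\<bar> < \<epsilon>" "\<And>y. y \<notin> K ==> q y = p y \<and> q' y = p y" for q q'
   by (rule main[OF assms(3) order_refl]) (use that K0(2) in \<open>metis abs_zero diff_self\<close>)+
 qed
qed

text \<open>The second difference over a small square is \<open>d * d\<close> times a mixed
  derivative at some jet of the box, in either order of differentiation; continuity of both mixed
  derivatives closes the gap.\<close>

lemma pd_commute:
 assumes "open S" "Ck 2 S F" "p \<in> S"
 shows "pd y (pd z F) p = pd z (pd y F) p"
proof (cases "y = z")
 case False
 have C1: "Ck (Suc 0) S F" using assms(2) Ck_Suc_imp by (simp add: numeral_2_eq_2 del: Ck.simps)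
 have C1': "Ck (Suc 0) S (pd v F)" for v using assms(2) by (metis Ck_Suc_pd numeral_2_eq_2)
 have cont: "continuous_on S (pd v (pd w F))" for v w using C1'[of w] by simp
 have MV: "\<exists>q. (\<forall>x. \<bar>q x - p x\<bar> \<le> d) \<and>
   F (p(v := p v + d, w := p w + d)) - F (p(v := p v + d)) - F (p(w := p w + d)) + F p = d * d * pd v (pd w F) q"
  if "d > 0" "v \<noteq> w" and box: "\<And>q. (\<And>x. \<bar>q x - p x\<bar> \<le> d) ==> q \<in> S" for d v w
 proof -
  define g where "g s = F (p(v := p v + d, w := s)) - F (p(w := s))" for s
  obtain \<xi> where \<xi>: "\<bar>\<xi> - p w\<bar> \<le> \<bar>p w + d - p w\<bar>"
   "g (p w + d) - g (p w) = (p w + d - p w) * (pd w F (p(v := p v + d, w := \<xi>)) - pd w F (p(w := \<xi>)))"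
  proof (rule mvt_segment)
   show "(g has_real_derivative pd w F (p(v := p v + d, w := \<xi>)) - pd w F (p(w := \<xi>))) (at \<xi>)"
    if "\<bar>\<xi> - p w\<bar> \<le> \<bar>p w + d - p w\<bar>" for \<xi>
    unfolding g_def
    by (intro DERIV_diff Ck_DERIV'[OF C1] box) (use that \<open>d > 0\<close> in auto)
  qed auto
  obtain \<zeta> where \<zeta>: "\<bar>\<zeta> - p v\<bar> \<le> \<bar>p v + d - p v\<bar>"
   "pd w F (p(w := \<xi>, v := p v + d)) - pd w F (p(w := \<xi>, v := p v)) = (p v + d - p v) * pd v (pd w F) (p(w := \<xi>, v := \<zeta>))"
  proof (rule mvt_segment)
   show "((\<lambda>s. pd w F (p(w := \<xi>, v := s))) has_real_derivative pd v (pd w F) (p(w := \<xi>, v := \<zeta>))) (at \<zeta>)"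
    if "\<bar>\<zeta> - p v\<bar> \<le> \<bar>p v + d - p v\<bar>" for \<zeta>
    by (intro Ck_DERIV'[OF C1'] box) (use that \<xi>(1) \<open>d > 0\<close> in auto)
  qed auto
  have e1: "p(v := p v + d, w := \<xi>) = p(w := \<xi>, v := p v + d)" "p(w := \<xi>, v := p v) = p(w := \<xi>)" "p(v := p v + d, w := p w) = p(v := p v + d)"
   using \<open>v \<noteq> w\<close> by (auto simp: fun_upd_twist)
  show ?thesis
   by (rule exI[of _ "p(w := \<xi>, v := \<zeta>)"])
    (use \<xi> \<zeta> e1 \<open>d > 0\<close> in \<open>auto simp: g_def algebra_simps\<close>)
 qed
 have "\<bar>pd y (pd z F) p - pd z (pd y F) p\<bar> < 2 * e" if "e > 0" for e
 proof -
  define N where "N v w = S \<inter> pd v (pd w F) -` ball (pd v (pd w F) p) e" for v w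
  have "open (N v w)" for v w unfolding N_def by (rule continuous_open_preimage[OF cont assms(1) open_ball])
  then have "open (N y z \<inter> N z y)" by blast
  moreover have "p \<in> N y z \<inter> N z y" using assms(3) that by (simp add: N_def)
  ultimately obtain K0 \<epsilon> where K0: "finite K0" "\<epsilon> > 0" "\<And>q. (\<And>x. x \<in> K0 ==> \<bar>q x - p x\<bar> < \<epsilon>) ==> q \<in> N y z \<inter> N z y"
   using open_jet_box by metis
  define d where "d = \<epsilon> / 2"
  have d: "d > 0" "d < \<epsilon>" using K0 by (auto simp: d_def)
  have box: "q \<in> N y z \<inter> N z y" if "\<And>x. \<bar>q x - p x\<bar> \<le> d" for q
   by (rule K0(3)) (use that d in \<open>metis order_le_less_trans\<close>)
  have boxS: "q \<in> S" if "\<And>x. \<bar>q x - p x\<bar> \<le> d" for q using box[OF that] by (auto simp: N_def)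
  obtain q where q: "\<And>x. \<bar>q x - p x\<bar> \<le> d"
   "F (p(y := p y + d, z := p z + d)) - F (p(y := p y + d)) - F (p(z := p z + d)) + F p = d * d * pd y (pd z F) q"
   using MV[OF d(1) False boxS] by blast
  obtain q' where q': "\<And>x. \<bar>q' x - p x\<bar> \<le> d"
   "F (p(z := p z + d, y := p y + d)) - F (p(z := p z + d)) - F (p(y := p y + d)) + F p = d * d * pd z (pd y F) q'"
   using MV[OF d(1) False[symmetric] boxS] by blast
  have "d * d * pd y (pd z F) q = d * d * pd z (pd y F) q'"
   using q(2) q'(2) unfolding fun_upd_twist[OF False, of p "p y + d" "p z + d"] by linarith
  then have "pd y (pd z F) q = pd z (pd y F) q'" using d by simp
  moreover have "\<bar>pd y (pd z F) p - pd y (pd z F) q\<bar> < e" "\<bar>pd z (pd y F) p - pd z (pd y F) q'\<bar> < e"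
   using box[OF q(1)] box[OF q'(1)] by (auto simp: N_def dist_real_def)
  ultimately show ?thesis by linarith
 qed
 then show ?thesis by (metis abs_ge_zero diff_numeral_special(9) eq_iff_diff_eq_0 field_sum_of_halves less_irrefl mult_2 zero_less_abs_iff half_gt_zero)
qed simp

section \<open>Primitives in one coordinate\<close>

lemma scaled_integral_vector_derivative:
 fixes g :: "real \<Rightarrow> 'a::banach"
 assumes "continuous_on {a..b} g" "a \<le> 0" "0 \<le> b" "s \<in> {a..b}"
 shows "((\<lambda>s. s *\<^sub>R integral {0..1} (\<lambda>\<theta>. g (\<theta> * s))) has_vector_derivative g s) (at s within {a..b})"
proof -
 obtain G where G: "\<And>x. x \<in> {a..b} ==> (G has_vector_derivative g x) (at x within {a..b})"
  using antiderivative_continuous[OF assms(1)] by blast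
 have mem: "\<theta> * s \<in> {a..b}" if "\<theta> \<in> {0..1}" "s \<in> {a..b}" for \<theta> s
 proof -
  have "\<theta> * s \<le> max 0 s" "min 0 s \<le> \<theta> * s"
   using that(1) mult_left_le_one_le[of s \<theta>] mult_left_le_one_le[of "-s" \<theta>] mult_nonneg_nonneg[of \<theta> s] mult_nonneg_nonpos[of \<theta> s]
   by (auto simp: max_def min_def)
  then show ?thesis using assms that(2) by auto
 qed
 have eq: "s *\<^sub>R integral {0..1} (\<lambda>\<theta>. g (\<theta> * s)) = G s - G 0" if "s \<in> {a..b}" for s
 proof -
  have "((\<lambda>\<theta>. s *\<^sub>R g (\<theta> * s)) has_integral (G (1 * s) - G (0 * s))) {0..1}"
  proof (rule fundamental_theorem_of_calculus)
   fix \<theta> :: real assume \<theta>: "\<theta> \<in> {0..1}"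
   have "((\<lambda>\<theta>. \<theta> * s) has_vector_derivative s) (at \<theta> within {0..1})"
    by (auto intro!: derivative_eq_intros simp: has_real_derivative_iff_has_vector_derivative[symmetric])
   moreover have "(G has_vector_derivative g (\<theta> * s)) (at (\<theta> * s) within (\<lambda>\<theta>. \<theta> * s) ` {0..1})"
    by (rule has_vector_derivative_within_subset[OF G[OF mem[OF \<theta> that]]]) (use mem that in auto)
   ultimately show "((\<lambda>\<theta>. G (\<theta> * s)) has_vector_derivative s *\<^sub>R g (\<theta> * s)) (at \<theta> within {0..1})"
    using vector_diff_chain_within[of "\<lambda>\<theta>. \<theta> * s" s \<theta> "{0..1}" G "g (\<theta> * s)"] by (simp add: o_def)
  qed auto
  moreover have "(\<lambda>\<theta>. g (\<theta> * s)) integrable_on {0..1}"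
   by (rule integrable_continuous_real, rule continuous_on_compose2[OF assms(1)])
    (use mem that in \<open>auto intro!: continuous_intros\<close>)
  ultimately show ?thesis by (metis integral_cmul integral_unique mult_1 mult_zero_left)
 qed
 have "((\<lambda>s. G s - G 0) has_vector_derivative g s) (at s within {a..b})"
  using has_vector_derivative_diff[OF G[OF assms(4)] has_vector_derivative_const] by simp
 then show ?thesis
  by (rule has_vector_derivative_transform[OF assms(4), rotated]) (use eq in auto)
qed

lemma scaled_integral_DERIV:
 fixes g :: "real \<Rightarrow> real"
 assumes "open A" "s \<in> A" "\<And>s \<theta>. s \<in> A ==> \<theta> \<in> {0..1} ==> \<theta> * s \<in> A" "continuous_on A g"
 shows "((\<lambda>s. s * integral {0..1} (\<lambda>\<theta>. g (\<theta> * s))) has_field_derivative g s) (at s)"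
proof -
 have 0: "0 \<in> A" using assms(3)[OF assms(2), of 0] by simp
 obtain e where e: "e > 0" "cball s e \<subseteq> A" using assms(1,2) open_contains_cball by blast
 obtain e' where e': "e' > 0" "cball 0 e' \<subseteq> A" using assms(1) 0 open_contains_cball by blast
 define a where "a = min (s - e) (- e')"
 define b where "b = max (s + e) e'"
 have ab: "a \<in> A" "b \<in> A" "a < 0" "0 < b" "a < s" "s < b"
  using e e' by (auto simp: a_def b_def min_def max_def dist_real_def)
 have sub: "{a..b} \<subseteq> A"
 proof
  fix x assume x: "x \<in> {a..b}"
  show "x \<in> A"
  proof (cases "x \<ge> 0")
   case True
   then show ?thesis using assms(3)[OF ab(2), of "x / b"] x ab by auto
  next
   case False
   then show ?thesis using assms(3)[OF ab(1), of "x / a"] x ab by (auto simp: divide_simps)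
  qed
 qed
 have "((\<lambda>s. s *\<^sub>R integral {0..1} (\<lambda>\<theta>. g (\<theta> * s))) has_vector_derivative g s) (at s within {a..b})"
  by (rule scaled_integral_vector_derivative) (use ab sub assms(4) in \<open>auto intro: continuous_on_subset\<close>)
 then have "((\<lambda>s. s * integral {0..1} (\<lambda>\<theta>. g (\<theta> * s))) has_field_derivative g s) (at s within {a..b})"
  by (simp add: has_real_derivative_iff_has_vector_derivative)
 then show ?thesis using ab by (simp add: at_within_Icc_at)
qed

text \<open>The primitive in the coordinate \<open>y\<close> that vanishes at \<open>y = 0\<close>,
  with the integral transported to the fixed interval [0,1]. No case distinction on signs arises and
  theorems on parameter integrals apply directly; the price is that domains must be star-shaped in
  the direction \<open>y\<close>.\<close>

definition Iy :: "jvar \<Rightarrow> (jet \<Rightarrow> real) \<Rightarrow> jet \<Rightarrow> real" where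
 "Iy y F p = p y * integral {0..1} (\<lambda>\<theta>. F (p(y := \<theta> * p y)))"

lemma continuous_on_fst_proj: "continuous_on A (\<lambda>x. (fst x :: jet) y)"
 by (rule continuous_on_product_then_coordinatewise) (intro continuous_intros)

lemma Iy_integrand_continuous:
 fixes F :: "jet \<Rightarrow> real"
 assumes "continuous_on S F" "\<And>p \<theta>. p \<in> S ==> \<theta> \<in> {0..1} ==> p(y := \<theta> * p y) \<in> S"
 shows "continuous_on (S \<times> cbox 0 1) (\<lambda>(p, \<theta>). F (p(y := \<theta> * p y)))"
 unfolding split_beta
proof (rule continuous_on_compose2[OF assms(1)])
 show "continuous_on (S \<times> cbox 0 1) (\<lambda>x. (fst x)(y := snd x * fst x y))"
 proof (rule continuous_on_fun_upd)
  show "continuous_on (S \<times> cbox 0 1) (\<lambda>x. snd x * fst x y)"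
   using continuous_on_mult[OF continuous_on_snd[OF continuous_on_id] continuous_on_fst_proj] .
 qed (rule continuous_on_fst[OF continuous_on_id])
qed (use assms(2) in auto)

lemma Iy_continuous:
 fixes F :: "jet \<Rightarrow> real"
 assumes "continuous_on S F" "\<And>p \<theta>. p \<in> S ==> \<theta> \<in> {0..1} ==> p(y := \<theta> * p y) \<in> S"
 shows "continuous_on S (Iy y F)"
 using integral_continuous_on_param[OF Iy_integrand_continuous[OF assms]]
 unfolding Iy_def by (auto intro!: continuous_on_mult continuous_on_jet_proj)

lemma Iy_DERIV:
 fixes F :: "jet \<Rightarrow> real"
 assumes "open S" "continuous_on S F" "\<And>p \<theta>. p \<in> S ==> \<theta> \<in> {0..1} ==> p(y := \<theta> * p y) \<in> S" "p \<in> S"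
 shows "((\<lambda>s. Iy y F (p(y := s))) has_field_derivative F p) (at (p y))"
proof -
 have "((\<lambda>s. s * integral {0..1} (\<lambda>\<theta>. F (p(y := \<theta> * s)))) has_field_derivative F (p(y := p y))) (at (p y))"
 proof (rule scaled_integral_DERIV[OF open_slice[OF assms(1), of p y]])
  show "\<theta> * s \<in> {s. p(y := s) \<in> S}" if "s \<in> {s. p(y := s) \<in> S}" "\<theta> \<in> {0..1}" for s \<theta>
   using assms(3)[of "p(y := s)" \<theta>] that by simp
  show "continuous_on {s. p(y := s) \<in> S} (\<lambda>s. F (p(y := s)))"
   by (rule continuous_on_compose2[OF assms(2) continuous_on_slice]) auto
 qed (use assms(4) in auto)
 then show ?thesis unfolding Iy_def by simp
qed

lemma Iy_DERIV_other:
 fixes F :: "jet \<Rightarrow> real"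
 assumes "open S" "Ck 1 S F" "\<And>p \<theta>. p \<in> S ==> \<theta> \<in> {0..1} ==> p(y := \<theta> * p y) \<in> S" "p \<in> S" "z \<noteq> y"
 shows "((\<lambda>s. Iy y F (p(z := s))) has_field_derivative Iy y (pd z F) p) (at (p z))"
proof -
 obtain e where e: "e > 0" "ball (p z) e \<subseteq> {s. p(z := s) \<in> S}"
  using open_slice[OF assms(1), of p z] assms(4) open_contains_ball by (metis (mono_tags) fun_upd_triv mem_Collect_eq)
 have inS: "p(z := s, y := \<theta> * p y) \<in> S" if "s \<in> ball (p z) e" "\<theta> \<in> {0..1}" for s \<theta>
  using assms(3)[of "p(z := s)" \<theta>] e that assms(5) by auto
 have C: "Ck (Suc 0) S F" using assms(2) by simp
 have cF: "continuous_on S F" "continuous_on S (pd z F)" using C by auto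
 have "((\<lambda>s. integral (cbox 0 1) (\<lambda>\<theta>. F (p(z := s, y := \<theta> * p y)))) has_field_derivative
   integral (cbox 0 1) (\<lambda>\<theta>. pd z F (p(z := p z, y := \<theta> * p y)))) (at (p z) within ball (p z) e)"
 proof (rule leibniz_rule_field_derivative[where fx = "\<lambda>s \<theta>. pd z F (p(z := s, y := \<theta> * p y))"])
  show "((\<lambda>s. F (p(z := s, y := t * p y))) has_field_derivative pd z F (p(z := s, y := t * p y))) (at s within ball (p z) e)"
   if "s \<in> ball (p z) e" "t \<in> cbox 0 1" for s t
  proof -
   have "p(z := s, y := t * p y) = p(y := t * p y, z := s)" for s using assms(5) by (simp add: fun_upd_twist)
   then show ?thesis
    using Ck_DERIV'[OF C, of "p(y := t * p y)" z s] inS[of s t] that by (auto intro: has_field_derivative_at_within)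
  qed
  have ci: "continuous_on {0..1} (\<lambda>\<theta>. p(z := s, y := \<theta> * p y))" for s
   by (intro continuous_on_fun_upd continuous_on_const continuous_intros)
  show "(\<lambda>\<theta>. F (p(z := s, y := \<theta> * p y))) integrable_on cbox 0 1" if "s \<in> ball (p z) e" for s
   unfolding cbox_interval
   by (rule integrable_continuous_real, rule continuous_on_compose2[OF cF(1) ci]) (use inS that in auto)
  show "continuous_on (ball (p z) e \<times> cbox 0 1) (\<lambda>(s, \<theta>). pd z F (p(z := s, y := \<theta> * p y)))"
   unfolding split_beta
  proof (rule continuous_on_compose2[OF cF(2)])
   show "continuous_on (ball (p z) e \<times> cbox 0 1) (\<lambda>x. p(z := fst x, y := snd x * p y))"
    by (intro continuous_on_fun_upd continuous_on_const continuous_on_mult continuous_on_fst continuous_on_snd continuous_on_id)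
  qed (use inS in auto)
 qed (use e in auto)
 then have "((\<lambda>s. integral {0..1} (\<lambda>\<theta>. F (p(z := s, y := \<theta> * p y)))) has_field_derivative
   integral {0..1} (\<lambda>\<theta>. pd z F (p(y := \<theta> * p y)))) (at (p z))"
  using e by (simp add: at_within_open[of _ "ball (p z) e"])
 from DERIV_cmult[OF this, of "p y"] assms(5) show ?thesis unfolding Iy_def by simp
qed

lemma Iy_Ck:
 fixes F :: "jet \<Rightarrow> real"
 assumes "open S" "Ck k S F" "\<And>p \<theta>. p \<in> S ==> \<theta> \<in> {0..1} ==> p(y := \<theta> * p y) \<in> S"
 shows "Ck k S (Iy y F)"
 using assms(2)
proof (induction k arbitrary: F)
 case 0
 then show ?case using Iy_continuous[OF _ assms(3)] by simp
next
 case (Suc k)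
 show ?case
 proof (rule Ck_SucI[OF assms(1), where D = "\<lambda>z. if z = y then F else Iy y (pd z F)"])
  show "continuous_on S (Iy y F)" by (rule Iy_continuous[OF Ck_continuous[OF Suc.prems] assms(3)])
  show "Ck k S (if z = y then F else Iy y (pd z F))" for z
   using Suc.IH[OF Ck_Suc_pd[OF Suc.prems]] Ck_Suc_imp[OF Suc.prems] by simp
  show "((\<lambda>s. Iy y F (p(z := s))) has_real_derivative (if z = y then F else Iy y (pd z F)) p) (at (p z))"
   if "p \<in> S" for p z
   using Iy_DERIV[OF assms(1) Ck_continuous[OF Suc.prems] assms(3) that]
    Iy_DERIV_other[OF assms(1) Ck_mono[OF Suc.prems] assms(3) that] by auto
 qed
qed

section \<open>A Goursat problem\<close>

lemma integral_diff_bound: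
 fixes f g :: "real \<Rightarrow> 'a::banach"
 assumes "continuous_on {0..1} f" "continuous_on {0..1} g" "\<And>\<theta>. \<theta> \<in> {0..1} ==> norm (f \<theta> - g \<theta>) \<le> K"
 shows "norm (integral {0..1} f - integral {0..1} g) \<le> K"
proof -
 have "integral {0..1} f - integral {0..1} g = integral {0..1} (\<lambda>\<theta>. f \<theta> - g \<theta>)"
  by (rule integral_diff[symmetric]) (use assms integrable_continuous_real in auto)
 also have "norm \<dots> \<le> K * (1 - 0)"
  by (rule integral_bound) (use assms in \<open>auto intro!: continuous_intros\<close>)
 finally show ?thesis by simp
qed

text \<open>Contraction on continuous functions with values in the closed ball around
  \<open>w0\<close>. The first component is integrated in \<open>t\<close> from data on
  \<open>t = 0\<close>, the second in \<open>y\<close> from data on \<open>y = 0\<close>. Banach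
  spaces are allowed because the same statement, with \<open>F2 = 0\<close>, later yields ordinary
  differential equations.\<close>

lemma goursat:
 fixes F1 :: "'a::banach \<times> 'b::banach \<Rightarrow> 'a" and F2 :: "'a \<times> 'b \<Rightarrow> 'b"
 assumes "\<rho> > 0" "L \<ge> 0"
  and L1: "\<And>w w'. w \<in> cball w0 \<rho> ==> w' \<in> cball w0 \<rho> ==> norm (F1 w - F1 w') \<le> L * norm (w - w')"
  and L2: "\<And>w w'. w \<in> cball w0 \<rho> ==> w' \<in> cball w0 \<rho> ==> norm (F2 w - F2 w') \<le> L * norm (w - w')"
  and a0: "continuous_on UNIV a0" "a0 0 = fst w0" and b0: "continuous_on UNIV b0" "b0 0 = snd w0"
 obtains r and w :: "real \<times> real \<Rightarrow> 'a \<times> 'b" where "r > 0" "continuous_on UNIV w" "\<forall>q. w q \<in> cball w0 \<rho>"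
  "\<forall>y t. \<bar>y\<bar> \<le> r \<and> \<bar>t\<bar> \<le> r \<longrightarrow> fst (w (y, t)) = a0 y + t *\<^sub>R integral {0..1} (\<lambda>\<theta>. F1 (w (y, \<theta> * t)))"
  "\<forall>y t. \<bar>y\<bar> \<le> r \<and> \<bar>t\<bar> \<le> r \<longrightarrow> snd (w (y, t)) = b0 t + y *\<^sub>R integral {0..1} (\<lambda>\<theta>. F2 (w (\<theta> * y, t)))"
proof -
 define B where "B = 1 + norm (F1 w0) + norm (F2 w0) + L * \<rho>"
 have Bpos: "B \<ge> 1" using assms by (simp add: B_def)
 have F1B: "norm (F1 w) \<le> B" if "w \<in> cball w0 \<rho>" for w
 proof -
  have "norm (F1 w) \<le> norm (F1 w0) + norm (F1 w - F1 w0)" by norm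
  also have "norm (F1 w - F1 w0) \<le> L * norm (w - w0)" using L1 that assms(1) by auto
  also have "\<dots> \<le> L * \<rho>" using that assms(2) by (intro mult_left_mono) (auto simp: dist_norm norm_minus_commute)
  finally show ?thesis unfolding B_def using norm_ge_zero[of "F2 w0"] by linarith
 qed
 have F2B: "norm (F2 w) \<le> B" if "w \<in> cball w0 \<rho>" for w
 proof -
  have "norm (F2 w) \<le> norm (F2 w0) + norm (F2 w - F2 w0)" by norm
  also have "norm (F2 w - F2 w0) \<le> L * norm (w - w0)" using L2 that assms(1) by auto
  also have "\<dots> \<le> L * \<rho>" using that assms(2) by (intro mult_left_mono) (auto simp: dist_norm norm_minus_commute)
  finally show ?thesis unfolding B_def using norm_ge_zero[of "F1 w0"] by linarith
 qed
 have cF1: "continuous_on (cball w0 \<rho>) F1"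
  by (rule lipschitz_on_continuous_on[where L = L]) (use L1 assms(2) in \<open>auto simp: lipschitz_on_def dist_norm\<close>)
 have cF2: "continuous_on (cball w0 \<rho>) F2"
  by (rule lipschitz_on_continuous_on[where L = L]) (use L2 assms(2) in \<open>auto simp: lipschitz_on_def dist_norm\<close>)
 have "isCont a0 0" "isCont b0 0" using a0 b0 by (auto simp: continuous_on_eq_continuous_at)
 then obtain d1 d2 where d1: "d1 > 0" "\<And>y. \<bar>y\<bar> < d1 ==> dist (a0 y) (a0 0) < \<rho> / 4"
  and d2: "d2 > 0" "\<And>y. \<bar>y\<bar> < d2 ==> dist (b0 y) (b0 0) < \<rho> / 4"
  using assms(1) unfolding continuous_at_eps_delta by (metis dist_0_norm dist_commute real_norm_def zero_less_divide_iff zero_less_numeral)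
 \<comment> \<open>The data and the integral term each stay within \<rho>/4, so each component moves
   by at most \<rho>/2. The bound 1/4 on \<open>r * L\<close> in each of the two components gives
   the contraction factor 1/2.\<close>
 define r where "r = min (min (d1 / 2) (d2 / 2)) (min (\<rho> / (4 * B)) (1 / (4 * (L + 1))))"
 have r: "r > 0" "r < d1" "r < d2" "r * B \<le> \<rho> / 4" "r * L \<le> 1 / 4"
 proof -
  show "r > 0" using d1 d2 assms Bpos by (auto simp: r_def)
  show "r < d1" "r < d2" using d1 d2 by (auto simp: r_def min_def)
  have "r \<le> \<rho> / (4 * B)" by (simp add: r_def)
  then show "r * B \<le> \<rho> / 4" using Bpos by (simp add: field_simps)
  have "r \<le> 1 / (4 * (L + 1))" by (simp add: r_def)
  then have "r * (L + 1) \<le> 1 / 4" using assms(2) by (simp add: field_simps)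
  then show "r * L \<le> 1 / 4" using \<open>r > 0\<close> by (simp add: algebra_simps)
 qed
 \<comment> \<open>Clamping to the interval from -r to r makes the iteration act on functions on the
   whole plane, where bounded continuous functions form a complete space; inside the square the
   clamp is invisible.\<close>
 define c where "c y = max (- r) (min r y)" for y :: real
 have c: "\<bar>c y\<bar> \<le> r" for y using r by (auto simp: c_def)
 have c_id: "c y = y" if "\<bar>y\<bar> \<le> r" for y using that by (auto simp: c_def)
 have c_cont: "continuous_on A c" for A unfolding c_def by (intro continuous_intros)
 define P where "P w q = (a0 (c (fst q)) + c (snd q) *\<^sub>R integral {0..1} (\<lambda>\<theta>. F1 (w (c (fst q), \<theta> * c (snd q)))),
   b0 (c (snd q)) + c (fst q) *\<^sub>R integral {0..1} (\<lambda>\<theta>. F2 (w (\<theta> * c (fst q), c (snd q)))))"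
  for w :: "real \<times> real \<Rightarrow> 'a \<times> 'b" and q :: "real \<times> real"
 define s where "s = PiC UNIV (\<lambda>_ :: real \<times> real. cball w0 \<rho>)"
 have s_mem: "w \<in> s \<longleftrightarrow> (\<forall>q. apply_bcontfun w q \<in> cball w0 \<rho>)" for w by (auto simp: s_def mem_PiC_iff)
 have ci: "continuous_on {0..1} (\<lambda>\<theta>. F1 (apply_bcontfun w (y, \<theta> * t)))" "continuous_on {0..1} (\<lambda>\<theta>. F2 (apply_bcontfun w (\<theta> * y, t)))"
  if "w \<in> s" for w y t
 proof -
  show "continuous_on {0..1} (\<lambda>\<theta>. F1 (apply_bcontfun w (y, \<theta> * t)))"
   by (rule continuous_on_compose2[OF cF1], rule continuous_on_compose2[OF continuous_on_apply_bcontfun[of UNIV]])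
    (use that s_mem in \<open>auto intro!: continuous_intros\<close>)
  show "continuous_on {0..1} (\<lambda>\<theta>. F2 (apply_bcontfun w (\<theta> * y, t)))"
   by (rule continuous_on_compose2[OF cF2], rule continuous_on_compose2[OF continuous_on_apply_bcontfun[of UNIV]])
    (use that s_mem in \<open>auto intro!: continuous_intros\<close>)
 qed
 have int_le: "norm (integral {0..1} f) \<le> B" if "continuous_on {0..1} f" "\<And>\<theta>. \<theta> \<in> {0..1} ==> norm (f \<theta>) \<le> B" for f :: "real \<Rightarrow> 'c::banach"
  using integral_bound[of 0 1 f B] that by simp
 have P_ball: "P (apply_bcontfun w) q \<in> cball w0 \<rho>" if "w \<in> s" for w q
 proof -
  have i1: "norm (c (snd q) *\<^sub>R integral {0..1} (\<lambda>\<theta>. F1 (apply_bcontfun w (c (fst q), \<theta> * c (snd q))))) \<le> r * B"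
   unfolding norm_scaleR by (intro mult_mono int_le ci[OF that] F1B) (use c r that s_mem in auto)
  have i2: "norm (c (fst q) *\<^sub>R integral {0..1} (\<lambda>\<theta>. F2 (apply_bcontfun w (\<theta> * c (fst q), c (snd q))))) \<le> r * B"
   unfolding norm_scaleR by (intro mult_mono int_le ci[OF that] F2B) (use c r that s_mem in auto)
  have j1: "norm (a0 (c (fst q)) - fst w0) \<le> \<rho> / 4"
   using d1(2)[of "c (fst q)"] c[of "fst q"] r a0(2) by (auto simp: dist_norm)
  have j2: "norm (b0 (c (snd q)) - snd w0) \<le> \<rho> / 4"
   using d2(2)[of "c (snd q)"] c[of "snd q"] r b0(2) by (auto simp: dist_norm)
  have tri: "norm (x + y - z) \<le> \<rho> / 2" if "norm (x - z) \<le> \<rho> / 4" "norm y \<le> r * B" for x y z :: "'d::real_normed_vector"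
  proof -
   have "norm (x + y - z) \<le> norm (x - z) + norm y" using norm_triangle_ineq[of "x - z" y] by (simp add: algebra_simps)
   then show ?thesis using that r(4) by linarith
  qed
  have "norm (fst (P (apply_bcontfun w) q) - fst w0) \<le> \<rho> / 2" "norm (snd (P (apply_bcontfun w) q) - snd w0) \<le> \<rho> / 2"
   unfolding P_def fst_conv snd_conv using tri[OF j1 i1] tri[OF j2 i2] by auto
  moreover have "P (apply_bcontfun w) q - w0 = (fst (P (apply_bcontfun w) q) - fst w0, snd (P (apply_bcontfun w) q) - snd w0)"
   by (simp add: prod_eq_iff)
  ultimately have "norm (P (apply_bcontfun w) q - w0) \<le> \<rho>"
   using norm_Pair_le[of "fst (P (apply_bcontfun w) q) - fst w0" "snd (P (apply_bcontfun w) q) - snd w0"] by simp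
  then show ?thesis by (simp add: dist_norm norm_minus_commute)
 qed
 have P_cont: "continuous_on UNIV (P (apply_bcontfun w))" if "w \<in> s" for w
 proof -
  have 1: "continuous_on (UNIV \<times> cbox 0 1) (\<lambda>(q, \<theta>). F1 (apply_bcontfun w (c (fst q), \<theta> * c (snd q))))"
   unfolding split_beta
   by (rule continuous_on_compose2[OF cF1], rule continuous_on_compose2[OF continuous_on_apply_bcontfun[of UNIV]])
    (use that s_mem in \<open>auto intro!: continuous_intros continuous_on_compose2[OF c_cont[of UNIV]]\<close>)
  have 2: "continuous_on (UNIV \<times> cbox 0 1) (\<lambda>(q, \<theta>). F2 (apply_bcontfun w (\<theta> * c (fst q), c (snd q))))"
   unfolding split_beta
   by (rule continuous_on_compose2[OF cF2], rule continuous_on_compose2[OF continuous_on_apply_bcontfun[of UNIV]])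
    (use that s_mem in \<open>auto intro!: continuous_intros continuous_on_compose2[OF c_cont[of UNIV]]\<close>)
  show ?thesis unfolding P_def
   using integral_continuous_on_param[OF 1] integral_continuous_on_param[OF 2]
   by (auto intro!: continuous_intros continuous_on_compose2[OF c_cont[of UNIV]] continuous_on_compose2[OF a0(1)] continuous_on_compose2[OF b0(1)])
 qed
 define T where "T w = Bcontfun (P (apply_bcontfun w))" for w
 have T: "apply_bcontfun (T w) = P (apply_bcontfun w)" if "w \<in> s" for w
  unfolding T_def
 proof (rule Bcontfun_inverse)
  have "range (P (apply_bcontfun w)) \<subseteq> cball w0 \<rho>" using P_ball[OF that] by auto
  then show "P (apply_bcontfun w) \<in> bcontfun"
   using P_cont[OF that] bounded_subset[OF bounded_cball] by (auto simp: bcontfun_def)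
 qed
 have "\<exists>!w\<in>s. T w = w"
 proof (rule Banach_fix[of s "1/2"])
  have "closed s" unfolding s_def by (rule closed_PiC) auto
  then show "complete s" using complete_eq_closed by blast
  have "const_bcontfun w0 \<in> s" using assms(1) by (simp add: s_mem)
  then show "s \<noteq> {}" by auto
  show "T ` s \<subseteq> s" using T P_ball by (auto simp: s_mem)
  show "dist (T v) (T w) \<le> 1/2 * dist v w" if vs: "v \<in> s" and ws: "w \<in> s" for v w
  proof (rule dist_bound)
   fix q
   have lip: "norm (F1 (apply_bcontfun v x) - F1 (apply_bcontfun w x)) \<le> L * dist v w"
    "norm (F2 (apply_bcontfun v x) - F2 (apply_bcontfun w x)) \<le> L * dist v w" for x
   proof -
    have "norm (apply_bcontfun v x - apply_bcontfun w x) \<le> dist v w"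
     using dist_bounded[of v x w] by (simp add: dist_norm)
    from mult_left_mono[OF this assms(2)] have *: "L * norm (apply_bcontfun v x - apply_bcontfun w x) \<le> L * dist v w" .
    have m: "apply_bcontfun v x \<in> cball w0 \<rho>" "apply_bcontfun w x \<in> cball w0 \<rho>" using vs ws s_mem by blast+
    show "norm (F1 (apply_bcontfun v x) - F1 (apply_bcontfun w x)) \<le> L * dist v w"
     using order_trans[OF L1[OF m] *] .
    show "norm (F2 (apply_bcontfun v x) - F2 (apply_bcontfun w x)) \<le> L * dist v w"
     using order_trans[OF L2[OF m] *] .
   qed
   have "norm (fst (P (apply_bcontfun v) q - P (apply_bcontfun w) q)) \<le> r * (L * dist v w)"
    unfolding P_def fst_diff fst_conv add_diff_add diff_self add_0 scaleR_diff_right[symmetric] norm_scaleR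
    by (intro mult_mono integral_diff_bound ci[OF vs] ci[OF ws] lip) (use c r assms(2) in auto)
   moreover have "norm (snd (P (apply_bcontfun v) q - P (apply_bcontfun w) q)) \<le> r * (L * dist v w)"
    unfolding P_def snd_diff snd_conv add_diff_add diff_self add_0 scaleR_diff_right[symmetric] norm_scaleR
    by (intro mult_mono integral_diff_bound ci[OF vs] ci[OF ws] lip) (use c r assms(2) in auto)
   moreover have "P (apply_bcontfun v) q - P (apply_bcontfun w) q =
     (fst (P (apply_bcontfun v) q - P (apply_bcontfun w) q), snd (P (apply_bcontfun v) q - P (apply_bcontfun w) q))"
    by (simp add: prod_eq_iff)
   then have "norm (P (apply_bcontfun v) q - P (apply_bcontfun w) q) \<le>
     norm (fst (P (apply_bcontfun v) q - P (apply_bcontfun w) q)) + norm (snd (P (apply_bcontfun v) q - P (apply_bcontfun w) q))"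
    by (metis norm_Pair_le)
   ultimately have "norm (P (apply_bcontfun v) q - P (apply_bcontfun w) q) \<le> 2 * ((r * L) * dist v w)"
    by (simp only: mult.assoc mult_2)
   also have "\<dots> \<le> 2 * (1/4 * dist v w)" using r(5) by (intro mult_left_mono mult_right_mono) auto
   finally show "dist (apply_bcontfun (T v) q) (apply_bcontfun (T w) q) \<le> 1/2 * dist v w"
    using T vs ws by (simp add: dist_norm)
  qed
 qed auto
 then obtain w where w: "w \<in> s" "T w = w" by blast
 then have fp: "apply_bcontfun w q = P (apply_bcontfun w) q" for q using T by metis
 show ?thesis
 proof (rule that[OF r(1), of "apply_bcontfun w"])
  show "continuous_on UNIV (apply_bcontfun w)" by simp
  show "\<forall>q. apply_bcontfun w q \<in> cball w0 \<rho>" using w(1) s_mem by blast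
  show "\<forall>y t. \<bar>y\<bar> \<le> r \<and> \<bar>t\<bar> \<le> r \<longrightarrow> fst (apply_bcontfun w (y, t)) = a0 y + t *\<^sub>R integral {0..1} (\<lambda>\<theta>. F1 (apply_bcontfun w (y, \<theta> * t)))"
   by (intro allI impI, subst fp) (simp add: P_def c_id)
  show "\<forall>y t. \<bar>y\<bar> \<le> r \<and> \<bar>t\<bar> \<le> r \<longrightarrow> snd (apply_bcontfun w (y, t)) = b0 t + y *\<^sub>R integral {0..1} (\<lambda>\<theta>. F2 (apply_bcontfun w (\<theta> * y, t)))"
   by (intro allI impI, subst fp) (simp add: P_def c_id)
 qed
qed

section \<open>Differentiability in a parameter\<close>

text \<open>The slots can hold the arguments of any function of three reals, which thereby enters
  the \<open>Ck\<close> calculus. In the characteristic system they hold its unknowns, not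
  \<open>u\<close>, \<open>u_x\<close>, \<open>u_xx\<close>.\<close>

definition mk3 :: "real \<Rightarrow> real \<Rightarrow> real \<Rightarrow> jet" where
 "mk3 a b c = (\<lambda>y. case y of jZ n \<Rightarrow> (if n = 0 then a else if n = 1 then b else if n = 2 then c else 0) | _ \<Rightarrow> 0)"

lemma mk3_simps [simp]: "mk3 a b c (jZ 0) = a" "mk3 a b c (jZ (Suc 0)) = b" "mk3 a b c (jZ 2) = c" "mk3 a b c (jZ 1) = b"
 by (auto simp: mk3_def)

lemma mk3_jets_over [simp]: "mk3 a b c \<in> jets_over W \<longleftrightarrow> (a, b, c) \<in> W"
 by (simp add: jets_over_def)

lemma continuous_on_mk3:
 fixes f g h :: "'a::topological_space \<Rightarrow> real"
 assumes "continuous_on A f" "continuous_on A g" "continuous_on A h"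
 shows "continuous_on A (\<lambda>x. mk3 (f x) (g x) (h x))"
proof (rule continuous_on_jetI)
 show "continuous_on A (\<lambda>x. mk3 (f x) (g x) (h x) y)" for y
 proof (cases y)
  case (jZ n)
  then show ?thesis using assms by (cases "n = 0"; cases "n = 1"; cases "n = 2") (auto simp: mk3_def)
 qed (auto simp: mk3_def)
qed

lemma open_jets_over: "open U ==> open (jets_over U)"
proof -
 assume "open U"
 have "continuous_on UNIV (\<lambda>p::jet. (p (jZ 0), p (jZ 1), p (jZ 2)))"
  by (intro continuous_on_Pair continuous_on_jet_proj)
 from open_vimage[OF \<open>open U\<close> this] show ?thesis by (simp add: jets_over_def vimage_def)
qed

text \<open>Differentiability in the parameter \<open>x\<close> of a solution of an ordinary
  differential equation in \<open>e\<close>. The increment caused by a shift \<open>h\<close> of the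
  parameter solves a linear equation exactly, with coefficients continuous up to
  \<open>h = 0\<close>; variation of constants gives it in closed form, and its quotient by
  \<open>h\<close> has a visible limit. The formula so obtained can itself be differentiated, which
  permits bootstrapping.\<close>

lemma scalar_parameter_derivative:
 fixes v E1 E2 :: "jet \<Rightarrow> real" and r :: real
 defines "B \<equiv> {p :: jet. \<bar>p jX\<bar> < r \<and> \<bar>p jT\<bar> < r}"
 assumes ex: "e \<in> {jX, jT}" "x \<in> {jX, jT}" "e \<noteq> x"
  and W: "open W" "convex W" and \<Phi>: "Ck 1 (jets_over W) \<Phi>" "depends_on {jZ 0, jZ 1, jZ 2} (jets_over W) \<Phi>"
  and cont: "continuous_on B v" "continuous_on B E1" "continuous_on B E2" "continuous_on B E1'" "continuous_on B E2'"
  and inW: "\<And>p. p \<in> B ==> (v p, E1 p, E2 p) \<in> W"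
  and ev: "\<And>p. p \<in> B ==> ((\<lambda>s. v (p(e := s))) has_field_derivative \<Phi> (mk3 (v p) (E1 p) (E2 p))) (at (p e))"
  and dE1: "\<And>p. p \<in> B ==> ((\<lambda>s. E1 (p(x := s))) has_field_derivative E1' p) (at (p x))"
  and dE2: "\<And>p. p \<in> B ==> ((\<lambda>s. E2 (p(x := s))) has_field_derivative E2' p) (at (p x))"
  and init: "\<And>p. p \<in> B ==> ((\<lambda>s. v (p(x := s, e := 0))) has_field_derivative v0' p) (at (p x))"
  and p0: "p0 \<in> B"
 defines "k \<equiv> (\<lambda>p. pd (jZ 0) \<Phi> (mk3 (v p) (E1 p) (E2 p)))"
  and "l \<equiv> (\<lambda>p. pd (jZ 1) \<Phi> (mk3 (v p) (E1 p) (E2 p)) * E1' p + pd (jZ 2) \<Phi> (mk3 (v p) (E1 p) (E2 p)) * E2' p)"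
 shows "((\<lambda>s. v (p0(x := s))) has_field_derivative
  exp (Iy e k p0) * (v0' p0 + Iy e (\<lambda>q. exp (- Iy e k q) * l q) p0)) (at (p0 x))"
proof -
 define S where "S = jets_over W"
 have S: "open S" using W open_jets_over by (simp add: S_def)
 have \<Phi>C: "Ck (Suc 0) S \<Phi>" using \<Phi>(1) by (simp add: S_def)
 have pdc: "continuous_on S (pd i \<Phi>)" for i using \<Phi>C by simp
 define D where "D = {q :: real \<times> real. \<bar>p0 x + fst q\<bar> < r \<and> \<bar>snd q\<bar> < r}"
 have D_open: "open D" unfolding D_def by (intro open_Collect_conj open_Collect_less continuous_intros)
 define pt where "pt h \<tau> = p0(x := p0 x + h, e := \<tau>)" for h \<tau>
 have pt_B: "pt h \<tau> \<in> B" if "(h, \<tau>) \<in> D" for h \<tau>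
  using ex that by (auto simp: pt_def B_def D_def)
 have zeroD: "(0, \<tau>) \<in> D" if "(h, \<tau>) \<in> D" for h \<tau> using that p0 ex by (auto simp: D_def B_def)
 have scD: "(\<theta> * h, \<tau>) \<in> D" if "(h, \<tau>) \<in> D" "\<theta> \<in> {0..1}" for h \<tau> \<theta>
 proof -
  have "p0 x + \<theta> * h = (1 - \<theta>) * p0 x + \<theta> * (p0 x + h)" by (simp add: algebra_simps)
  also have "\<bar>\<dots>\<bar> \<le> (1 - \<theta>) * \<bar>p0 x\<bar> + \<theta> * \<bar>p0 x + h\<bar>"
   using that(2) abs_triangle_ineq[of "(1 - \<theta>) * p0 x" "\<theta> * (p0 x + h)"] by (simp add: abs_mult)
  also have "\<dots> < r" using convex_bound_lt[of "\<bar>p0 x\<bar>" r "\<bar>p0 x + h\<bar>" "1 - \<theta>" \<theta>] that p0 ex by (auto simp: D_def B_def)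
  finally show ?thesis using that by (simp add: D_def)
 qed
 have scT: "(h, \<theta> * \<tau>) \<in> D" if "(h, \<tau>) \<in> D" "\<theta> \<in> {0..1}" for h \<tau> \<theta>
  using that mult_left_le_one_le[of "\<bar>\<tau>\<bar>" \<theta>] by (auto simp: D_def abs_mult)
 define V where "V h \<tau> = v (pt h \<tau>)" for h \<tau>
 define e1 where "e1 h \<tau> = E1 (pt h \<tau>)" for h \<tau>
 define e2 where "e2 h \<tau> = E2 (pt h \<tau>)" for h \<tau>
 have pt_cont: "continuous_on A (\<lambda>z. pt (f z) (g z))" if "continuous_on A f" "continuous_on A g"
  for A and f g :: "'z::topological_space \<Rightarrow> real"
  unfolding pt_def by (intro continuous_on_fun_upd continuous_on_const continuous_on_add that)
 have cV: "continuous_on A (\<lambda>z. F (pt (f z) (g z)))" if "continuous_on B F" "continuous_on A f" "continuous_on A g" "\<And>z. z \<in> A ==> (f z, g z) \<in> D"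
  for A F and f g :: "'z::topological_space \<Rightarrow> real"
  by (rule continuous_on_compose2[OF that(1) pt_cont[OF that(2,3)]]) (use that(4) pt_B in auto)
 define \<sigma> where "\<sigma> h \<tau> \<theta> = mk3 (V 0 \<tau> + \<theta> * (V h \<tau> - V 0 \<tau>)) (e1 0 \<tau> + \<theta> * (e1 h \<tau> - e1 0 \<tau>)) (e2 0 \<tau> + \<theta> * (e2 h \<tau> - e2 0 \<tau>))" for h \<tau> \<theta>
 have \<sigma>_S: "\<sigma> h \<tau> \<theta> \<in> S" if "(h, \<tau>) \<in> D" "\<theta> \<in> {0..1}" for h \<tau> \<theta>
 proof -
  have "(1 - \<theta>) *\<^sub>R (V 0 \<tau>, e1 0 \<tau>, e2 0 \<tau>) + \<theta> *\<^sub>R (V h \<tau>, e1 h \<tau>, e2 h \<tau>) \<in> W"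
   by (rule convexD_alt[OF W(2)]) (use that inW pt_B zeroD in \<open>auto simp: V_def e1_def e2_def\<close>)
  then show ?thesis unfolding S_def \<sigma>_def mk3_jets_over by (simp add: algebra_simps)
 qed
 have \<sigma>_cont: "continuous_on A (\<lambda>z. \<sigma> (f z) (g z) (u z))"
  if "continuous_on A f" "continuous_on A g" "continuous_on A u" "\<And>z. z \<in> A ==> (f z, g z) \<in> D"
  for A and f g u :: "'z::topological_space \<Rightarrow> real"
 proof -
  have z: "(0, g z) \<in> D" if "z \<in> A" for z using zeroD that \<open>\<And>z. z \<in> A ==> (f z, g z) \<in> D\<close> by blast
  note 1 = cV[OF _ that(1,2,4)] and 2 = cV[OF _ continuous_on_const that(2) z]
  show ?thesis unfolding \<sigma>_def V_def e1_def e2_def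
   by (intro continuous_on_mk3 continuous_on_add continuous_on_mult continuous_on_diff 1[OF cont(1)] 1[OF cont(2)] 1[OF cont(3)]
    2[OF cont(1)] 2[OF cont(2)] 2[OF cont(3)] that(3))
 qed
 define K where "K i h \<tau> = integral (cbox 0 1) (\<lambda>\<theta>. pd i \<Phi> (\<sigma> h \<tau> \<theta>))" for i h and \<tau> :: real
 have K_cont: "continuous_on D (\<lambda>q. K i (fst q) (snd q))" for i
  unfolding K_def
 proof (rule integral_continuous_on_param)
  show "continuous_on (D \<times> cbox 0 1) (\<lambda>(q, \<theta>). pd i \<Phi> (\<sigma> (fst q) (snd q) \<theta>))"
   unfolding split_beta
   by (rule continuous_on_compose2[OF pdc \<sigma>_cont]) (use \<sigma>_S in \<open>auto intro!: continuous_intros\<close>)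
 qed
 define M where "M F h \<tau> = integral (cbox 0 1) (\<lambda>\<theta>. F (pt (\<theta> * h) \<tau>))" for F :: "jet \<Rightarrow> real" and h \<tau> :: real
 have M_cont: "continuous_on D (\<lambda>q. M F (fst q) (snd q))" if "continuous_on B F" for F
  unfolding M_def
 proof (rule integral_continuous_on_param)
  show "continuous_on (D \<times> cbox 0 1) (\<lambda>(q, \<theta>). F (pt (\<theta> * fst q) (snd q)))"
   unfolding split_beta
   by (rule cV[OF that]) (use scD in \<open>auto intro!: continuous_intros\<close>)
 qed
 have M_eq: "F (pt h \<tau>) - F (pt 0 \<tau>) = h * M F' h \<tau>"
  if "(h, \<tau>) \<in> D" "continuous_on B F'" "\<And>p. p \<in> B ==> ((\<lambda>s. F (p(x := s))) has_field_derivative F' p) (at (p x))" for F F' h \<tau>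
 proof -
  have "((\<lambda>\<theta>. h * F' (pt (\<theta> * h) \<tau>)) has_integral (F (pt (1 * h) \<tau>) - F (pt (0 * h) \<tau>))) {0..1}"
  proof (rule fundamental_theorem_of_calculus)
   fix \<theta> :: real assume \<theta>: "\<theta> \<in> {0..1}"
   have pteq: "pt g \<tau> = (pt (\<theta> * h) \<tau>)(x := p0 x + g)" for g using ex by (auto simp: pt_def)
   have "((\<lambda>s. F ((pt (\<theta> * h) \<tau>)(x := s))) has_field_derivative F' (pt (\<theta> * h) \<tau>)) (at (p0 x + \<theta> * h))"
    using that(3)[OF pt_B[OF scD[OF that(1) \<theta>]]] ex by (auto simp: pt_def)
   then have "((\<lambda>\<theta>. F ((pt (\<theta>' * h) \<tau>)(x := p0 x + \<theta> * h))) has_field_derivative F' (pt (\<theta> * h) \<tau>) * h) (at \<theta>)" if "\<theta>' = \<theta>" for \<theta>'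
    unfolding that by (rule DERIV_chain2) (auto intro!: derivative_eq_intros)
   from this[OF refl] have "((\<lambda>\<theta>. F (pt (\<theta> * h) \<tau>)) has_field_derivative F' (pt (\<theta> * h) \<tau>) * h) (at \<theta>)"
    unfolding pteq[symmetric] .
   then show "((\<lambda>\<theta>. F (pt (\<theta> * h) \<tau>)) has_vector_derivative h * F' (pt (\<theta> * h) \<tau>)) (at \<theta> within {0..1})"
    by (auto simp: has_real_derivative_iff_has_vector_derivative[symmetric] mult.commute intro: has_field_derivative_at_within)
  qed auto
  then show ?thesis unfolding M_def by (simp add: has_integral_iff)
 qed
 define kk where "kk q = K (jZ 0) (fst q) (snd q)" for q
 define ll where "ll q = K (jZ 1) (fst q) (snd q) * M E1' (fst q) (snd q) + K (jZ 2) (fst q) (snd q) * M E2' (fst q) (snd q)" for q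
 have kk_cont: "continuous_on D kk" unfolding kk_def by (rule K_cont)
 have ll_cont: "continuous_on D ll" unfolding ll_def by (intro continuous_on_add continuous_on_mult K_cont M_cont cont)
 \<comment> \<open>Hadamard's lemma: the increment of \<open>\<Phi>\<close> over a segment is linear
   in the increments of its arguments, with averaged partial derivatives as coefficients. Convexity
   of \<open>W\<close> keeps the segment in the domain.\<close>
 have diff: "\<Phi> (mk3 (V h \<tau>) (e1 h \<tau>) (e2 h \<tau>)) - \<Phi> (mk3 (V 0 \<tau>) (e1 0 \<tau>) (e2 0 \<tau>)) = kk (h, \<tau>) * (V h \<tau> - V 0 \<tau>) + h * ll (h, \<tau>)"
  if hD: "(h, \<tau>) \<in> D" for h \<tau>
 proof -
  let ?d = "\<lambda>y. if y = jZ 0 then V h \<tau> - V 0 \<tau> else if y = jZ 1 then e1 h \<tau> - e1 0 \<tau> else e2 h \<tau> - e2 0 \<tau>"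
  have fin: "((\<lambda>\<theta>. \<Sum>y\<in>{jZ 0, jZ 1, jZ 2}. pd y \<Phi> (\<sigma> h \<tau> \<theta>) * ?d y) has_integral (\<Phi> (\<sigma> h \<tau> 1) - \<Phi> (\<sigma> h \<tau> 0))) {0..1}"
  proof (rule fundamental_theorem_of_calculus)
   fix \<theta> :: real assume \<theta>: "\<theta> \<in> {0..1}"
   have "continuous_on UNIV (\<sigma> h \<tau>)" unfolding \<sigma>_def by (intro continuous_on_mk3 continuous_intros)
   from open_vimage[OF S this] have "\<forall>\<^sub>F s in nhds \<theta>. \<sigma> h \<tau> s \<in> S"
    using \<sigma>_S[OF hD \<theta>] by (subst eventually_nhds) (auto simp: vimage_def)
   have "((\<lambda>s. \<sigma> h \<tau> s y) has_field_derivative ?d y) (at \<theta>)" if "y \<in> {jZ 0, jZ 1, jZ 2}" for y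
    using that by (auto simp: \<sigma>_def intro!: derivative_eq_intros)
   from chain_rule[OF S _ _ \<Phi>(2)[folded S_def] \<open>\<forall>\<^sub>F s in nhds \<theta>. \<sigma> h \<tau> s \<in> S\<close> this]
   have "((\<lambda>s. \<Phi> (\<sigma> h \<tau> s)) has_field_derivative (\<Sum>y\<in>{jZ 0, jZ 1, jZ 2}. pd y \<Phi> (\<sigma> h \<tau> \<theta>) * ?d y)) (at \<theta>)"
    using \<Phi>C by simp
   then show "((\<lambda>s. \<Phi> (\<sigma> h \<tau> s)) has_vector_derivative (\<Sum>y\<in>{jZ 0, jZ 1, jZ 2}. pd y \<Phi> (\<sigma> h \<tau> \<theta>) * ?d y)) (at \<theta> within {0..1})"
    by (auto simp: has_real_derivative_iff_has_vector_derivative[symmetric] intro: has_field_derivative_at_within)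
  qed auto
  have int: "(\<lambda>\<theta>. pd y \<Phi> (\<sigma> h \<tau> \<theta>)) integrable_on {0..1}" for y
   by (intro integrable_continuous_real continuous_on_compose2[OF pdc \<sigma>_cont])
    (use \<sigma>_S[OF hD] hD in \<open>auto intro!: continuous_intros\<close>)
  have "((\<lambda>\<theta>. \<Sum>y\<in>{jZ 0, jZ 1, jZ 2}. pd y \<Phi> (\<sigma> h \<tau> \<theta>) * ?d y) has_integral (\<Sum>y\<in>{jZ 0, jZ 1, jZ 2}. K y h \<tau> * ?d y)) {0..1}"
   unfolding K_def cbox_interval by (intro has_integral_sum has_integral_mult_left integrable_integral int) auto
  from has_integral_unique[OF fin this]
  have "\<Phi> (\<sigma> h \<tau> 1) - \<Phi> (\<sigma> h \<tau> 0) = K (jZ 0) h \<tau> * (V h \<tau> - V 0 \<tau>) + (K (jZ 1) h \<tau> * (e1 h \<tau> - e1 0 \<tau>) + K (jZ 2) h \<tau> * (e2 h \<tau> - e2 0 \<tau>))"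
   by simp
  moreover have "e1 h \<tau> - e1 0 \<tau> = h * M E1' h \<tau>" unfolding e1_def by (rule M_eq[OF hD cont(4) dE1])
  moreover have "e2 h \<tau> - e2 0 \<tau> = h * M E2' h \<tau>" unfolding e2_def by (rule M_eq[OF hD cont(5) dE2])
  ultimately show ?thesis by (simp add: \<sigma>_def kk_def ll_def algebra_simps)
 qed
 define J where "J g q = snd q * integral (cbox 0 1) (\<lambda>\<theta>. g (fst q, \<theta> * snd q))" for g :: "real \<times> real \<Rightarrow> real" and q
 have J_cont: "continuous_on D (J g)" if "continuous_on D g" for g
 proof -
  have "continuous_on (D \<times> cbox 0 1) (\<lambda>(q, \<theta>). g (fst q, \<theta> * snd q))"
   unfolding split_beta
   by (rule continuous_on_compose2[OF that]) (use scT in \<open>auto intro!: continuous_intros\<close>)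
  from integral_continuous_on_param[OF this] show ?thesis unfolding J_def by (auto intro!: continuous_intros)
 qed
 have slD: "open {\<tau>. (h, \<tau>) \<in> D}" for h
  using open_vimage[OF D_open, of "\<lambda>\<tau>. (h, \<tau>)"] continuous_on_Pair[OF continuous_on_const continuous_on_id, of UNIV h]
  by (simp add: vimage_def)
 have J_D: "((\<lambda>\<tau>. J g (h, \<tau>)) has_field_derivative g (h, \<tau>)) (at \<tau>)" if "continuous_on D g" "(h, \<tau>) \<in> D" for g h \<tau>
  unfolding J_def fst_conv snd_conv cbox_interval
 proof (rule scaled_integral_DERIV[where g = "\<lambda>\<tau>. g (h, \<tau>)", OF slD[of h]])
  show "continuous_on {\<tau>. (h, \<tau>) \<in> D} (\<lambda>\<tau>. g (h, \<tau>))"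
   by (rule continuous_on_compose2[OF that(1)]) (auto intro!: continuous_intros)
 qed (use that scT in auto)
 define g where "g q = exp (- J kk q) * ll q" for q
 have g_cont: "continuous_on D g" unfolding g_def by (intro continuous_on_mult continuous_on_exp continuous_on_minus J_cont kk_cont ll_cont)
 have V_D: "((\<lambda>\<tau>. V h \<tau>) has_field_derivative \<Phi> (mk3 (V h \<tau>) (e1 h \<tau>) (e2 h \<tau>))) (at \<tau>)" if "(h, \<tau>) \<in> D" for h \<tau>
  using ev[OF pt_B[OF that]] ex by (auto simp: V_def pt_def e1_def e2_def)
 define t where "t = p0 e"
 have sol: "V h t - V 0 t = exp (J kk (h, t)) * ((V h 0 - V 0 0) + h * J g (h, t))" if hD: "(h, t) \<in> D" for h
 proof -
  define A where "A = {\<tau>. (h, \<tau>) \<in> D}"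
  have hA: "(h, \<tau>) \<in> D" "(0, \<tau>) \<in> D" if "\<tau> \<in> A" for \<tau> using that zeroD by (auto simp: A_def)
  have "convex A" unfolding A_def D_def using convex_ball[of "0::real" r] that
   by (cases "\<bar>p0 x + h\<bar> < r") (auto simp: ball_def dist_real_def)
  \<comment> \<open>Integrating factor: this combination is constant in \<tau>, and its value is
    read off at \<tau> = 0.\<close>
  moreover have "((\<lambda>\<tau>. exp (- J kk (h, \<tau>)) * (V h \<tau> - V 0 \<tau>) - h * J g (h, \<tau>)) has_field_derivative 0) (at \<tau> within A)"
   if "\<tau> \<in> A" for \<tau>
  proof -
   have "((\<lambda>\<tau>. exp (- J kk (h, \<tau>)) * (V h \<tau> - V 0 \<tau>) - h * J g (h, \<tau>)) has_field_derivative
     exp (- J kk (h, \<tau>)) * (- kk (h, \<tau>)) * (V h \<tau> - V 0 \<tau>) +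
     (\<Phi> (mk3 (V h \<tau>) (e1 h \<tau>) (e2 h \<tau>)) - \<Phi> (mk3 (V 0 \<tau>) (e1 0 \<tau>) (e2 0 \<tau>))) * exp (- J kk (h, \<tau>)) - h * g (h, \<tau>)) (at \<tau>)"
    by (rule DERIV_diff[OF DERIV_mult[OF DERIV_chain2[OF DERIV_exp DERIV_minus[OF J_D[OF kk_cont hA(1)[OF that]]]]
      DERIV_diff[OF V_D[OF hA(1)[OF that]] V_D[OF hA(2)[OF that]]]] DERIV_cmult[OF J_D[OF g_cont hA(1)[OF that]]]])
   then have "((\<lambda>\<tau>. exp (- J kk (h, \<tau>)) * (V h \<tau> - V 0 \<tau>) - h * J g (h, \<tau>)) has_field_derivative 0) (at \<tau>)"
    unfolding diff[OF hA(1)[OF that]] by (simp add: g_def algebra_simps)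
   then show ?thesis by (rule has_field_derivative_at_within)
  qed
  ultimately have "\<exists>c. \<forall>\<tau>\<in>A. exp (- J kk (h, \<tau>)) * (V h \<tau> - V 0 \<tau>) - h * J g (h, \<tau>) = c"
   by (rule has_field_derivative_zero_constant)
  then obtain c where c: "\<And>\<tau>. \<tau> \<in> A ==> exp (- J kk (h, \<tau>)) * (V h \<tau> - V 0 \<tau>) - h * J g (h, \<tau>) = c"
   by blast
  have "0 \<in> A" "t \<in> A" using scT[OF hD, of 0] hD by (auto simp: A_def)
  from c[OF this(1)] c[OF this(2)] have "exp (- J kk (h, t)) * (V h t - V 0 t) = (V h 0 - V 0 0) + h * J g (h, t)"
   by (simp add: J_def)
  then have "exp (J kk (h, t)) * (exp (- J kk (h, t)) * (V h t - V 0 t)) = exp (J kk (h, t)) * ((V h 0 - V 0 0) + h * J g (h, t))" by simp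
  then show ?thesis using exp_minus_inverse[of "J kk (h, t)"] by (simp only: mult.assoc[symmetric] mult_1)
 qed
 have tD: "(0, t) \<in> D" using p0 ex by (auto simp: D_def B_def t_def)
 have slh: "open {h. (h, t) \<in> D}"
  using open_vimage[OF D_open, of "\<lambda>h. (h, t)"] continuous_on_Pair[OF continuous_on_id continuous_on_const, of UNIV t]
  by (simp add: vimage_def)
 have evh: "\<forall>\<^sub>F h in at 0. (h, t) \<in> D"
  using slh tD by (auto simp: eventually_at_topological)
 have lim: "((\<lambda>h. F (h, t)) \<longlongrightarrow> F (0, t)) (at 0)" if "continuous_on D F" for F :: "real \<times> real \<Rightarrow> real"
 proof -
  have "continuous_on {h. (h, t) \<in> D} (\<lambda>h. F (h, t))"
   by (rule continuous_on_compose2[OF that]) (auto intro!: continuous_intros)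
  then have "isCont (\<lambda>h. F (h, t)) 0" using slh tD continuous_on_eq_continuous_at by blast
  then show ?thesis by (simp add: isCont_def)
 qed
 have pt0: "pt 0 \<tau> = p0(e := \<tau>)" for \<tau> using ex by (auto simp: pt_def)
 have kk0: "kk (0, \<tau>) = k (p0(e := \<tau>))" for \<tau>
  unfolding kk_def K_def k_def by (simp add: \<sigma>_def V_def e1_def e2_def pt0)
 have M0: "M F 0 \<tau> = F (p0(e := \<tau>))" for F \<tau> unfolding M_def by (simp add: pt0)
 have ll0: "ll (0, \<tau>) = l (p0(e := \<tau>))" for \<tau>
  unfolding ll_def K_def l_def fst_conv snd_conv M0 by (simp add: \<sigma>_def V_def e1_def e2_def pt0)
 have J0: "J kk (0, \<tau>) = Iy e k (p0(e := \<tau>))" for \<tau> unfolding J_def Iy_def by (simp add: kk0)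
 have J0': "J g (0, t) = Iy e (\<lambda>q. exp (- Iy e k q) * l q) p0"
  unfolding J_def Iy_def[of e "\<lambda>q. exp (- Iy e k q) * l q"] by (simp add: g_def J0 ll0 t_def)
 have "((\<lambda>s. v (p0(x := s, e := 0))) has_field_derivative v0' p0) (at (p0 x))" by (rule init[OF p0])
 then have "((\<lambda>h. (v (p0(x := p0 x + h, e := 0)) - v (p0(x := p0 x, e := 0))) / h) \<longlongrightarrow> v0' p0) (at 0)"
  by (simp only: DERIV_def)
 then have "((\<lambda>h. (V h 0 - V 0 0) / h) \<longlongrightarrow> v0' p0) (at 0)" by (simp add: V_def pt_def)
 then have L: "((\<lambda>h. exp (J kk (h, t)) * ((V h 0 - V 0 0) / h + J g (h, t))) \<longlongrightarrow> exp (J kk (0, t)) * (v0' p0 + J g (0, t))) (at 0)"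
  by (intro tendsto_intros lim J_cont kk_cont g_cont)
 have "((\<lambda>h. (V h t - V 0 t) / h) \<longlongrightarrow> exp (J kk (0, t)) * (v0' p0 + J g (0, t))) (at 0)"
 proof (rule Lim_transform_eventually[OF L])
  have "\<forall>\<^sub>F h in at (0::real). h \<noteq> 0" by (simp add: eventually_neq_at_within)
  with evh show "\<forall>\<^sub>F h in at 0. exp (J kk (h, t)) * ((V h 0 - V 0 0) / h + J g (h, t)) = (V h t - V 0 t) / h"
   by eventually_elim (simp add: sol field_simps)
 qed
 moreover have "V h t = v (p0(x := p0 x + h))" for h unfolding V_def pt_def t_def using ex by (metis fun_upd_twist fun_upd_triv)
 moreover have "J kk (0, t) = Iy e k p0" using J0[of t] by (simp add: t_def)
 ultimately show ?thesis unfolding J0' DERIV_def by simp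
qed

text \<open>Continuous partial derivatives give a total derivative. It is needed where two variables
  move together: in the inverse function theorem and for the differentiability demanded by
  \<open>admissible_psi\<close>.\<close>

lemma Ck_two_variable_derivative:
 assumes S: "open S" "Ck 1 S F" "p \<in> S" and "y \<noteq> z"
 shows "((\<lambda>(a, b). F (p(y := a, z := b))) has_derivative (\<lambda>(h, k). pd y F p * h + pd z F p * k)) (at (p y, p z))"
proof -
 have C: "Ck (Suc 0) S F" using S by simp
 have "open ((\<lambda>q. p(y := fst q, z := snd q)) -` S)"
  by (rule open_vimage[OF S(1)]) (intro continuous_on_fun_upd continuous_on_const continuous_on_fst continuous_on_snd continuous_on_id)
 moreover have "(p y, p z) \<in> (\<lambda>q. p(y := fst q, z := snd q)) -` S" using S by simp
 ultimately obtain A B where AB: "open A" "open B" "(p y, p z) \<in> A \<times> B" "A \<times> B \<subseteq> (\<lambda>q. p(y := fst q, z := snd q)) -` S"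
  by (rule open_prod_elim)
 obtain e where e: "e > 0" "ball (p z) e \<subseteq> B" using AB(2,3) open_contains_ball[of B] by auto
 have inS: "p(y := a, z := b) \<in> S" if "a \<in> A" "b \<in> ball (p z) e" for a b
  using subsetD[OF AB(4), of "(a, b)"] that e(2) by auto
 have tw: "p(y := a, z := b) = p(z := b, y := a)" for a b using assms(4) by (simp add: fun_upd_twist)
 have "((\<lambda>(a, b). F (p(y := a, z := b))) has_derivative
   (\<lambda>(h, k). pd y F p * h + blinfun_mult_right (pd z F (p(y := p y, z := p z))) k)) (at (p y, p z) within A \<times> ball (p z) e)"
 proof (rule has_derivative_partialsI)
  have "((\<lambda>a. F (p(y := a, z := p z))) has_field_derivative pd y F p) (at (p y))"
   using Ck_DERIV[OF C S(3), of y] unfolding tw by simp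
  then show "((\<lambda>a. F (p(y := a, z := p z))) has_derivative (\<lambda>h. pd y F p * h)) (at (p y) within A)"
   using has_field_derivative_at_within has_field_derivative_imp_has_derivative by blast
  show "((\<lambda>b. F (p(y := a, z := b))) has_derivative blinfun_apply (blinfun_mult_right (pd z F (p(y := a, z := b))))) (at b within ball (p z) e)"
   if "a \<in> A" "b \<in> ball (p z) e" for a b
   using Ck_DERIV'[OF C, of "p(y := a)" z b] inS[OF that] has_field_derivative_at_within
   by (auto simp: has_field_derivative_def intro: has_derivative_at_withinI)
  have "continuous_on (A \<times> ball (p z) e) (\<lambda>(a, b). blinfun_mult_right (pd z F (p(y := a, z := b))))"
  proof -
   have "continuous_on (A \<times> ball (p z) e) (\<lambda>q. pd z F (p(y := fst q, z := snd q)))"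
    by (rule continuous_on_compose2[of S "pd z F"])
     (use C inS in \<open>auto intro!: continuous_on_fun_upd continuous_on_const continuous_on_fst continuous_on_snd continuous_on_id simp del: continuous_on_fst\<close>)
   then show ?thesis unfolding split_beta
    by (rule bounded_linear.continuous_on[OF bounded_linear_blinfun_mult_right])
  qed
  then show "continuous (at (p y, p z) within A \<times> ball (p z) e) (\<lambda>(a, b). blinfun_mult_right (pd z F (p(y := a, z := b))))"
   using AB(3) e(1) by (simp add: continuous_on_eq_continuous_within)
 qed (use e in auto)
 moreover have "open (A \<times> ball (p z) e)" using AB(1) by (simp add: open_Times)
 ultimately show ?thesis using AB(3) e(1) by (simp add: at_within_open[of _ "A \<times> ball (p z) e"])
qed

definition lipschitz3 :: "(jet \<Rightarrow> real) \<Rightarrow> real \<Rightarrow> real \<Rightarrow> real \<Rightarrow> real \<Rightarrow> real \<Rightarrow> bool" where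
 "lipschitz3 \<Phi> a0 b0 c0 \<epsilon> C \<longleftrightarrow> (\<forall>a b c a' b' c'. \<bar>a - a0\<bar> < \<epsilon> \<and> \<bar>b - b0\<bar> < \<epsilon> \<and> \<bar>c - c0\<bar> < \<epsilon> \<and>
   \<bar>a' - a0\<bar> < \<epsilon> \<and> \<bar>b' - b0\<bar> < \<epsilon> \<and> \<bar>c' - c0\<bar> < \<epsilon> \<longrightarrow>
   \<bar>\<Phi> (mk3 a b c) - \<Phi> (mk3 a' b' c')\<bar> \<le> C * (\<bar>a - a'\<bar> + \<bar>b - b'\<bar> + \<bar>c - c'\<bar>))"

lemma lipschitz_mk3:
 assumes "open W" "Ck 1 (jets_over W) \<Phi>" "(a0, b0, c0) \<in> W"
 obtains \<epsilon> C where "\<epsilon> > 0" "C \<ge> 0"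
  "\<forall>a b c. \<bar>a - a0\<bar> < \<epsilon> \<and> \<bar>b - b0\<bar> < \<epsilon> \<and> \<bar>c - c0\<bar> < \<epsilon> \<longrightarrow> (a, b, c) \<in> W" "lipschitz3 \<Phi> a0 b0 c0 \<epsilon> C"
proof -
 have S: "open (jets_over W)" using assms(1) by (rule open_jets_over)
 have p: "mk3 a0 b0 c0 \<in> jets_over W" using assms(3) by simp
 have out: "mk3 a b c y = mk3 a' b' c' y" if "y \<notin> {jZ 0, jZ 1, jZ 2}" for a b c a' b' c' y
  using that by (auto simp: mk3_def split: jvar.splits)
 have fin: "finite {jZ 0, jZ 1, jZ 2}" by simp
 show ?thesis
 proof (rule local_lipschitz[OF S assms(2) fin p])
  fix \<epsilon> C assume eC: "\<epsilon> > 0" "C \<ge> 0"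
   "\<And>q. (\<And>y. y \<in> {jZ 0, jZ 1, jZ 2} ==> \<bar>q y - mk3 a0 b0 c0 y\<bar> < \<epsilon>) ==> (\<And>y. y \<notin> {jZ 0, jZ 1, jZ 2} ==> q y = mk3 a0 b0 c0 y) ==> q \<in> jets_over W"
   "\<And>q q'. (\<And>y. y \<in> {jZ 0, jZ 1, jZ 2} ==> \<bar>q y - mk3 a0 b0 c0 y\<bar> < \<epsilon> \<and> \<bar>q' y - mk3 a0 b0 c0 y\<bar> < \<epsilon>) ==>
     (\<And>y. y \<notin> {jZ 0, jZ 1, jZ 2} ==> q y = mk3 a0 b0 c0 y \<and> q' y = mk3 a0 b0 c0 y) ==>
     \<bar>\<Phi> q - \<Phi> q'\<bar> \<le> C * (\<Sum>y\<in>{jZ 0, jZ 1, jZ 2}. \<bar>q y - q' y\<bar>)"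
  show thesis
 proof (rule that[OF eC(1,2)])
  show "\<forall>a b c. \<bar>a - a0\<bar> < \<epsilon> \<and> \<bar>b - b0\<bar> < \<epsilon> \<and> \<bar>c - c0\<bar> < \<epsilon> \<longrightarrow> (a, b, c) \<in> W"
  proof (intro allI impI)
   fix a b c assume h: "\<bar>a - a0\<bar> < \<epsilon> \<and> \<bar>b - b0\<bar> < \<epsilon> \<and> \<bar>c - c0\<bar> < \<epsilon>"
   have "mk3 a b c \<in> jets_over W"
   proof (rule eC(3))
    show "\<bar>mk3 a b c y - mk3 a0 b0 c0 y\<bar> < \<epsilon>" if "y \<in> {jZ 0, jZ 1, jZ 2}" for y using that h by auto
   qed (rule out)
   then show "(a, b, c) \<in> W" by simp
  qed
  show "lipschitz3 \<Phi> a0 b0 c0 \<epsilon> C"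
   unfolding lipschitz3_def
  proof (intro allI impI)
   fix a b c a' b' c' assume h: "\<bar>a - a0\<bar> < \<epsilon> \<and> \<bar>b - b0\<bar> < \<epsilon> \<and> \<bar>c - c0\<bar> < \<epsilon> \<and> \<bar>a' - a0\<bar> < \<epsilon> \<and> \<bar>b' - b0\<bar> < \<epsilon> \<and> \<bar>c' - c0\<bar> < \<epsilon>"
   have "\<bar>\<Phi> (mk3 a b c) - \<Phi> (mk3 a' b' c')\<bar> \<le> C * (\<Sum>y\<in>{jZ 0, jZ 1, jZ 2}. \<bar>mk3 a b c y - mk3 a' b' c' y\<bar>)"
   proof (rule eC(4))
    show "\<bar>mk3 a b c y - mk3 a0 b0 c0 y\<bar> < \<epsilon> \<and> \<bar>mk3 a' b' c' y - mk3 a0 b0 c0 y\<bar> < \<epsilon>" if y: "y \<in> {jZ 0, jZ 1, jZ 2}" for y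
     using y h by auto
   qed (use out in blast)
   then show "\<bar>\<Phi> (mk3 a b c) - \<Phi> (mk3 a' b' c')\<bar> \<le> C * (\<bar>a - a'\<bar> + \<bar>b - b'\<bar> + \<bar>c - c'\<bar>)" by (simp add: add.assoc)
  qed
 qed
 qed
qed

lemma Ck_mk3:
 assumes "open S" "open W" "Ck k (jets_over W) \<Phi>" "depends_on {jZ 0, jZ 1, jZ 2} (jets_over W) \<Phi>"
  and "\<And>p. p \<in> S ==> (f p, g p, h p) \<in> W" "Ck k S f" "Ck k S g" "Ck k S h"
 shows "Ck k S (\<lambda>p. \<Phi> (mk3 (f p) (g p) (h p)))"
 by (rule Ck_compose[OF assms(1) open_jets_over[OF assms(2)] assms(3) _ assms(4)])
  (use assms in \<open>auto intro!: continuous_on_mk3 Ck_continuous\<close>)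

text \<open>One order is gained: the derivative in \<open>e\<close> is the right-hand side of the
  equation, the derivative in \<open>x\<close> is the variation of constants formula, and both are
  as smooth as \<open>v\<close>, its coefficients and their derivatives in \<open>x\<close>. All
  other partial derivatives vanish by \<open>dep\<close>.\<close>

lemma scalar_parameter_Ck:
 fixes v E1 E2 :: "jet \<Rightarrow> real" and r :: real
 defines "B \<equiv> {p :: jet. \<bar>p jX\<bar> < r \<and> \<bar>p jT\<bar> < r}"
 assumes ex: "e \<in> {jX, jT}" "x \<in> {jX, jT}" "e \<noteq> x"
  and W: "open W" "convex W" and \<Phi>: "\<And>k. Ck k (jets_over W) \<Phi>" "depends_on {jZ 0, jZ 1, jZ 2} (jets_over W) \<Phi>"
  and Ck: "Ck k B v" "Ck k B E1" "Ck k B E2" "Ck k B E1'" "Ck k B E2'" "Ck k B v0'"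
  and inW: "\<And>p. p \<in> B ==> (v p, E1 p, E2 p) \<in> W"
  and ev: "\<And>p. p \<in> B ==> ((\<lambda>s. v (p(e := s))) has_field_derivative \<Phi> (mk3 (v p) (E1 p) (E2 p))) (at (p e))"
  and dE1: "\<And>p. p \<in> B ==> ((\<lambda>s. E1 (p(x := s))) has_field_derivative E1' p) (at (p x))"
  and dE2: "\<And>p. p \<in> B ==> ((\<lambda>s. E2 (p(x := s))) has_field_derivative E2' p) (at (p x))"
  and init: "\<And>p. p \<in> B ==> ((\<lambda>s. v (p(x := s, e := 0))) has_field_derivative v0' p) (at (p x))"
  and dep: "\<And>p q. p jX = q jX ==> p jT = q jT ==> v p = v q"
 shows "Ck (Suc k) B v"
proof -
 define \<kappa> where "\<kappa> = (\<lambda>p. pd (jZ 0) \<Phi> (mk3 (v p) (E1 p) (E2 p)))"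
 define l where "l = (\<lambda>p. pd (jZ 1) \<Phi> (mk3 (v p) (E1 p) (E2 p)) * E1' p + pd (jZ 2) \<Phi> (mk3 (v p) (E1 p) (E2 p)) * E2' p)"
 define N where "N = (\<lambda>p. exp (Iy e \<kappa> p) * (v0' p + Iy e (\<lambda>q. exp (- Iy e \<kappa> q) * l q) p))"
 have B: "open B" unfolding B_def
  by (intro open_Collect_conj open_Collect_less continuous_on_rabs continuous_on_jet_proj continuous_on_const)
 have star: "p(e := \<theta> * p e) \<in> B" if "p \<in> B" "\<theta> \<in> {0..1}" for p \<theta>
  using that ex mult_left_le_one_le[of "\<bar>p e\<bar>" \<theta>] by (auto simp: B_def abs_mult)
 have pdC: "Ck k B (\<lambda>p. pd y \<Phi> (mk3 (v p) (E1 p) (E2 p)))" for y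
  by (rule Ck_mk3[OF B W(1) Ck_Suc_pd[OF \<Phi>(1)] depends_on_pd[OF open_jets_over[OF W(1)] \<Phi>(2)] inW Ck(1-3)])
 have \<kappa>C: "Ck k B \<kappa>" unfolding \<kappa>_def by (rule pdC)
 have lC: "Ck k B l" unfolding l_def by (intro Ck_add Ck_mult B pdC Ck)
 have NC: "Ck k B N" unfolding N_def
  by (intro Ck_mult Ck_exp Ck_add Iy_Ck Ck_minus B \<kappa>C lC Ck star)
 have \<Phi>C: "Ck k B (\<lambda>p. \<Phi> (mk3 (v p) (E1 p) (E2 p)))"
  by (rule Ck_mk3[OF B W(1) \<Phi>(1) \<Phi>(2) inW Ck(1-3)])
 show ?thesis
 proof (rule Ck_SucI[OF B Ck_continuous[OF Ck(1)], where D = "\<lambda>y. if y = e then (\<lambda>p. \<Phi> (mk3 (v p) (E1 p) (E2 p))) else if y = x then N else (\<lambda>_. 0)"])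
  show "Ck k B (if y = e then (\<lambda>p. \<Phi> (mk3 (v p) (E1 p) (E2 p))) else if y = x then N else (\<lambda>_. 0))" for y
   using NC \<Phi>C B by simp
  fix p y assume p: "p \<in> B"
  have "((\<lambda>s. v (p(x := s))) has_field_derivative N p) (at (p x))"
   unfolding N_def \<kappa>_def l_def
   by (rule scalar_parameter_derivative[where r = r, folded B_def, OF ex W \<Phi> Ck(1-5)[THEN Ck_continuous] inW ev dE1 dE2 init p])
  moreover have "(\<lambda>s. v (p(y := s))) = (\<lambda>_. v p)" if "y \<noteq> e" "y \<noteq> x"
  proof
   fix s
   have "y \<noteq> jX" "y \<noteq> jT" using ex that by auto
   then show "v (p(y := s)) = v p" by (intro dep) auto
  qed
  ultimately show "((\<lambda>s. v (p(y := s))) has_real_derivative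
    (if y = e then (\<lambda>p. \<Phi> (mk3 (v p) (E1 p) (E2 p))) else if y = x then N else (\<lambda>_. 0)) p) (at (p y))"
   using ev[OF p] by (auto simp del: fun_upd_apply)
 qed
qed

text \<open>In the characteristic coordinates \<open>(y,t)\<close> with \<open>X_t = \<lambda> u\<close> the equation becomes a semilinear Goursat
 problem for \<open>J = X_y\<close>, \<open>M = u - u_xx\<close> and \<open>R\<^sub>\<plusminus> = u \<plusminus> u_x\<close>.\<close>

locale characteristic_system =
 fixes r lam :: real and J M Rp Rm :: "jet \<Rightarrow> real" and W :: "(real \<times> real \<times> real) set"
  and K :: "jet \<Rightarrow> real" and m0' :: "real \<Rightarrow> real" and rp' rm' :: real
 fixes B defines "B \<equiv> {p :: jet. \<bar>p jX\<bar> < r \<and> \<bar>p jT\<bar> < r}"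
 assumes W: "open W" "convex W" and K: "\<And>k. Ck k (jets_over W) K" "depends_on {jZ 0, jZ 1, jZ 2} (jets_over W) K"
  and cont: "continuous_on B J" "continuous_on B M" "continuous_on B Rp" "continuous_on B Rm"
  and inW: "\<And>p. p \<in> B ==> (M p, Rp p, Rm p) \<in> W"
  and J_t: "\<And>p. p \<in> B ==> ((\<lambda>s. J (p(jT := s))) has_field_derivative lam * ((Rp p - Rm p) / 2) * J p) (at (p jT))"
  and M_t: "\<And>p. p \<in> B ==> ((\<lambda>s. M (p(jT := s))) has_field_derivative K (mk3 (M p) (Rp p) (Rm p))) (at (p jT))"
  and Rp_y: "\<And>p. p \<in> B ==> ((\<lambda>s. Rp (p(jX := s))) has_field_derivative (Rp p - M p) * J p) (at (p jX))"
  and Rm_y: "\<And>p. p \<in> B ==> ((\<lambda>s. Rm (p(jX := s))) has_field_derivative - ((Rm p - M p) * J p)) (at (p jX))"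
  and J_0: "\<And>p. p \<in> B ==> ((\<lambda>s. J (p(jX := s, jT := 0))) has_field_derivative 0) (at (p jX))"
  and M_0: "\<And>p. p \<in> B ==> ((\<lambda>s. M (p(jX := s, jT := 0))) has_field_derivative m0' (p jX)) (at (p jX))"
  and Rp_0: "\<And>p. p \<in> B ==> ((\<lambda>s. Rp (p(jT := s, jX := 0))) has_field_derivative rp') (at (p jT))"
  and Rm_0: "\<And>p. p \<in> B ==> ((\<lambda>s. Rm (p(jT := s, jX := 0))) has_field_derivative rm') (at (p jT))"
  and m0': "\<And>k. Ck k B (\<lambda>p. m0' (p jX))"
  and dep: "\<And>p q. p jX = q jX ==> p jT = q jT ==> J p = J q \<and> M p = M q \<and> Rp p = Rp q \<and> Rm p = Rm q"
begin

lemma B_open: "open B"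
 unfolding B_def by (intro open_Collect_conj open_Collect_less continuous_on_rabs continuous_on_jet_proj continuous_on_const)

lemma B_star: "p \<in> B ==> \<theta> \<in> {0..1} ==> p(y := \<theta> * p y) \<in> B"
 using mult_left_le_one_le[of "\<bar>p y\<bar>" \<theta>] by (cases "y = jX"; cases "y = jT") (auto simp: B_def abs_mult)

lemma jets_over_UNIV: "jets_over UNIV = UNIV"
 by (auto simp: jets_over_def)

text \<open>All four unknowns gain an order together. The equations in \<open>t\<close> have
  coefficients \<open>Rp\<close>, \<open>Rm\<close>, whose derivatives in \<open>y\<close> the
  system provides; the equations in \<open>y\<close> have coefficients \<open>M\<close>,
  \<open>J\<close>, whose derivatives in \<open>t\<close> it provides. So each unknown falls under
  the parameter lemma, with the other variable as parameter.\<close>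

lemma system_Ck: "Ck k B J \<and> Ck k B M \<and> Ck k B Rp \<and> Ck k B Rm"
proof (induction k)
 case 0
 then show ?case using cont by simp
next
 case (Suc k)
 then have IH: "Ck k B J" "Ck k B M" "Ck k B Rp" "Ck k B Rm" by auto
 have pr: "Ck k UNIV (\<lambda>q::jet. q y)" for k y by simp
 have RpC: "Ck k B (\<lambda>p. (Rp p - M p) * J p)" and RmC: "Ck k B (\<lambda>p. - ((Rm p - M p) * J p))"
  and JC: "Ck k B (\<lambda>p. lam * ((Rp p - Rm p) / 2) * J p)"
  unfolding divide_inverse by (intro Ck_minus Ck_mult Ck_diff Ck_const B_open IH)+
 have MC: "Ck k B (\<lambda>p. K (mk3 (M p) (Rp p) (Rm p)))"
  by (rule Ck_mk3[OF B_open W(1) K inW IH(2-4)])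
 have deps: "\<And>p q. p jX = q jX ==> p jT = q jT ==> J p = J q" "\<And>p q. p jX = q jX ==> p jT = q jT ==> M p = M q"
  "\<And>p q. p jX = q jX ==> p jT = q jT ==> Rp p = Rp q" "\<And>p q. p jX = q jX ==> p jT = q jT ==> Rm p = Rm q"
  using dep by blast+
 have "Ck (Suc k) B J"
 proof -
  define \<Phi> :: "jet \<Rightarrow> real" where "\<Phi> = (\<lambda>q. lam * ((q (jZ 1) - q (jZ 2)) / 2) * q (jZ 0))"
  have \<Phi>: "Ck k (jets_over UNIV) \<Phi>" for k
   unfolding \<Phi>_def jets_over_UNIV divide_inverse by (intro Ck_minus Ck_mult Ck_diff Ck_const pr open_UNIV)
  have d: "depends_on {jZ 0, jZ 1, jZ 2} (jets_over UNIV) \<Phi>" by (simp add: \<Phi>_def depends_on_def)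
  have ev: "((\<lambda>s. J (p(jT := s))) has_field_derivative \<Phi> (mk3 (J p) (Rp p) (Rm p))) (at (p jT))" if "p \<in> B" for p
   using J_t[OF that] by (simp only: \<Phi>_def mk3_simps)
  show ?thesis
   by (rule scalar_parameter_Ck[where r = r and e = jT and x = jX and v0' = "\<lambda>_. 0", folded B_def, OF _ _ _ open_UNIV convex_UNIV \<Phi> d IH(1) IH(3) IH(4) RpC RmC Ck_const[OF B_open] UNIV_I ev Rp_y Rm_y J_0 deps(1)]) auto
 qed
 moreover have "Ck (Suc k) B M"
 proof -
  show ?thesis
   by (rule scalar_parameter_Ck[where r = r and e = jT and x = jX and v0' = "\<lambda>p. m0' (p jX)", folded B_def, OF _ _ _ W K IH(2) IH(3) IH(4) RpC RmC m0' inW M_t Rp_y Rm_y M_0 deps(2)]) auto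
 qed
 moreover have "Ck (Suc k) B Rp"
 proof -
  define \<Phi> :: "jet \<Rightarrow> real" where "\<Phi> = (\<lambda>q. (q (jZ 0) - q (jZ 1)) * q (jZ 2))"
  have \<Phi>: "Ck k (jets_over UNIV) \<Phi>" for k
   unfolding \<Phi>_def jets_over_UNIV divide_inverse by (intro Ck_minus Ck_mult Ck_diff Ck_const pr open_UNIV)
  have d: "depends_on {jZ 0, jZ 1, jZ 2} (jets_over UNIV) \<Phi>" by (simp add: \<Phi>_def depends_on_def)
  have ev: "((\<lambda>s. Rp (p(jX := s))) has_field_derivative \<Phi> (mk3 (Rp p) (M p) (J p))) (at (p jX))" if "p \<in> B" for p
   using Rp_y[OF that] by (simp only: \<Phi>_def mk3_simps)
  show ?thesis
   by (rule scalar_parameter_Ck[where r = r and e = jX and x = jT and v0' = "\<lambda>_. rp'", folded B_def, OF _ _ _ open_UNIV convex_UNIV \<Phi> d IH(3) IH(2) IH(1) MC JC Ck_const[OF B_open] UNIV_I ev M_t J_t Rp_0 deps(3)]) auto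
 qed
 moreover have "Ck (Suc k) B Rm"
 proof -
  define \<Phi> :: "jet \<Rightarrow> real" where "\<Phi> = (\<lambda>q. - ((q (jZ 0) - q (jZ 1)) * q (jZ 2)))"
  have \<Phi>: "Ck k (jets_over UNIV) \<Phi>" for k
   unfolding \<Phi>_def jets_over_UNIV divide_inverse by (intro Ck_minus Ck_mult Ck_diff Ck_const pr open_UNIV)
  have d: "depends_on {jZ 0, jZ 1, jZ 2} (jets_over UNIV) \<Phi>" by (simp add: \<Phi>_def depends_on_def)
  have ev: "((\<lambda>s. Rm (p(jX := s))) has_field_derivative \<Phi> (mk3 (Rm p) (M p) (J p))) (at (p jX))" if "p \<in> B" for p
   using Rm_y[OF that] by (simp only: \<Phi>_def mk3_simps)
  show ?thesis
   by (rule scalar_parameter_Ck[where r = r and e = jX and x = jT and v0' = "\<lambda>_. rm'", folded B_def, OF _ _ _ open_UNIV convex_UNIV \<Phi> d IH(4) IH(2) IH(1) MC JC Ck_const[OF B_open] UNIV_I ev M_t J_t Rm_0 deps(4)]) auto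
 qed
 ultimately show ?case by blast
qed

end

text \<open>\<open>K\<close> is the derivative of \<open>u - u_xx\<close> along characteristics:
  adding \<open>lam u\<close> times its x-derivative to (T) cancels \<open>u_xxx\<close> and leaves
  \<open>lam u u_x + G\<close>, which is why the system closes. The numbers \<open>rp'\<close>,
  \<open>rm'\<close> are the slopes of \<open>u + u_x\<close> and \<open>u - u_x\<close> along
  \<open>y = 0\<close>.\<close>

locale characteristic_solution = characteristic_system +
 fixes U :: "(real \<times> real \<times> real) set" and G :: "real \<Rightarrow> real \<Rightarrow> real \<Rightarrow> real" and m0 :: "real \<Rightarrow> real" and z0 z1 :: real
 assumes r: "r > 0"
  and J_pos: "\<And>p. p \<in> B ==> J p > 0"
  and J_init: "\<And>p. p \<in> B ==> J (p(jT := 0)) = 1"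
  and M_init: "\<And>p. p \<in> B ==> M (p(jT := 0)) = m0 (p jX)"
  and Rp_init: "\<And>p. p \<in> B ==> Rp (p(jX := 0)) = z0 + z1 + rp' * p jT"
  and Rm_init: "\<And>p. p \<in> B ==> Rm (p(jX := 0)) = z0 - z1 + rm' * p jT"
  and W_U: "\<And>a b c. (a, b, c) \<in> W ==> ((b + c) / 2, (b - c) / 2, (b + c) / 2 - a) \<in> U"
  and K_eq: "\<And>a b c. K (mk3 a b c) = lam * ((b + c) / 2) * ((b - c) / 2) + G ((b + c) / 2) ((b - c) / 2) ((b + c) / 2 - a)"

lemma norm_prod_le:
 "norm (fst x) \<le> norm x" "norm (snd x) \<le> norm x" "norm x \<le> norm (fst x) + norm (snd x)"
 by (metis norm_fst_le prod.collapse) (metis norm_snd_le prod.collapse, metis norm_Pair_le prod.collapse)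

lemma norm_component_le:
 fixes w w' :: "(real \<times> real) \<times> (real \<times> real)"
 shows "\<bar>fst (fst w) - fst (fst w')\<bar> \<le> norm (w - w')" "\<bar>snd (fst w) - snd (fst w')\<bar> \<le> norm (w - w')"
  "\<bar>fst (snd w) - fst (snd w')\<bar> \<le> norm (w - w')" "\<bar>snd (snd w) - snd (snd w')\<bar> \<le> norm (w - w')"
proof -
 have "\<bar>fst (fst (w - w'))\<bar> \<le> norm (w - w')" "\<bar>snd (fst (w - w'))\<bar> \<le> norm (w - w')"
  using norm_prod_le(1,2)[of "fst (w - w')"] norm_prod_le(1)[of "w - w'"] unfolding real_norm_def by linarith+
 moreover have "\<bar>fst (snd (w - w'))\<bar> \<le> norm (w - w')" "\<bar>snd (snd (w - w'))\<bar> \<le> norm (w - w')"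
  using norm_prod_le(1,2)[of "snd (w - w')"] norm_prod_le(2)[of "w - w'"] unfolding real_norm_def by linarith+
 ultimately show "\<bar>fst (fst w) - fst (fst w')\<bar> \<le> norm (w - w')" "\<bar>snd (fst w) - snd (fst w')\<bar> \<le> norm (w - w')"
  "\<bar>fst (snd w) - fst (snd w')\<bar> \<le> norm (w - w')" "\<bar>snd (snd w) - snd (snd w')\<bar> \<le> norm (w - w')"
  by simp_all
qed

lemma jets_over_UNIV [simp]: "jets_over UNIV = UNIV"
 by (auto simp: jets_over_def)

lemma has_derivative_components:
 assumes "(f has_vector_derivative (a, b :: real)) (at (t :: real))"
 shows "((\<lambda>s. fst (f s)) has_field_derivative (a :: real)) (at t)" "((\<lambda>s. snd (f s)) has_field_derivative b) (at t)"
 using bounded_linear.has_vector_derivative[OF bounded_linear_fst assms] bounded_linear.has_vector_derivative[OF bounded_linear_snd assms]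
 by (simp_all add: has_real_derivative_iff_has_vector_derivative)

lemma characteristic_solution_exists:
 fixes G :: "real \<Rightarrow> real \<Rightarrow> real \<Rightarrow> real"
 assumes U: "open U" and G: "\<And>k. Ck k (jets_over U) (\<lambda>p. G (p (jZ 0)) (p (jZ 1)) (p (jZ 2)))"
  and z: "(z0, z1, z2) \<in> U" and m0: "m0 0 = z0 - z2" "\<And>y. (m0 has_field_derivative m0' y) (at y)"
  and m0': "\<And>k S. open S ==> Ck k S (\<lambda>p. m0' (p jX))"
 obtains r J M Rp Rm W K where "characteristic_solution r lam J M Rp Rm W K m0' rp' rm' U G m0 z0 z1"
proof -
 obtain \<epsilon>0 where \<epsilon>0: "\<epsilon>0 > 0" "ball (z0, z1, z2) \<epsilon>0 \<subseteq> U" using U z open_contains_ball by blast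
 define L where "L = (\<lambda>q :: real \<times> real \<times> real. ((fst (snd q) + snd (snd q)) / 2, (fst (snd q) - snd (snd q)) / 2, (fst (snd q) + snd (snd q)) / 2 - fst q))"
 \<comment> \<open>The preimage of a ball under a linear map is convex, as the parameter lemma
   demands.\<close>
 define W where "W = L -` ball (z0, z1, z2) \<epsilon>0"
 have linL: "linear L" unfolding L_def by (rule linearI) (auto simp: algebra_simps add_divide_distrib diff_divide_distrib)
 have W: "open W" "convex W" unfolding W_def
  using linL by (auto intro!: open_vimage convex_linear_vimage linear_continuous_on simp: linear_conv_bounded_linear)
 have W_U: "((b + c) / 2, (b - c) / 2, (b + c) / 2 - a) \<in> U" if "(a, b, c) \<in> W" for a b c
  using that \<epsilon>0(2) by (auto simp: W_def L_def)
 define P where "P q = (q (jZ 1) + q (jZ 2)) / 2" for q :: jet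
 define Q where "Q q = (q (jZ 1) - q (jZ 2)) / 2" for q :: jet
 define K where "K q = lam * P q * Q q + G (P q) (Q q) (P q - q (jZ 0))" for q
 have oW: "open (jets_over W)" using W(1) by (rule open_jets_over)
 have KC: "Ck k (jets_over W) K" for k
 proof -
  have pr: "Ck k (jets_over W) (\<lambda>q::jet. q y)" for k y using oW by simp
  have PC: "Ck k (jets_over W) P" and QC: "Ck k (jets_over W) Q"
   unfolding P_def Q_def divide_inverse by (intro Ck_mult Ck_add Ck_diff Ck_const pr oW)+
  have "Ck k (jets_over W) (\<lambda>q. (\<lambda>p. G (p (jZ 0)) (p (jZ 1)) (p (jZ 2))) (mk3 (P q) (Q q) (P q - q (jZ 0))))"
  proof (rule Ck_mk3[OF oW U G])
   show "depends_on {jZ 0, jZ 1, jZ 2} (jets_over U) (\<lambda>p. G (p (jZ 0)) (p (jZ 1)) (p (jZ 2)))" by (simp add: depends_on_def)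
   show "(P q, Q q, P q - q (jZ 0)) \<in> U" if "q \<in> jets_over W" for q
    using W_U that by (simp add: jets_over_def P_def Q_def)
  qed (intro PC QC Ck_diff pr oW)+
  then show ?thesis unfolding K_def by (intro Ck_add Ck_mult Ck_const PC QC oW) (simp only: mk3_simps)
 qed
 have Kd: "depends_on {jZ 0, jZ 1, jZ 2} (jets_over W) K" by (simp add: depends_on_def K_def P_def Q_def)
 have K_eq: "K (mk3 a b c) = lam * ((b + c) / 2) * ((b - c) / 2) + G ((b + c) / 2) ((b - c) / 2) ((b + c) / 2 - a)" for a b c
  by (simp only: K_def P_def Q_def mk3_simps)
 have base: "(z0 - z2, z0 + z1, z0 - z1) \<in> W" using \<epsilon>0(1) by (simp add: W_def L_def)
 obtain eK CK where eK: "eK > 0" "CK \<ge> 0"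
  and eKW: "\<forall>a b c. \<bar>a - (z0 - z2)\<bar> < eK \<and> \<bar>b - (z0 + z1)\<bar> < eK \<and> \<bar>c - (z0 - z1)\<bar> < eK \<longrightarrow> (a, b, c) \<in> W"
  and lipK: "lipschitz3 K (z0 - z2) (z0 + z1) (z0 - z1) eK CK"
  by (rule lipschitz_mk3[OF W(1) KC base])
 define \<Phi>1 :: "jet \<Rightarrow> real" where "\<Phi>1 = (\<lambda>q. lam * ((q (jZ 1) - q (jZ 2)) / 2) * q (jZ 0))"
 define \<Phi>2 :: "jet \<Rightarrow> real" where "\<Phi>2 = (\<lambda>q. (q (jZ 0) - q (jZ 1)) * q (jZ 2))"
 have pr: "Ck k UNIV (\<lambda>q::jet. q y)" for k y by simp
 have C12: "Ck 1 (jets_over UNIV) \<Phi>1" "Ck 1 (jets_over UNIV) \<Phi>2"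
  unfolding \<Phi>1_def \<Phi>2_def jets_over_UNIV divide_inverse by (intro Ck_mult Ck_diff Ck_const pr open_UNIV)+
 obtain e1 C1 where e1: "e1 > 0" "C1 \<ge> 0" and lip1: "lipschitz3 \<Phi>1 1 (z0 + z1) (z0 - z1) e1 C1"
  by (rule lipschitz_mk3[OF open_UNIV C12(1) UNIV_I])
 obtain e2 C2 where e2: "e2 > 0" "C2 \<ge> 0" and lip2: "lipschitz3 \<Phi>2 (z0 + z1) (z0 - z2) 1 e2 C2"
  by (rule lipschitz_mk3[OF open_UNIV C12(2) UNIV_I])
 obtain e3 C3 where e3: "e3 > 0" "C3 \<ge> 0" and lip3: "lipschitz3 \<Phi>2 (z0 - z1) (z0 - z2) 1 e3 C3"
  by (rule lipschitz_mk3[OF open_UNIV C12(2) UNIV_I])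
 define w0 where "w0 = ((1 :: real, z0 - z2), (z0 + z1, z0 - z1))"
 \<comment> \<open>The bound 1/2 keeps \<open>J\<close> within 1/2 of its initial value 1, hence
   positive; the other bounds keep all arguments where the Lipschitz estimates hold.\<close>
 define \<rho> where "\<rho> = min (min (eK / 2) (1 / 2)) (min (e1 / 2) (min (e2 / 2) (e3 / 2)))"
 have \<rho>: "\<rho> > 0" "\<rho> < eK" "\<rho> \<le> 1 / 2" "\<rho> < e1" "\<rho> < e2" "\<rho> < e3" using eK e1 e2 e3 by (auto simp: \<rho>_def min_def)
 define C where "C = CK + C1 + C2 + C3"
 define F1 where "F1 w = (\<Phi>1 (mk3 (fst (fst w)) (fst (snd w)) (snd (snd w))), K (mk3 (snd (fst w)) (fst (snd w)) (snd (snd w))))"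
  for w :: "(real \<times> real) \<times> (real \<times> real)"
 define F2 where "F2 w = (\<Phi>2 (mk3 (fst (snd w)) (snd (fst w)) (fst (fst w))), - \<Phi>2 (mk3 (snd (snd w)) (snd (fst w)) (fst (fst w))))"
  for w :: "(real \<times> real) \<times> (real \<times> real)"
 have wb: "\<bar>fst (fst w) - 1\<bar> \<le> \<rho>" "\<bar>snd (fst w) - (z0 - z2)\<bar> \<le> \<rho>" "\<bar>fst (snd w) - (z0 + z1)\<bar> \<le> \<rho>" "\<bar>snd (snd w) - (z0 - z1)\<bar> \<le> \<rho>"
  if "w \<in> cball w0 \<rho>" for w
 proof -
  have "norm (w - w0) \<le> \<rho>" using that by (simp add: dist_norm norm_minus_commute)
  then show "\<bar>fst (fst w) - 1\<bar> \<le> \<rho>" "\<bar>snd (fst w) - (z0 - z2)\<bar> \<le> \<rho>" "\<bar>fst (snd w) - (z0 + z1)\<bar> \<le> \<rho>" "\<bar>snd (snd w) - (z0 - z1)\<bar> \<le> \<rho>"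
   using norm_component_le[of w w0] by (auto simp: w0_def)
 qed
 \<comment> \<open>Three arguments, each moving by at most the norm of the difference; the two
   components together then give the constant \<open>6 * C\<close>.\<close>
 have three: "c * (x + y + z) \<le> C * (3 * d)" if "0 \<le> c" "c \<le> C" "0 \<le> x" "0 \<le> y" "0 \<le> z" "x \<le> d" "y \<le> d" "z \<le> d" for c x y z d :: real
  using that by (intro mult_mono) auto
 have CC: "CK \<le> C" "C1 \<le> C" "C2 \<le> C" "C3 \<le> C" "0 \<le> C" using eK e1 e2 e3 by (auto simp: C_def)
 have L1: "norm (F1 w - F1 w') \<le> 6 * C * norm (w - w')" if "w \<in> cball w0 \<rho>" "w' \<in> cball w0 \<rho>" for w w'
 proof -
  note b = wb[OF that(1)] wb[OF that(2)]
  have "\<bar>fst (F1 w - F1 w')\<bar> \<le> C * (3 * norm (w - w'))"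
   unfolding F1_def fst_diff fst_conv
   by (rule order_trans[OF lip1[unfolded lipschitz3_def, rule_format] three]) (intro conjI b[THEN le_less_trans[OF _ \<rho>(4)]] e1 CC abs_ge_zero norm_component_le)+
  moreover have "\<bar>snd (F1 w - F1 w')\<bar> \<le> C * (3 * norm (w - w'))"
   unfolding F1_def snd_diff snd_conv
   by (rule order_trans[OF lipK[unfolded lipschitz3_def, rule_format] three]) (intro conjI b[THEN le_less_trans[OF _ \<rho>(2)]] eK CC abs_ge_zero norm_component_le)+
  ultimately show ?thesis using norm_prod_le(3)[of "F1 w - F1 w'"] unfolding real_norm_def by linarith
 qed
 have L2: "norm (F2 w - F2 w') \<le> 6 * C * norm (w - w')" if "w \<in> cball w0 \<rho>" "w' \<in> cball w0 \<rho>" for w w'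
 proof -
  note b = wb[OF that(1)] wb[OF that(2)]
  have "\<bar>fst (F2 w - F2 w')\<bar> \<le> C * (3 * norm (w - w'))"
   unfolding F2_def fst_diff fst_conv
   by (rule order_trans[OF lip2[unfolded lipschitz3_def, rule_format] three]) (intro conjI b[THEN le_less_trans[OF _ \<rho>(5)]] e2 CC abs_ge_zero norm_component_le)+
  moreover have "\<bar>\<Phi>2 (mk3 (snd (snd w)) (snd (fst w)) (fst (fst w))) - \<Phi>2 (mk3 (snd (snd w')) (snd (fst w')) (fst (fst w')))\<bar> \<le> C * (3 * norm (w - w'))"
   by (rule order_trans[OF lip3[unfolded lipschitz3_def, rule_format] three]) (intro conjI b[THEN le_less_trans[OF _ \<rho>(6)]] e3 CC abs_ge_zero norm_component_le)+
  then have "\<bar>snd (F2 w - F2 w')\<bar> \<le> C * (3 * norm (w - w'))"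
   unfolding F2_def snd_diff snd_conv by (simp add: abs_minus_commute)
  ultimately show ?thesis using norm_prod_le(3)[of "F2 w - F2 w'"] unfolding real_norm_def by linarith
 qed
 have ca: "continuous_on UNIV (\<lambda>y. (1 :: real, m0 y))"
  using m0(2) by (intro continuous_on_Pair continuous_on_const) (auto intro: DERIV_isCont continuous_at_imp_continuous_on)
 have cb: "continuous_on UNIV (\<lambda>t. (z0 + z1 + rp' * t, z0 - z1 + rm' * t))"
  by (intro continuous_intros)
 have C6: "6 * C \<ge> 0" using CC by simp
 have a00: "(1, m0 0) = fst w0" and b00: "(z0 + z1 + rp' * 0, z0 - z1 + rm' * 0) = snd w0" by (simp_all add: w0_def m0(1))
 obtain r and w :: "real \<times> real \<Rightarrow> (real \<times> real) \<times> (real \<times> real)" where r: "r > 0" and wc: "continuous_on UNIV w" and wball': "\<forall>q. w q \<in> cball w0 \<rho>"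
  and w1': "\<forall>y t. \<bar>y\<bar> \<le> r \<and> \<bar>t\<bar> \<le> r \<longrightarrow> fst (w (y, t)) = (1, m0 y) + t *\<^sub>R integral {0..1} (\<lambda>\<theta>. F1 (w (y, \<theta> * t)))"
  and w2': "\<forall>y t. \<bar>y\<bar> \<le> r \<and> \<bar>t\<bar> \<le> r \<longrightarrow> snd (w (y, t)) = (z0 + z1 + rp' * t, z0 - z1 + rm' * t) + y *\<^sub>R integral {0..1} (\<lambda>\<theta>. F2 (w (\<theta> * y, t)))"
  by (rule goursat[OF \<rho>(1) C6 L1 L2 ca a00 cb b00])
 note wball = wball'[rule_format] and w1 = w1'[rule_format, OF conjI] and w2 = w2'[rule_format, OF conjI]
 have cF1: "continuous_on (cball w0 \<rho>) F1"
  by (rule lipschitz_on_continuous_on[where L = "6 * C"]) (use L1 CC in \<open>auto simp: lipschitz_on_def dist_norm\<close>)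
 have cF2: "continuous_on (cball w0 \<rho>) F2"
  by (rule lipschitz_on_continuous_on[where L = "6 * C"]) (use L2 CC in \<open>auto simp: lipschitz_on_def dist_norm\<close>)
 define J where "J p = fst (fst (w (p jX, p jT)))" for p :: jet
 define M where "M p = snd (fst (w (p jX, p jT)))" for p :: jet
 define Rp where "Rp p = fst (snd (w (p jX, p jT)))" for p :: jet
 define Rm where "Rm p = snd (snd (w (p jX, p jT)))" for p :: jet
 define B where "B = {p :: jet. \<bar>p jX\<bar> < r \<and> \<bar>p jT\<bar> < r}"
 have d1: "((\<lambda>s. fst (w (y, s))) has_vector_derivative F1 (w (y, t))) (at t)" if "\<bar>y\<bar> < r" "\<bar>t\<bar> < r" for y t
 proof -
  have c: "continuous_on {-r..r} (\<lambda>s. F1 (w (y, s)))"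
   by (rule continuous_on_compose2[OF cF1], rule continuous_on_compose2[OF wc]) (use wball in \<open>auto intro!: continuous_intros\<close>)
  have "((\<lambda>s. s *\<^sub>R integral {0..1} (\<lambda>\<theta>. F1 (w (y, \<theta> * s)))) has_vector_derivative F1 (w (y, t))) (at t within {-r..r})"
   by (rule scaled_integral_vector_derivative[OF c]) (use that in auto)
  from has_vector_derivative_add[OF has_vector_derivative_const this, of "(1, m0 y)"]
  have "((\<lambda>s. fst (w (y, s))) has_vector_derivative F1 (w (y, t))) (at t within {-r..r})"
   unfolding add_0
   by (rule has_vector_derivative_transform[rotated 2]) (use that w1 in auto)
  then show ?thesis using that by (simp add: at_within_Icc_at)
 qed
 have d2: "((\<lambda>s. snd (w (s, t))) has_vector_derivative F2 (w (y, t))) (at y)" if "\<bar>y\<bar> < r" "\<bar>t\<bar> < r" for y t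
 proof -
  have c: "continuous_on {-r..r} (\<lambda>s. F2 (w (s, t)))"
   by (rule continuous_on_compose2[OF cF2], rule continuous_on_compose2[OF wc]) (use wball in \<open>auto intro!: continuous_intros\<close>)
  have "((\<lambda>s. s *\<^sub>R integral {0..1} (\<lambda>\<theta>. F2 (w (\<theta> * s, t)))) has_vector_derivative F2 (w (y, t))) (at y within {-r..r})"
   by (rule scaled_integral_vector_derivative[OF c]) (use that in auto)
  from has_vector_derivative_add[OF has_vector_derivative_const this, of "(z0 + z1 + rp' * t, z0 - z1 + rm' * t)"]
  have "((\<lambda>s. snd (w (s, t))) has_vector_derivative F2 (w (y, t))) (at y within {-r..r})"
   unfolding add_0
   by (rule has_vector_derivative_transform[rotated 2]) (use that w2 in auto)
  then show ?thesis using that by (simp add: at_within_Icc_at)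
 qed
 have mk: "\<Phi>1 (mk3 a b c) = lam * ((b - c) / 2) * a" "\<Phi>2 (mk3 a b c) = (a - b) * c" for a b c
  by (simp_all only: \<Phi>1_def \<Phi>2_def mk3_simps)
 have cpair: "continuous_on B (\<lambda>p::jet. w (p jX, p jT))"
  by (rule continuous_on_compose2[OF wc]) (auto intro!: continuous_on_Pair continuous_on_jet_proj)
 have w10: "fst (w (y, 0)) = (1, m0 y)" if "\<bar>y\<bar> < r" for y using w1[of y 0] that r by simp
 have w20: "snd (w (0, t)) = (z0 + z1 + rp' * t, z0 - z1 + rm' * t)" if "\<bar>t\<bar> < r" for t using w2[of 0 t] that r by simp
 have near: "\<forall>\<^sub>F s in nhds x. \<bar>s\<bar> < r" if "\<bar>x\<bar> < r" for x :: real
  using that by (intro eventually_nhds_in_open[of "{s. \<bar>s\<bar> < r}", simplified]) (auto intro!: open_Collect_less continuous_intros)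
 show ?thesis
 proof (rule that[of r J M Rp Rm W K], unfold_locales, fold B_def)
  show "open W" "convex W" by (rule W)+
  show "Ck k (jets_over W) K" for k by (rule KC)
  show "depends_on {jZ 0, jZ 1, jZ 2} (jets_over W) K" by (rule Kd)
  show "continuous_on B J" "continuous_on B M" "continuous_on B Rp" "continuous_on B Rm"
   unfolding J_def M_def Rp_def Rm_def by (intro continuous_on_fst continuous_on_snd cpair)+
  show "(M p, Rp p, Rm p) \<in> W" for p
   unfolding M_def Rp_def Rm_def by (rule eKW[rule_format]) (intro conjI wb[OF wball, THEN le_less_trans[OF _ \<rho>(2)]])
  show "((\<lambda>s. J (p(jT := s))) has_field_derivative lam * ((Rp p - Rm p) / 2) * J p) (at (p jT))" if "p \<in> B" for p
   using has_derivative_components(1)[OF d1[of "p jX" "p jT", unfolded F1_def mk]] that by (simp add: B_def J_def Rp_def Rm_def)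
  show "((\<lambda>s. M (p(jT := s))) has_field_derivative K (mk3 (M p) (Rp p) (Rm p))) (at (p jT))" if "p \<in> B" for p
   using has_derivative_components(2)[OF d1[of "p jX" "p jT", unfolded F1_def]] that by (simp add: B_def M_def Rp_def Rm_def)
  show "((\<lambda>s. Rp (p(jX := s))) has_field_derivative (Rp p - M p) * J p) (at (p jX))" if "p \<in> B" for p
   using has_derivative_components(1)[OF d2[of "p jX" "p jT", unfolded F2_def mk]] that by (simp add: B_def M_def Rp_def J_def)
  show "((\<lambda>s. Rm (p(jX := s))) has_field_derivative - ((Rm p - M p) * J p)) (at (p jX))" if "p \<in> B" for p
   using has_derivative_components(2)[OF d2[of "p jX" "p jT", unfolded F2_def mk]] that by (simp add: B_def M_def Rm_def J_def)
  show "((\<lambda>s. J (p(jX := s, jT := 0))) has_field_derivative 0) (at (p jX))" if "p \<in> B" for p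
  proof -
   have "\<forall>\<^sub>F s in nhds (p jX). J (p(jX := s, jT := 0)) = 1"
    using near[of "p jX"] that by (auto simp: B_def J_def w10 elim!: eventually_mono)
   from DERIV_cong_ev[OF refl this refl] show ?thesis by simp
  qed
  show "((\<lambda>s. M (p(jX := s, jT := 0))) has_field_derivative m0' (p jX)) (at (p jX))" if "p \<in> B" for p
  proof -
   have "\<forall>\<^sub>F s in nhds (p jX). M (p(jX := s, jT := 0)) = m0 s"
    using near[of "p jX"] that by (auto simp: B_def M_def w10 elim!: eventually_mono)
   from DERIV_cong_ev[OF refl this refl] m0(2) show ?thesis by simp
  qed
  show "((\<lambda>s. Rp (p(jT := s, jX := 0))) has_field_derivative rp') (at (p jT))" if "p \<in> B" for p
  proof -
   have "\<forall>\<^sub>F s in nhds (p jT). Rp (p(jT := s, jX := 0)) = z0 + z1 + rp' * s"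
    using near[of "p jT"] that by (auto simp: B_def Rp_def w20 elim!: eventually_mono)
   from DERIV_cong_ev[OF refl this refl] show ?thesis by (auto intro!: derivative_eq_intros)
  qed
  show "((\<lambda>s. Rm (p(jT := s, jX := 0))) has_field_derivative rm') (at (p jT))" if "p \<in> B" for p
  proof -
   have "\<forall>\<^sub>F s in nhds (p jT). Rm (p(jT := s, jX := 0)) = z0 - z1 + rm' * s"
    using near[of "p jT"] that by (auto simp: B_def Rm_def w20 elim!: eventually_mono)
   from DERIV_cong_ev[OF refl this refl] show ?thesis by (auto intro!: derivative_eq_intros)
  qed
  show "Ck k B (\<lambda>p. m0' (p jX))" for k unfolding B_def
   by (intro m0' open_Collect_conj open_Collect_less continuous_on_rabs continuous_on_jet_proj continuous_on_const)
  show "J p = J q \<and> M p = M q \<and> Rp p = Rp q \<and> Rm p = Rm q" if "p jX = q jX" "p jT = q jT" for p q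
   using that by (simp add: J_def M_def Rp_def Rm_def)
  show "r > 0" by (rule r)
  show "J p > 0" if "p \<in> B" for p
   using wb(1)[OF wball[of "(p jX, p jT)"]] \<rho>(3) by (auto simp: J_def)
  show "J (p(jT := 0)) = 1" "M (p(jT := 0)) = m0 (p jX)" if "p \<in> B" for p
   using w10 that by (auto simp: B_def J_def M_def)
  show "Rp (p(jX := 0)) = z0 + z1 + rp' * p jT" "Rm (p(jX := 0)) = z0 - z1 + rm' * p jT" if "p \<in> B" for p
   using w20 that by (auto simp: B_def Rp_def Rm_def)
  show "((b + c) / 2, (b - c) / 2, (b + c) / 2 - a) \<in> U" if "(a, b, c) \<in> W" for a b c by (rule W_U[OF that])
  show "K (mk3 a b c) = lam * ((b + c) / 2) * ((b - c) / 2) + G ((b + c) / 2) ((b - c) / 2) ((b + c) / 2 - a)" for a b c by (rule K_eq)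
 qed
qed


section \<open>Return from characteristic to physical coordinates\<close>

definition jxt :: "real \<times> real \<Rightarrow> jet" where
 "jxt q = (\<lambda>y. case y of jX \<Rightarrow> fst q | jT \<Rightarrow> snd q | _ \<Rightarrow> 0)"

lemma jxt_simps [simp]: "jxt q jX = fst q" "jxt q jT = snd q"
 by (simp_all add: jxt_def)

lemma jxt_upd: "(jxt q)(jX := a, jT := b) = jxt (a, b)" "(jxt q)(jX := a) = jxt (a, snd q)" "(jxt q)(jT := b) = jxt (fst q, b)"
 by (auto simp: jxt_def fun_eq_iff split: jvar.splits)

lemma continuous_on_jxt: "continuous_on A f ==> continuous_on A (\<lambda>x. jxt (f x))"
proof (rule continuous_on_jetI)
 show "continuous_on A (\<lambda>x. jxt (f x) y)" if "continuous_on A f" for y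
  using that by (cases y) (auto simp: jxt_def intro: continuous_intros)
qed

context characteristic_solution
begin

definition P where "P p = (Rp p + Rm p) / 2"
definition Q where "Q p = (Rp p - Rm p) / 2"

lemma system_smooth: "Ck k B J" "Ck k B M" "Ck k B Rp" "Ck k B Rm"
 using system_Ck by auto

lemma PQ_smooth: "Ck k B P" "Ck k B Q"
 unfolding P_def Q_def divide_inverse by (intro Ck_mult Ck_add Ck_diff Ck_const B_open system_smooth)+

lemma deps: "p jX = q jX ==> p jT = q jT ==> J p = J q" "p jX = q jX ==> p jT = q jT ==> M p = M q"
 "p jX = q jX ==> p jT = q jT ==> P p = P q" "p jX = q jX ==> p jT = q jT ==> Q p = Q q"
 using dep[of p q] by (simp_all add: P_def Q_def)

lemma PQ_y:
 assumes "p \<in> B"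
 shows "((\<lambda>s. P (p(jX := s))) has_field_derivative Q p * J p) (at (p jX))"
  "((\<lambda>s. Q (p(jX := s))) has_field_derivative (P p - M p) * J p) (at (p jX))"
proof -
 have "((\<lambda>s. (Rp (p(jX := s)) + Rm (p(jX := s))) / 2) has_field_derivative ((Rp p - M p) * J p + - ((Rm p - M p) * J p)) / 2) (at (p jX))"
  by (intro DERIV_cdivide DERIV_add Rp_y Rm_y assms)
 then show "((\<lambda>s. P (p(jX := s))) has_field_derivative Q p * J p) (at (p jX))"
  unfolding P_def Q_def by (rule DERIV_cong) (simp add: algebra_simps)
 have "((\<lambda>s. (Rp (p(jX := s)) - Rm (p(jX := s))) / 2) has_field_derivative ((Rp p - M p) * J p - - ((Rm p - M p) * J p)) / 2) (at (p jX))"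
  by (intro DERIV_cdivide DERIV_diff Rp_y Rm_y assms)
 then show "((\<lambda>s. Q (p(jX := s))) has_field_derivative (P p - M p) * J p) (at (p jX))"
  unfolding P_def Q_def by (rule DERIV_cong) (simp add: field_simps)
qed

lemma pd_system:
 assumes "p \<in> B"
 shows "pd jX P p = Q p * J p" "pd jX Q p = (P p - M p) * J p" "pd jT J p = lam * Q p * J p"
  "pd jT M p = lam * P p * Q p + G (P p) (Q p) (P p - M p)"
proof -
 show "pd jX P p = Q p * J p" "pd jX Q p = (P p - M p) * J p"
  using pd_eqI[OF PQ_y(1)[OF assms]] pd_eqI[OF PQ_y(2)[OF assms]] .
 show "pd jT J p = lam * Q p * J p" "pd jT M p = lam * P p * Q p + G (P p) (Q p) (P p - M p)"
  using pd_eqI[OF J_t[OF assms]] pd_eqI[OF M_t[OF assms]] by (simp_all add: K_eq P_def Q_def)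
qed

text \<open>Position at time \<open>t\<close> of the characteristic that starts at
  \<open>y\<close>.\<close>

definition X where "X p = p jX + lam * Iy jT P p"

lemma X_smooth: "Ck k B X"
 unfolding X_def by (intro Ck_add Ck_mult Ck_const Ck_proj Iy_Ck B_open PQ_smooth B_star)

lemma X_T: "p \<in> B ==> pd jT X p = lam * P p"
 unfolding X_def
proof (rule pd_eqI)
 assume "p \<in> B"
 from Iy_DERIV[OF B_open Ck_continuous[OF PQ_smooth(1)] B_star this, where y = jT]
 show "((\<lambda>s. (p(jT := s)) jX + lam * Iy jT P (p(jT := s))) has_real_derivative lam * P p) (at (p jT))"
  by (auto intro!: derivative_eq_intros simp del: fun_upd_apply simp: fun_upd_other)
qed

text \<open>\<open>J\<close> and the y-derivative of the formula for \<open>X\<close> both equal 1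
  at \<open>t = 0\<close> and have the same time derivative \<open>lam u_x J\<close>. So the unknown
  \<open>J\<close> really is the Jacobian of the change of coordinates.\<close>

lemma X_Y: assumes p: "p \<in> B" shows "pd jX X p = J p"
proof -
 have e: "pd jX X q = 1 + lam * Iy jT (pd jX P) q" if q: "q \<in> B" for q
  unfolding X_def
 proof (rule pd_eqI)
  have "((\<lambda>s. Iy jT P (q(jX := s))) has_field_derivative Iy jT (pd jX P) q) (at (q jX))"
   by (rule Iy_DERIV_other[OF B_open PQ_smooth(1) B_star q]) auto
  then show "((\<lambda>s. (q(jX := s)) jX + lam * Iy jT P (q(jX := s))) has_real_derivative 1 + lam * Iy jT (pd jX P) q) (at (q jX))"
   by (auto intro!: derivative_eq_intros simp del: fun_upd_apply simp: fun_upd_same)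
 qed
 define g where "g s = 1 + lam * Iy jT (pd jX P) (p(jT := s)) - J (p(jT := s))" for s
 have inB: "p(jT := s) \<in> B" if "s \<in> {-r<..<r}" for s using that p by (auto simp: B_def)
 have "(g has_field_derivative 0) (at s within {-r<..<r})" if s: "s \<in> {-r<..<r}" for s
 proof -
  have "((\<lambda>s'. Iy jT (pd jX P) ((p(jT := s))(jT := s'))) has_field_derivative pd jX P (p(jT := s))) (at ((p(jT := s)) jT))"
   by (rule Iy_DERIV[OF B_open _ B_star inB[OF s]]) (use Ck_continuous[OF Ck_Suc_pd[OF PQ_smooth(1)]] in auto)
  moreover have "((\<lambda>s'. J ((p(jT := s))(jT := s'))) has_field_derivative lam * ((Rp (p(jT := s)) - Rm (p(jT := s))) / 2) * J (p(jT := s))) (at ((p(jT := s)) jT))"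
   by (rule J_t[OF inB[OF s]])
  ultimately have "(g has_field_derivative (0 + lam * pd jX P (p(jT := s)) - lam * ((Rp (p(jT := s)) - Rm (p(jT := s))) / 2) * J (p(jT := s)))) (at s)"
   unfolding g_def fun_upd_upd fun_upd_same by (intro DERIV_diff DERIV_add DERIV_const DERIV_cmult)
  then have "(g has_field_derivative 0) (at s)"
   using pd_system(1)[OF inB[OF s]] by (simp add: Q_def algebra_simps)
  then show ?thesis by (rule has_field_derivative_at_within)
 qed
 then have "\<exists>c. \<forall>s\<in>{-r<..<r}. g s = c" by (intro has_field_derivative_zero_constant) auto
 moreover have "g 0 = 0" using J_init[OF p] by (simp add: g_def Iy_def)
 moreover have "0 \<in> {-r<..<r}" "p jT \<in> {-r<..<r}" using r p by (auto simp: B_def)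
 ultimately have "g (p jT) = 0" by metis
 then show ?thesis using e[OF p] by (simp add: g_def)
qed

definition Xi :: "real \<times> real \<Rightarrow> real \<times> real" where "Xi q = (X (jxt q), snd q)"

definition box :: "(real \<times> real) set" where "box = {-r<..<r} \<times> {-r<..<r}"

lemma box: "open box" "(0, 0) \<in> box" "q \<in> box ==> jxt q \<in> B"
 using r by (auto simp: box_def B_def intro!: open_Times)

lemma Xi_derivative:
 assumes "q \<in> box"
 shows "(Xi has_derivative (\<lambda>(h, k). (J (jxt q) * h + lam * P (jxt q) * k, k))) (at q)"
proof -
 have "((\<lambda>(a, b). X ((jxt q)(jX := a, jT := b))) has_derivative (\<lambda>(h, k). pd jX X (jxt q) * h + pd jT X (jxt q) * k)) (at (jxt q jX, jxt q jT))"
  by (rule Ck_two_variable_derivative[OF B_open X_smooth box(3)[OF assms]]) auto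
 then have "((\<lambda>q'. X (jxt q')) has_derivative (\<lambda>hk. J (jxt q) * fst hk + lam * P (jxt q) * snd hk)) (at q)"
  unfolding jxt_upd fst_conv snd_conv split_beta prod.collapse jxt_simps X_T[OF box(3)[OF assms]] X_Y[OF box(3)[OF assms]] .
 from has_derivative_Pair[OF this has_derivative_snd[OF has_derivative_ident]]
 show ?thesis unfolding Xi_def by (simp add: case_prod_beta')
qed

text \<open>Positivity of \<open>J\<close> makes the derivative of \<open>Xi\<close> invertible. On
  \<open>t = 0\<close> the map is the identity, hence so is its local inverse there, and initial
  data are transported unchanged.\<close>

lemma inverse_exists:
 obtains V g where "open V" "(0, 0) \<in> V" "\<forall>q\<in>V. g q \<in> box" "\<forall>q\<in>V. Xi (g q) = q"
  "\<forall>\<^sub>F x in nhds 0. g (x, 0) = (x, 0)"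
  "\<forall>q\<in>V. (g has_derivative (\<lambda>(a, b). ((a - lam * P (jxt (g q)) * b) / J (jxt (g q)), b))) (at q)"
proof -
 define f' where "f' q = J (jxt q) *\<^sub>R Blinfun (\<lambda>(h :: real, k :: real). (h, 0 :: real)) + (lam * P (jxt q)) *\<^sub>R Blinfun (\<lambda>(h :: real, k :: real). (k, 0 :: real)) + Blinfun (\<lambda>(h, k). (0 :: real, k :: real))" for q
 have bl: "bounded_linear (\<lambda>(h :: real, k :: real). (h, 0 :: real))" "bounded_linear (\<lambda>(h :: real, k :: real). (k, 0 :: real))"
  "bounded_linear (\<lambda>(h :: real, k :: real). (0 :: real, k))"
  by (auto intro!: linearI simp: linear_conv_bounded_linear[symmetric])
 have f': "blinfun_apply (f' q) = (\<lambda>(h, k). (J (jxt q) * h + lam * P (jxt q) * k, k))" for q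
  by (rule ext) (auto simp: f'_def blinfun.add_left blinfun.scaleR_left bounded_linear_Blinfun_apply[OF bl(1)]
    bounded_linear_Blinfun_apply[OF bl(2)] bounded_linear_Blinfun_apply[OF bl(3)])
 define invf where "invf = Blinfun (\<lambda>(a, b). (a - lam * P (jxt (0, 0)) * b, b))"
 have bli: "bounded_linear (\<lambda>(a, b). (a - lam * P (jxt (0, 0)) * b, b))"
  by (auto intro!: linearI simp: linear_conv_bounded_linear[symmetric] algebra_simps)
 have J0: "J (jxt (0, 0)) = 1"
  using J_init[OF box(3)[OF box(2)]] by (simp add: jxt_upd)
 have inv: "invf o\<^sub>L f' (0, 0) = id_blinfun"
  by (rule blinfun_eqI) (auto simp: invf_def f' J0 bounded_linear_Blinfun_apply[OF bli])
 have cont: "continuous_on box f'"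
 proof -
  have "continuous_on box (\<lambda>q. F (jxt q))" if "Ck 0 B F" for F
   by (rule continuous_on_compose2[of B F]) (use that box in \<open>auto intro!: continuous_on_jxt continuous_on_id\<close>)
  then show ?thesis unfolding f'_def using system_smooth(1) PQ_smooth(1) by (intro continuous_intros) blast+
 qed
 have Xi0: "Xi (x, 0) = (x, 0)" for x by (simp add: Xi_def X_def Iy_def)
 have der: "(Xi has_derivative blinfun_apply (f' q)) (at q)" if "q \<in> box" for q
  using Xi_derivative[OF that] by (simp add: f')
 show ?thesis
 proof (rule inverse_function_theorem[OF box(1) der cont box(2) inv])
  fix U' V g g' assume ift: "open U'" "U' \<subseteq> box" "(0, 0) \<in> U'" "open V" "Xi (0, 0) \<in> V" "homeomorphism U' V Xi g"
   "\<And>y. y \<in> V ==> (g has_derivative (g' y)) (at y)"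
   "\<And>y. y \<in> V ==> g' y = inv (blinfun_apply (f' (g y)))"
   "\<And>y. y \<in> V ==> bij (blinfun_apply (f' (g y)))"
 have gU: "g q \<in> U'" if "q \<in> V" for q using ift(6) that by (auto simp: homeomorphism_def)
 show thesis
 proof (rule that[of V g])
  show "open V" by (rule ift)
  show "(0, 0) \<in> V" using ift(5) Xi0 by simp
  show "\<forall>q\<in>V. g q \<in> box" using gU ift(2) by auto
  show "\<forall>q\<in>V. Xi (g q) = q" using ift(6) by (auto simp: homeomorphism_def)
  have "open {x. (x, 0) \<in> U'}"
   using open_vimage[OF ift(1), of "\<lambda>x. (x, 0)"] continuous_on_Pair[OF continuous_on_id continuous_on_const, of UNIV 0]
   by (simp add: vimage_def)
  moreover have "g (x, 0) = (x, 0)" if "(x, 0) \<in> U'" for x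
   using ift(6) that Xi0[of x] by (auto simp: homeomorphism_def; metis)
  ultimately show "\<forall>\<^sub>F x in nhds 0. g (x, 0) = (x, 0)"
   using ift(3) eventually_nhds by (metis (mono_tags, lifting) mem_Collect_eq)
  show "\<forall>q\<in>V. (g has_derivative (\<lambda>(a, b). ((a - lam * P (jxt (g q)) * b) / J (jxt (g q)), b))) (at q)"
  proof
   fix q assume that: "q \<in> V"
   have "J (jxt (g q)) > 0" using gU[OF that] ift(2) box(3) J_pos by blast
   then have "inv (blinfun_apply (f' (g q))) = (\<lambda>(a, b). ((a - lam * P (jxt (g q)) * b) / J (jxt (g q)), b))"
    by (intro ext inv_f_eq bij_is_inj[OF ift(9)[OF that]]) (auto simp: f' field_simps)
   then show "(g has_derivative (\<lambda>(a, b). ((a - lam * P (jxt (g q)) * b) / J (jxt (g q)), b))) (at q)"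
    using ift(7)[OF that] ift(8)[OF that] by simp
  qed
 qed
 qed
qed

end

lemma pd_power_lift: "(pd jX ^^ k) (\<lambda>p. u (p jX) (p jT)) = (\<lambda>p. (dx ^^ k) u (p jX) (p jT))"
proof (induction k)
 case (Suc k)
 then show ?case by (auto simp: pd_def dx_def fun_eq_iff)
qed simp

lemma pd_lift: "pd jX (\<lambda>p. u (p jX) (p jT)) = (\<lambda>p. dx u (p jX) (p jT))" "pd jT (\<lambda>p. u (p jX) (p jT)) = (\<lambda>p. dt u (p jX) (p jT))"
 by (auto simp: pd_def dx_def dt_def fun_eq_iff)

lemma dx_jxt: "dx u x t = pd jX (\<lambda>p. u (p jX) (p jT)) (jxt (x, t))" "dt u x t = pd jT (\<lambda>p. u (p jX) (p jT)) (jxt (x, t))"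
 by (simp_all add: pd_lift)

lemma deriv_power_germ:
 assumes "\<forall>\<^sub>F x in nhds x0. u x t = f x"
 shows "\<forall>\<^sub>F x in nhds x0. (dx ^^ k) u x t = (deriv ^^ k) f x"
proof (induction k)
 case (Suc k)
 have "\<forall>\<^sub>F x in nhds x0. \<forall>\<^sub>F y in nhds x. (dx ^^ k) u y t = (deriv ^^ k) f y"
  using Suc by (simp add: eventually_eventually)
 then show ?case
 proof eventually_elim
  case (elim x)
  then show ?case unfolding funpow.simps o_apply dx_def[of "(dx ^^ k) u"] by (rule deriv_cong_ev) simp
 qed
qed (use assms in simp)

section \<open>Solutions of (T) through a prescribed jet\<close>

definition pol :: "(nat \<Rightarrow> real) \<Rightarrow> nat \<Rightarrow> real \<Rightarrow> real" where
 "pol c N y = (\<Sum>k\<le>N. c k / fact k * y ^ k)"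

lemma pol_0: "pol c N 0 = c 0"
 unfolding pol_def by (simp add: sum.atMost_shift)

lemma DERIV_pol: "(pol c (Suc N) has_field_derivative pol (\<lambda>i. c (Suc i)) N y) (at y)"
proof -
 have "((\<lambda>y. c 0 + (\<Sum>k\<le>N. c (Suc k) / fact (Suc k) * y ^ Suc k)) has_field_derivative
   0 + (\<Sum>k\<le>N. c (Suc k) / fact (Suc k) * (of_nat (Suc k) * y ^ k))) (at y)"
  by (intro DERIV_add DERIV_const DERIV_sum DERIV_cmult) (rule DERIV_cong[OF DERIV_pow], simp)
 moreover have "pol c (Suc N) = (\<lambda>y. c 0 + (\<Sum>k\<le>N. c (Suc k) / fact (Suc k) * y ^ Suc k))"
  by (rule ext) (simp only: pol_def sum.atMost_Suc_shift power_0 fact_0 div_by_1 mult_1_right)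
 moreover have "c (Suc k) / fact (Suc k) * (of_nat (Suc k) * y ^ k) = c (Suc k) / fact k * y ^ k" for k
  by (simp add: divide_simps del: of_nat_Suc)
 ultimately show ?thesis by (simp only: pol_def add_0)
qed

lemma deriv_pol: "k \<le> N ==> (deriv ^^ k) (pol c N) = pol (\<lambda>i. c (i + k)) (N - k)"
proof (induction k)
 case (Suc k)
 then have e: "N - k = Suc (N - Suc k)" by simp
 have "deriv (pol (\<lambda>i. c (i + k)) (Suc (N - Suc k))) = pol (\<lambda>i. c (Suc i + k)) (N - Suc k)"
  by (rule ext) (rule DERIV_imp_deriv[OF DERIV_pol])
 then show ?case using Suc e by simp
qed simp

lemma Ck_pol: "open S ==> Ck k S (\<lambda>p. pol c N (p y))"
 unfolding pol_def by (intro Ck_sum Ck_mult Ck_const Ck_power Ck_proj)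

lemma Ck_power_pd: "Ck (m + k) S F ==> Ck m S ((pd y ^^ k) F)"
proof (induction k arbitrary: m)
 case (Suc k)
 have "Ck (Suc m + k) S F" using Suc.prems by (simp del: Ck.simps)
 from Ck_Suc_pd[OF Suc.IH[OF this]] show ?case by simp
qed simp

lemma pd_add:
 assumes "Ck (Suc 0) S F" "Ck (Suc 0) S H" "p \<in> S"
 shows "pd y (\<lambda>p. F p + H p) p = pd y F p + pd y H p"
 by (rule pd_eqI[OF DERIV_add[OF Ck_DERIV[OF assms(1,3)] Ck_DERIV[OF assms(2,3)]]])

lemma pd_diff:
 assumes "Ck (Suc 0) S F" "Ck (Suc 0) S H" "p \<in> S"
 shows "pd y (\<lambda>p. F p - H p) p = pd y F p - pd y H p"
 by (rule pd_eqI[OF DERIV_diff[OF Ck_DERIV[OF assms(1,3)] Ck_DERIV[OF assms(2,3)]]])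

lemma pd_mult:
 assumes "Ck (Suc 0) S F" "Ck (Suc 0) S H" "p \<in> S"
 shows "pd y (\<lambda>p. F p * H p) p = F p * pd y H p + pd y F p * H p"
 using pd_eqI[OF DERIV_mult[OF Ck_DERIV[OF assms(1,3), of y] Ck_DERIV[OF assms(2,3), of y]]] by (simp add: mult.commute)

lemma pd_power_diff:
 assumes "open S" "\<And>k. Ck k S F" "\<And>k. Ck k S H" "p \<in> S"
 shows "(pd y ^^ k) (\<lambda>p. F p - H p) p = (pd y ^^ k) F p - (pd y ^^ k) H p"
 using assms(4)
proof (induction k arbitrary: p)
 case (Suc k)
 have "pd y ((pd y ^^ k) (\<lambda>p. F p - H p)) p = pd y (\<lambda>p. (pd y ^^ k) F p - (pd y ^^ k) H p) p"
  by (rule pd_cong[OF assms(1) Suc.prems Suc.IH])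
 also have "\<dots> = pd y ((pd y ^^ k) F) p - pd y ((pd y ^^ k) H) p"
  by (rule pd_diff[OF Ck_power_pd Ck_power_pd Suc.prems]) (rule assms)+
 finally show ?case by simp
qed simp

context characteristic_solution
begin

lemma solution_exists:
 obtains D u m where "open D" "(0, 0) \<in> D" "\<And>k. Ck k {p. (p jX, p jT) \<in> D} (\<lambda>p. u (p jX) (p jT))"
  "\<And>k. Ck k {p. (p jX, p jT) \<in> D} (\<lambda>p. m (p jX) (p jT))"
  "\<And>x t. (x, t) \<in> D ==> (u x t, dx u x t, dx (dx u) x t) \<in> U"
  "\<And>x t. (x, t) \<in> D ==> equation_T lam G u x t"
  "\<And>x t. (x, t) \<in> D ==> dx (dx u) x t = u x t - m x t" "\<forall>\<^sub>F x in nhds 0. m x 0 = m0 x"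
  "u 0 0 = z0" "dx u 0 0 = z1" "dt u 0 0 = (rp' + rm') / 2 - lam * z0 * z1" "dt (dx u) 0 0 = (rp' - rm') / 2 - lam * z0 * (z0 - m0 0)"
proof -
 obtain V g where V': "open V" "(0, 0) \<in> V" "\<forall>q\<in>V. g q \<in> box" "\<forall>q\<in>V. Xi (g q) = q"
  "\<forall>\<^sub>F x in nhds 0. g (x, 0) = (x, 0)"
  "\<forall>q\<in>V. (g has_derivative (\<lambda>(a, b). ((a - lam * P (jxt (g q)) * b) / J (jxt (g q)), b))) (at q)"
  by (rule inverse_exists)
 note V = V'(1,2) V'(3,4)[rule_format] V'(5) V'(6)[rule_format]
 define S where "S = {p :: jet. (p jX, p jT) \<in> V}"
 define \<psi> where "\<psi> p = jxt (g (p jX, p jT))" for p :: jet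
 have S: "open S"
 proof -
  have "continuous_on UNIV (\<lambda>p::jet. (p jX, p jT))" by (intro continuous_on_Pair continuous_on_jet_proj)
  from open_vimage[OF V(1) this] show ?thesis by (simp add: S_def vimage_def)
 qed
 have \<psi>B: "\<psi> p \<in> B" if "p \<in> S" for p using V(3) box(3) that by (simp add: \<psi>_def S_def)
 have \<psi>T: "\<psi> p jT = p jT" if "p \<in> S" for p
  using V(4)[of "(p jX, p jT)"] that by (auto simp: \<psi>_def S_def Xi_def prod_eq_iff)
 have J: "J (\<psi> p) > 0" if "p \<in> S" for p using J_pos \<psi>B that by blast
 have \<psi>_cont: "continuous_on S \<psi>"
 proof -
  have "continuous_on V g" using has_derivative_continuous[OF V(6)] by (auto intro: continuous_at_imp_continuous_on)
  then have "continuous_on S (\<lambda>p. g (p jX, p jT))"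
   by (rule continuous_on_compose2) (auto simp: S_def intro!: continuous_on_Pair continuous_on_jet_proj)
  then show ?thesis unfolding \<psi>_def by (rule continuous_on_jxt)
 qed
 \<comment> \<open>Chain rule for the inverse coordinates: the x-derivative is the y-derivative over
   \<open>J\<close>, and the t-derivative is the one along characteristics minus
   \<open>lam u\<close> times the x-derivative.\<close>
 define Dv where "Dv F z = (\<lambda>p. if z = jX then pd jX F p / J p else if z = jT then pd jT F p - lam * P p * pd jX F p / J p else 0)"
  for F :: "jet \<Rightarrow> real" and z
 have der: "((\<lambda>s. F (\<psi> (p(z := s)))) has_field_derivative Dv F z (\<psi> p)) (at (p z))"
  if F: "Ck 1 B F" "depends_on {jX, jT} B F" and p: "p \<in> S" for F p z
 proof -
  consider "z = jX" | "z = jT" | "z \<noteq> jX" "z \<noteq> jT" by blast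
  then show ?thesis
  proof cases
   case 3
   then have "\<psi> (p(z := s)) = \<psi> p" for s by (simp add: \<psi>_def)
   then show ?thesis using 3 by (simp add: Dv_def)
  next
   case 1
   have "\<forall>\<^sub>F s in nhds (p z). \<psi> (p(z := s)) \<in> B"
    using eventually_slice[OF S p, of z] by eventually_elim (rule \<psi>B)
   moreover have "((\<lambda>s. \<psi> (p(z := s)) y) has_field_derivative (if y = jX then 1 / J (\<psi> p) else 0)) (at (p z))" if "y \<in> {jX, jT}" for y
   proof -
    have "((\<lambda>s. g (s, p jT)) has_derivative (\<lambda>h. (h / J (\<psi> p), 0))) (at (p jX))"
     using has_derivative_compose[of "\<lambda>s. (s, p jT)" "\<lambda>h. (h, 0)" "p jX" UNIV g, OF has_derivative_Pair[OF has_derivative_ident has_derivative_const] V(6)[of "(p jX, p jT)"]] p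
     by (auto simp: S_def \<psi>_def)
    from has_derivative_fst[OF this] has_derivative_snd[OF this] show ?thesis
     using that 1 by (auto simp: \<psi>_def has_field_derivative_def fun_eq_iff elim!: has_derivative_eq_rhs)
   qed
   ultimately have "((\<lambda>s. F (\<psi> (p(z := s)))) has_field_derivative (\<Sum>y\<in>{jX, jT}. pd y F (\<psi> (p(z := p z))) * (if y = jX then 1 / J (\<psi> p) else 0))) (at (p z))"
    by (intro chain_rule[OF B_open F(1) _ F(2)]) auto
   then show ?thesis using 1 by (simp add: Dv_def)
  next
   case 2
   have "\<forall>\<^sub>F s in nhds (p z). \<psi> (p(z := s)) \<in> B"
    using eventually_slice[OF S p, of z] by eventually_elim (rule \<psi>B)
   moreover have "((\<lambda>s. \<psi> (p(z := s)) y) has_field_derivative (if y = jX then - (lam * P (\<psi> p)) / J (\<psi> p) else 1)) (at (p z))" if "y \<in> {jX, jT}" for y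
   proof -
    have "((\<lambda>s. g (p jX, s)) has_derivative (\<lambda>h. (- (lam * P (\<psi> p) * h) / J (\<psi> p), h))) (at (p jT))"
     using has_derivative_compose[of "\<lambda>s. (p jX, s)" "\<lambda>h. (0, h)" "p jT" UNIV g, OF has_derivative_Pair[OF has_derivative_const has_derivative_ident] V(6)[of "(p jX, p jT)"]] p
     by (auto simp: S_def \<psi>_def)
    from has_derivative_fst[OF this] has_derivative_snd[OF this] show ?thesis
     using that 2 by (auto simp: \<psi>_def has_field_derivative_def fun_eq_iff elim!: has_derivative_eq_rhs)
   qed
   ultimately have "((\<lambda>s. F (\<psi> (p(z := s)))) has_field_derivative (\<Sum>y\<in>{jX, jT}. pd y F (\<psi> (p(z := p z))) * (if y = jX then - (lam * P (\<psi> p)) / J (\<psi> p) else 1))) (at (p z))"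
    by (intro chain_rule[OF B_open F(1) _ F(2)]) auto
   then show ?thesis using 2 by (simp add: Dv_def algebra_simps)
  qed
 qed
 have Jne: "J q \<noteq> 0" if "q \<in> B" for q using J_pos[OF that] by simp
 have dJP: "depends_on {jX, jT} B J" "depends_on {jX, jT} B P" "depends_on {jX, jT} B M" "depends_on {jX, jT} B Q"
  unfolding depends_on_def by (intro ballI impI deps; simp)+
 \<comment> \<open>Differentiating a composition with \<open>\<psi>\<close> yields again such a
   composition, with \<open>Dv F\<close> in place of \<open>F\<close>; the induction stays inside
   this class.\<close>
 have smooth: "Ck k S (\<lambda>p. F (\<psi> p))" if "\<And>k. Ck k B F" "depends_on {jX, jT} B F" for F k
  using that
 proof (induction k arbitrary: F)
  case 0
  then show ?case using continuous_on_compose2[OF Ck_continuous[OF 0(1)] \<psi>_cont] \<psi>B by auto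
 next
  case (Suc k)
  have Dk: "Ck j B (Dv F z)" for j z
  proof -
   note F' = Ck_Suc_pd[OF Suc.prems(1)]
   consider "z = jX" | "z = jT" | "z \<noteq> jX" "z \<noteq> jT" by blast
   then show ?thesis
   proof cases
    case 1
    then show ?thesis unfolding Dv_def by (simp, intro Ck_divide B_open F' system_smooth Jne)
   next
    case 2
    then show ?thesis unfolding Dv_def by (simp, intro Ck_divide Ck_diff Ck_mult Ck_const B_open F' system_smooth PQ_smooth Jne)
   qed (simp add: Dv_def B_open)
  qed
  have Dd: "depends_on {jX, jT} B (Dv F z)" for z
   unfolding depends_on_def
  proof (intro ballI impI)
   fix p q assume pq: "p \<in> B" "q \<in> B" "\<forall>y\<in>{jX, jT}. p y = q y"
   note e = depends_onD[OF _ pq(1,2) pq(3)[rule_format]]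
   show "Dv F z p = Dv F z q"
    using e[OF dJP(1)] e[OF dJP(2)] e[OF depends_on_pd[OF B_open Suc.prems(2), of jX]] e[OF depends_on_pd[OF B_open Suc.prems(2), of jT]]
    by (simp add: Dv_def)
  qed
  show ?case
   by (rule Ck_SucI[OF S _ der[OF Suc.prems(1) Suc.prems(2)] Suc.IH[OF Dk Dd]])
    (use continuous_on_compose2[OF Ck_continuous[OF Suc.prems(1)] \<psi>_cont] \<psi>B in auto)
 qed
 have pdF: "pd z (\<lambda>p. F (\<psi> p)) p = Dv F z (\<psi> p)" if "Ck 1 B F" "depends_on {jX, jT} B F" "p \<in> S" for F z p
  by (rule pd_eqI[OF der[OF that]])
 define u where "u x t = P (jxt (g (x, t)))" for x t
 define m where "m x t = M (jxt (g (x, t)))" for x t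
 have lift_u: "(\<lambda>p. u (p jX) (p jT)) = (\<lambda>p. P (\<psi> p))" by (simp add: u_def \<psi>_def)
 have lift_m: "(\<lambda>p. m (p jX) (p jT)) = (\<lambda>p. M (\<psi> p))" by (simp add: m_def \<psi>_def)
 have \<psi>jxt: "\<psi> (jxt q) = jxt (g q)" for q by (simp add: \<psi>_def)
 have jS: "jxt q \<in> S \<longleftrightarrow> q \<in> V" for q by (simp add: S_def)
 have ux: "dx u x t = Q (jxt (g (x, t)))" if "(x, t) \<in> V" for x t
  unfolding dx_jxt lift_u using pdF[OF PQ_smooth(1) dJP(2), of "jxt (x, t)" jX] that jS
   pd_system(1)[OF box(3)[OF V(3)[OF that]]] Jne[OF box(3)[OF V(3)[OF that]]] by (simp add: Dv_def \<psi>jxt)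
 have lift_ux: "dx u (p jX) (p jT) = Q (\<psi> p)" if "p \<in> S" for p using ux that by (simp add: S_def \<psi>_def)
 have uxx: "dx (dx u) x t = P (jxt (g (x, t))) - M (jxt (g (x, t)))" if "(x, t) \<in> V" for x t
 proof -
  have "dx (dx u) x t = pd jX (\<lambda>p. Q (\<psi> p)) (jxt (x, t))"
   unfolding dx_jxt(1)[of "dx u"] by (rule pd_cong[OF S]) (use that jS lift_ux in auto)
  then show ?thesis using pdF[OF PQ_smooth(2) dJP(4), of "jxt (x, t)" jX] that jS
   pd_system(2)[OF box(3)[OF V(3)[OF that]]] Jne[OF box(3)[OF V(3)[OF that]]] by (simp add: Dv_def \<psi>jxt)
 qed
 have lift_uxx: "dx (dx u) (p jX) (p jT) = (\<lambda>q. P q - M q) (\<psi> p)" if "p \<in> S" for p using uxx that by (simp add: S_def \<psi>_def)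
 have PM: "Ck k B (\<lambda>q. P q - M q)" for k by (intro Ck_diff B_open PQ_smooth system_smooth)
 have dPM: "depends_on {jX, jT} B (\<lambda>q. P q - M q)" unfolding depends_on_def
  by (intro ballI impI arg_cong2[of _ _ _ _ "(-)"] deps; simp)
 have ut: "dt u x t = Dv P jT (jxt (g (x, t)))" if "(x, t) \<in> V" for x t
  unfolding dx_jxt lift_u using pdF[OF PQ_smooth(1) dJP(2), of "jxt (x, t)" jT] that jS by (simp add: \<psi>jxt)
 have uxt: "dt (dx u) x t = Dv Q jT (jxt (g (x, t)))" if "(x, t) \<in> V" for x t
 proof -
  have "dt (dx u) x t = pd jT (\<lambda>p. Q (\<psi> p)) (jxt (x, t))"
   unfolding dx_jxt(2)[of "dx u"] by (rule pd_cong[OF S]) (use that jS lift_ux in auto)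
  then show ?thesis using pdF[OF PQ_smooth(2) dJP(4), of "jxt (x, t)" jT] that jS by (simp add: \<psi>jxt)
 qed
 have uxxz: "pd z (\<lambda>p. dx (dx u) (p jX) (p jT)) (jxt q) = Dv (\<lambda>q. P q - M q) z (jxt (g q))" if "q \<in> V" for z q
 proof -
  have "pd z (\<lambda>p. dx (dx u) (p jX) (p jT)) (jxt q) = pd z (\<lambda>p. (\<lambda>q. P q - M q) (\<psi> p)) (jxt q)"
   by (rule pd_cong[OF S]) (use that jS lift_uxx in auto)
  then show ?thesis using pdF[OF PM dPM, of "jxt q" z] that jS by (simp add: \<psi>jxt)
 qed
 \<comment> \<open>The y-derivative of \<open>M\<close>, which the system does not provide, occurs
   on both sides only through \<open>lam u u_xxx\<close> and cancels.\<close>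
 have eqT: "equation_T lam G u x t" if xt: "(x, t) \<in> V" for x t
 proof -
  define q where "q = jxt (g (x, t))"
  have q: "q \<in> B" unfolding q_def by (rule box(3)[OF V(3)[OF xt]])
  have C1: "Ck (Suc 0) B P" "Ck (Suc 0) B M" by (rule PQ_smooth system_smooth)+
  have a: "dt (dx (dx u)) x t = (pd jT P q - pd jT M q) - lam * P q * (pd jX P q - pd jX M q) / J q"
   using uxxz[OF xt, of jT] unfolding dx_jxt(2)[of "dx (dx u)"] q_def[symmetric]
   by (simp add: Dv_def pd_diff[OF C1 q])
  have b: "dx (dx (dx u)) x t = (pd jX P q - pd jX M q) / J q"
   using uxxz[OF xt, of jX] unfolding dx_jxt(1)[of "dx (dx u)"] q_def[symmetric]
   by (simp add: Dv_def pd_diff[OF C1 q])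
  have c: "dt u x t = pd jT P q - lam * P q * pd jX P q / J q" "u x t = P q" "dx u x t = Q q" "dx (dx u) x t = P q - M q"
   using ut[OF xt] ux[OF xt] uxx[OF xt] by (simp_all add: q_def u_def Dv_def)
  show ?thesis
   unfolding equation_T_def a b c pd_system[OF q] using Jne[OF q] by (simp add: divide_simps) (simp add: algebra_simps)
 qed
 have g0: "g (0, 0) = (0, 0)" using V(5) eventually_nhds_x_imp_x by blast
 have j0: "jxt (0, 0) \<in> B" by (rule box(3)[OF box(2)])
 have P0: "P (p(jX := 0)) = z0 + (rp' + rm') / 2 * p jT" "Q (p(jX := 0)) = z1 + (rp' - rm') / 2 * p jT" if "p \<in> B" for p
  using Rp_init[OF that] Rm_init[OF that] by (simp_all add: P_def Q_def field_simps)
 have P00: "P (jxt (0, 0)) = z0" "Q (jxt (0, 0)) = z1" using P0[OF j0] by (simp_all add: jxt_upd)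
 have J00: "J (jxt (0, 0)) = 1" "M (jxt (0, 0)) = m0 0" using J_init[OF j0] M_init[OF j0] by (simp_all add: jxt_upd)
 have near: "\<forall>\<^sub>F s in nhds (jxt (0, 0) jT). (jxt (0, 0))(jT := s) \<in> B" by (rule eventually_slice[OF B_open j0])
 have P0t: "pd jT P (jxt (0, 0)) = (rp' + rm') / 2" "pd jT Q (jxt (0, 0)) = (rp' - rm') / 2"
 proof -
  have "\<forall>\<^sub>F s in nhds (jxt (0, 0) jT). P ((jxt (0, 0))(jT := s)) = z0 + (rp' + rm') / 2 * s"
   using near by eventually_elim (use P0(1)[of "(jxt (0, 0))(jT := s)" for s] in \<open>auto simp: jxt_upd\<close>)
  from DERIV_cong_ev[OF refl this refl, of "(rp' + rm') / 2"] show "pd jT P (jxt (0, 0)) = (rp' + rm') / 2"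
   by (intro pd_eqI) (auto intro!: derivative_eq_intros)
  have "\<forall>\<^sub>F s in nhds (jxt (0, 0) jT). Q ((jxt (0, 0))(jT := s)) = z1 + (rp' - rm') / 2 * s"
   using near by eventually_elim (use P0(2)[of "(jxt (0, 0))(jT := s)" for s] in \<open>auto simp: jxt_upd\<close>)
  from DERIV_cong_ev[OF refl this refl, of "(rp' - rm') / 2"] show "pd jT Q (jxt (0, 0)) = (rp' - rm') / 2"
   by (intro pd_eqI) (auto intro!: derivative_eq_intros)
 qed
 show ?thesis
 proof (rule that[of V u m, folded S_def])
  show "open V" "(0, 0) \<in> V" by (rule V)+
  show "Ck k S (\<lambda>p. u (p jX) (p jT))" for k unfolding lift_u by (rule smooth[OF PQ_smooth(1) dJP(2)])
  show "Ck k S (\<lambda>p. m (p jX) (p jT))" for k unfolding lift_m by (rule smooth[OF system_smooth(2) dJP(3)])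
  show "(u x t, dx u x t, dx (dx u) x t) \<in> U" if "(x, t) \<in> V" for x t
   unfolding ux[OF that] uxx[OF that] u_def P_def Q_def by (rule W_U[OF inW[OF box(3)[OF V(3)[OF that]]]])
  show "equation_T lam G u x t" if "(x, t) \<in> V" for x t by (rule eqT[OF that])
  show "dx (dx u) x t = u x t - m x t" if "(x, t) \<in> V" for x t using uxx[OF that] by (simp add: u_def m_def)
  have "\<forall>\<^sub>F x in nhds 0. (jxt (0, 0))(jX := x) \<in> B" using eventually_slice[OF B_open j0, of jX] by simp
  with V(5) show "\<forall>\<^sub>F x in nhds 0. m x 0 = m0 x"
   by eventually_elim (use M_init[of "(jxt (0, 0))(jX := x)" for x] in \<open>auto simp: jxt_upd m_def\<close>)
  show "u 0 0 = z0" using P00 g0 by (simp add: u_def)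
  show "dx u 0 0 = z1" using ux[OF V(2)] P00 g0 by simp
  show "dt u 0 0 = (rp' + rm') / 2 - lam * z0 * z1"
   using ut[OF V(2)] pd_system(1)[OF j0] P00 J00 P0t g0 by (simp add: Dv_def)
  show "dt (dx u) 0 0 = (rp' - rm') / 2 - lam * z0 * (z0 - m0 0)"
   using uxt[OF V(2)] pd_system(2)[OF j0] P00 J00 P0t g0 by (simp add: Dv_def)
 qed
qed

end


lemma pd_power_cong:
 assumes "open S" "\<And>q. q \<in> S ==> F q = H q" "p \<in> S"
 shows "(pd y ^^ k) F p = (pd y ^^ k) H p"
 using assms(3)
proof (induction k arbitrary: p)
 case (Suc k)
 show ?case unfolding funpow.simps o_apply by (rule pd_cong[OF assms(1) Suc.prems Suc.IH])
qed (use assms in simp)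

lemma dx_power_jxt: "(dx ^^ k) u x t = (pd jX ^^ k) (\<lambda>p. u (p jX) (p jT)) (jxt (x, t))"
 by (simp add: pd_power_lift)

lemma open_lift: "open D ==> open {p :: jet. (p jX, p jT) \<in> D}"
proof -
 assume "open D"
 have "continuous_on UNIV (\<lambda>p::jet. (p jX, p jT))" by (intro continuous_on_Pair continuous_on_jet_proj)
 from open_vimage[OF \<open>open D\<close> this] show ?thesis by (simp add: vimage_def)
qed

text \<open>The differences \<open>z_k - z_(k+2)\<close> are the x-derivatives of
  \<open>u - u_xx\<close>, which is taken as a polynomial on \<open>t = 0\<close>; conversely they
  determine all \<open>z_k\<close> from \<open>z_0\<close> and \<open>z_1\<close>. The values of
  \<open>u_t\<close> and \<open>u_xt\<close> remain free, because (T) prescribes only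
  \<open>u_t - u_xxt\<close>.\<close>

lemma T_solution_exists:
 assumes U: "open U" and G: "\<And>k. Ck k (jets_over U) (\<lambda>p. G (p (jZ 0)) (p (jZ 1)) (p (jZ 2)))"
  and p: "p \<in> jets_over U"
 obtains D u where "open D" "(0, 0) \<in> D" "\<forall>k. Ck k {p. (p jX, p jT) \<in> D} (\<lambda>p. u (p jX) (p jT))"
  "\<forall>(x, t)\<in>D. (u x t, dx u x t, dx (dx u) x t) \<in> U" "\<forall>(x, t)\<in>D. equation_T lam G u x t"
  "\<forall>k\<le>N. (dx ^^ k) u 0 0 = p (jZ k)" "dt u 0 0 = p (jW 0)" "dt (dx u) 0 0 = p (jV 0)"
proof -
 define c where "c k = p (jZ k) - p (jZ (Suc (Suc k)))" for k
 \<comment> \<open>\<alpha> and \<beta> are the derivatives of \<open>u\<close> and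
   \<open>u_x\<close> along the characteristic: the prescribed time derivative plus
   \<open>lam u\<close> times the x-derivative. Their sum and difference are the slopes of
   \<open>u + u_x\<close> and \<open>u - u_x\<close>.\<close>
 define \<alpha> where "\<alpha> = p (jW 0) + lam * p (jZ 0) * p (jZ 1)"
 define \<beta> where "\<beta> = p (jV 0) + lam * p (jZ 0) * p (jZ 2)"
 have zU: "(p (jZ 0), p (jZ 1), p (jZ 2)) \<in> U" using p by (simp add: jets_over_def)
 have c0: "pol c (Suc N) 0 = p (jZ 0) - p (jZ 2)" by (simp add: pol_0 c_def numeral_2_eq_2)
 show ?thesis
 proof (rule characteristic_solution_exists[OF U G zU c0 DERIV_pol Ck_pol])
  fix r J M Rp Rm W K
  assume "characteristic_solution r lam J M Rp Rm W K (pol (\<lambda>i. c (Suc i)) N) (\<alpha> + \<beta>) (\<alpha> - \<beta>) U G (pol c (Suc N)) (p (jZ 0)) (p (jZ 1))"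
  then interpret characteristic_solution r lam J M Rp Rm W K "pol (\<lambda>i. c (Suc i)) N" "\<alpha> + \<beta>" "\<alpha> - \<beta>"
   "{p :: jet. \<bar>p jX\<bar> < r \<and> \<bar>p jT\<bar> < r}" U G "pol c (Suc N)" "p (jZ 0)" "p (jZ 1)" .
  show thesis
  proof (rule solution_exists)
   fix D u m
   assume h: "open D" "(0, 0) \<in> D" "\<And>k. Ck k {p. (p jX, p jT) \<in> D} (\<lambda>p. u (p jX) (p jT))"
    "\<And>k. Ck k {p. (p jX, p jT) \<in> D} (\<lambda>p. m (p jX) (p jT))"
    "\<And>x t. (x, t) \<in> D ==> (u x t, dx u x t, dx (dx u) x t) \<in> U"
    "\<And>x t. (x, t) \<in> D ==> equation_T lam G u x t"
    "\<And>x t. (x, t) \<in> D ==> dx (dx u) x t = u x t - m x t" "\<forall>\<^sub>F x in nhds 0. m x 0 = pol c (Suc N) x"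
    "u 0 0 = p (jZ 0)" "dx u 0 0 = p (jZ 1)" "dt u 0 0 = (\<alpha> + \<beta> + (\<alpha> - \<beta>)) / 2 - lam * p (jZ 0) * p (jZ 1)"
    "dt (dx u) 0 0 = (\<alpha> + \<beta> - (\<alpha> - \<beta>)) / 2 - lam * p (jZ 0) * (p (jZ 0) - pol c (Suc N) 0)"
   define S where "S = {p :: jet. (p jX, p jT) \<in> D}"
   have S: "open S" unfolding S_def by (rule open_lift[OF h(1)])
   have j0: "jxt (0, 0) \<in> S" using h(2) by (simp add: S_def)
   have zk: "(dx ^^ k) u 0 0 = p (jZ k)" if "k \<le> N" for k
    using that
   proof (induction k rule: less_induct)
    case (less k)
    consider "k = 0" | "k = 1" | j where "k = j + 2" by (metis One_nat_def add_2_eq_Suc' not0_implies_Suc)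
    then show ?case
    proof cases
     case (3 j)
     have "(dx ^^ k) u 0 0 = (dx ^^ j) (dx (dx u)) 0 0"
      unfolding 3 by (simp add: funpow_swap1)
     also have "\<dots> = (pd jX ^^ j) (\<lambda>p. dx (dx u) (p jX) (p jT)) (jxt (0, 0))" by (rule dx_power_jxt)
     also have "\<dots> = (pd jX ^^ j) (\<lambda>p. u (p jX) (p jT) - m (p jX) (p jT)) (jxt (0, 0))"
      by (rule pd_power_cong[OF S _ j0]) (use h(7) in \<open>auto simp: S_def\<close>)
     also have "\<dots> = (dx ^^ j) u 0 0 - (dx ^^ j) m 0 0"
      using pd_power_diff[OF S _ _ j0, where F = "\<lambda>p. u (p jX) (p jT)" and H = "\<lambda>p. m (p jX) (p jT)" and y = jX and k = j] h(3,4)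
      by (simp add: S_def pd_power_lift)
     also have "(dx ^^ j) m 0 0 = (deriv ^^ j) (pol c (Suc N)) 0"
      using eventually_nhds_x_imp_x[OF deriv_power_germ[where u = m and t = 0 and f = "pol c (Suc N)" and k = j, OF h(8)]] .
     also have "\<dots> = c j" using deriv_pol[of j "Suc N" c] less.prems 3 by (simp add: pol_0)
     finally show ?thesis using less.IH[of j] less.prems 3 by (simp add: c_def)
    qed (use h in simp_all)
   qed
   show thesis
   proof (rule that[of D u])
    show "\<forall>k\<le>N. (dx ^^ k) u 0 0 = p (jZ k)" using zk by blast
    show "dt u 0 0 = p (jW 0)" "dt (dx u) 0 0 = p (jV 0)" using h(11,12) unfolding c0 \<alpha>_def \<beta>_def by (simp_all add: field_simps)
   qed (use h in auto)
  qed
 qed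
qed

section \<open>The structure equations on jets\<close>

lemma jet_of_simps [simp]: "jet_of u x t jX = x" "jet_of u x t jT = t" "jet_of u x t (jZ k) = (dx ^^ k) u x t"
 "jet_of u x t (jW k) = (dt ^^ Suc k) u x t" "jet_of u x t (jV k) = (dt ^^ Suc k) (dx u) x t"
 by (simp_all add: jet_of_def)

lemma dx_DERIV:
 assumes "Ck (Suc 0) {p. (p jX, p jT) \<in> D} (\<lambda>p. v (p jX) (p jT))" "(x, t) \<in> D"
 shows "((\<lambda>s. v s t) has_field_derivative dx v x t) (at x)" "((\<lambda>s. v x s) has_field_derivative dt v x t) (at t)"
 using Ck_DERIV[OF assms(1), of "jxt (x, t)" jX] Ck_DERIV[OF assms(1), of "jxt (x, t)" jT] assms(2)
 by (simp_all add: dx_jxt[symmetric] jxt_upd)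

lemma lift_dx_Ck:
 assumes "\<forall>k. Ck k {p. (p jX, p jT) \<in> D} (\<lambda>p. u (p jX) (p jT))"
 shows "Ck m {p. (p jX, p jT) \<in> D} (\<lambda>p. (dx ^^ k) u (p jX) (p jT))"
  "Ck m {p. (p jX, p jT) \<in> D} (\<lambda>p. dt u (p jX) (p jT))"
 using Ck_power_pd[of m k _ "\<lambda>p. u (p jX) (p jT)" jX] Ck_Suc_pd[of m _ "\<lambda>p. u (p jX) (p jT)" jT] assms
 unfolding pd_power_lift pd_lift by blast+

lemma dt_dx_power_commute:
 assumes "open D" "\<forall>k. Ck k {p. (p jX, p jT) \<in> D} (\<lambda>p. u (p jX) (p jT))" "(x, t) \<in> D"
 shows "dt ((dx ^^ k) u) x t = (dx ^^ k) (dt u) x t"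
proof -
 define S where "S = {p :: jet. (p jX, p jT) \<in> D}"
 have S: "open S" unfolding S_def by (rule open_lift[OF assms(1)])
 define F where "F = (\<lambda>p::jet. u (p jX) (p jT))"
 have F: "Ck k S F" for k using assms(2) by (simp add: S_def F_def)
 have "pd jT ((pd jX ^^ k) F) p = (pd jX ^^ k) (pd jT F) p" if "p \<in> S" for p
  using that
 proof (induction k arbitrary: p)
  case (Suc k)
  have "pd jT (pd jX ((pd jX ^^ k) F)) p = pd jX (pd jT ((pd jX ^^ k) F)) p"
   by (rule pd_commute[OF S Ck_power_pd[OF F] Suc.prems])
  also have "\<dots> = pd jX ((pd jX ^^ k) (pd jT F)) p"
   by (rule pd_cong[OF S Suc.prems Suc.IH])
  finally show ?case by simp
 qed simp
 from this[of "jxt (x, t)"] show ?thesis using assms(3)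
  unfolding F_def pd_power_lift pd_lift by (simp add: S_def)
qed

lemma nat_two_cases:
 fixes k :: nat
 obtains "k = 0" | "k = 1" | j where "k = Suc (Suc j)"
proof (cases k)
 case (Suc n)
 then show ?thesis using that by (cases n) auto
qed

lemma sum_jZ: "(\<Sum>y\<in>jZ ` {..l}. f y) = (\<Sum>k\<le>l. f (jZ k))"
 by (subst sum.reindex) (auto simp: inj_on_def)

lemma jet_chain:
 assumes D: "open D" "\<forall>k. Ck k {p. (p jX, p jT) \<in> D} (\<lambda>p. u (p jX) (p jT))"
  and S: "open S" "\<And>x t. (x, t) \<in> D ==> jet_of u x t \<in> S"
  and F: "Ck 1 S F" "depends_on (jZ ` {..l}) S F" and xt: "(x, t) \<in> D"
 shows "dx (\<lambda>x t. F (jet_of u x t)) x t = (\<Sum>k\<le>l. pd (jZ k) F (jet_of u x t) * (dx ^^ Suc k) u x t)"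
  "dt (\<lambda>x t. F (jet_of u x t)) x t = (\<Sum>k\<le>l. pd (jZ k) F (jet_of u x t) * dt ((dx ^^ k) u) x t)"
proof -
 have d: "((\<lambda>s. (dx ^^ k) u s t) has_field_derivative (dx ^^ Suc k) u x t) (at x)"
  "((\<lambda>s. (dx ^^ k) u x s) has_field_derivative dt ((dx ^^ k) u) x t) (at t)" for k
  using dx_DERIV[OF lift_dx_Ck(1)[OF D(2)] xt, of k] by simp_all
 have "open {s. (s, t) \<in> D}" "open {s. (x, s) \<in> D}"
  using open_vimage[OF D(1), of "\<lambda>s. (s, t)"] open_vimage[OF D(1), of "\<lambda>s. (x, s)"]
   continuous_on_Pair[OF continuous_on_id continuous_on_const, of UNIV t] continuous_on_Pair[OF continuous_on_const continuous_on_id, of UNIV x]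
  by (simp_all add: vimage_def)
 then have ev: "\<forall>\<^sub>F s in nhds x. jet_of u s t \<in> S" "\<forall>\<^sub>F s in nhds t. jet_of u x s \<in> S"
  using S(2) xt by (auto simp: eventually_nhds)
 have "((\<lambda>s. F (jet_of u s t)) has_field_derivative (\<Sum>y\<in>jZ ` {..l}. pd y F (jet_of u x t) * (case y of jZ k \<Rightarrow> (dx ^^ Suc k) u x t | _ \<Rightarrow> 0))) (at x)"
  by (rule chain_rule[OF S(1) F(1) _ F(2) ev(1)]) (use d in auto)
 then show "dx (\<lambda>x t. F (jet_of u x t)) x t = (\<Sum>k\<le>l. pd (jZ k) F (jet_of u x t) * (dx ^^ Suc k) u x t)"
  unfolding dx_def[of "\<lambda>x t. F (jet_of u x t)"] sum_jZ by (simp add: DERIV_imp_deriv)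
 have "((\<lambda>s. F (jet_of u x s)) has_field_derivative (\<Sum>y\<in>jZ ` {..l}. pd y F (jet_of u x t) * (case y of jZ k \<Rightarrow> dt ((dx ^^ k) u) x t | _ \<Rightarrow> 0))) (at t)"
  by (rule chain_rule[OF S(1) F(1) _ F(2) ev(2)]) (use d in auto)
 then show "dt (\<lambda>x t. F (jet_of u x t)) x t = (\<Sum>k\<le>l. pd (jZ k) F (jet_of u x t) * dt ((dx ^^ k) u) x t)"
  unfolding dt_def[of "\<lambda>x t. F (jet_of u x t)"] sum_jZ by (simp add: DERIV_imp_deriv)
qed

section \<open>Formal total derivatives on the equation\<close>

locale equation_jets =
 fixes U :: "(real \<times> real \<times> real) set" and lam :: real and G :: "real \<Rightarrow> real \<Rightarrow> real \<Rightarrow> real"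
 fixes S defines "S \<equiv> jets_over U"
 assumes U: "open U" and G: "\<And>k. Ck k S (\<lambda>p. G (p (jZ 0)) (p (jZ 1)) (p (jZ 2)))"
begin

lemma S_open: "open S"
 unfolding S_def by (rule open_jets_over[OF U])

lemma S_upd: "p \<in> S ==> y \<notin> {jZ 0, jZ 1, jZ 2} ==> p(y := s) \<in> S"
 by (auto simp: S_def jets_over_def)

lemma rhs_smooth: "Ck k S (rhs lam G)"
proof -
 have "Ck k S (\<lambda>p. lam * p (jZ 0) * p (jZ 3) + G (p (jZ 0)) (p (jZ 1)) (p (jZ 2)))"
  by (intro Ck_add Ck_mult Ck_const Ck_proj G S_open)
 then show ?thesis unfolding rhs_def[abs_def] .
qed

lemma rhs_depends: "depends_on (jZ ` {..3}) S (rhs lam G)"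
 by (auto simp: depends_on_def rhs_def)

lemma Dx_z_sum:
 assumes "depends_on (jZ ` {..l}) S F" "p \<in> S"
 shows "Dx_z F p = (\<Sum>k\<le>l. p (jZ (Suc k)) * pd (jZ k) F p)"
 unfolding Dx_z_def derivation_eq_sum[OF S_open assms(1) _ assms(2), simplified] sum_jZ by simp

lemma Dx_z_smooth:
 assumes "depends_on (jZ ` {..l}) S F" "\<And>k. Ck k S F"
 shows "Ck k S (Dx_z F)"
proof -
 have "Ck k S (\<lambda>p. \<Sum>k\<le>l. p (jZ (Suc k)) * pd (jZ k) F p)"
  by (intro Ck_sum Ck_mult Ck_proj S_open Ck_Suc_pd[OF assms(2)])
 then show ?thesis by (rule Ck_cong[OF S_open, rotated]) (simp add: Dx_z_sum[OF assms(1)])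
qed

lemma Dx_z_depends:
 assumes "depends_on (jZ ` {..l}) S F"
 shows "depends_on (jZ ` {..Suc l}) S (Dx_z F)"
 unfolding depends_on_def
proof (intro ballI impI)
 fix p q assume pq: "p \<in> S" "q \<in> S" "\<forall>y\<in>jZ ` {..Suc l}. p y = q y"
 have "pd (jZ k) F p = pd (jZ k) F q" for k
  by (rule depends_onD[OF depends_on_pd[OF S_open assms] pq(1,2)]) (use pq(3) in auto)
 then show "Dx_z F p = Dx_z F q" using pq by (simp add: Dx_z_sum[OF assms])
qed

lemma rhs_x: "Ck k S ((Dx_z ^^ i) (rhs lam G)) \<and> depends_on (jZ ` {..i + 3}) S ((Dx_z ^^ i) (rhs lam G))"
proof (induction i arbitrary: k)
 case (Suc i)
 then show ?case using Dx_z_smooth[of "i + 3" "(Dx_z ^^ i) (rhs lam G)"] Dx_z_depends[of "i + 3" "(Dx_z ^^ i) (rhs lam G)"] by simp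
qed (simp add: rhs_smooth rhs_depends)

text \<open>Only the term \<open>lam u u_xxx\<close> produces the highest derivative, and each total
  differentiation raises its index while keeping the coefficient \<open>lam u\<close>.\<close>

lemma rhs_x_top:
 assumes "p \<in> S"
 shows "(Dx_z ^^ i) (rhs lam G) (p(jZ (i + 3) := s)) = (Dx_z ^^ i) (rhs lam G) p + lam * p (jZ 0) * (s - p (jZ (i + 3)))"
 using assms
proof (induction i arbitrary: p s)
 case 0
 show ?case by (simp add: rhs_def algebra_simps)
next
 case (Suc i)
 let ?F = "(Dx_z ^^ i) (rhs lam G)"
 have dep: "depends_on (jZ ` {..i + 3}) S ?F" using rhs_x by blast
 let ?q = "p(jZ (Suc i + 3) := s)"
 have q: "?q \<in> S" using S_upd[OF Suc.prems] by simp
 have pdq: "pd (jZ k) ?F ?q = pd (jZ k) ?F p" for k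
  by (rule depends_onD[OF depends_on_pd[OF S_open dep] q Suc.prems]) auto
 have top: "pd (jZ (i + 3)) ?F p = lam * p (jZ 0)"
 proof (rule pd_eqI)
  have "((\<lambda>s. ?F p + lam * p (jZ 0) * (s - p (jZ (i + 3)))) has_field_derivative lam * p (jZ 0)) (at (p (jZ (i + 3))))"
   by (auto intro!: derivative_eq_intros)
  then show "((\<lambda>s. ?F (p(jZ (i + 3) := s))) has_real_derivative lam * p (jZ 0)) (at (p (jZ (i + 3))))"
   unfolding Suc.IH[OF Suc.prems] .
 qed
 have "?q (jZ (Suc k)) * pd (jZ k) ?F p = p (jZ (Suc k)) * pd (jZ k) ?F p" if "k \<in> {..<i + 3}" for k
  using that by simp
 then have sm: "(\<Sum>k<i + 3. ?q (jZ (Suc k)) * pd (jZ k) ?F p) = (\<Sum>k<i + 3. p (jZ (Suc k)) * pd (jZ k) ?F p)"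
  by (rule sum.cong[OF refl])
 have s: "(\<Sum>k\<le>i + 3. f k) = (\<Sum>k<i + 3. f k) + f (i + 3)" for f :: "nat \<Rightarrow> real"
  unfolding lessThan_Suc_atMost[symmetric] sum.lessThan_Suc ..
 have "?q (jZ (Suc (i + 3))) = s" by simp
 then have "Dx_z ?F ?q = Dx_z ?F p + (s - p (jZ (Suc (i + 3)))) * pd (jZ (i + 3)) ?F p"
  unfolding Dx_z_sum[OF dep q] Dx_z_sum[OF dep Suc.prems] pdq s sm by (simp only: left_diff_distrib)
 then show ?case unfolding top by (simp only: funpow.simps o_apply add_Suc mult.commute)
qed

lemma z_t_depends: "depends_on ({jW 0, jV 0} \<union> jZ ` {..Suc k}) S (z_t lam G k)"
proof (induction k rule: less_induct)
 case (less k)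
 consider "k = 0" | "k = 1" | j where "k = Suc (Suc j)" by (rule nat_two_cases)
 then show ?case
 proof cases
  case (3 j)
  have 1: "depends_on ({jW 0, jV 0} \<union> jZ ` {..Suc k}) S (z_t lam G j)"
   by (rule depends_on_mono[OF less.IH[of j]]) (use 3 in auto)
  have 2: "depends_on ({jW 0, jV 0} \<union> jZ ` {..Suc k}) S ((Dx_z ^^ j) (rhs lam G))"
   by (rule depends_on_mono[OF conjunct2[OF rhs_x]]) (use 3 in auto)
  show ?thesis unfolding depends_on_def
  proof (intro ballI impI)
   fix p q assume pq: "p \<in> S" "q \<in> S" "\<forall>y\<in>{jW 0, jV 0} \<union> jZ ` {..Suc k}. p y = q y"
   show "z_t lam G k p = z_t lam G k q"
    unfolding 3 z_t.simps
    by (rule arg_cong2[of _ _ _ _ "(-)"]) (rule depends_onD[OF 1 pq(1,2)] depends_onD[OF 2 pq(1,2)], use pq(3) in blast)+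
  qed
 qed (auto simp: depends_on_def)
qed

text \<open>Elimination of \<open>u_xxt\<close> expresses the t-derivative of \<open>z_(k+2)\<close>
  by that of \<open>z_k\<close> and terms in the \<open>z_i\<close>. Hence \<open>u_t\<close> enters
  with coefficient 1 at even indices and \<open>u_xt\<close> at odd ones.\<close>

lemma z_t_W:
 assumes "p \<in> S" and y: "y = (if w then jW 0 else jV 0)"
 shows "z_t lam G k (p(y := s)) = z_t lam G k p + (if even k = w then s - p y else 0)"
proof (induction k rule: less_induct)
 case (less k)
 show ?case
 proof (cases k rule: nat_two_cases)
  case (3 j)
  have e: "(Dx_z ^^ j) (rhs lam G) (p(y := s)) = (Dx_z ^^ j) (rhs lam G) p"
   by (rule depends_onD[OF conjunct2[OF rhs_x] S_upd[OF assms(1)] assms(1)]) (use y in auto)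
  have j: "j < k" using 3 by simp
  show ?thesis unfolding 3 z_t.simps e less.IH[OF j] by simp
 qed (use y in auto)
qed

lemma z_t_top:
 assumes "p \<in> S" "k \<ge> 2"
 shows "z_t lam G k (p(jZ (Suc k) := s)) = z_t lam G k p - lam * p (jZ 0) * (s - p (jZ (Suc k)))"
proof -
 obtain j where k: "k = Suc (Suc j)" using assms(2) by (metis add_2_eq_Suc le_Suc_ex)
 have "z_t lam G j (p(jZ (Suc k) := s)) = z_t lam G j p"
  by (rule depends_onD[OF z_t_depends S_upd[OF assms(1)] assms(1)]) (use k in auto)
 moreover have e: "Suc (Suc (Suc j)) = j + 3" by simp
 ultimately show ?thesis unfolding k z_t.simps e rhs_x_top[OF assms(1)] by simp
qed

lemma z_t_low: "p \<in> S ==> y \<notin> {jW 0, jV 0} \<union> jZ ` {..Suc k} ==> p(y := s) \<in> S ==> z_t lam G k (p(y := s)) = z_t lam G k p"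
 by (rule depends_onD[OF z_t_depends]) auto

lemma rhs_x_jet:
 assumes D: "open D" "\<forall>k. Ck k {p. (p jX, p jT) \<in> D} (\<lambda>p. u (p jX) (p jT))"
  and S: "\<And>x t. (x, t) \<in> D ==> jet_of u x t \<in> S" and xt: "(x, t) \<in> D"
 shows "(dx ^^ i) (\<lambda>x t. rhs lam G (jet_of u x t)) x t = (Dx_z ^^ i) (rhs lam G) (jet_of u x t)"
 using xt
proof (induction i arbitrary: x t)
 case (Suc i)
 let ?F = "(Dx_z ^^ i) (rhs lam G)"
 have F: "Ck 1 S ?F" "depends_on (jZ ` {..i + 3}) S ?F" using rhs_x by blast+
 have "dx ((dx ^^ i) (\<lambda>x t. rhs lam G (jet_of u x t))) x t = dx (\<lambda>x t. ?F (jet_of u x t)) x t"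
  unfolding dx_jxt(1)[of "(dx ^^ i) (\<lambda>x t. rhs lam G (jet_of u x t))"] dx_jxt(1)[of "\<lambda>x t. ?F (jet_of u x t)"]
  by (rule pd_cong[OF open_lift[OF D(1)]]) (use Suc in auto)
 also have "\<dots> = (\<Sum>k\<le>i + 3. pd (jZ k) ?F (jet_of u x t) * (dx ^^ Suc k) u x t)"
  by (rule jet_chain(1)[OF D S_open S F Suc.prems])
 also have "\<dots> = Dx_z ?F (jet_of u x t)"
  unfolding Dx_z_sum[OF F(2) S[OF Suc.prems]] by (simp add: mult.commute)
 finally show ?case by simp
qed simp

lemma rhs_jet_lift_Ck:
 assumes D: "open D" "\<forall>k. Ck k {p. (p jX, p jT) \<in> D} (\<lambda>p. u (p jX) (p jT))"
  and S: "\<And>x t. (x, t) \<in> D ==> jet_of u x t \<in> S"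
 shows "Ck k {p. (p jX, p jT) \<in> D} (\<lambda>p. rhs lam G (jet_of u (p jX) (p jT)))"
proof -
 define \<sigma> where "\<sigma> p y = (case y of jZ k \<Rightarrow> (dx ^^ k) u (p jX) (p jT) | _ \<Rightarrow> 0)" for p y
 have "\<sigma> p \<in> S" if "p \<in> {p. (p jX, p jT) \<in> D}" for p
  using S[of "p jX" "p jT"] that by (simp add: S_def jets_over_def \<sigma>_def)
 moreover have c: "Ck k {p. (p jX, p jT) \<in> D} (\<lambda>p. \<sigma> p y)" for y k
  using lift_dx_Ck(1)[OF D(2)] open_lift[OF D(1)] by (cases y) (auto simp: \<sigma>_def)
 moreover have "continuous_on {p. (p jX, p jT) \<in> D} \<sigma>"
  by (rule continuous_on_jetI) (rule Ck_continuous[OF c])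
 ultimately have "Ck k {p. (p jX, p jT) \<in> D} (\<lambda>p. rhs lam G (\<sigma> p))"
  by (intro Ck_compose[OF open_lift[OF D(1)] S_open rhs_smooth _ rhs_depends]) auto
 then show ?thesis by (simp add: rhs_def \<sigma>_def)
qed

text \<open>On a solution, commuting partial derivatives and repeated x-differentiation of (T)
  reproduce the formal elimination step by step.\<close>

lemma z_t_solution:
 assumes D: "open D" "\<forall>k. Ck k {p. (p jX, p jT) \<in> D} (\<lambda>p. u (p jX) (p jT))"
  and S: "\<And>x t. (x, t) \<in> D ==> jet_of u x t \<in> S" and T: "\<And>x t. (x, t) \<in> D ==> equation_T lam G u x t"
  and xt: "(x, t) \<in> D"
 shows "dt ((dx ^^ k) u) x t = z_t lam G k (jet_of u x t)"
 using xt
proof (induction k arbitrary: x t rule: less_induct)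
 case (less k)
 consider "k = 0" | "k = 1" | j where "k = Suc (Suc j)" by (rule nat_two_cases)
 then show ?case
 proof cases
  case (3 j)
  let ?S = "{p :: jet. (p jX, p jT) \<in> D}"
  have uxx: "\<forall>k. Ck k ?S (\<lambda>p. dx (dx u) (p jX) (p jT))"
   using lift_dx_Ck(1)[OF D(2), of _ 2] by (simp add: numeral_2_eq_2)
  have ut: "Ck k ?S (\<lambda>p. dt u (p jX) (p jT))" for k using lift_dx_Ck(2)[OF D(2)] .
  have "(dx ^^ k) u = (dx ^^ j) (dx (dx u))" unfolding 3 by (simp add: funpow_swap1)
  then have "dt ((dx ^^ k) u) x t = (dx ^^ j) (dt (dx (dx u))) x t"
   using dt_dx_power_commute[OF D(1) uxx less.prems] by simp
  also have "\<dots> = (pd jX ^^ j) (\<lambda>p. dt u (p jX) (p jT) - rhs lam G (jet_of u (p jX) (p jT))) (jxt (x, t))"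
   unfolding dx_power_jxt
  proof (rule pd_power_cong[OF open_lift[OF D(1)]])
   show "dt (dx (dx u)) (q jX) (q jT) = dt u (q jX) (q jT) - rhs lam G (jet_of u (q jX) (q jT))" if "q \<in> ?S" for q
    using T[of "q jX" "q jT"] that by (simp add: equation_T_def rhs_def numeral_2_eq_2 numeral_3_eq_3)
  qed (use less.prems in auto)
  also have "\<dots> = (dx ^^ j) (dt u) x t - (dx ^^ j) (\<lambda>x t. rhs lam G (jet_of u x t)) x t"
   unfolding dx_power_jxt
   by (rule pd_power_diff[OF open_lift[OF D(1)] ut rhs_jet_lift_Ck[OF D S]]) (use less.prems in auto)
  also have "\<dots> = dt ((dx ^^ j) u) x t - (Dx_z ^^ j) (rhs lam G) (jet_of u x t)"
   using dt_dx_power_commute[OF D less.prems, of j] rhs_x_jet[OF D S less.prems] by simp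
  finally show ?thesis using less.IH[of j] less.prems 3 by simp
 qed simp_all
qed

end

section \<open>Ordinary differential equations of arbitrary order\<close>

instantiation nat :: metric_space
begin

definition dist_nat :: "nat \<Rightarrow> nat \<Rightarrow> real" where
 "dist_nat m n = \<bar>real m - real n\<bar>"

definition uniformity_nat :: "(nat \<times> nat) filter" where
 "uniformity_nat = (INF e\<in>{0 <..}. principal {(x, y). dist x y < e})"

instance
proof
 show "open A \<longleftrightarrow> (\<forall>x\<in>A. \<forall>\<^sub>F (x', y) in uniformity. x' = x \<longrightarrow> y \<in> A)" for A :: "nat set"
 proof -
  have "\<forall>\<^sub>F (x', y) in uniformity. x' = x \<longrightarrow> y \<in> A" if "x \<in> A" for x
   unfolding uniformity_nat_def
  proof (subst eventually_INF_base)
   show "\<exists>b\<in>{0<..}. \<forall>\<^sub>F (x', y) in principal {(x :: nat, y). dist x y < b}. x' = x \<longrightarrow> y \<in> A"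
   proof (rule bexI[of _ 1])
    have "y = x" if "\<bar>real x - real y\<bar> < 1" for y using that by linarith
    then show "\<forall>\<^sub>F (x', y) in principal {(x :: nat, y). dist x y < 1}. x' = x \<longrightarrow> y \<in> A"
     using \<open>x \<in> A\<close> by (auto simp: eventually_principal dist_nat_def)
   qed simp
  qed (auto simp: Ball_def intro!: bexI[of _ "min _ _"])
  then show ?thesis by (simp add: open_discrete)
 qed
qed (auto simp: dist_nat_def uniformity_nat_def)

end

text \<open>The order of the differential equation is a variable, so its state cannot live in a
  fixed finite product; bounded functions on the naturals form one Banach space for all orders. The
  metric on \<open>nat\<close> fits this instance and induces the discrete topology, so continuity
  is no restriction.\<close>

instance bcontfun :: (metric_space, banach) banach ..

lemma continuous_on_nat [simp]: "continuous_on A (f :: nat \<Rightarrow> 'b::topological_space)"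
 by (simp add: continuous_on_discrete)

text \<open>Companion system: each \<open>Z k\<close> has derivative \<open>Z (Suc k)\<close>, and
  \<open>\<Theta>\<close> closes the chain at \<open>L\<close>. It is the Goursat problem with
  trivial second component and data independent of \<open>y\<close>; components above
  \<open>L\<close> are kept at zero.\<close>

lemma ode_family:
 fixes \<Theta> :: "jet \<Rightarrow> real" and p :: jet and L :: nat
 assumes T: "open T" "Ck 1 T \<Theta>" "p \<in> T"
 obtains r and Z :: "nat \<Rightarrow> real \<Rightarrow> real" where "r > 0" "\<forall>k\<le>L. Z k 0 = p (jZ k)"
  "\<forall>t. \<bar>t\<bar> < r \<longrightarrow> (\<lambda>y. case y of jZ k \<Rightarrow> if k \<le> L then Z k t else p (jZ k) | _ \<Rightarrow> p y) \<in> T"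
  "\<forall>k<L. \<forall>t. \<bar>t\<bar> < r \<longrightarrow> (Z k has_field_derivative Z (Suc k) t) (at t)"
  "\<forall>t. \<bar>t\<bar> < r \<longrightarrow> (Z L has_field_derivative \<Theta> (\<lambda>y. case y of jZ k \<Rightarrow> if k \<le> L then Z k t else p (jZ k) | _ \<Rightarrow> p y)) (at t)"
proof -
 define zj where "zj w = (\<lambda>y. case y of jZ k \<Rightarrow> if k \<le> L then w k else p (jZ k) | _ \<Rightarrow> p y)" for w :: "nat \<Rightarrow> real"
 define K where "K = jZ ` {..L}"
 have K: "finite K" by (simp add: K_def)
 have bc: "(\<lambda>k. if k \<le> L then g k else 0) \<in> bcontfun" for g :: "nat \<Rightarrow> real"
 proof -
  have "range (\<lambda>k. if k \<le> L then g k else 0) \<subseteq> insert 0 (g ` {..L})" by auto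
  then have "bounded (range (\<lambda>k. if k \<le> L then g k else 0))"
   by (rule bounded_subset[rotated]) (auto intro: finite_imp_bounded)
  then show ?thesis by (simp add: bcontfun_def)
 qed
 show ?thesis
 proof (rule local_lipschitz[OF T(1,2) K T(3)])
  fix \<epsilon> C assume \<epsilon>: "\<epsilon> > 0" and C: "C \<ge> 0"
   and inT: "\<And>q. (\<And>y. y \<in> K ==> \<bar>q y - p y\<bar> < \<epsilon>) ==> (\<And>y. y \<notin> K ==> q y = p y) ==> q \<in> T"
   and lip: "\<And>q q'. (\<And>y. y \<in> K ==> \<bar>q y - p y\<bar> < \<epsilon> \<and> \<bar>q' y - p y\<bar> < \<epsilon>) ==> (\<And>y. y \<notin> K ==> q y = p y \<and> q' y = p y) ==>
    \<bar>\<Theta> q - \<Theta> q'\<bar> \<le> C * (\<Sum>y\<in>K. \<bar>q y - q' y\<bar>)"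
  define w0 :: "(nat \<Rightarrow>\<^sub>C real) \<times> real" where "w0 = (Bcontfun (\<lambda>k. if k \<le> L then p (jZ k) else 0), 0)"
  have w0: "apply_bcontfun (fst w0) k = (if k \<le> L then p (jZ k) else 0)" for k
   by (simp add: w0_def Bcontfun_inverse[OF bc])
  define F where "F w = Bcontfun (\<lambda>k. if k \<le> L then (if k < L then apply_bcontfun (fst w) (Suc k) else \<Theta> (zj (apply_bcontfun (fst w)))) else 0)"
   for w :: "(nat \<Rightarrow>\<^sub>C real) \<times> real"
  have F: "apply_bcontfun (F w) k = (if k \<le> L then (if k < L then apply_bcontfun (fst w) (Suc k) else \<Theta> (zj (apply_bcontfun (fst w)))) else 0)" for w k
   by (simp add: F_def Bcontfun_inverse[OF bc])
  define \<rho> where "\<rho> = \<epsilon> / 2"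
  have \<rho>: "\<rho> > 0" "\<rho> < \<epsilon>" using \<epsilon> by (auto simp: \<rho>_def)
  have comp: "\<bar>apply_bcontfun (fst w) k - apply_bcontfun (fst w') k\<bar> \<le> norm (w - w')" for w w' :: "(nat \<Rightarrow>\<^sub>C real) \<times> real" and k
  proof -
   have "\<bar>apply_bcontfun (fst w) k - apply_bcontfun (fst w') k\<bar> \<le> dist (fst w) (fst w')"
    using dist_bounded[of "fst w" k "fst w'"] by (simp add: dist_real_def)
   also have "\<dots> \<le> norm (w - w')" using norm_prod_le(1)[of "w - w'"] by (simp add: dist_norm)
   finally show ?thesis .
  qed
  have zjK: "\<bar>zj (apply_bcontfun (fst w)) y - p y\<bar> < \<epsilon>" if h: "w \<in> cball w0 \<rho>" "y \<in> K" for w y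
  proof -
   obtain k where k: "y = jZ k" "k \<le> L" using h(2) by (auto simp: K_def)
   have "norm (w - w0) \<le> \<rho>" using h(1) by (simp add: dist_norm norm_minus_commute)
   then show ?thesis using comp[of w k w0] k \<rho> w0[of k] by (simp add: zj_def)
  qed
  have zjN: "zj w y = p y" if "y \<notin> K" for w y using that by (auto simp: zj_def K_def split: jvar.splits)
  have zjT: "zj (apply_bcontfun (fst w)) \<in> T" if "w \<in> cball w0 \<rho>" for w
   using inT[OF zjK[OF that] zjN] by blast
  \<comment> \<open>The shift of components costs 1; the last component costs \<open>C\<close> for
    each of the \<open>L + 1\<close> coordinates that move.\<close>
  define L' where "L' = 1 + C * (real L + 1)"
  have L': "L' \<ge> 1" using C by (simp add: L'_def)
  have L1: "norm (F w - F w') \<le> L' * norm (w - w')" if "w \<in> cball w0 \<rho>" "w' \<in> cball w0 \<rho>" for w w'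
  proof -
   have "dist (F w) (F w') \<le> L' * norm (w - w')"
   proof (rule dist_bound)
    fix k
    have a: "norm (w - w') \<le> L' * norm (w - w')" using L' mult_right_mono[OF L', of "norm (w - w')"] by simp
    have "\<bar>\<Theta> (zj (apply_bcontfun (fst w))) - \<Theta> (zj (apply_bcontfun (fst w')))\<bar>
      \<le> C * (\<Sum>y\<in>K. \<bar>zj (apply_bcontfun (fst w)) y - zj (apply_bcontfun (fst w')) y\<bar>)"
     by (rule lip) (use zjK[OF that(1)] zjK[OF that(2)] zjN in auto)
    also have "\<dots> \<le> C * (of_nat (card K) * norm (w - w'))"
    proof (intro mult_left_mono C sum_bounded_above)
     fix y assume "y \<in> K"
     then show "\<bar>zj (apply_bcontfun (fst w)) y - zj (apply_bcontfun (fst w')) y\<bar> \<le> norm (w - w')"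
      using comp[of w _ w'] by (auto simp: K_def zj_def)
    qed
    also have "card K = L + 1" unfolding K_def by (subst card_image) (auto simp: inj_on_def)
    also have "C * (of_nat (L + 1) * norm (w - w')) \<le> L' * norm (w - w')"
     by (simp add: L'_def algebra_simps)
    finally have b: "\<bar>\<Theta> (zj (apply_bcontfun (fst w))) - \<Theta> (zj (apply_bcontfun (fst w')))\<bar> \<le> L' * norm (w - w')" .
    show "dist (apply_bcontfun (F w) k) (apply_bcontfun (F w') k) \<le> L' * norm (w - w')"
     using a b comp[of w "Suc k" w'] order_trans[OF norm_ge_zero a] by (auto simp: F dist_real_def)
   qed
   then show ?thesis by (simp add: dist_norm)
  qed
  have L2: "norm ((\<lambda>_. 0 :: real) w - (\<lambda>_. 0) w') \<le> L' * norm (w - w')" if "w \<in> cball w0 \<rho>" "w' \<in> cball w0 \<rho>" for w w' :: "(nat \<Rightarrow>\<^sub>C real) \<times> real"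
   using L' by simp
  have L'0: "L' \<ge> 0" using L' by simp
  have sw: "0 = snd w0" by (simp add: w0_def)
  show thesis
  proof (rule goursat[where ?F1.0 = F and ?F2.0 = "\<lambda>_. 0" and ?a0.0 = "\<lambda>_. fst w0" and ?b0.0 = "\<lambda>_. 0",
     OF \<rho>(1) L'0 L1 L2 continuous_on_const refl continuous_on_const sw])
   fix r and w :: "real \<times> real \<Rightarrow> (nat \<Rightarrow>\<^sub>C real) \<times> real"
   assume r: "r > 0" and wc: "continuous_on UNIV w" and wb: "\<forall>q. w q \<in> cball w0 \<rho>"
    and w1: "\<forall>y t. \<bar>y\<bar> \<le> r \<and> \<bar>t\<bar> \<le> r \<longrightarrow> fst (w (y, t)) = fst w0 + t *\<^sub>R integral {0..1} (\<lambda>\<theta>. F (w (y, \<theta> * t)))"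
   define Z where "Z k t = apply_bcontfun (fst (w (0, t))) k" for k t
   have cF: "continuous_on (cball w0 \<rho>) F"
    by (rule lipschitz_on_continuous_on[where L = L']) (use L1 L'0 in \<open>auto simp: lipschitz_on_def dist_norm\<close>)
   have c: "continuous_on {-r..r} (\<lambda>s. F (w (0, s)))"
    by (rule continuous_on_compose2[OF cF], rule continuous_on_compose2[OF wc]) (use wb in \<open>auto intro!: continuous_intros\<close>)
   have d: "((\<lambda>s. fst (w (0, s))) has_vector_derivative F (w (0, t))) (at t)" if "\<bar>t\<bar> < r" for t
   proof -
    have "((\<lambda>s. s *\<^sub>R integral {0..1} (\<lambda>\<theta>. F (w (0, \<theta> * s)))) has_vector_derivative F (w (0, t))) (at t within {-r..r})"
     by (rule scaled_integral_vector_derivative[OF c]) (use that in auto)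
    from has_vector_derivative_add[OF has_vector_derivative_const this, of "fst w0"]
    have "((\<lambda>s. fst (w (0, s))) has_vector_derivative F (w (0, t))) (at t within {-r..r})"
     unfolding add_0 by (rule has_vector_derivative_transform[rotated 2]) (use that w1 r in auto)
    then show ?thesis using that by (simp add: at_within_Icc_at)
   qed
   have nb: "\<bar>apply_bcontfun g k\<bar> \<le> norm g" for g :: "nat \<Rightarrow>\<^sub>C real" and k using norm_bounded[of g k] by simp
   have ev: "bounded_linear (\<lambda>g :: nat \<Rightarrow>\<^sub>C real. apply_bcontfun g k)" for k
    by (rule bounded_linear_intro[where K = 1]) (use nb in auto)
   have dZ: "(Z k has_field_derivative apply_bcontfun (F (w (0, t))) k) (at t)" if "\<bar>t\<bar> < r" for k t
    using bounded_linear.has_vector_derivative[OF ev d[OF that], of k]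
    by (simp add: Z_def[abs_def] has_real_derivative_iff_has_vector_derivative)
   have zZ: "zj (apply_bcontfun (fst (w (0, t)))) = (\<lambda>y. case y of jZ k \<Rightarrow> if k \<le> L then Z k t else p (jZ k) | _ \<Rightarrow> p y)" for t
    by (auto simp: zj_def Z_def fun_eq_iff split: jvar.splits)
   show thesis
   proof (rule that[OF r, of Z])
    show "\<forall>k\<le>L. Z k 0 = p (jZ k)" using w1 r w0 by (simp add: Z_def)
    show "\<forall>t. \<bar>t\<bar> < r \<longrightarrow> (\<lambda>y. case y of jZ k \<Rightarrow> if k \<le> L then Z k t else p (jZ k) | _ \<Rightarrow> p y) \<in> T"
     using zjT wb unfolding zZ[symmetric] by blast
    show "\<forall>k<L. \<forall>t. \<bar>t\<bar> < r \<longrightarrow> (Z k has_field_derivative Z (Suc k) t) (at t)"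
    proof (intro allI impI)
     fix k t assume k: "k < L" "\<bar>t\<bar> < r"
     have "apply_bcontfun (F (w (0, t))) k = Z (Suc k) t" using k(1) by (simp add: F Z_def)
     then show "(Z k has_field_derivative Z (Suc k) t) (at t)" using dZ[OF k(2), of k] by simp
    qed
    show "\<forall>t. \<bar>t\<bar> < r \<longrightarrow> (Z L has_field_derivative \<Theta> (\<lambda>y. case y of jZ k \<Rightarrow> if k \<le> L then Z k t else p (jZ k) | _ \<Rightarrow> p y)) (at t)"
    proof (intro allI impI)
     fix t assume t: "\<bar>t\<bar> < r"
     have "apply_bcontfun (F (w (0, t))) L = \<Theta> (\<lambda>y. case y of jZ k \<Rightarrow> if k \<le> L then Z k t else p (jZ k) | _ \<Rightarrow> p y)"
      by (simp add: F zZ)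
     then show "(Z L has_field_derivative \<Theta> (\<lambda>y. case y of jZ k \<Rightarrow> if k \<le> L then Z k t else p (jZ k) | _ \<Rightarrow> p y)) (at t)"
      using dZ[OF t, of L] by simp
    qed
   qed
  qed
 qed
qed

section \<open>The structure equations as identities on jets\<close>

locale pss_jets = equation_jets +
 fixes f :: "nat \<Rightarrow> nat \<Rightarrow> jet \<Rightarrow> real" and \<mu> \<eta> :: "nat \<Rightarrow> real"
 assumes convex: "convex U"
  and f_smooth: "\<And>i j k. i \<in> {1, 2, 3} ==> j \<in> {1, 2} ==> Ck k S (f i j)"
  and f_depends: "\<exists>l. \<forall>i\<in>{1, 2, 3}. \<forall>j\<in>{1, 2}. depends_on (jZ ` {..l}) S (f i j)"
  and C: "\<And>i p. i \<in> {1, 2, 3} ==> p \<in> S ==> f i 1 p = \<mu> i * f 1 1 p + \<eta> i"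
  and \<mu>1: "\<mu> 1 = 1" "\<eta> 1 = 0"
  and Delta12: "\<And>p. p \<in> S ==> Delta f 1 2 p \<noteq> 0"
  and pss: "\<And>D u. open D ==> \<forall>k. Ck k {p. (p jX, p jT) \<in> D} (\<lambda>p. u (p jX) (p jT)) ==>
   (\<And>x t. (x, t) \<in> D ==> (u x t, dx u x t, dx (dx u) x t) \<in> U) ==>
   (\<forall>(x, t)\<in>D. structure_eqs f u x t) \<longleftrightarrow> (\<forall>(x, t)\<in>D. equation_T lam G u x t)"
begin

text \<open>Right-hand sides of the structure equations, indexed so that the three equations can be
  treated uniformly.\<close>

definition R :: "nat \<Rightarrow> jet \<Rightarrow> real" where
 "R i = (if i = 1 then Delta f 3 2 else if i = 2 then Delta f 1 3 else Delta f 1 2)"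

lemma structure_eqs_R: "structure_eqs f u x t \<longleftrightarrow> (\<forall>i\<in>{1, 2, 3}. d_omega f i u x t = R i (jet_of u x t))"
 by (simp add: structure_eqs_def R_def)

definition dep_order :: "nat \<Rightarrow> bool" where
 "dep_order l \<longleftrightarrow> (\<forall>i\<in>{1, 2, 3}. \<forall>j\<in>{1, 2}. depends_on (jZ ` {..l}) S (f i j))"

lemma jet_of_S: "(u x t, dx u x t, dx (dx u) x t) \<in> U ==> jet_of u x t \<in> S"
 by (simp add: S_def jets_over_def numeral_2_eq_2)

lemma f1_pd: "i \<in> {1, 2, 3} ==> p \<in> S ==> pd y (f i 1) p = \<mu> i * pd y (f 1 1) p"
proof -
 assume i: "i \<in> {1, 2, 3}" and p: "p \<in> S"
 have "pd y (f i 1) p = pd y (\<lambda>p. \<mu> i * f 1 1 p + \<eta> i) p"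
  by (rule pd_cong[OF S_open p C[OF i]])
 also have "\<dots> = \<mu> i * pd y (f 1 1) p"
  using DERIV_add[OF DERIV_cmult[OF Ck_DERIV[OF f_smooth p]] DERIV_const] by (intro pd_eqI) auto
 finally show ?thesis .
qed

lemma d_omega_jets:
 assumes D: "open D" "\<forall>k. Ck k {p. (p jX, p jT) \<in> D} (\<lambda>p. u (p jX) (p jT))"
  and uU: "\<And>x t. (x, t) \<in> D ==> (u x t, dx u x t, dx (dx u) x t) \<in> U" and xt: "(x, t) \<in> D"
  and l: "dep_order l" and i: "i \<in> {1, 2, 3}"
 shows "d_omega f i u x t = (\<Sum>k\<le>l. pd (jZ k) (f i 2) (jet_of u x t) * (dx ^^ Suc k) u x t)
   - (\<Sum>k\<le>l. pd (jZ k) (f i 1) (jet_of u x t) * dt ((dx ^^ k) u) x t)"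
proof -
 have j: "1 \<in> {1, 2 :: nat}" "2 \<in> {1, 2 :: nat}" by auto
 have d: "depends_on (jZ ` {..l}) S (f i 1)" "depends_on (jZ ` {..l}) S (f i 2)" using l i j unfolding dep_order_def by blast+
 have "dx (\<lambda>x t. f i 2 (jet_of u x t)) x t = (\<Sum>k\<le>l. pd (jZ k) (f i 2) (jet_of u x t) * (dx ^^ Suc k) u x t)"
  by (rule jet_chain(1)[OF D S_open jet_of_S[OF uU] f_smooth[OF i j(2)] d(2) xt])
 moreover have "dt (\<lambda>x t. f i 1 (jet_of u x t)) x t = (\<Sum>k\<le>l. pd (jZ k) (f i 1) (jet_of u x t) * dt ((dx ^^ k) u) x t)"
  by (rule jet_chain(2)[OF D S_open jet_of_S[OF uU] f_smooth[OF i j(1)] d(1) xt])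
 ultimately show ?thesis unfolding d_omega_def by simp
qed

lemma R_depends:
 assumes "dep_order l" "i \<in> {1, 2, 3}" shows "depends_on (jZ ` {..l}) S (R i)"
 unfolding depends_on_def
proof (intro ballI impI)
 fix p q assume pq: "p \<in> S" "q \<in> S" "\<forall>y\<in>jZ ` {..l}. p y = q y"
 have "f i j p = f i j q" if "i \<in> {1, 2, 3}" "j \<in> {1, 2}" for i j
  using assms(1) that pq unfolding dep_order_def depends_on_def by blast
 then show "R i p = R i q" using assms(2) by (auto simp: R_def Delta_def)
qed

lemma pd_f_depends: "dep_order l ==> i \<in> {1, 2, 3} ==> j \<in> {1, 2} ==> depends_on (jZ ` {..l}) S (pd y (f i j))"
 unfolding dep_order_def using depends_on_pd[OF S_open] by blast

text \<open>A solution passes through the given jet, and for it \<open>pss\<close> yields the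
  structure equations. Both sides involve only finitely many \<open>z_k\<close>, \<open>u_t\<close>
  and \<open>u_xt\<close>, all of which the solution matches at the origin.\<close>

lemma formal_identity:
 assumes p: "p \<in> S" and l: "dep_order l" and i: "i \<in> {1, 2, 3}"
 shows "(\<Sum>k\<le>l. pd (jZ k) (f i 2) p * p (jZ (Suc k))) - (\<Sum>k\<le>l. pd (jZ k) (f i 1) p * z_t lam G k p) = R i p"
proof (rule T_solution_exists[OF U G[unfolded S_def] p[unfolded S_def], of lam "Suc (Suc l)"])
 fix D u
 assume D: "open D" "(0, 0) \<in> D" "\<forall>k. Ck k {p. (p jX, p jT) \<in> D} (\<lambda>p. u (p jX) (p jT))"
  and uU: "\<forall>(x, t)\<in>D. (u x t, dx u x t, dx (dx u) x t) \<in> U" and T: "\<forall>(x, t)\<in>D. equation_T lam G u x t"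
  and z: "\<forall>k\<le>Suc (Suc l). (dx ^^ k) u 0 0 = p (jZ k)" "dt u 0 0 = p (jW 0)" "dt (dx u) 0 0 = p (jV 0)"
 have uU': "(u x t, dx u x t, dx (dx u) x t) \<in> U" if "(x, t) \<in> D" for x t using uU that by auto
 have T': "equation_T lam G u x t" if "(x, t) \<in> D" for x t using T that by auto
 define j where "j = jet_of u 0 0"
 have j: "j \<in> S" unfolding j_def by (rule jet_of_S[OF uU'[OF D(2)]])
 have jz: "j (jZ k) = p (jZ k)" if "k \<le> Suc (Suc l)" for k using z(1) that by (simp add: j_def)
 have "structure_eqs f u 0 0" using pss[OF D(1,3) uU'] T D(2) by auto
 then have "d_omega f i u 0 0 = R i j" unfolding structure_eqs_R j_def using i by blast
 moreover have "R i j = R i p" by (rule depends_onD[OF R_depends[OF l i] j p]) (use jz in auto)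
 moreover have "pd y (f i b) j = pd y (f i b) p" if "b \<in> {1, 2}" for y b
  by (rule depends_onD[OF pd_f_depends[OF l i that] j p]) (use jz in auto)
 moreover have "dt ((dx ^^ k) u) 0 0 = z_t lam G k p" if "k \<le> l" for k
 proof -
  have "dt ((dx ^^ k) u) 0 0 = z_t lam G k j"
   unfolding j_def by (rule z_t_solution[OF D(1,3) jet_of_S[OF uU'] T' D(2)])
  also have "\<dots> = z_t lam G k p"
   by (rule depends_onD[OF z_t_depends j p]) (use jz that z in \<open>auto simp: j_def\<close>)
  finally show ?thesis .
 qed
 ultimately show ?thesis
  using d_omega_jets[OF D(1,3) uU' D(2) l i] z(1) by (simp add: j_def[symmetric] del: funpow.simps)
qed

text \<open>By (C) the gradients of the \<open>f_i1\<close> are proportional. So for any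
  \<open>u\<close>, solution or not, the three structure equations fail by the multiples
  \<open>\<mu> i\<close> of one common quantity; as \<open>\<mu> 1 = 1\<close>, the first equation
  implies the other two.\<close>

lemma structure_residual:
 assumes D: "open D" "\<forall>k. Ck k {p. (p jX, p jT) \<in> D} (\<lambda>p. u (p jX) (p jT))"
  and uU: "\<And>x t. (x, t) \<in> D ==> (u x t, dx u x t, dx (dx u) x t) \<in> U" and xt: "(x, t) \<in> D"
  and l: "dep_order l" and i: "i \<in> {1, 2, 3}"
 shows "d_omega f i u x t - R i (jet_of u x t) =
   - \<mu> i * (\<Sum>k\<le>l. pd (jZ k) (f 1 1) (jet_of u x t) * (dt ((dx ^^ k) u) x t - z_t lam G k (jet_of u x t)))"
proof -
 have j: "jet_of u x t \<in> S" by (rule jet_of_S[OF uU[OF xt]])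
 have "d_omega f i u x t - R i (jet_of u x t) =
   - (\<Sum>k\<le>l. pd (jZ k) (f i 1) (jet_of u x t) * (dt ((dx ^^ k) u) x t - z_t lam G k (jet_of u x t)))"
  using d_omega_jets[OF D uU xt l i] formal_identity[OF j l i]
  by (simp add: right_diff_distrib sum_subtractf del: funpow.simps)
 then show ?thesis unfolding f1_pd[OF i j] by (simp add: sum_distrib_left mult.assoc sum_negf)
qed

text \<open>In the formal identity \<open>u_t\<close> and \<open>u_xt\<close> occur only through the
  t-derivatives of the \<open>z_k\<close>, with coefficient 1 at one parity each. Raising one of
  them by 1 isolates the corresponding sum.\<close>

lemma even_odd_sums:
 assumes p: "p \<in> S" and l: "dep_order l"
 shows "(\<Sum>k\<le>l. if even k = w then pd (jZ k) (f 1 1) p else 0) = 0"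
proof -
 define y where "y = (if w then jW 0 else jV 0)"
 define q where "q = p(y := p y + 1)"
 have q: "q \<in> S" unfolding q_def by (rule S_upd[OF p]) (simp add: y_def)
 have e: "F q = F p" if "depends_on (jZ ` {..l}) S F" for F
  by (rule depends_onD[OF that q p]) (auto simp: q_def y_def)
 have i: "1 \<in> {1, 2, 3 :: nat}" "1 \<in> {1, 2 :: nat}" "2 \<in> {1, 2 :: nat}" by auto
 have z: "q (jZ k) = p (jZ k)" for k by (simp add: q_def y_def)
 have zt: "z_t lam G k q = z_t lam G k p + (if even k = w then 1 else 0)" for k
  unfolding q_def using z_t_W[OF p y_def, of k "p y + 1"] by simp
 have "(\<Sum>k\<le>l. pd (jZ k) (f 1 1) p * z_t lam G k q) = (\<Sum>k\<le>l. pd (jZ k) (f 1 1) p * z_t lam G k p)"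
  using formal_identity[OF p l i(1)] formal_identity[OF q l i(1)]
  unfolding e[OF pd_f_depends[OF l i(1,2)]] e[OF pd_f_depends[OF l i(1,3)]] e[OF R_depends[OF l i(1)]] z by linarith
 then have "(\<Sum>k\<le>l. pd (jZ k) (f 1 1) p * (if even k = w then 1 else 0)) = 0"
  unfolding zt distrib_left sum.distrib by simp
 then show ?thesis by (simp add: if_distrib cong: if_cong)
qed

text \<open>\<open>z_(l+1)\<close> enters the formal identity through the x-derivative of
  \<open>f_i2\<close> and, because \<open>l\<close> is at least 2, through the t-derivative of
  \<open>z_l\<close> with coefficient \<open>- lam u\<close>. Raising it by 1 isolates the two
  contributions.\<close>

lemma top_coefficient:
 assumes p: "p \<in> S" and l: "dep_order l" "l \<ge> 2" and i: "i \<in> {1, 2, 3}"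
 shows "pd (jZ l) (f i 2) p + lam * p (jZ 0) * pd (jZ l) (f i 1) p = 0"
proof -
 define y where "y = jZ (Suc l)"
 define q where "q = p(y := p y + 1)"
 have q: "q \<in> S" unfolding q_def by (rule S_upd[OF p]) (use l in \<open>simp add: y_def\<close>)
 have e: "F q = F p" if "depends_on (jZ ` {..l}) S F" for F
  by (rule depends_onD[OF that q p]) (auto simp: q_def y_def)
 have j: "1 \<in> {1, 2 :: nat}" "2 \<in> {1, 2 :: nat}" by auto
 have s: "(\<Sum>k\<le>l. g k) = (\<Sum>k<l. g k) + g l" for g :: "nat \<Rightarrow> real"
  unfolding lessThan_Suc_atMost[symmetric] sum.lessThan_Suc ..
 have 1: "(\<Sum>k<l. pd (jZ k) (f i 2) p * q (jZ (Suc k))) = (\<Sum>k<l. pd (jZ k) (f i 2) p * p (jZ (Suc k)))"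
  by (rule sum.cong) (auto simp: q_def y_def)
 have 2: "(\<Sum>k<l. pd (jZ k) (f i 1) p * z_t lam G k q) = (\<Sum>k<l. pd (jZ k) (f i 1) p * z_t lam G k p)"
 proof (rule sum.cong)
  fix k assume "k \<in> {..<l}"
  then have "z_t lam G k q = z_t lam G k p" unfolding q_def
   by (intro z_t_low[OF p _ q[unfolded q_def]]) (auto simp: y_def)
  then show "pd (jZ k) (f i 1) p * z_t lam G k q = pd (jZ k) (f i 1) p * z_t lam G k p" by simp
 qed simp
 have 3: "z_t lam G l q = z_t lam G l p - lam * p (jZ 0)"
  using z_t_top[OF p l(2), of "p y + 1"] by (simp add: q_def y_def)
 have 4: "q (jZ (Suc l)) = p (jZ (Suc l)) + 1" by (simp add: q_def y_def)
 show ?thesis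
  using formal_identity[OF p l(1) i] formal_identity[OF q l(1) i]
  unfolding e[OF pd_f_depends[OF l(1) i j(1)]] e[OF pd_f_depends[OF l(1) i j(2)]] e[OF R_depends[OF l(1) i]] s 1 2 3 4
  by (simp add: algebra_simps)
qed

end

section \<open>Reduction of the frame to order two\<close>

context pss_jets
begin

text \<open>If \<open>f\<^sub>1\<^sub>1\<close> had order \<open>L > 2\<close>, the structure equations would reduce for a travelling wave \<open>u = Z(x - ct)\<close> to an
 ordinary differential equation of order \<open>L + 1\<close>, whose initial values can be chosen so that \<open>u\<close> does not solve the equation.\<close>

lemma top_derivative_zero:
 assumes p0: "p0 \<in> S" and l: "dep_order L" "L \<ge> 3"
 shows "pd (jZ L) (f 1 1) p0 = 0"
proof (rule ccontr)
 assume nz: "pd (jZ L) (f 1 1) p0 \<noteq> 0"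
 have i1: "1 \<in> {1, 2, 3 :: nat}" "1 \<in> {1, 2 :: nat}" "2 \<in> {1, 2 :: nat}" by auto
 have pdC: "Ck k S (pd y (f 1 b))" if "b \<in> {1, 2}" for k y b
  by (rule Ck_Suc_pd[OF f_smooth[OF i1(1) that]])
 have pdd: "depends_on (jZ ` {..L}) S (pd y (f 1 b))" if "b \<in> {1, 2}" for y b
  by (rule pd_f_depends[OF l(1) i1(1) that])
 define N where "N = S \<inter> pd (jZ L) (f 1 1) -` (- {0})"
 have cN: "continuous_on S (pd y (f 1 1))" for y by (rule Ck_continuous[OF pdC[OF i1(2)]])
 have "open N" unfolding N_def by (rule continuous_open_preimage[OF cN S_open]) (simp add: open_Compl)
 then have N: "open N" "p0 \<in> N" using nz p0 by (auto simp: N_def)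
 have "open {s. p0(jZ 3 := s) \<in> N}" by (rule open_slice[OF N(1)])
 moreover have "p0 (jZ 3) \<in> {s. p0(jZ 3 := s) \<in> N}" using N(2) by simp
 ultimately obtain e where e: "e > 0" "ball (p0 (jZ 3)) e \<subseteq> {s. p0(jZ 3 := s) \<in> N}" using open_contains_ball by blast
 \<comment> \<open>\<open>z_3\<close> is moved slightly, inside the open set where the top
   derivative is nonzero, so that it differs from \<open>z_1\<close>: otherwise (T) for the
   travelling wave would not involve the speed at the origin.\<close>
 define s3 where "s3 = (if p0 (jZ 1) = p0 (jZ 3) then p0 (jZ 3) + e / 2 else p0 (jZ 3))"
 define p where "p = p0(jZ 3 := s3)"
 have "s3 \<in> ball (p0 (jZ 3)) e" using e(1) by (auto simp: s3_def dist_real_def)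
 then have pN: "p \<in> N" using e(2) unfolding p_def by blast
 have p13: "p (jZ 1) \<noteq> p (jZ 3)" using e by (auto simp: p_def s3_def)
 have p: "p \<in> S" "pd (jZ L) (f 1 1) p \<noteq> 0" using pN by (auto simp: N_def)
 \<comment> \<open>The speed avoids two values: \<open>lam u\<close>, for which the highest
   derivative could not be solved for, and the one for which the wave would satisfy (T) at the
   origin.\<close>
 have "\<exists>c. c \<notin> {lam * p (jZ 0), rhs lam G p / (p (jZ 3) - p (jZ 1))}"
  by (rule ex_new_if_finite) (auto simp: infinite_UNIV_char_0)
 then obtain c where c: "c \<noteq> lam * p (jZ 0)" "c * (p (jZ 3) - p (jZ 1)) \<noteq> rhs lam G p"
  using p13 by (auto simp: field_simps)
 define T where "T = S \<inter> (\<lambda>q. (c - lam * q (jZ 0)) * pd (jZ L) (f 1 1) q) -` (- {0})"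
 have T: "open T" unfolding T_def
  by (intro continuous_open_preimage S_open continuous_on_mult continuous_on_diff continuous_on_const continuous_on_jet_proj cN open_Compl) auto
 have TS: "T \<subseteq> S" and pT: "p \<in> T" using p c by (auto simp: T_def)
 \<comment> \<open>The first structure equation for \<open>u = Z(x - c t)\<close>, solved for the
   derivative of order \<open>L + 1\<close>. By the top-order relation between \<open>f_12\<close>
   and \<open>f_11\<close> its coefficient is \<open>c - lam u\<close> times the top derivative of
   \<open>f_11\<close>.\<close>
 define \<Theta> where "\<Theta> q = (R 1 q - (\<Sum>k<L. (pd (jZ k) (f 1 2) q + c * pd (jZ k) (f 1 1) q) * q (jZ (Suc k)))) / ((c - lam * q (jZ 0)) * pd (jZ L) (f 1 1) q)" for q
 have fC: "Ck k T (f i j)" if "i \<in> {1, 2, 3}" "j \<in> {1, 2}" for k i j by (rule Ck_subset[OF f_smooth[OF that] TS])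
 have R1C: "Ck k T (R 1)" for k
 proof -
  have "Ck k T (\<lambda>q. f 3 1 q * f 2 2 q - f 2 1 q * f 3 2 q)" by (intro Ck_diff Ck_mult T fC) auto
  then show ?thesis by (simp add: R_def Delta_def[abs_def])
 qed
 have \<Theta>C: "Ck k T \<Theta>" for k unfolding \<Theta>_def
  by (intro Ck_divide Ck_diff R1C Ck_sum Ck_mult Ck_add Ck_const Ck_proj T Ck_subset[OF pdC TS]) (auto simp: T_def)
 have \<Theta>d: "depends_on (jZ ` {..L}) T \<Theta>"
  unfolding depends_on_def
 proof (intro ballI impI)
  fix q q' assume q: "q \<in> T" "q' \<in> T" "\<forall>y\<in>jZ ` {..L}. q y = q' y"
  have qS: "q \<in> S" "q' \<in> S" using q TS by auto
  have "R 1 q = R 1 q'" by (rule depends_onD[OF R_depends[OF l(1) i1(1)] qS]) (use q in auto)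
  moreover have "pd y (f 1 b) q = pd y (f 1 b) q'" if "b \<in> {1, 2}" for y b by (rule depends_onD[OF pdd[OF that] qS]) (use q in auto)
  moreover have "q (jZ k) = q' (jZ k)" if "k \<le> L" for k using q that by auto
  ultimately show "\<Theta> q = \<Theta> q'" by (simp add: \<Theta>_def)
 qed
 show False
 proof (rule ode_family[OF T \<Theta>C pT, of L])
  fix r Z assume r: "r > 0" and Z0: "\<forall>k\<le>L. Z k 0 = p (jZ k)"
   and ZT: "\<forall>t. \<bar>t\<bar> < r \<longrightarrow> (\<lambda>y. case y of jZ k \<Rightarrow> if k \<le> L then Z k t else p (jZ k) | _ \<Rightarrow> p y) \<in> T"
   and dZ: "\<forall>k<L. \<forall>t. \<bar>t\<bar> < r \<longrightarrow> (Z k has_field_derivative Z (Suc k) t) (at t)"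
   and dZL: "\<forall>t. \<bar>t\<bar> < r \<longrightarrow> (Z L has_field_derivative \<Theta> (\<lambda>y. case y of jZ k \<Rightarrow> if k \<le> L then Z k t else p (jZ k) | _ \<Rightarrow> p y)) (at t)"
  define zj where "zj t = (\<lambda>y. case y of jZ k \<Rightarrow> if k \<le> L then Z k t else p (jZ k) | _ \<Rightarrow> p y)" for t
  define D where "D = {q :: real \<times> real. \<bar>fst q - c * snd q\<bar> < r}"
  have D: "open D" "(0, 0) \<in> D" unfolding D_def using r by (auto intro!: open_Collect_less continuous_intros)
  define B where "B = {q :: jet. (q jX, q jT) \<in> D}"
  have B: "open B" unfolding B_def by (rule open_lift[OF D(1)])
  define \<xi> where "\<xi> q = q jX - c * q jT" for q :: jet
  have \<xi>: "\<bar>\<xi> q\<bar> < r" if "q \<in> B" for q using that by (simp add: B_def D_def \<xi>_def)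
  have zjT: "zj t \<in> T" if "\<bar>t\<bar> < r" for t using ZT that by (simp add: zj_def)
  define dZj where "dZj t k = (if k < L then Z (Suc k) t else \<Theta> (zj t))" for t k
  have dZj: "((\<lambda>t. zj t (jZ k)) has_field_derivative dZj t k) (at t)" if "\<bar>t\<bar> < r" "k \<le> L" for t k
   using dZ dZL that by (cases "k < L") (auto simp: zj_def dZj_def)
  \<comment> \<open>Differentiation along the solution curve: the total derivative with
    \<open>z_(L+1)\<close> replaced by \<open>\<Theta>\<close>.\<close>
  define Dop where "Dop \<Phi> q = (\<Sum>k<L. pd (jZ k) \<Phi> q * q (jZ (Suc k))) + pd (jZ L) \<Phi> q * \<Theta> q" for \<Phi> q
  have near: "\<forall>\<^sub>F s in nhds t. zj s \<in> T" if "\<bar>t\<bar> < r" for t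
  proof -
   have "\<forall>\<^sub>F s in nhds t. \<bar>s\<bar> < r"
    using that by (intro eventually_nhds_in_open[of "{s. \<bar>s\<bar> < r}", simplified]) (auto intro!: open_Collect_less continuous_intros)
   then show ?thesis by eventually_elim (rule zjT)
  qed
  have der: "((\<lambda>t. \<Phi> (zj t)) has_field_derivative Dop \<Phi> (zj t)) (at t)"
   if "Ck 1 T \<Phi>" "depends_on (jZ ` {..L}) T \<Phi>" "\<bar>t\<bar> < r" for \<Phi> t
  proof -
   have "((\<lambda>t. \<Phi> (zj t)) has_field_derivative (\<Sum>y\<in>jZ ` {..L}. pd y \<Phi> (zj t) * (case y of jZ k \<Rightarrow> dZj t k | _ \<Rightarrow> 0))) (at t)"
    by (rule chain_rule[OF T that(1) _ that(2) near[OF that(3)]]) (use dZj that in auto)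
   moreover have "(\<Sum>y\<in>jZ ` {..L}. pd y \<Phi> (zj t) * (case y of jZ k \<Rightarrow> dZj t k | _ \<Rightarrow> 0)) = Dop \<Phi> (zj t)"
   proof -
    have "(\<Sum>y\<in>jZ ` {..L}. pd y \<Phi> (zj t) * (case y of jZ k \<Rightarrow> dZj t k | _ \<Rightarrow> 0)) = (\<Sum>k\<le>L. pd (jZ k) \<Phi> (zj t) * dZj t k)"
     unfolding sum_jZ by simp
    also have "\<dots> = (\<Sum>k<L. pd (jZ k) \<Phi> (zj t) * dZj t k) + pd (jZ L) \<Phi> (zj t) * \<Theta> (zj t)"
     unfolding lessThan_Suc_atMost[symmetric] sum.lessThan_Suc by (simp add: dZj_def)
    also have "(\<Sum>k<L. pd (jZ k) \<Phi> (zj t) * dZj t k) = (\<Sum>k<L. pd (jZ k) \<Phi> (zj t) * zj t (jZ (Suc k)))"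
     by (rule sum.cong) (auto simp: dZj_def zj_def)
    finally show ?thesis by (simp add: Dop_def)
   qed
   ultimately show ?thesis by simp
  qed
  have der2: "((\<lambda>s. \<Phi> (zj (\<xi> (q(y := s))))) has_field_derivative (if y = jX then 1 else if y = jT then - c else 0) * Dop \<Phi> (zj (\<xi> q))) (at (q y))"
   if "Ck 1 T \<Phi>" "depends_on (jZ ` {..L}) T \<Phi>" "q \<in> B" for \<Phi> q y
  proof -
   have "((\<lambda>s. \<xi> (q(y := s))) has_field_derivative (if y = jX then 1 else if y = jT then - c else 0)) (at (q y))"
    by (auto simp: \<xi>_def intro!: derivative_eq_intros)
   from DERIV_chain2[OF _ this, of "\<lambda>t. \<Phi> (zj t)"] der[OF that(1,2) \<xi>[OF that(3)]] show ?thesis by (simp add: mult.commute)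
  qed
  have DopC: "Ck k T (Dop \<Phi>)" if "\<And>k. Ck k T \<Phi>" for k \<Phi>
   unfolding Dop_def by (intro Ck_add Ck_sum Ck_mult Ck_proj T \<Theta>C Ck_Suc_pd[OF that])
  have Dopd: "depends_on (jZ ` {..L}) T (Dop \<Phi>)" if "depends_on (jZ ` {..L}) T \<Phi>" for \<Phi>
   unfolding depends_on_def
  proof (intro ballI impI)
   fix q q' assume q: "q \<in> T" "q' \<in> T" "\<forall>y\<in>jZ ` {..L}. q y = q' y"
   have "pd y \<Phi> q = pd y \<Phi> q'" for y by (rule depends_onD[OF depends_on_pd[OF T that] q(1,2)]) (use q in auto)
   moreover have "\<Theta> q = \<Theta> q'" by (rule depends_onD[OF \<Theta>d q(1,2)]) (use q in auto)
   moreover have "q (jZ k) = q' (jZ k)" if "k \<le> L" for k using q that by auto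
   ultimately show "Dop \<Phi> q = Dop \<Phi> q'" by (simp add: Dop_def)
  qed
  have cont: "continuous_on B (\<lambda>q. zj (\<xi> q))"
  proof (rule continuous_on_jetI)
   fix y
   show "continuous_on B (\<lambda>q. zj (\<xi> q) y)"
   proof (cases "\<exists>k\<le>L. y = jZ k")
    case True
    then obtain k where k: "k \<le> L" "y = jZ k" by blast
    have "continuous_on {t. \<bar>t\<bar> < r} (\<lambda>t. zj t (jZ k))"
     using DERIV_isCont[OF dZj[OF _ k(1)]] by (auto intro!: continuous_at_imp_continuous_on)
    then show ?thesis unfolding k(2)
     by (rule continuous_on_compose2) (use \<xi> in \<open>auto simp: \<xi>_def intro!: continuous_on_diff continuous_on_mult continuous_on_const continuous_on_jet_proj\<close>)
   next
    case False
    then have "zj t y = p y" for t by (auto simp: zj_def split: jvar.splits)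
    then show ?thesis by simp
   qed
  qed
  have smooth: "Ck k B (\<lambda>q. \<Phi> (zj (\<xi> q)))" if "\<And>k. Ck k T \<Phi>" "depends_on (jZ ` {..L}) T \<Phi>" for k \<Phi>
   using that
  proof (induction k arbitrary: \<Phi>)
   case 0
   then show ?case using continuous_on_compose2[OF Ck_continuous[OF 0(1)] cont] zjT \<xi> by auto
  next
   case (Suc k)
   show ?case
   proof (rule Ck_SucI[OF B _ der2[OF Suc.prems(1,2)]])
    show "continuous_on B (\<lambda>q. \<Phi> (zj (\<xi> q)))"
     using continuous_on_compose2[OF Ck_continuous[OF Suc.prems(1)] cont] zjT \<xi> by auto
    show "Ck k B (\<lambda>q. (if y = jX then 1 else if y = jT then - c else 0) * Dop \<Phi> (zj (\<xi> q)))" for y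
     by (intro Ck_mult Ck_const B Suc.IH DopC Dopd Suc.prems)
   qed
  qed
  have pdB: "pd jX (\<lambda>q. \<Phi> (zj (\<xi> q))) q = Dop \<Phi> (zj (\<xi> q))" "pd jT (\<lambda>q. \<Phi> (zj (\<xi> q))) q = - c * Dop \<Phi> (zj (\<xi> q))"
   if "\<And>k. Ck k T \<Phi>" "depends_on (jZ ` {..L}) T \<Phi>" "q \<in> B" for \<Phi> q
   using pd_eqI[OF der2[OF that, of jX]] pd_eqI[OF der2[OF that, of jT]] by simp_all
  define u where "u x t = Z 0 (x - c * t)" for x t
  define H where "H k = (if k \<le> L then (\<lambda>q. q (jZ k)) else \<Theta>)" for k
  have HC: "Ck m T (H k)" for k m using \<Theta>C T by (simp add: H_def)
  have Hd: "depends_on (jZ ` {..L}) T (H k)" for k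
  proof (cases "k \<le> L")
   case True
   then show ?thesis unfolding H_def depends_on_def by simp
  qed (simp add: H_def \<Theta>d)
  have pdproj: "pd y (\<lambda>q. q z) q = (if z = y then 1 else 0)" for y z and q :: jet
   by (rule pd_eqI) auto
  have DopH: "Dop (H k) q = H (Suc k) q" if "k \<le> L" for k q
  proof -
   have h: "H k = (\<lambda>q. q (jZ k))" using that by (simp add: H_def)
   have "(\<Sum>j<L. (if k = j then 1 else 0) * q (jZ (Suc j))) = (\<Sum>j<L. if k = j then q (jZ (Suc j)) else 0)"
    by (rule sum.cong) auto
   then have "(\<Sum>j<L. (if k = j then 1 else 0) * q (jZ (Suc j))) = (if k < L then q (jZ (Suc k)) else 0)"
    by simp
   then show ?thesis using that unfolding Dop_def h pdproj jvar.inject by (auto simp: H_def)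
  qed
  have dxu: "(dx ^^ k) u (q jX) (q jT) = H k (zj (\<xi> q))" if "k \<le> Suc L" "q \<in> B" for k q
   using that
  proof (induction k arbitrary: q)
   case 0
   then show ?case by (simp add: u_def H_def zj_def \<xi>_def)
  next
   case (Suc k)
   have "(dx ^^ Suc k) u (q jX) (q jT) = pd jX (\<lambda>q. (dx ^^ k) u (q jX) (q jT)) q"
    by (simp add: pd_lift)
   also have "\<dots> = pd jX (\<lambda>q. H k (zj (\<xi> q))) q"
    by (rule pd_cong[OF B Suc.prems(2)]) (use Suc in auto)
   also have "\<dots> = H (Suc k) (zj (\<xi> q))"
    using pdB(1)[OF HC Hd Suc.prems(2)] DopH Suc.prems by simp
   finally show ?case .
  qed
  have dtu: "dt ((dx ^^ k) u) (q jX) (q jT) = - c * (dx ^^ Suc k) u (q jX) (q jT)" if "k \<le> L" "q \<in> B" for k q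
  proof -
   have "dt ((dx ^^ k) u) (q jX) (q jT) = pd jT (\<lambda>q. (dx ^^ k) u (q jX) (q jT)) q" by (simp add: pd_lift)
   also have "\<dots> = pd jT (\<lambda>q. H k (zj (\<xi> q))) q"
    by (rule pd_cong[OF B that(2)]) (use that dxu in auto)
   also have "\<dots> = - c * H (Suc k) (zj (\<xi> q))"
    using pdB(2)[OF HC Hd that(2)] DopH that by simp
   finally show ?thesis using dxu[of "Suc k" q] that by simp
  qed
  have uC: "\<forall>k. Ck k {q. (q jX, q jT) \<in> D} (\<lambda>q. u (q jX) (q jT))"
  proof
   fix k
   have "Ck k B (\<lambda>q. H 0 (zj (\<xi> q)))" by (rule smooth[OF HC Hd])
   then show "Ck k {q. (q jX, q jT) \<in> D} (\<lambda>q. u (q jX) (q jT))"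
    by (simp add: B_def H_def zj_def u_def \<xi>_def)
  qed
  have jB: "jxt (x, t) \<in> B" if "(x, t) \<in> D" for x t using that by (simp add: B_def)
  have dxu': "(dx ^^ k) u x t = H k (zj (x - c * t))" if "k \<le> Suc L" "(x, t) \<in> D" for k x t
   using dxu[OF that(1) jB[OF that(2)]] by (simp add: \<xi>_def)
  have dtu': "dt ((dx ^^ k) u) x t = - c * (dx ^^ Suc k) u x t" if "k \<le> L" "(x, t) \<in> D" for k x t
   using dtu[OF that(1) jB[OF that(2)]] by simp
  have zjD: "zj (x - c * t) \<in> T" if "(x, t) \<in> D" for x t using zjT that by (simp add: D_def)
  have uU: "(u x t, dx u x t, dx (dx u) x t) \<in> U" if "(x, t) \<in> D" for x t
  proof -
   have "zj (x - c * t) \<in> S" using zjD[OF that] TS by blast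
   moreover have "u x t = zj (x - c * t) (jZ 0)" "dx u x t = zj (x - c * t) (jZ 1)" "dx (dx u) x t = zj (x - c * t) (jZ 2)"
    using dxu'[of 0 x t] dxu'[of 1 x t] dxu'[of 2 x t] that l(2) by (simp_all add: H_def numeral_2_eq_2)
   ultimately show ?thesis by (simp add: S_def jets_over_def)
  qed
  have struct: "structure_eqs f u x t" if xt: "(x, t) \<in> D" for x t
  proof -
   define j where "j = jet_of u x t"
   define q where "q = zj (x - c * t)"
   have q: "q \<in> T" "q \<in> S" using zjD[OF xt] TS by (auto simp: q_def)
   have j: "j \<in> S" unfolding j_def by (rule jet_of_S[OF uU[OF xt]])
   have jq: "j (jZ k) = q (jZ k)" if "k \<le> L" for k using dxu'[OF _ xt, of k] that by (simp add: j_def q_def H_def)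
   have pdj: "pd y (f 1 b) j = pd y (f 1 b) q" if "b \<in> {1, 2}" for y b
    by (rule depends_onD[OF pdd[OF that] j q(2)]) (use jq in auto)
   have Rj: "R 1 j = R 1 q" by (rule depends_onD[OF R_depends[OF l(1) i1(1)] j q(2)]) (use jq in auto)
   have top: "pd (jZ L) (f 1 2) q = - lam * q (jZ 0) * pd (jZ L) (f 1 1) q"
    using top_coefficient[OF q(2) l(1) _ i1(1)] l(2) by simp
   have sp: "(\<Sum>k\<le>L. g k) = (\<Sum>k<L. g k) + g L" for g :: "nat \<Rightarrow> real"
    unfolding lessThan_Suc_atMost[symmetric] sum.lessThan_Suc ..
   have low: "(\<Sum>k<L. (pd (jZ k) (f 1 2) q + c * pd (jZ k) (f 1 1) q) * (dx ^^ Suc k) u x t) =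
     (\<Sum>k<L. (pd (jZ k) (f 1 2) q + c * pd (jZ k) (f 1 1) q) * q (jZ (Suc k)))"
    by (rule sum.cong) (use dxu'[OF _ xt] in \<open>auto simp: q_def H_def simp del: funpow.simps\<close>)
   have "d_omega f 1 u x t = (\<Sum>k\<le>L. pd (jZ k) (f 1 2) j * (dx ^^ Suc k) u x t) - (\<Sum>k\<le>L. pd (jZ k) (f 1 1) j * dt ((dx ^^ k) u) x t)"
    unfolding j_def by (rule d_omega_jets[OF D(1) uC uU xt l(1) i1(1)])
   also have "\<dots> = (\<Sum>k\<le>L. (pd (jZ k) (f 1 2) q + c * pd (jZ k) (f 1 1) q) * (dx ^^ Suc k) u x t)"
    using dtu'[OF _ xt] pdj by (simp add: distrib_right sum.distrib sum_subtractf[symmetric] mult.assoc del: funpow.simps)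
     (simp add: sum_negf[symmetric] algebra_simps sum.distrib del: funpow.simps)
   also have "\<dots> = (\<Sum>k<L. (pd (jZ k) (f 1 2) q + c * pd (jZ k) (f 1 1) q) * q (jZ (Suc k))) + ((c - lam * q (jZ 0)) * pd (jZ L) (f 1 1) q) * \<Theta> q"
    unfolding sp low using dxu'[OF _ xt, of "Suc L"] top by (simp add: q_def H_def algebra_simps del: funpow.simps)
   also have "\<dots> = R 1 q" using q(1) by (simp add: \<Theta>_def T_def)
   finally have r1: "d_omega f 1 u x t - R 1 (jet_of u x t) = 0" using Rj by (simp add: j_def)
   define E where "E = (\<Sum>k\<le>L. pd (jZ k) (f 1 1) j * (dt ((dx ^^ k) u) x t - z_t lam G k j))"
   have res: "d_omega f i u x t - R i (jet_of u x t) = - \<mu> i * E" if "i \<in> {1, 2, 3}" for i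
    unfolding E_def j_def by (rule structure_residual[OF D(1) uC uU xt l(1) that])
   have "E = 0" using res[OF i1(1)] r1 \<mu>1 by simp
   then show ?thesis unfolding structure_eqs_R using res by force
  qed
  \<comment> \<open>The structure equations hold, so the equivalence forces (T). At the origin it
    reads \<open>c (z_3 - z_1) = rhs\<close>, against the choice of \<open>c\<close>; order at least
    3 is what makes \<open>z_3\<close> a prescribed initial value.\<close>
  have "equation_T lam G u 0 0" using pss[OF D(1) uC uU] struct D(2) by auto
  moreover have k: "(dx ^^ k) u 0 0 = p (jZ k)" if "k \<le> L" for k
   using dxu'[of k 0 0] that D(2) Z0 by (simp add: H_def zj_def)
  moreover have "dt u 0 0 = - c * (dx ^^ 1) u 0 0" "dt (dx (dx u)) 0 0 = - c * (dx ^^ 3) u 0 0"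
   using dtu'[of 0 0 0] dtu'[of 2 0 0] D(2) l(2) by (simp_all add: numeral_2_eq_2 numeral_3_eq_3)
  ultimately have "- c * p (jZ 1) + c * p (jZ 3) = rhs lam G p"
   using k[of 0] k[of 1] k[of 2] k[of 3] l(2) by (simp add: equation_T_def rhs_def numeral_2_eq_2 numeral_3_eq_3)
  then show False using c(2) by (simp add: algebra_simps)
 qed
qed

text \<open>The top derivative of \<open>f_11\<close> vanishes, by (C) so does that of every
  \<open>f_i1\<close>, and by the top-order relation that of every \<open>f_i2\<close>. Over
  \<open>U\<close> the coordinate \<open>z_(L+1)\<close> ranges over all reals, so a vanishing
  derivative means independence.\<close>

lemma reduce_order:
 assumes l: "dep_order (Suc L)" "L \<ge> 2"
 shows "dep_order L"
 unfolding dep_order_def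
proof (intro ballI)
 fix i j :: nat assume ij: "i \<in> {1, 2, 3}" "j \<in> {1, 2}"
 have "pd (jZ (Suc L)) (f 1 1) p = 0" if "p \<in> S" for p by (rule top_derivative_zero[OF that l(1)]) (use l in auto)
 then have 1: "pd (jZ (Suc L)) (f i 1) p = 0" if "p \<in> S" for p using f1_pd[OF ij(1) that] that by simp
 then have 2: "pd (jZ (Suc L)) (f i 2) p = 0" if "p \<in> S" for p using top_coefficient[OF that l(1) _ ij(1)] that l(2) by simp
 have z: "pd (jZ (Suc L)) (f i j) p = 0" if "p \<in> S" for p using 1[OF that] 2[OF that] ij(2) by auto
 have C1: "Ck (Suc 0) S (f i j)" by (rule f_smooth[OF ij])
 have const: "f i j (p(jZ (Suc L) := s)) = f i j p" if p: "p \<in> S" for p s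
 proof -
  have inS: "p(jZ (Suc L) := s) \<in> S" for s by (rule S_upd[OF p]) (use l in auto)
  have "((\<lambda>s. f i j (p(jZ (Suc L) := s))) has_field_derivative 0) (at s)" for s
   using Ck_DERIV'[OF C1 inS, of s] z[OF inS] by simp
  from DERIV_isconst_all[of "\<lambda>s. f i j (p(jZ (Suc L) := s))" s "p (jZ (Suc L))"] this show ?thesis by simp
 qed
 show "depends_on (jZ ` {..L}) S (f i j)"
  unfolding depends_on_def
 proof (intro ballI impI)
  fix p q assume pq: "p \<in> S" "q \<in> S" "\<forall>y\<in>jZ ` {..L}. p y = q y"
  have "f i j p = f i j (p(jZ (Suc L) := q (jZ (Suc L))))" using const[OF pq(1)] by simp
  also have "\<dots> = f i j q"
   using l(1) ij pq S_upd[OF pq(1), of "jZ (Suc L)"] l(2) unfolding dep_order_def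
   by (intro depends_onD[of "jZ ` {..Suc L}" S "f i j"]) (auto simp: le_Suc_eq)
  finally show "f i j p = f i j q" .
 qed
qed

lemma order_two: "dep_order 2"
proof -
 obtain l where l: "dep_order l" using f_depends unfolding dep_order_def by blast
 have "dep_order (2 + n) ==> dep_order 2" for n
  by (induction n) (use reduce_order in auto)
 moreover have "dep_order (2 + l)"
  using l unfolding dep_order_def by (meson atMost_subset_iff depends_on_mono image_mono le_add2 order_refl)
 ultimately show ?thesis by blast
qed

end

section \<open>Second order reduction\<close>

lemma slice_other:
 fixes S :: "jet set"
 assumes "open S" "p \<in> S"
 obtains s where "s \<noteq> p y" "p(y := s) \<in> S"
proof -
 obtain e where e: "e > 0" "ball (p y) e \<subseteq> {s. p(y := s) \<in> S}"
  using open_slice[OF assms(1), of p y] assms(2) open_contains_ball by (metis (mono_tags) fun_upd_triv mem_Collect_eq)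
 show ?thesis
 proof (rule that[of "p y + e / 2"])
  have "p y + e / 2 \<in> ball (p y) e" using e(1) by (simp add: dist_real_def)
  then show "p(y := p y + e / 2) \<in> S" using e(2) by blast
 qed (use e in simp)
qed

lemma pd_proj: "pd y (\<lambda>q. q z) q = (if z = y then 1 else 0)"
 by (rule pd_eqI) auto

lemma pd_const [simp]: "pd y (\<lambda>q. c) q = 0"
 by (rule pd_eqI) auto

lemma pd_zero_fun:
 assumes "open S" "p \<in> S" "\<And>q. q \<in> S ==> F q = 0"
 shows "pd y F p = 0"
 using pd_cong[OF assms(1,2), of F "\<lambda>_. 0" y] assms(3) by simp

lemma slice_invariant:
 assumes "depends_on K S F" "p \<in> S" "p(y := s) \<in> S" "y \<notin> K"
 shows "F (p(y := s)) = F p"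
 by (rule depends_onD[OF assms(1,3,2)]) (use assms(4) in auto)

lemma affine_in_z2:
 assumes "open S" "p \<in> S" "depends_on K S A" "depends_on K S B" "depends_on K S C" "jZ 2 \<notin> K" "K \<subseteq> {jZ 0, jZ 1}"
  and "\<And>p. p \<in> S ==> A p * p (jZ 1) + B p * p (jZ 2) + C p = 0"
 shows "B p = 0" "A p * p (jZ 1) + C p = 0"
proof -
 obtain s where s: "s \<noteq> p (jZ 2)" "p(jZ 2 := s) \<in> S" by (rule slice_other[OF assms(1,2)])
 have "A p * p (jZ 1) + B p * s + C p = 0"
  using assms(8)[OF s(2)] slice_invariant[OF assms(3,2) s(2) assms(6)] slice_invariant[OF assms(4,2) s(2) assms(6)]
   slice_invariant[OF assms(5,2) s(2) assms(6)] by simp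
 then have "B p * (s - p (jZ 2)) = 0" using assms(8)[OF assms(2)] unfolding right_diff_distrib by linarith
 then show "B p = 0" using s(1) by simp
 then show "A p * p (jZ 1) + C p = 0" using assms(8)[OF assms(2)] by simp
qed

text \<open>The conditions on \<open>M\<close> say that it varies with \<open>s = u - u_xx\<close>
  only. Differentiating \<open>D_x H = M\<close> in the two directions in which \<open>M\<close> is
  stationary gives identities affine in \<open>z_2\<close>, because derivatives of \<open>H\<close>
  are free of \<open>z_2\<close>; comparing coefficients kills the gradient of \<open>H\<close>.
  This rigidity applies whenever a total derivative equals an expression in the
  \<open>f_i1\<close>.\<close>

lemma total_derivative_of_s:
 assumes S: "open S" and H: "Ck 2 S H" "depends_on {jZ 0, jZ 1} S H" and M: "Ck 1 S M"
  "\<And>p. p \<in> S ==> pd (jZ 1) M p = 0" "\<And>p. p \<in> S ==> pd (jZ 0) M p + pd (jZ 2) M p = 0"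
  and eq: "\<And>p. p \<in> S ==> pd (jZ 0) H p * p (jZ 1) + pd (jZ 1) H p * p (jZ 2) = M p"
  and p: "p \<in> S"
 shows "M p = 0" "pd (jZ 0) H p = 0" "pd (jZ 1) H p = 0"
proof -
 define A where "A = pd (jZ 0) H"
 define B where "B = pd (jZ 1) H"
 have AB: "Ck (Suc 0) S A" "Ck (Suc 0) S B" unfolding A_def B_def using H(1) by (auto intro: Ck_Suc_pd simp: numeral_2_eq_2 simp del: Ck.simps)
 have dA: "depends_on {jZ 0, jZ 1} S A" "depends_on {jZ 0, jZ 1} S B" unfolding A_def B_def by (rule depends_on_pd[OF S H(2)])+
 have dpd: "depends_on {jZ 0, jZ 1} S (pd y A)" "depends_on {jZ 0, jZ 1} S (pd y B)" for y
  by (rule depends_on_pd[OF S dA(1)], rule depends_on_pd[OF S dA(2)])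
 have M1: "Ck (Suc 0) S M" using M(1) by simp
 have pr: "Ck (Suc 0) S (\<lambda>p. p y)" for y by (rule Ck_proj[OF S])
 have AM: "Ck (Suc 0) S (\<lambda>p. A p * p (jZ 1))" "Ck (Suc 0) S (\<lambda>p. B p * p (jZ 2))"
  by (intro Ck_mult S AB pr)+
 have I: "pd y A p * p (jZ 1) + A p * (if y = jZ 1 then 1 else 0) + (pd y B p * p (jZ 2) + B p * (if y = jZ 2 then 1 else 0)) - pd y M p = 0"
  if "p \<in> S" for y p
 proof -
  have "pd y (\<lambda>p. (A p * p (jZ 1) + B p * p (jZ 2)) - M p) p = 0"
   by (rule pd_zero_fun[OF S that]) (use eq in \<open>simp add: A_def B_def\<close>)
  then show ?thesis
   unfolding pd_diff[OF Ck_add[OF S AM] M1 that] pd_add[OF AM that] pd_mult[OF AB(1) pr that] pd_mult[OF AB(2) pr that] pd_proj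
   by (auto simp: algebra_simps)
 qed
 have z2: "pd (jZ 2) A p = 0" "pd (jZ 2) B p = 0" if "p \<in> S" for p
  by (rule pd_zero_outside[OF S dA(1) that], simp, rule pd_zero_outside[OF S dA(2) that], simp)
 have e02: "pd (jZ 0) A p * p (jZ 1) + pd (jZ 0) B p * p (jZ 2) + B p = 0" if "p \<in> S" for p
  using I[OF that, of "jZ 0"] I[OF that, of "jZ 2"] z2[OF that] M(3)[OF that] by simp
 have e1: "pd (jZ 1) A p * p (jZ 1) + pd (jZ 1) B p * p (jZ 2) + A p = 0" if "p \<in> S" for p
  using I[OF that, of "jZ 1"] M(2)[OF that] by simp
 have B0: "pd (jZ 0) B p = 0" "pd (jZ 0) A p * p (jZ 1) + B p = 0" if "p \<in> S" for p
  using affine_in_z2[OF S that dpd(1) dpd(2) dA(2) _ _ e02] by auto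
 have B1: "pd (jZ 1) B p = 0" "pd (jZ 1) A p * p (jZ 1) + A p = 0" if "p \<in> S" for p
  using affine_in_z2[OF S that dpd(1) dpd(2) dA(1) _ _ e1] by auto
 have "pd (jZ 1) A p = 0" if "p \<in> S" for p
  using B0(1)[OF that] pd_commute[OF S H(1) that, of "jZ 0" "jZ 1"] by (simp add: A_def B_def)
 then have A0: "A p = 0" if "p \<in> S" for p using B1(2)[OF that] that by simp
 have "pd (jZ 0) A p = 0" by (rule pd_zero_fun[OF S p A0])
 then have "B p = 0" using B0(2)[OF p] by simp
 then show "M p = 0" "pd (jZ 0) H p = 0" "pd (jZ 1) H p = 0" using A0[OF p] eq[OF p] by (simp_all add: A_def B_def)
qed

section \<open>The characteristic coframe\<close>

context pss_jets
begin

text \<open>In the coframe \<open>dx - lam u dt\<close>, \<open>dt\<close> one has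
  \<open>\<omega>_i = f_i1 (dx - lam u dt) + \<phi>_i dt\<close>, and \<open>Delta\<close> keeps its
  form. \<Gamma> below is the derivative of \<open>u - u_xx\<close> along the characteristics on
  solutions.\<close>

definition \<phi> :: "nat \<Rightarrow> jet \<Rightarrow> real" where "\<phi> i p = f i 2 p + lam * p (jZ 0) * f i 1 p"
definition \<Gamma> :: "jet \<Rightarrow> real" where "\<Gamma> p = G (p (jZ 0)) (p (jZ 1)) (p (jZ 2)) + lam * p (jZ 0) * p (jZ 1)"

lemma I3: "1 \<in> {1, 2, 3 :: nat}" "2 \<in> {1, 2, 3 :: nat}" "3 \<in> {1, 2, 3 :: nat}" "1 \<in> {1, 2 :: nat}" "2 \<in> {1, 2 :: nat}"
 by auto

lemma jZ_2: "jZ ` {..2} = {jZ 0, jZ 1, jZ 2}"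
 by (auto simp: numeral_2_eq_2 atMost_Suc)

lemma sum_2: "(\<Sum>k\<le>2. g k) = g 0 + g 1 + g (2 :: nat)" for g :: "nat \<Rightarrow> real"
 by (simp add: numeral_2_eq_2)

lemma f_depends_2: "i \<in> {1, 2, 3} ==> j \<in> {1, 2} ==> depends_on {jZ 0, jZ 1, jZ 2} S (f i j)"
 using order_two unfolding dep_order_def jZ_2 by blast

lemma f1_derivatives:
 assumes "p \<in> S" "i \<in> {1, 2, 3}"
 shows "pd (jZ 1) (f i 1) p = 0" "pd (jZ 2) (f i 1) p = - pd (jZ 0) (f i 1) p" "pd (jZ 0) (f i 1) p = \<mu> i * pd (jZ 0) (f 1 1) p"
 using even_odd_sums[OF assms(1) order_two, of True] even_odd_sums[OF assms(1) order_two, of False] f1_pd[OF assms(2,1)]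
 by (simp_all add: sum_2 algebra_simps add_eq_0_iff2)

lemma \<phi>_smooth: "i \<in> {1, 2, 3} ==> Ck k S (\<phi> i)"
 unfolding \<phi>_def by (intro Ck_add Ck_mult Ck_const Ck_proj S_open f_smooth I3)

lemma f2_eq: "f i 2 p = \<phi> i p - lam * p (jZ 0) * f i 1 p"
 by (simp add: \<phi>_def)

lemma Delta_\<phi>: "Delta f i j p = f i 1 p * \<phi> j p - f j 1 p * \<phi> i p"
 by (simp add: Delta_def \<phi>_def algebra_simps)

lemma pd_\<phi>:
 assumes "p \<in> S" "i \<in> {1, 2, 3}"
 shows "pd y (\<phi> i) p = pd y (f i 2) p + lam * (p (jZ 0) * pd y (f i 1) p + (if y = jZ 0 then f i 1 p else 0))"
proof -
 have C: "Ck (Suc 0) S (f i 2)" "Ck (Suc 0) S (f i 1)" "Ck (Suc 0) S (\<lambda>p. lam * p (jZ 0))"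
  by (intro Ck_mult Ck_const Ck_proj S_open f_smooth assms(2) I3)+
 have "pd y (\<lambda>p. lam * p (jZ 0)) p = lam * (if y = jZ 0 then 1 else 0)"
  using pd_mult[OF Ck_const[OF S_open] Ck_proj[OF S_open] assms(1), of y lam "jZ 0"] by (auto simp: pd_proj)
 then show ?thesis
  unfolding \<phi>_def[abs_def] pd_add[OF C(1) Ck_mult[OF S_open C(3,2)] assms(1)] pd_mult[OF C(3,2) assms(1)]
  by (simp add: algebra_simps)
qed

lemma pd2_\<phi>: "p \<in> S ==> i \<in> {1, 2, 3} ==> pd (jZ 2) (\<phi> i) p = 0"
 using top_coefficient[OF _ order_two, of p i] by (simp add: pd_\<phi> algebra_simps)

lemma segment_S:
 assumes "p \<in> S" "q \<in> S" "\<theta> \<in> {0..1}"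
 shows "(\<lambda>y. p y + \<theta> * (q y - p y)) \<in> S"
proof -
 have "(1 - \<theta>) *\<^sub>R (p (jZ 0), p (jZ 1), p (jZ 2)) + \<theta> *\<^sub>R (q (jZ 0), q (jZ 1), q (jZ 2)) \<in> U"
  by (rule convexD_alt[OF convex]) (use assms in \<open>auto simp: S_def jets_over_def\<close>)
 then show ?thesis by (simp add: S_def jets_over_def algebra_simps)
qed

text \<open>Convexity of \<open>U\<close> keeps the whole segment between two jets in the domain, so
  vanishing of the derivative along it compares jets that are far apart.\<close>

lemma path_constant:
 assumes F: "Ck 1 S F" "depends_on {jZ 0, jZ 1, jZ 2} S F" and pq: "p \<in> S" "q \<in> S"
  and zero: "\<And>r. r \<in> S ==> pd (jZ 0) F r * (q (jZ 0) - p (jZ 0)) + pd (jZ 1) F r * (q (jZ 1) - p (jZ 1)) + pd (jZ 2) F r * (q (jZ 2) - p (jZ 2)) = 0"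
 shows "F p = F q"
proof -
 define \<gamma> where "\<gamma> \<theta> = (\<lambda>y. p y + \<theta> * (q y - p y))" for \<theta>
 have "continuous_on UNIV \<gamma>" unfolding \<gamma>_def by (intro continuous_on_jetI continuous_intros)
 from open_vimage[OF S_open this] have op: "open {\<theta>. \<gamma> \<theta> \<in> S}" by (simp add: vimage_def)
 have "((\<lambda>\<theta>. F (\<gamma> \<theta>)) has_field_derivative 0) (at \<theta> within {0..1})" if "\<theta> \<in> {0..1}" for \<theta>
 proof -
  have g: "\<gamma> \<theta> \<in> S" unfolding \<gamma>_def by (rule segment_S[OF pq that])
  have ev: "\<forall>\<^sub>F s in nhds \<theta>. \<gamma> s \<in> S" using op g by (auto simp: eventually_nhds)
  have "((\<lambda>\<theta>. F (\<gamma> \<theta>)) has_field_derivative (\<Sum>y\<in>{jZ 0, jZ 1, jZ 2}. pd y F (\<gamma> \<theta>) * (q y - p y))) (at \<theta>)"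
   by (rule chain_rule[OF S_open F(1) _ F(2) ev]) (auto simp: \<gamma>_def intro!: derivative_eq_intros)
  then have "((\<lambda>\<theta>. F (\<gamma> \<theta>)) has_field_derivative 0) (at \<theta>)" using zero[OF g] by (simp add: add.assoc)
  then show ?thesis by (rule has_field_derivative_at_within)
 qed
 then have "\<exists>c. \<forall>\<theta>\<in>{0..1}. F (\<gamma> \<theta>) = c" by (intro has_field_derivative_zero_constant) auto
 then have "F (\<gamma> 0) = F (\<gamma> 1)" by force
 then show ?thesis by (simp add: \<gamma>_def)
qed

lemma \<phi>_depends: assumes i: "i \<in> {1, 2, 3}" shows "depends_on {jZ 0, jZ 1} S (\<phi> i)"
 unfolding depends_on_def
proof (intro ballI impI)
 fix p q assume pq: "p \<in> S" "q \<in> S" "\<forall>y\<in>{jZ 0, jZ 1}. p y = q y"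
 have "depends_on {jZ 0, jZ 1, jZ 2} S (\<phi> i)"
  using f_depends_2[OF i I3(4)] f_depends_2[OF i I3(5)] unfolding depends_on_def \<phi>_def by (metis insertI1)
 then show "\<phi> i p = \<phi> i q"
  by (rule path_constant[OF \<phi>_smooth[OF i] _ pq(1,2)]) (use pd2_\<phi> i pq in auto)
qed

lemma same_s:
 assumes F: "Ck 1 S F" "depends_on {jZ 0, jZ 1, jZ 2} S F" "\<And>p. p \<in> S ==> pd (jZ 1) F p = 0" "\<And>p. p \<in> S ==> pd (jZ 0) F p + pd (jZ 2) F p = 0"
  and pq: "p \<in> S" "q \<in> S" "p (jZ 0) - p (jZ 2) = q (jZ 0) - q (jZ 2)"
 shows "F p = F q"
proof (rule path_constant[OF F(1,2) pq(1,2)])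
 fix r assume r: "r \<in> S"
 have "pd (jZ 2) F r = - pd (jZ 0) F r" using F(4)[OF r] by simp
 moreover have "q (jZ 2) - p (jZ 2) = q (jZ 0) - p (jZ 0)" using pq(3) by simp
 ultimately show "pd (jZ 0) F r * (q (jZ 0) - p (jZ 0)) + pd (jZ 1) F r * (q (jZ 1) - p (jZ 1)) + pd (jZ 2) F r * (q (jZ 2) - p (jZ 2)) = 0"
  using F(3)[OF r] by simp
qed

lemma f1_same_s: "i \<in> {1, 2, 3} ==> p \<in> S ==> q \<in> S ==> p (jZ 0) - p (jZ 2) = q (jZ 0) - q (jZ 2) ==> f i 1 p = f i 1 q"
 by (rule same_s[OF f_smooth[OF _ I3(4)] f_depends_2[OF _ I3(4)]]) (simp_all add: f1_derivatives(1)[unfolded One_nat_def] f1_derivatives(2)[unfolded One_nat_def])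

lemma h'_derivatives:
 assumes "p \<in> S"
 shows "pd (jZ 1) (pd (jZ 0) (f 1 1)) p = 0" "pd (jZ 0) (pd (jZ 0) (f 1 1)) p + pd (jZ 2) (pd (jZ 0) (f 1 1)) p = 0"
proof -
 have C: "Ck k S (f 1 1)" for k by (rule f_smooth) auto
 have "pd (jZ 1) (pd (jZ 0) (f 1 1)) p = pd (jZ 0) (pd (jZ 1) (f 1 1)) p" by (rule pd_commute[OF S_open C assms])
 also have "\<dots> = 0" by (rule pd_zero_fun[OF S_open assms]) (use f1_derivatives(1)[OF _ I3(1)] in auto)
 finally show "pd (jZ 1) (pd (jZ 0) (f 1 1)) p = 0" .
 have "pd (jZ 0) (\<lambda>p. pd (jZ 0) (f 1 1) p + pd (jZ 2) (f 1 1) p) p = 0"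
  by (rule pd_zero_fun[OF S_open assms]) (use f1_derivatives(2)[OF _ I3(1)] in auto)
 moreover have "pd (jZ 2) (pd (jZ 0) (f 1 1)) p = pd (jZ 0) (pd (jZ 2) (f 1 1)) p" by (rule pd_commute[OF S_open C assms])
 ultimately show "pd (jZ 0) (pd (jZ 0) (f 1 1)) p + pd (jZ 2) (pd (jZ 0) (f 1 1)) p = 0"
  unfolding pd_add[OF Ck_Suc_pd[OF C] Ck_Suc_pd[OF C] assms] by simp
qed

lemma h'_same_s: "p \<in> S ==> q \<in> S ==> p (jZ 0) - p (jZ 2) = q (jZ 0) - q (jZ 2) ==> pd (jZ 0) (f 1 1) p = pd (jZ 0) (f 1 1) q"
 by (rule same_s[OF Ck_Suc_pd[OF f_smooth[OF I3(1,4)]] depends_on_pd[OF S_open f_depends_2[OF I3(1,4)]] h'_derivatives])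

text \<open>The structure equations in the characteristic coframe. Terms in \<open>u_t\<close>,
  \<open>u_xt\<close> and \<open>u_xxx\<close> cancel by the derivative relations for
  \<open>f_i1\<close> and \<open>\<phi>_i\<close>; what remains determines \<Gamma>, hence
  \<open>G\<close>, wherever the derivative of \<open>f_11\<close> is nonzero.\<close>

lemma structure_identity:
 assumes "p \<in> S" "i \<in> {1, 2, 3}"
 shows "\<mu> i * pd (jZ 0) (f 1 1) p * \<Gamma> p =
  pd (jZ 0) (\<phi> i) p * p (jZ 1) + pd (jZ 1) (\<phi> i) p * p (jZ 2) - lam * p (jZ 1) * f i 1 p - R i p"
proof -
 have z2: "z_t lam G 2 p = p (jW 0) - rhs lam G p" by (simp add: numeral_2_eq_2)
 have n3: "Suc 2 = 3" by simp
 have "pd (jZ 0) (f i 2) p * p (jZ 1) + pd (jZ 1) (f i 2) p * p (jZ 2) + pd (jZ 2) (f i 2) p * p (jZ 3)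
   - (pd (jZ 0) (f i 1) p * p (jW 0) + pd (jZ 1) (f i 1) p * p (jV 0) + pd (jZ 2) (f i 1) p * (p (jW 0) - rhs lam G p)) = R i p"
  using formal_identity[OF assms(1) order_two assms(2)] unfolding sum_2 z2 n3 by (simp add: numeral_2_eq_2)
 moreover have "pd (jZ 0) (\<phi> i) p = pd (jZ 0) (f i 2) p + lam * (p (jZ 0) * pd (jZ 0) (f i 1) p + f i 1 p)"
  "pd (jZ 1) (\<phi> i) p = pd (jZ 1) (f i 2) p + lam * (p (jZ 0) * pd (jZ 1) (f i 1) p)"
  "0 = pd (jZ 2) (f i 2) p + lam * (p (jZ 0) * pd (jZ 2) (f i 1) p)"
  using pd2_\<phi>[OF assms] unfolding pd_\<phi>[OF assms] by simp_all
 moreover from this(3) have "pd (jZ 2) (f i 2) p = - (lam * (p (jZ 0) * pd (jZ 2) (f i 1) p))" by linarith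
 ultimately show ?thesis unfolding f1_derivatives[OF assms] \<Gamma>_def rhs_def by (simp add: algebra_simps)
qed

end

text \<open>Relational form of \<open>pd\<close>: introduction rules then compute the derivative of
  a compound expression together with its existence.\<close>

definition pder :: "jvar \<Rightarrow> (jet \<Rightarrow> real) \<Rightarrow> real \<Rightarrow> jet \<Rightarrow> bool" where
 "pder y F d p \<longleftrightarrow> ((\<lambda>s. F (p(y := s))) has_field_derivative d) (at (p y))"

lemma pder_pd: "pder y F d p ==> d = e ==> pd y F p = e"
 using pd_eqI unfolding pder_def by blast

lemma pder_eq: "pder y F d p ==> d = e ==> pder y F e p"
 by simp

lemma pder_Ck: "p \<in> S ==> Ck (Suc k) S F ==> pder y F (pd y F p) p"
 unfolding pder_def by (rule Ck_DERIV)

lemma pder_const: "pder y (\<lambda>p. c) 0 p"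
 by (simp add: pder_def)

lemma pder_proj: "pder y (\<lambda>p. p z) (if z = y then 1 else 0) p"
 by (auto simp: pder_def)

lemma pder_add: "pder y F a p ==> pder y H b p ==> pder y (\<lambda>p. F p + H p) (a + b) p"
 unfolding pder_def by (rule DERIV_add)

lemma pder_diff: "pder y F a p ==> pder y H b p ==> pder y (\<lambda>p. F p - H p) (a - b) p"
 unfolding pder_def by (rule DERIV_diff)

lemma pder_minus: "pder y F a p ==> pder y (\<lambda>p. - F p) (- a) p"
 unfolding pder_def by (rule DERIV_minus)

lemma pder_mult: "pder y F a p ==> pder y H b p ==> pder y (\<lambda>p. F p * H p) (a * H p + F p * b) p"
 unfolding pder_def using DERIV_mult[of "\<lambda>s. F (p(y := s))" a "p y" UNIV "\<lambda>s. H (p(y := s))" b] by (simp add: mult.commute)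

lemma pder_square: "pder y F a p ==> pder y (\<lambda>p. (F p)\<^sup>2) (2 * F p * a) p"
 using pder_mult[of y F a p F a] by (simp add: power2_eq_square algebra_simps)

lemma pder_divide: "pder y F a p ==> pder y H b p ==> H p \<noteq> 0 ==> pder y (\<lambda>p. F p / H p) ((a * H p - F p * b) / (H p * H p)) p"
 unfolding pder_def using DERIV_divide[of "\<lambda>s. F (p(y := s))" a "p y" UNIV "\<lambda>s. H (p(y := s))" b] by (simp add: mult.commute)

lemma pder_arctan: "pder y F a p ==> pder y (\<lambda>p. arctan (F p)) (a / (1 + (F p)\<^sup>2)) p"
 unfolding pder_def using DERIV_arctan[THEN DERIV_chain2, of "\<lambda>s. F (p(y := s))" a "p y" UNIV]
 by (simp add: divide_inverse mult.commute)

lemmas pder_intros = pder_add pder_diff pder_minus pder_square pder_mult pder_arctan pder_const pder_proj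

section \<open>Nonvanishing of the derivative of \<open>f_11\<close>\<close>

context pss_jets
begin

abbreviation "h' \<equiv> pd (jZ 0) (f 1 1)"

lemma \<Gamma>_smooth: "Ck k S \<Gamma>"
 unfolding \<Gamma>_def[abs_def] by (intro Ck_add G Ck_mult Ck_const Ck_proj S_open)

lemma R_smooth: "Ck k S (R i)"
proof -
 have "Ck k S (Delta f a b)" if "a \<in> {1, 2, 3}" "b \<in> {1, 2, 3}" for a b
  unfolding Delta_def[abs_def] by (intro Ck_diff Ck_mult f_smooth that I3 S_open)
 then show ?thesis unfolding R_def by simp
qed

lemma identity_pd:
 assumes p: "p \<in> S" and i: "i \<in> {1, 2, 3}"
 shows "\<mu> i * (pd y h' p * \<Gamma> p + h' p * pd y \<Gamma> p) =
  pd y (pd (jZ 0) (\<phi> i)) p * p (jZ 1) + pd (jZ 0) (\<phi> i) p * (if jZ 1 = y then 1 else 0)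
  + (pd y (pd (jZ 1) (\<phi> i)) p * p (jZ 2) + pd (jZ 1) (\<phi> i) p * (if jZ 2 = y then 1 else 0))
  - lam * ((if jZ 1 = y then 1 else 0) * f i 1 p + p (jZ 1) * pd y (f i 1) p) - pd y (R i) p"
proof -
 have "pd y (\<lambda>p. \<mu> i * (h' p * \<Gamma> p)) p =
   pd y (\<lambda>p. pd (jZ 0) (\<phi> i) p * p (jZ 1) + pd (jZ 1) (\<phi> i) p * p (jZ 2) - lam * (p (jZ 1) * f i 1 p) - R i p) p"
  by (rule pd_cong[OF S_open p]) (use structure_identity[OF _ i] in \<open>simp add: mult.assoc\<close>)
 moreover have "pd y (\<lambda>p. \<mu> i * (h' p * \<Gamma> p)) p = \<mu> i * (pd y h' p * \<Gamma> p + h' p * pd y \<Gamma> p)"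
  by (rule pder_pd, (rule pder_intros pder_Ck[OF p] Ck_Suc_pd f_smooth[OF I3(1,4)] \<Gamma>_smooth)+) simp
 moreover have "pd y (\<lambda>p. pd (jZ 0) (\<phi> i) p * p (jZ 1) + pd (jZ 1) (\<phi> i) p * p (jZ 2) - lam * (p (jZ 1) * f i 1 p) - R i p) p =
  pd y (pd (jZ 0) (\<phi> i)) p * p (jZ 1) + pd (jZ 0) (\<phi> i) p * (if jZ 1 = y then 1 else 0)
  + (pd y (pd (jZ 1) (\<phi> i)) p * p (jZ 2) + pd (jZ 1) (\<phi> i) p * (if jZ 2 = y then 1 else 0))
  - lam * ((if jZ 1 = y then 1 else 0) * f i 1 p + p (jZ 1) * pd y (f i 1) p) - pd y (R i) p"
  by (rule pder_pd, (rule pder_intros pder_Ck[OF p] Ck_Suc_pd f_smooth[OF i I3(4)] \<phi>_smooth[OF i] R_smooth)+) simp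
 ultimately show ?thesis by simp
qed

lemma pd_R_zero:
 assumes p: "p \<in> S" and z: "\<And>i. i \<in> {1, 2, 3} ==> pd y (f i 1) p = 0 \<and> pd y (\<phi> i) p = 0"
 shows "pd y (R i) p = 0"
proof -
 have "pd y (\<lambda>p. f i 1 p * \<phi> j p - f j 1 p * \<phi> i p) p = 0" if "i \<in> {1, 2, 3}" "j \<in> {1, 2, 3}" for i j
  by (rule pder_pd, (rule pder_intros pder_Ck[OF p] f_smooth[OF _ I3(4)] \<phi>_smooth that)+) (use z that in simp)
 then have D: "pd y (Delta f i j) p = 0" if "i \<in> {1, 2, 3}" "j \<in> {1, 2, 3}" for i j
  using that unfolding Delta_\<phi>[abs_def] by blast
 show ?thesis unfolding R_def using D by simp
qed

lemma dx_exponential: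
 "(dx ^^ k) (\<lambda>x t. s0 + \<alpha> * exp x + \<beta> * exp (- x)) = (\<lambda>x t. (if k = 0 then s0 else 0) + \<alpha> * exp x + (- 1) ^ k * \<beta> * exp (- x))"
proof (induction k)
 case (Suc k)
 have "dx (\<lambda>x t. c + \<alpha> * exp x + b * exp (- x)) = (\<lambda>x t. \<alpha> * exp x - b * exp (- x))" for c b
  unfolding dx_def by (intro ext DERIV_imp_deriv) (auto intro!: derivative_eq_intros)
 from this[of "if k = 0 then s0 else 0" "(- 1) ^ k * \<beta>"] Suc show ?case by simp
qed simp

text \<open>Along \<open>u = s0 + \<alpha> e^x + \<beta> e^-x\<close> the quantity \<open>u - u_xx\<close> is constant; if \<open>h'\<close> vanished there,
 the structure equations would hold whatever \<open>G\<close> is.\<close>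

lemma \<Gamma>_zero:
 assumes p: "p \<in> S" "h' p = 0" and q: "q \<in> S" "q (jZ 0) - q (jZ 2) = p (jZ 0) - p (jZ 2)"
 shows "\<Gamma> q = 0"
proof -
 define s0 where "s0 = p (jZ 0) - p (jZ 2)"
 \<comment> \<open>These coefficients give the exponential function the values of \<open>u\<close>,
   \<open>u_x\<close> and \<open>u_xx\<close> at \<open>q\<close>, while \<open>u - u_xx\<close> is
   \<open>s0\<close> throughout.\<close>
 define \<alpha> where "\<alpha> = (q (jZ 0) - s0 + q (jZ 1)) / 2"
 define \<beta> where "\<beta> = (q (jZ 0) - s0 - q (jZ 1)) / 2"
 define u :: "real \<Rightarrow> real \<Rightarrow> real" where "u = (\<lambda>x t. s0 + \<alpha> * exp x + \<beta> * exp (- x))"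
 have dxu: "(dx ^^ k) u = (\<lambda>x t. (if k = 0 then s0 else 0) + \<alpha> * exp x + (- 1) ^ k * \<beta> * exp (- x))" for k
  unfolding u_def by (rule dx_exponential)
 have d1: "dx u = (\<lambda>x t. \<alpha> * exp x - \<beta> * exp (- x))" using dxu[of 1] by (simp add: fun_eq_iff)
 have d2: "dx (dx u) = (\<lambda>x t. \<alpha> * exp x + \<beta> * exp (- x))" using dxu[of 2] by (simp add: fun_eq_iff numeral_2_eq_2)
 have d3: "dx (dx (dx u)) = (\<lambda>x t. \<alpha> * exp x - \<beta> * exp (- x))" using dxu[of 3] by (simp add: fun_eq_iff numeral_3_eq_3)
 have dtu: "dt ((dx ^^ k) u) x t = 0" for k x t unfolding dxu dt_def by (rule DERIV_imp_deriv) simp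
 define D where "D = {z :: real \<times> real. (u (fst z) (snd z), dx u (fst z) (snd z), dx (dx u) (fst z) (snd z)) \<in> U}"
 have "continuous_on UNIV (\<lambda>z :: real \<times> real. (u (fst z) (snd z), dx u (fst z) (snd z), dx (dx u) (fst z) (snd z)))"
  unfolding d2 unfolding d1 unfolding u_def by (intro continuous_intros)
 from open_vimage[OF U this] have D: "open D" by (simp add: D_def vimage_def)
 have uU: "(u x t, dx u x t, dx (dx u) x t) \<in> U" if "(x, t) \<in> D" for x t using that by (simp add: D_def)
 have q2: "q (jZ 2) = q (jZ 0) - s0" using q(2) by (simp add: s0_def)
 have v0: "u 0 0 = s0 + \<alpha> + \<beta>" "dx u 0 0 = \<alpha> - \<beta>" "dx (dx u) 0 0 = \<alpha> + \<beta>"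
  by (simp add: u_def, simp add: d1, simp add: d2)
 have "(u 0 0, dx u 0 0, dx (dx u) 0 0) = (q (jZ 0), q (jZ 1), q (jZ 2))"
  unfolding q2 using v0 by (simp add: \<alpha>_def \<beta>_def field_simps)
 then have D0: "(0, 0) \<in> D" and v: "u 0 0 = q (jZ 0)" "dx u 0 0 = q (jZ 1)" "dx (dx u) 0 0 = q (jZ 2)"
  using q(1) by (simp_all add: D_def S_def jets_over_def)
 have op: "open {p :: jet. (p jX, p jT) \<in> D}" by (rule open_lift[OF D])
 have smooth: "\<forall>k. Ck k {p. (p jX, p jT) \<in> D} (\<lambda>p. u (p jX) (p jT))"
  unfolding u_def by (intro allI Ck_add Ck_mult Ck_const Ck_exp Ck_minus Ck_proj op)
 have "structure_eqs f u x t" if xt: "(x, t) \<in> D" for x t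
  unfolding structure_eqs_R
 proof
  fix i :: nat assume i: "i \<in> {1, 2, 3}"
  let ?j = "jet_of u x t"
  have j: "?j \<in> S" by (rule jet_of_S[OF uU[OF xt]])
  have "?j (jZ 0) - ?j (jZ 2) = s0" using dxu[of 0] dxu[of 2] by (simp add: numeral_2_eq_2)
  then have "h' ?j = 0" using h'_same_s[OF j p(1)] p(2) by (simp add: s0_def)
  then have "pd (jZ k) (f 1 1) ?j = 0" if "k \<le> 2" for k
   using f1_derivatives(1,2)[OF j I3(1)] that by (cases k rule: nat_two_cases) (auto simp: numeral_2_eq_2)
  then have "(\<Sum>k\<le>2. pd (jZ k) (f 1 1) ?j * (dt ((dx ^^ k) u) x t - z_t lam G k ?j)) = 0"
   by (intro sum.neutral) auto
  then show "d_omega f i u x t = R i ?j"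
   using structure_residual[OF D smooth uU xt order_two i] by simp
 qed
 then have "equation_T lam G u 0 0" using pss[OF D smooth uU] D0 by blast
 moreover have "dt u 0 0 = 0" "dt (dx (dx u)) 0 0 = 0" using dtu[of 0 0 0] dtu[of 2 0 0] by (simp_all add: numeral_2_eq_2)
 moreover have "dx (dx (dx u)) 0 0 = q (jZ 1)" using v(2) v0(2) unfolding d3 by simp
 ultimately show "\<Gamma> q = 0" using v by (simp add: equation_T_def \<Gamma>_def)
qed

text \<open>On the leaf through \<open>p\<close> where \<open>u - u_xx\<close> is constant, both
  \<open>h'\<close> and \<Gamma> vanish. Differentiating the structure identity there in
  \<open>u_xx\<close> shows that the \<open>u_x\<close>-derivative of each \<open>\<phi>_i\<close>
  is zero, and differentiating in \<open>u_x\<close> that the \<open>u\<close>-derivative of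
  \<open>\<phi>_3\<close> is \<open>lam f_31\<close>. What is left of the identity is
  \<open>R 3 p = 0\<close>, against \<omega>_1 \<and> \<omega>_2 \<noteq> 0.\<close>

lemma h'_nonzero:
 assumes p: "p \<in> S"
 shows "h' p \<noteq> 0"
proof
 assume h0: "h' p = 0"
 define T where "T = {q \<in> S. q (jZ 0) - q (jZ 2) = p (jZ 0) - p (jZ 2)}"
 have T: "q \<in> S" "h' q = 0" "\<Gamma> q = 0" if "q \<in> T" for q
  using that h'_same_s[OF _ p] h0 \<Gamma>_zero[OF p h0] by (auto simp: T_def)
 have pT: "p \<in> T" using p by (simp add: T_def)
 have f0: "pd y (f i 1) q = 0" if "q \<in> T" "i \<in> {1, 2, 3}" for y i q
 proof -
  have "pd y (f i 1) q = 0" if "y \<notin> {jZ 0, jZ 1, jZ 2}"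
   by (rule pd_zero_outside[OF S_open f_depends_2[OF \<open>i \<in> _\<close> I3(4)] T(1)[OF \<open>q \<in> T\<close>] that])
  then show ?thesis using f1_derivatives[OF T(1)[OF that(1)] that(2)] T(2)[OF that(1)] by auto
 qed
 have \<phi>2: "pd (jZ 2) F q = 0" if "q \<in> T" "depends_on {jZ 0, jZ 1} S F" for F q
  by (rule pd_zero_outside[OF S_open that(2) T(1)[OF that(1)]]) simp
 have dep: "depends_on {jZ 0, jZ 1} S (pd y (\<phi> i))" if "i \<in> {1, 2, 3}" for y i
  by (rule depends_on_pd[OF S_open \<phi>_depends[OF that]])
 have one: "pd (jZ 1) (\<phi> i) q = 0" if "q \<in> T" "i \<in> {1, 2, 3}" for q i
  using identity_pd[OF T(1)[OF that(1)] that(2), of "jZ 2"] T(2,3)[OF that(1)] f0[OF that] \<phi>2[OF that(1) dep[OF that(2)]]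
   pd_R_zero[OF T(1)[OF that(1)], of "jZ 2" i] f0[OF that(1)] \<phi>2[OF that(1) \<phi>_depends] by simp
 \<comment> \<open>The \<open>u_x\<close>-derivative is known to vanish only on the leaf, but it
   does not depend on \<open>u_xx\<close>; adjusting \<open>u_xx\<close> brings any nearby value of
   \<open>u\<close> back to the leaf.\<close>
 have zero: "pd (jZ 0) (pd (jZ 1) (\<phi> i)) p = 0" if i: "i \<in> {1, 2, 3}" for i
 proof -
  have "continuous_on UNIV (\<lambda>s. p(jZ 0 := s, jZ 2 := s - (p (jZ 0) - p (jZ 2))))"
   by (intro continuous_on_fun_upd continuous_intros)
  from open_vimage[OF S_open this] have "open {s. p(jZ 0 := s, jZ 2 := s - (p (jZ 0) - p (jZ 2))) \<in> S}" by (simp add: vimage_def)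
  moreover have "p(jZ 0 := p (jZ 0), jZ 2 := p (jZ 0) - (p (jZ 0) - p (jZ 2))) = p" by auto
  ultimately have "\<forall>\<^sub>F s in nhds (p (jZ 0)). p(jZ 0 := s, jZ 2 := s - (p (jZ 0) - p (jZ 2))) \<in> S"
   using p by (auto simp: eventually_nhds)
  with eventually_slice[OF S_open p, of "jZ 0"]
  have ev: "\<forall>\<^sub>F s in nhds (p (jZ 0)). pd (jZ 1) (\<phi> i) (p(jZ 0 := s)) = 0"
  proof eventually_elim
   fix s assume s: "p(jZ 0 := s) \<in> S" "p(jZ 0 := s, jZ 2 := s - (p (jZ 0) - p (jZ 2))) \<in> S"
   let ?q = "p(jZ 0 := s, jZ 2 := s - (p (jZ 0) - p (jZ 2)))"
   have "pd (jZ 1) (\<phi> i) (p(jZ 0 := s)) = pd (jZ 1) (\<phi> i) ?q"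
    by (rule depends_onD[OF dep[OF i] s]) auto
   also have "\<dots> = 0" by (rule one[OF _ i]) (use s in \<open>simp add: T_def\<close>)
   finally show "pd (jZ 1) (\<phi> i) (p(jZ 0 := s)) = 0" .
  qed
  show ?thesis by (rule pd_eqI, subst DERIV_cong_ev[OF refl ev refl]) simp
 qed
 have "R 3 p = 0"
 proof -
  have i: "3 \<in> {1, 2, 3 :: nat}" by simp
  have ev: "\<forall>\<^sub>F s in nhds (p (jZ 1)). pd (jZ 1) (\<phi> 3) (p(jZ 1 := s)) = 0"
   using eventually_slice[OF S_open p, of "jZ 1"]
   by eventually_elim (rule one[OF _ i], use pT in \<open>simp add: T_def\<close>)
  have "pd (jZ 1) (pd (jZ 1) (\<phi> 3)) p = 0" by (rule pd_eqI, subst DERIV_cong_ev[OF refl ev refl]) simp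
  moreover have "pd (jZ 1) (pd (jZ 0) (\<phi> 3)) p = 0"
   using zero[OF i] pd_commute[OF S_open \<phi>_smooth[OF i] p, of "jZ 0" "jZ 1"] by simp
  moreover have "pd (jZ 1) (R 3) p = 0"
   by (rule pd_R_zero[OF p]) (use f0[OF pT] one[OF pT] in blast)
  ultimately have "pd (jZ 0) (\<phi> 3) p = lam * f 3 1 p"
   using identity_pd[OF p i, of "jZ 1"] T(2,3)[OF pT] f0[OF pT i] by simp
  then show ?thesis using structure_identity[OF p i] h0 one[OF pT i] by simp
 qed
 then show False using Delta12[OF p] by (simp add: R_def)
qed

end

section \<open>The exceptional families\<close>

lemma depends_on_op2: "depends_on K S F ==> depends_on K S H ==> depends_on K S (\<lambda>p. g (F p) (H p))"
 unfolding depends_on_def by (intro ballI impI arg_cong2[of _ _ _ _ g]) blast+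

context pss_jets
begin

text \<open>The functions \<open>h\<close> and \<psi> of both families, recovered from
  \<open>f_31\<close> and \<open>\<phi>_3\<close> by choosing any jet over the arguments. The choice
  is immaterial because \<open>f_31\<close> depends on \<open>u - u_xx\<close> only and
  \<open>\<phi>_3\<close> on \<open>u\<close>, \<open>u_x\<close> only.\<close>

definition h3 :: "real \<Rightarrow> real" where "h3 s = f 3 1 (SOME p. p \<in> S \<and> p (jZ 0) - p (jZ 2) = s)"
definition \<psi>3 :: "real \<Rightarrow> real \<Rightarrow> real" where "\<psi>3 a b = \<phi> 3 (SOME p. p \<in> S \<and> p (jZ 0) = a \<and> p (jZ 1) = b)"

lemma h3_eq: "p \<in> S ==> h3 (p (jZ 0) - p (jZ 2)) = f 3 1 p"
 unfolding h3_def by (rule someI2[of _ p], simp, rule f1_same_s[OF I3(3)]) auto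

lemma \<psi>3_eq: "p \<in> S ==> \<psi>3 (p (jZ 0)) (p (jZ 1)) = \<phi> 3 p"
 unfolding \<psi>3_def by (rule someI2[of _ p], simp, rule depends_onD[OF \<phi>_depends[OF I3(3)]]) auto

lemma h3_DERIV:
 assumes p: "p \<in> S"
 shows "(h3 has_field_derivative \<mu> 3 * h' p) (at (p (jZ 0) - p (jZ 2)))"
proof -
 have ev: "\<forall>\<^sub>F s in nhds (p (jZ 0)). h3 (s + - p (jZ 2)) = f 3 1 (p(jZ 0 := s))"
  using eventually_slice[OF S_open p, of "jZ 0"]
 proof eventually_elim
  case (elim s)
  then show ?case using h3_eq[of "p(jZ 0 := s)"] by simp
 qed
 have "((\<lambda>s. f 3 1 (p(jZ 0 := s))) has_field_derivative pd (jZ 0) (f 3 1) p) (at (p (jZ 0)))"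
  by (rule Ck_DERIV[OF f_smooth[of 3 1 "Suc 0"] p]) auto
 then have "((\<lambda>s. h3 (s + - p (jZ 2))) has_field_derivative pd (jZ 0) (f 3 1) p) (at (p (jZ 0)))"
  by (subst DERIV_cong_ev[OF refl ev refl])
 then show ?thesis unfolding DERIV_shift[symmetric] using f1_derivatives(3)[OF p, of 3] by simp
qed

lemma \<psi>3_differentiable:
 assumes p: "p \<in> S"
 shows "(\<lambda>(a, b). \<psi>3 a b) differentiable (at (p (jZ 0), p (jZ 1)))"
  "psi_x \<psi>3 (p (jZ 0)) (p (jZ 1)) (p (jZ 2)) = pd (jZ 0) (\<phi> 3) p * p (jZ 1) + pd (jZ 1) (\<phi> 3) p * p (jZ 2)"
proof -
 have C: "Ck (Suc 0) S (\<phi> 3)" by (rule \<phi>_smooth) simp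
 have op: "open {z. p(jZ 0 := fst z, jZ 1 := snd z) \<in> S}"
  using open_vimage[OF S_open, of "\<lambda>z. p(jZ 0 := fst z, jZ 1 := snd z)"]
  by (simp add: vimage_def continuous_on_fun_upd continuous_intros)
 have "((\<lambda>(a, b). \<phi> 3 (p(jZ 0 := a, jZ 1 := b))) has_derivative
   (\<lambda>(h, k). pd (jZ 0) (\<phi> 3) p * h + pd (jZ 1) (\<phi> 3) p * k)) (at (p (jZ 0), p (jZ 1)))"
  by (rule Ck_two_variable_derivative[OF S_open _ p]) (use C in auto)
 then have "((\<lambda>(a, b). \<psi>3 a b) has_derivative
   (\<lambda>(h, k). pd (jZ 0) (\<phi> 3) p * h + pd (jZ 1) (\<phi> 3) p * k)) (at (p (jZ 0), p (jZ 1)))"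
 proof (rule has_derivative_transform_within_open[OF _ op])
  show "(p (jZ 0), p (jZ 1)) \<in> {z. p(jZ 0 := fst z, jZ 1 := snd z) \<in> S}" using p by simp
  fix z assume "z \<in> {z. p(jZ 0 := fst z, jZ 1 := snd z) \<in> S}"
  then show "(case z of (a, b) \<Rightarrow> \<phi> 3 (p(jZ 0 := a, jZ 1 := b))) = (case z of (a, b) \<Rightarrow> \<psi>3 a b)"
   using \<psi>3_eq[of "p(jZ 0 := fst z, jZ 1 := snd z)"] by (simp add: case_prod_unfold)
 qed
 then show "(\<lambda>(a, b). \<psi>3 a b) differentiable (at (p (jZ 0), p (jZ 1)))" by (auto simp: differentiable_def)
 have "\<forall>\<^sub>F s in nhds (p (jZ 0)). \<psi>3 s (p (jZ 1)) = \<phi> 3 (p(jZ 0 := s))"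
  using eventually_slice[OF S_open p, of "jZ 0"]
 proof eventually_elim
  case (elim s)
  then show ?case using \<psi>3_eq[of "p(jZ 0 := s)"] by simp
 qed
 then have 0: "deriv (\<lambda>s. \<psi>3 s (p (jZ 1))) (p (jZ 0)) = pd (jZ 0) (\<phi> 3) p"
  unfolding pd_def by (rule deriv_cong_ev) simp
 have "\<forall>\<^sub>F s in nhds (p (jZ 1)). \<psi>3 (p (jZ 0)) s = \<phi> 3 (p(jZ 1 := s))"
  using eventually_slice[OF S_open p, of "jZ 1"]
 proof eventually_elim
  case (elim s)
  then show ?case using \<psi>3_eq[of "p(jZ 1 := s)"] by simp
 qed
 then have "deriv (\<lambda>s. \<psi>3 (p (jZ 0)) s) (p (jZ 1)) = pd (jZ 1) (\<phi> 3) p"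
  unfolding pd_def by (rule deriv_cong_ev) simp
 with 0 show "psi_x \<psi>3 (p (jZ 0)) (p (jZ 1)) (p (jZ 2)) = pd (jZ 0) (\<phi> 3) p * p (jZ 1) + pd (jZ 1) (\<phi> 3) p * p (jZ 2)"
  by (simp add: psi_x_def)
qed

lemma pd_jet1_zero:
 assumes "depends_on {jZ 0, jZ 1} S F" "p \<in> S"
 shows "pd (jZ 2) F p = 0"
 by (rule pd_zero_outside[OF S_open assms]) simp

text \<open>Under the two relations the coframe can be rotated by the constant angle of \<open>(1, \<mu>\<^sub>2)/\<mu>\<^sub>3\<close>,
 after which \<open>f\<^sub>1\<^sub>1 = f\<^sub>3\<^sub>1\<close> and \<open>f\<^sub>2\<^sub>1\<close> is constant.\<close>

lemma exceptional_family:
 assumes \<mu>: "1 + (\<mu> 2)\<^sup>2 = (\<mu> 3)\<^sup>2" and \<eta>: "\<mu> 2 * \<eta> 2 = \<mu> 3 * \<eta> 3" and U_ne: "U \<noteq> {}"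
 shows "family_A U lam G \<or> family_B U lam G"
proof -
 have \<mu>3: "\<mu> 3 \<noteq> 0"
 proof
  assume "\<mu> 3 = 0"
  then have "1 + (\<mu> 2)\<^sup>2 = 0" using \<mu> by simp
  with zero_le_power2[of "\<mu> 2"] show False by linarith
 qed
 \<comment> \<open>Constant value of the rotated \<open>f_21\<close>. Below, \<theta> and \<xi> are
   the rotated \<open>\<phi>_1\<close> and \<open>\<phi>_2\<close>, and \<open>d\<close> will turn
   out to vanish.\<close>
 define m1 where "m1 = \<eta> 2 / \<mu> 3"
 define \<theta> where "\<theta> p = (\<phi> 1 p + \<mu> 2 * \<phi> 2 p) / \<mu> 3" for p
 define \<xi> where "\<xi> p = (\<phi> 2 p - \<mu> 2 * \<phi> 1 p) / \<mu> 3" for p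
 define d where "d p = \<phi> 3 p - \<theta> p" for p
 note i = I3(1-3)
 have rot: "\<phi> 1 p + \<mu> 2 * \<phi> 2 p = \<mu> 3 * \<theta> p" "\<phi> 2 p - \<mu> 2 * \<phi> 1 p = \<mu> 3 * \<xi> p" for p
  using \<mu>3 by (simp_all add: \<theta>_def \<xi>_def)
 have F: "f 1 1 p + \<mu> 2 * f 2 1 p = \<mu> 3 * f 3 1 p" "f 2 1 p - \<mu> 2 * f 1 1 p = \<mu> 3 * m1" if "p \<in> S" for p
 proof -
  have "f 1 1 p + \<mu> 2 * f 2 1 p = (1 + (\<mu> 2)\<^sup>2) * f 1 1 p + \<mu> 2 * \<eta> 2"
   unfolding C[OF i(2) that] by (simp add: algebra_simps power2_eq_square)
  also have "\<dots> = \<mu> 3 * f 3 1 p" unfolding \<mu> \<eta> C[OF i(3) that] by (simp add: algebra_simps power2_eq_square)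
  finally show "f 1 1 p + \<mu> 2 * f 2 1 p = \<mu> 3 * f 3 1 p" .
  show "f 2 1 p - \<mu> 2 * f 1 1 p = \<mu> 3 * m1" unfolding C[OF i(2) that] using \<mu>3 by (simp add: m1_def)
 qed
 have C\<theta>: "Ck k S \<theta>" "Ck k S \<xi>" "Ck k S d" for k
 proof -
  note \<phi>C = \<phi>_smooth[OF i(1)] \<phi>_smooth[OF i(2)] \<phi>_smooth[OF i(3)]
  show \<theta>C: "Ck k S \<theta>" unfolding \<theta>_def[abs_def]
   by (rule Ck_divide[OF S_open Ck_add[OF S_open \<phi>C(1) Ck_cmult[OF S_open \<phi>C(2)]] Ck_const[OF S_open] \<mu>3])
  show "Ck k S \<xi>" unfolding \<xi>_def[abs_def]
   by (rule Ck_divide[OF S_open Ck_diff[OF S_open \<phi>C(2) Ck_cmult[OF S_open \<phi>C(1)]] Ck_const[OF S_open] \<mu>3])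
  show "Ck k S d" unfolding d_def[abs_def] by (rule Ck_diff[OF S_open \<phi>C(3) \<theta>C])
 qed
 have d\<theta>: "depends_on {jZ 0, jZ 1} S \<theta>" "depends_on {jZ 0, jZ 1} S \<xi>" "depends_on {jZ 0, jZ 1} S d"
 proof -
  note \<phi>d = \<phi>_depends[OF i(1)] \<phi>_depends[OF i(2)] \<phi>_depends[OF i(3)]
  show \<theta>d: "depends_on {jZ 0, jZ 1} S \<theta>" unfolding \<theta>_def[abs_def]
   by (rule depends_on_op2[OF \<phi>d(1,2), of "\<lambda>a b. (a + \<mu> 2 * b) / \<mu> 3"])
  show "depends_on {jZ 0, jZ 1} S \<xi>" unfolding \<xi>_def[abs_def]
   by (rule depends_on_op2[OF \<phi>d(1,2), of "\<lambda>a b. (b - \<mu> 2 * a) / \<mu> 3"])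
  show "depends_on {jZ 0, jZ 1} S d" unfolding d_def[abs_def]
   by (rule depends_on_op2[OF \<phi>d(3) \<theta>d, of "\<lambda>a b. a - b"])
 qed
 have pd\<theta>: "pd y \<theta> p = (pd y (\<phi> 1) p + \<mu> 2 * pd y (\<phi> 2) p) / \<mu> 3"
  "pd y \<xi> p = (pd y (\<phi> 2) p - \<mu> 2 * pd y (\<phi> 1) p) / \<mu> 3"
  "pd y d p = pd y (\<phi> 3) p - pd y \<theta> p" if "p \<in> S" for y p
 proof -
  show "pd y \<theta> p = (pd y (\<phi> 1) p + \<mu> 2 * pd y (\<phi> 2) p) / \<mu> 3"
   unfolding \<theta>_def[abs_def] divide_inverse
   by (rule pder_pd, (rule pder_intros pder_Ck[OF that] \<phi>_smooth I3)+) simp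
  show "pd y \<xi> p = (pd y (\<phi> 2) p - \<mu> 2 * pd y (\<phi> 1) p) / \<mu> 3"
   unfolding \<xi>_def[abs_def] divide_inverse
   by (rule pder_pd, (rule pder_intros pder_Ck[OF that] \<phi>_smooth I3)+) simp
  show "pd y d p = pd y (\<phi> 3) p - pd y \<theta> p"
   unfolding d_def[abs_def]
   by (rule pder_pd, (rule pder_intros pder_Ck[OF that] \<phi>_smooth C\<theta> I3)+) simp
 qed
 have id: "\<mu> i * h' p * \<Gamma> p = pd (jZ 0) (\<phi> i) p * p (jZ 1) + pd (jZ 1) (\<phi> i) p * p (jZ 2) - lam * p (jZ 1) * f i 1 p - R i p"
  if "p \<in> S" "i \<in> {1, 2, 3}" for i p by (rule structure_identity[OF that])
 have idX: "pd (jZ 0) (\<phi> i) p * p (jZ 1) + pd (jZ 1) (\<phi> i) p * p (jZ 2) = \<mu> i * h' p * \<Gamma> p + lam * p (jZ 1) * f i 1 p + R i p"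
  if "p \<in> S" "i \<in> {1, 2, 3}" for i p using id[OF that] by linarith
 have R: "R 1 p = f 3 1 p * \<phi> 2 p - f 2 1 p * \<phi> 3 p" "R 2 p = f 1 1 p * \<phi> 3 p - f 3 1 p * \<phi> 1 p"
  "R 3 p = f 1 1 p * \<phi> 2 p - f 2 1 p * \<phi> 1 p" for p by (simp_all add: R_def Delta_\<phi>)
 have e1: "pd (jZ 0) \<theta> p * p (jZ 1) + pd (jZ 1) \<theta> p * p (jZ 2) = \<mu> 3 * h' p * \<Gamma> p + lam * p (jZ 1) * f 3 1 p + f 3 1 p * \<xi> p - m1 * \<phi> 3 p"
  if p: "p \<in> S" for p
 proof -
  have "\<mu> 3 * (pd (jZ 0) \<theta> p * p (jZ 1) + pd (jZ 1) \<theta> p * p (jZ 2)) =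
   (pd (jZ 0) (\<phi> 1) p * p (jZ 1) + pd (jZ 1) (\<phi> 1) p * p (jZ 2)) + \<mu> 2 * (pd (jZ 0) (\<phi> 2) p * p (jZ 1) + pd (jZ 1) (\<phi> 2) p * p (jZ 2))"
   unfolding pd\<theta>[OF p] using \<mu>3 by (simp add: field_simps)
  also have "\<dots> = (1 + (\<mu> 2)\<^sup>2) * h' p * \<Gamma> p + lam * p (jZ 1) * (f 1 1 p + \<mu> 2 * f 2 1 p) + f 3 1 p * (\<phi> 2 p - \<mu> 2 * \<phi> 1 p) - (f 2 1 p - \<mu> 2 * f 1 1 p) * \<phi> 3 p"
   unfolding idX[OF p i(1)] idX[OF p i(2)] R \<mu>1 by (simp add: algebra_simps power2_eq_square)
  also have "\<dots> = \<mu> 3 * (\<mu> 3 * h' p * \<Gamma> p + lam * p (jZ 1) * f 3 1 p + f 3 1 p * \<xi> p - m1 * \<phi> 3 p)"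
   unfolding \<mu> F[OF p] rot by (simp add: algebra_simps power2_eq_square)
  finally show ?thesis using \<mu>3 by simp
 qed
 have e2: "pd (jZ 0) \<xi> p * p (jZ 1) + pd (jZ 1) \<xi> p * p (jZ 2) = lam * p (jZ 1) * m1 + f 3 1 p * d p"
  if p: "p \<in> S" for p
 proof -
  have "\<mu> 3 * (pd (jZ 0) \<xi> p * p (jZ 1) + pd (jZ 1) \<xi> p * p (jZ 2)) =
   (pd (jZ 0) (\<phi> 2) p * p (jZ 1) + pd (jZ 1) (\<phi> 2) p * p (jZ 2)) - \<mu> 2 * (pd (jZ 0) (\<phi> 1) p * p (jZ 1) + pd (jZ 1) (\<phi> 1) p * p (jZ 2))"
   unfolding pd\<theta>[OF p] using \<mu>3 by (simp add: field_simps)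
  also have "\<dots> = lam * p (jZ 1) * (f 2 1 p - \<mu> 2 * f 1 1 p) + (f 1 1 p + \<mu> 2 * f 2 1 p) * \<phi> 3 p - f 3 1 p * (\<phi> 1 p + \<mu> 2 * \<phi> 2 p)"
   unfolding idX[OF p i(1)] idX[OF p i(2)] R \<mu>1 by (simp add: algebra_simps power2_eq_square)
  also have "\<dots> = \<mu> 3 * (lam * p (jZ 1) * m1 + f 3 1 p * d p)"
   unfolding F[OF p] rot by (simp add: algebra_simps d_def)
  finally show ?thesis using \<mu>3 by simp
 qed
 have R3: "R 3 p = f 3 1 p * \<xi> p - m1 * \<theta> p" if p: "p \<in> S" for p
 proof -
  have "(\<mu> 3)\<^sup>2 * R 3 p = (f 1 1 p + \<mu> 2 * f 2 1 p) * (\<phi> 2 p - \<mu> 2 * \<phi> 1 p) - (f 2 1 p - \<mu> 2 * f 1 1 p) * (\<phi> 1 p + \<mu> 2 * \<phi> 2 p)"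
   unfolding R \<mu>[symmetric] by (simp add: algebra_simps power2_eq_square)
  also have "\<dots> = (\<mu> 3)\<^sup>2 * (f 3 1 p * \<xi> p - m1 * \<theta> p)"
   unfolding F[OF p] rot by (simp add: algebra_simps power2_eq_square)
  finally show ?thesis using \<mu>3 by simp
 qed
 \<comment> \<open>Subtracting the rotated first equation from the third eliminates \<Gamma> and
   leaves \<open>D_x d = m1 d\<close>. As \<open>d\<close> depends on \<open>u\<close>,
   \<open>u_x\<close> only, comparing coefficients kills its gradient.\<close>
 have e3: "pd (jZ 0) d p * p (jZ 1) + pd (jZ 1) d p * p (jZ 2) + - (m1 * d p) = 0" if p: "p \<in> S" for p
  using e1[OF p] id[OF p i(3)] unfolding pd\<theta>(3)[OF p] R3[OF p] by (simp add: algebra_simps d_def)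
 have dd: "depends_on {jZ 0, jZ 1} S (pd y d)" for y by (rule depends_on_pd[OF S_open d\<theta>(3)])
 have dm: "depends_on {jZ 0, jZ 1} S (\<lambda>p. - (m1 * d p))" 
  by (rule depends_on_op2[OF d\<theta>(3) d\<theta>(3), of "\<lambda>a b. - (m1 * a)"])
 have d1: "pd (jZ 1) d p = 0" "pd (jZ 0) d p * p (jZ 1) + - (m1 * d p) = 0" if p: "p \<in> S" for p
  using affine_in_z2[OF S_open p dd dd dm _ _ e3] by auto
 have d0': "pd (jZ 0) d p = 0" if p: "p \<in> S" for p
 proof -
  have "pd (jZ 1) (\<lambda>p. pd (jZ 0) d p * p (jZ 1) + - (m1 * d p)) p = 0"
   by (rule pd_zero_fun[OF S_open p d1(2)])
  moreover have "pd (jZ 1) (\<lambda>p. pd (jZ 0) d p * p (jZ 1) + - (m1 * d p)) p =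
    pd (jZ 1) (pd (jZ 0) d) p * p (jZ 1) + pd (jZ 0) d p - m1 * pd (jZ 1) d p"
   by (rule pder_pd, (rule pder_intros pder_Ck[OF p] Ck_Suc_pd C\<theta>)+) simp
  moreover have "pd (jZ 1) (pd (jZ 0) d) p = pd (jZ 0) (pd (jZ 1) d) p" by (rule pd_commute[OF S_open C\<theta>(3) p])
  moreover have "pd (jZ 0) (pd (jZ 1) d) p = 0" by (rule pd_zero_fun[OF S_open p d1(1)])
  ultimately show ?thesis using d1(1)[OF p] by simp
 qed
 \<comment> \<open>The rotated second equation says that \<open>\<xi> - lam m1 u\<close> has total
   derivative \<open>f_31 d\<close>. Since \<open>d\<close> has zero gradient, this is a function of
   \<open>u - u_xx\<close>; rigidity makes it zero, and the nonvanishing of \<open>h'\<close> then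
   forces \<open>d = 0\<close>.\<close>
 define H where "H p = \<xi> p - lam * m1 * p (jZ 0)" for p
 have CH: "Ck k S H" for k unfolding H_def[abs_def] by (intro Ck_diff Ck_mult Ck_const Ck_proj S_open C\<theta>)
 have d0: "depends_on {jZ 0, jZ 1} S (\<lambda>p. p (jZ 0))" by (simp add: depends_on_def)
 have dH: "depends_on {jZ 0, jZ 1} S H" unfolding H_def[abs_def]
  by (rule depends_on_op2[OF d\<theta>(2) d0, of "\<lambda>a b. a - lam * m1 * b"])
 have pdH: "pd y H p = pd y \<xi> p - lam * m1 * (if jZ 0 = y then 1 else 0)" if p: "p \<in> S" for y p
  unfolding H_def[abs_def] by (rule pder_pd, (rule pder_intros pder_Ck[OF p] C\<theta>)+) simp
 define M where "M p = f 3 1 p * d p" for p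
 have CM: "Ck k S M" for k unfolding M_def[abs_def] by (intro Ck_mult S_open f_smooth I3 C\<theta>)
 have pdM: "pd y M p = pd y (f 3 1) p * d p" if p: "p \<in> S" "y \<in> {jZ 0, jZ 1, jZ 2}" for y p
  unfolding M_def[abs_def]
  by (rule pder_pd, (rule pder_intros pder_Ck[OF p(1)] C\<theta> f_smooth I3)+) (use p(2) d0'[OF p(1)] d1(1)[OF p(1)] pd_jet1_zero[OF d\<theta>(3) p(1)] in auto)
 have M1: "pd (jZ 1) M p = 0" "pd (jZ 0) M p + pd (jZ 2) M p = 0" if p: "p \<in> S" for p
  using pdM[OF p] f1_derivatives(1,2)[OF p i(3)] by (simp_all add: distrib_right[symmetric])
 have HM: "pd (jZ 0) H p * p (jZ 1) + pd (jZ 1) H p * p (jZ 2) = M p" if p: "p \<in> S" for p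
  using e2[OF p] unfolding pdH[OF p] M_def by (simp add: algebra_simps)
 note T = total_derivative_of_s[OF S_open CH dH CM M1 HM]
 have d_zero: "d p = 0" if p: "p \<in> S" for p
 proof -
  have "pd (jZ 0) M p = 0" by (rule pd_zero_fun[OF S_open p T(1)])
  then show ?thesis using pdM[OF p, of "jZ 0"] f1_derivatives(3)[OF p i(3)] \<mu>3 h'_nonzero[OF p] by simp
 qed
 obtain p0 where p0: "p0 \<in> S" using U_ne S_def mk3_jets_over by (metis ex_in_conv prod_cases3)
 define m2 where "m2 = H p0"
 have Hc: "H p = m2" if p: "p \<in> S" for p
  unfolding m2_def by (rule path_constant[OF CH depends_on_mono[OF dH] p p0]) (use T(2,3) pd_jet1_zero[OF dH] in auto)
 have \<xi>: "\<xi> p = lam * m1 * p (jZ 0) + m2" if p: "p \<in> S" for p using Hc[OF p] by (simp add: H_def)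
 have \<theta>3: "\<theta> p = \<phi> 3 p" if p: "p \<in> S" for p using d_zero[OF p] by (simp add: d_def)
 have g: "G a b c = 1 / (\<mu> 3 * h' p) * (m1 * \<phi> 3 p + (pd (jZ 0) (\<phi> 3) p * b + pd (jZ 1) (\<phi> 3) p * c)
   - lam * a * b * (\<mu> 3 * h' p) - (lam * b + lam * m1 * a + m2) * f 3 1 p)"
  and k: "p \<in> S" "p (jZ 0) = a" "p (jZ 1) = b" "p (jZ 2) = c" if abc: "(a, b, c) \<in> U" "p = mk3 a b c" for a b c p
 proof -
  show p: "p \<in> S" "p (jZ 0) = a" "p (jZ 1) = b" "p (jZ 2) = c" using abc by (simp_all add: S_def)
  have "\<mu> 3 * h' p * (G a b c + lam * a * b) = pd (jZ 0) (\<phi> 3) p * b + pd (jZ 1) (\<phi> 3) p * c - lam * b * f 3 1 p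
    - (f 3 1 p * (lam * m1 * a + m2) - m1 * \<phi> 3 p)"
   using id[OF p(1) i(3)] unfolding R3[OF p(1)] \<theta>3[OF p(1)] \<xi>[OF p(1)] \<Gamma>_def p(2-4) .
  then show "G a b c = 1 / (\<mu> 3 * h' p) * (m1 * \<phi> 3 p + (pd (jZ 0) (\<phi> 3) p * b + pd (jZ 1) (\<phi> 3) p * c)
   - lam * a * b * (\<mu> 3 * h' p) - (lam * b + lam * m1 * a + m2) * f 3 1 p)"
   using \<mu>3 h'_nonzero[OF p(1)] by (simp add: field_simps)
 qed
 have dh: "(h3 has_field_derivative \<mu> 3 * h' (mk3 a b c)) (at (a - c))" "h3 (a - c) = f 3 1 (mk3 a b c)"
  "\<mu> 3 * h' (mk3 a b c) \<noteq> 0" if "(a, b, c) \<in> U" for a b c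
  using h3_DERIV[of "mk3 a b c"] h3_eq[of "mk3 a b c"] k[OF that refl] \<mu>3 h'_nonzero by auto
 have ah: "admissible_h U h3"
  unfolding admissible_h_def using dh DERIV_imp_deriv by (fastforce simp: real_differentiable_def)
 have d\<psi>: "(\<lambda>(r, s). \<psi>3 r s) differentiable (at (a, b))"
  "psi_x \<psi>3 a b c = pd (jZ 0) (\<phi> 3) (mk3 a b c) * b + pd (jZ 1) (\<phi> 3) (mk3 a b c) * c"
  "\<psi>3 a b = \<phi> 3 (mk3 a b c)" if "(a, b, c) \<in> U" for a b c
  using \<psi>3_differentiable[of "mk3 a b c"] \<psi>3_eq[of "mk3 a b c"] k[OF that refl] by (simp_all del: One_nat_def)
 have a\<psi>: "admissible_psi U \<psi>3" unfolding admissible_psi_def using d\<psi>(1) by auto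
 have G': "G a b c = 1 / deriv h3 (a - c) * (m1 * \<psi>3 a b + psi_x \<psi>3 a b c - lam * a * b * deriv h3 (a - c) - (lam * b + lam * m1 * a + m2) * h3 (a - c))"
  if "(a, b, c) \<in> U" for a b c
  unfolding DERIV_imp_deriv[OF dh(1)[OF that]] d\<psi>(2,3)[OF that] dh(2)[OF that] by (rule g[OF that refl])
 \<comment> \<open>If \<open>lam m1\<close> and \<open>m2\<close> vanish, then \<xi> = 0 and
   \<open>R 3\<close> is \<open>- m1 \<phi>_3\<close>; hence \<open>m1\<close> and
   \<open>\<phi>_3\<close> are nonzero and \<open>lam = 0\<close>, which is type (A) with
   \<open>m = m1\<close>. Otherwise the side condition of type (B) holds.\<close>
 show ?thesis
 proof (cases "(lam * m1)\<^sup>2 + m2\<^sup>2 = 0")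
  case False
  have "family_B U lam G"
   unfolding family_B_def
   by (rule exI[of _ m1], rule exI[of _ m2], rule exI[of _ h3], rule exI[of _ \<psi>3])
    (use False ah a\<psi> G' in auto)
  then show ?thesis ..
 next
  case True
  then have z: "lam * m1 = 0" "m2 = 0" by (auto simp: sum_power2_eq_zero_iff)
  have nz: "m1 \<noteq> 0" "\<phi> 3 p \<noteq> 0" if p: "p \<in> S" for p
   using Delta12[OF p] R3[OF p] \<theta>3[OF p] \<xi>[OF p] z by (auto simp: R_def)
  have m1: "m1 \<noteq> 0" using nz(1)[OF p0] .
  then have l: "lam = 0" using z by simp
  have "family_A U lam G"
   unfolding family_A_def
   by (rule exI[of _ m1], rule exI[of _ h3], rule exI[of _ \<psi>3])
    (use m1 l z ah a\<psi> G' nz(2)[OF k(1)] d\<psi>(3) in auto)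
  then show ?thesis ..
 qed
qed

end

section \<open>Second fundamental forms on boxes\<close>

definition fs :: "jet set \<Rightarrow> (jet \<Rightarrow> real) \<Rightarrow> bool" where
 "fs B F \<longleftrightarrow> (\<forall>k. Ck k B F) \<and> (\<exists>K. finite K \<and> depends_on K B F)"

lemma fs_Ck: "fs B F ==> Ck k B F"
 by (simp add: fs_def)

lemma fs_op2:
 assumes "fs B F" "fs B H" "\<And>k. Ck k B (\<lambda>p. g (F p) (H p))"
 shows "fs B (\<lambda>p. g (F p) (H p))"
proof -
 obtain K L where K: "finite K" "depends_on K B F" "finite L" "depends_on L B H" using assms(1,2) by (auto simp: fs_def)
 have "depends_on (K \<union> L) B (\<lambda>p. g (F p) (H p))"
  by (rule depends_on_op2[OF depends_on_mono[OF K(2)] depends_on_mono[OF K(4)]]) auto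
 then show ?thesis using K assms(3) unfolding fs_def by blast
qed

lemma fs_const: "open B ==> fs B (\<lambda>p. c)"
 by (auto simp: fs_def depends_on_def intro!: exI[of _ "{}"])

lemma fs_proj: "open B ==> fs B (\<lambda>p. p y)"
 by (auto simp: fs_def depends_on_def intro!: exI[of _ "{y}"])

lemma fs_add: "open B ==> fs B F ==> fs B H ==> fs B (\<lambda>p. F p + H p)"
 by (rule fs_op2) (auto intro: Ck_add fs_Ck)

lemma fs_diff: "open B ==> fs B F ==> fs B H ==> fs B (\<lambda>p. F p - H p)"
 by (rule fs_op2) (auto intro: Ck_diff fs_Ck)

lemma fs_mult: "open B ==> fs B F ==> fs B H ==> fs B (\<lambda>p. F p * H p)"
 by (rule fs_op2) (auto intro: Ck_mult fs_Ck)

lemma fs_divide: "open B ==> fs B F ==> fs B H ==> (\<And>p. p \<in> B ==> H p \<noteq> 0) ==> fs B (\<lambda>p. F p / H p)"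
 by (rule fs_op2) (auto intro: Ck_divide fs_Ck)

lemma fs_arctan: "open B ==> fs B F ==> fs B (\<lambda>p. arctan (F p))"
 by (rule fs_op2[of B F F "\<lambda>a b. arctan a"]) (auto intro: Ck_arctan fs_Ck)

lemma fs_subset: "fs B F ==> B' \<subseteq> B ==> fs B' F"
 unfolding fs_def by (intro conjI allI) (rule Ck_subset, auto intro: depends_on_mono[OF _ order_refl])

lemma fs_open_nonzero:
 assumes "open B" "fs B F"
 shows "open {p \<in> B. F p \<noteq> 0}"
proof -
 have "open (B \<inter> F -` (- {0}))"
  by (rule continuous_open_preimage[OF Ck_continuous[OF fs_Ck[OF assms(2)]] assms(1)]) (intro open_Compl closed_singleton)
 moreover have "B \<inter> F -` (- {0}) = {p \<in> B. F p \<noteq> 0}" by auto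
 ultimately show ?thesis by simp
qed

text \<open>Sum, product, quotient and arctangent rules all say that the gradient of a compound is a
  pointwise combination of the gradients of its parts. Taking one finite set of coordinates for all
  functions turns this into the rule for any derivation.\<close>

lemma derivation_linear:
 assumes "open B" "p \<in> B" "fs B F" "fs B H" "fs B W" "\<And>y. pd y W p = \<alpha> * pd y F p + \<beta> * pd y H p"
 shows "derivation c W p = \<alpha> * derivation c F p + \<beta> * derivation c H p"
proof -
 obtain K L J where K: "finite K" "depends_on K B F" "finite L" "depends_on L B H" "finite J" "depends_on J B W"
  using assms(3-5) unfolding fs_def by blast
 let ?M = "K \<union> L \<union> J"
 have M: "finite ?M" using K by simp
 have d: "depends_on ?M B F" "depends_on ?M B H" "depends_on ?M B W"
  using depends_on_mono[OF K(2), of ?M B] depends_on_mono[OF K(4), of ?M B] depends_on_mono[OF K(6), of ?M B] by auto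
 show ?thesis
  unfolding derivation_eq_sum[OF assms(1) d(1) M assms(2)] derivation_eq_sum[OF assms(1) d(2) M assms(2)]
   derivation_eq_sum[OF assms(1) d(3) M assms(2)] assms(6)
  by (simp add: sum_distrib_left sum.distrib[symmetric] algebra_simps)
qed

lemma derivation_const: "derivation c (\<lambda>p. k) p = 0"
 by (simp add: derivation_def)

lemma derivation_add:
 assumes "open B" "p \<in> B" "fs B F" "fs B H"
 shows "derivation c (\<lambda>p. F p + H p) p = derivation c F p + derivation c H p"
 using derivation_linear[OF assms fs_add[OF assms(1,3,4)], of 1 1 c] pd_add[OF fs_Ck[OF assms(3)] fs_Ck[OF assms(4)] assms(2)] by simp

lemma derivation_diff:
 assumes "open B" "p \<in> B" "fs B F" "fs B H"
 shows "derivation c (\<lambda>p. F p - H p) p = derivation c F p - derivation c H p"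
 using derivation_linear[OF assms fs_diff[OF assms(1,3,4)], of 1 "-1" c] pd_diff[OF fs_Ck[OF assms(3)] fs_Ck[OF assms(4)] assms(2)] by simp

lemma derivation_mult:
 assumes "open B" "p \<in> B" "fs B F" "fs B H"
 shows "derivation c (\<lambda>p. F p * H p) p = derivation c F p * H p + F p * derivation c H p"
 using derivation_linear[OF assms fs_mult[OF assms(1,3,4)], of "H p" "F p" c] pd_mult[OF fs_Ck[OF assms(3)] fs_Ck[OF assms(4)] assms(2)]
 by (simp add: algebra_simps)

lemma derivation_divide:
 assumes "open B" "p \<in> B" "fs B F" "fs B H" "\<And>p. p \<in> B ==> H p \<noteq> 0"
 shows "derivation c (\<lambda>p. F p / H p) p = (derivation c F p * H p - F p * derivation c H p) / (H p * H p)"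
proof -
 have "pd y (\<lambda>p. F p / H p) p = inverse (H p) * pd y F p + (- F p / (H p * H p)) * pd y H p" for y
  by (rule pder_pd[OF pder_divide[OF pder_Ck[OF assms(2) fs_Ck[OF assms(3)]] pder_Ck[OF assms(2) fs_Ck[OF assms(4)]]]])
   (use assms(5)[OF assms(2)] in \<open>simp_all add: field_simps\<close>)
 from derivation_linear[OF assms(1-4) fs_divide[OF assms(1,3,4,5)] this, of c] show ?thesis
  using assms(5)[OF assms(2)] by (simp add: field_simps)
qed

lemma derivation_arctan:
 assumes "open B" "p \<in> B" "fs B F"
 shows "derivation c (\<lambda>p. arctan (F p)) p = derivation c F p / (1 + (F p)\<^sup>2)"
proof -
 have "pd y (\<lambda>p. arctan (F p)) p = inverse (1 + (F p)\<^sup>2) * pd y F p + 0 * pd y F p" for y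
  by (rule pder_pd[OF pder_arctan[OF pder_Ck[OF assms(2) fs_Ck[OF assms(3)]]]]) (simp add: field_simps)
 from derivation_linear[OF assms(1-3) assms(3) fs_arctan[OF assms(1,3)] this, of c] show ?thesis by (simp add: field_simps)
qed

lemma derivation_cong:
 assumes "open B" "p \<in> B" "\<And>q. q \<in> B ==> F q = H q"
 shows "derivation c F p = derivation c H p"
proof -
 have "pd y F p = pd y H p" for y by (rule pd_cong[OF assms])
 then show ?thesis by (simp add: derivation_def)
qed

lemma derivation_zero:
 assumes "open B" "p \<in> B" "\<And>q. q \<in> B ==> F q = k"
 shows "derivation c F p = 0"
 using derivation_cong[OF assms(1,2), of F "\<lambda>_. k" c] assms(3) by (simp add: derivation_const)

text \<open>Neighbourhoods that every coordinate line meets in an interval: there a vanishing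
  partial derivative implies independence of that variable, which fails on general open
  sets.\<close>

definition jet_box :: "jet set \<Rightarrow> bool" where
 "jet_box B \<longleftrightarrow> (\<exists>K p0 \<epsilon>. finite K \<and> \<epsilon> > 0 \<and> B = {p. \<forall>y\<in>K. \<bar>p y - p0 y\<bar> < \<epsilon>})"

lemma jet_box_open: "jet_box B ==> open B"
proof -
 assume "jet_box B"
 then obtain K p0 \<epsilon> where K: "finite K" "B = {p. \<forall>y\<in>K. \<bar>p y - p0 y\<bar> < \<epsilon>}" by (auto simp: jet_box_def)
 have "B = (\<Inter>y\<in>K. {p. \<bar>p y - p0 y\<bar> < \<epsilon>})" using K by auto
 moreover have "open {p :: jet. \<bar>p y - p0 y\<bar> < \<epsilon>}" for y
  by (intro open_Collect_less continuous_on_rabs continuous_on_diff continuous_on_jet_proj continuous_on_const)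
 ultimately show ?thesis using K(1) by auto
qed

lemma jet_box_exists:
 assumes "open V" "p \<in> V"
 shows "\<exists>B. jet_box B \<and> p \<in> B \<and> B \<subseteq> V"
proof (rule open_jet_box[OF assms])
 fix K \<epsilon> assume K: "finite K" "\<epsilon> > (0 :: real)" "\<And>q. (\<And>y. y \<in> K ==> \<bar>q y - p y\<bar> < \<epsilon>) ==> q \<in> V"
 then show ?thesis
  by (intro exI[of _ "{q. \<forall>y\<in>K. \<bar>q y - p y\<bar> < \<epsilon>}"]) (auto simp: jet_box_def)
qed

lemma jet_box_drop:
 assumes B: "jet_box B" and F: "Ck (Suc 0) B F" "depends_on (insert y K) B F" and z: "\<And>p. p \<in> B ==> pd y F p = 0"
 shows "depends_on K B F"
 unfolding depends_on_def
proof (intro ballI impI)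
 fix p q assume pq: "p \<in> B" "q \<in> B" "\<forall>y\<in>K. p y = q y"
 obtain L p0 \<epsilon> where L: "finite L" "B = {p. \<forall>y\<in>L. \<bar>p y - p0 y\<bar> < \<epsilon>}" using B by (auto simp: jet_box_def)
 define I where "I = {s. p(y := s) \<in> B}"
 have I: "I = (if y \<in> L then {p0 y - \<epsilon> <..< p0 y + \<epsilon>} else UNIV)"
  using pq(1) by (auto simp: I_def L(2) abs_less_iff split: if_splits)
 have pI: "p y \<in> I" "q y \<in> I" using pq(1) pq(2) unfolding I_def by (auto simp: L(2))
 have "((\<lambda>s. F (p(y := s))) has_field_derivative 0) (at s within I)" if "s \<in> I" for s
 proof -
  have s: "p(y := s) \<in> B" using that by (simp add: I_def)
  have "((\<lambda>s. F (p(y := s))) has_field_derivative 0) (at s)" using Ck_DERIV'[OF F(1) s] unfolding z[OF s] .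
  then show ?thesis by (rule has_field_derivative_at_within)
 qed
 then have "\<exists>c. \<forall>s\<in>I. F (p(y := s)) = c"
  by (intro has_field_derivative_zero_constant) (simp_all add: I)
 then have "F (p(y := p y)) = F (p(y := q y))" using pI by metis
 also have "\<dots> = F q" by (rule depends_onD[OF F(2)]) (use pI pq in \<open>auto simp: I_def\<close>)
 finally show "F p = F q" by simp
qed

lemma jet_box_drop_set:
 assumes B: "jet_box B" and F: "Ck (Suc 0) B F" and L: "finite L" "depends_on (L \<union> K) B F" "\<And>p y. p \<in> B ==> y \<in> L ==> pd y F p = 0"
 shows "depends_on K B F"
 using L
proof (induction L rule: finite_induct)
 case (insert y L)
 have "depends_on (L \<union> K) B F" by (rule jet_box_drop[OF B F, of y]) (use insert.prems in auto)
 then show ?case using insert by blast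
qed simp

lemma jet_box_constant:
 assumes B: "jet_box B" and F: "fs B F" and "\<And>p y. p \<in> B ==> pd y F p = 0" and pq: "p \<in> B" "q \<in> B"
 shows "F p = F q"
proof -
 obtain K where K: "finite K" "depends_on K B F" using F unfolding fs_def by blast
 have "depends_on {} B F" by (rule jet_box_drop_set[OF B fs_Ck[OF F] K(1)], simp add: K(2), rule assms(3))
 then show ?thesis by (rule depends_onD[OF _ pq]) simp
qed

text \<open>The equations are linear in \<open>A, B, C\<close>, and their determinant is the
  quadratic form at \<open>(v1, v2)\<close>. In use \<open>A, B, C\<close> are derivatives of
  \<open>a, b, c\<close>; the first two equations come from Codazzi, the third from differentiating
  Gauss.\<close>

lemma rank_one_zero:
 fixes a b c v1 v2 A B C :: real
 assumes "a * v1\<^sup>2 + 2 * b * v1 * v2 + c * v2\<^sup>2 \<noteq> 0" "v1 * A + v2 * B = 0" "v1 * B + v2 * C = 0" "c * A + a * C - 2 * b * B = 0"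
 shows "A = 0" "B = 0" "C = 0"
proof -
 let ?Q = "a * v1\<^sup>2 + 2 * b * v1 * v2 + c * v2\<^sup>2"
 have "?Q * A = 0" "?Q * B = 0" "?Q * C = 0" using assms(2-4) by algebra+
 then show "A = 0" "B = 0" "C = 0" using assms(1) by simp_all
qed

text \<open>One bound \<open>N\<close> serves both families of t-derivatives, since they are lowered
  together. It is exclusive whereas \<open>l\<close> is inclusive, so \<open>KK 0 l\<close> contains
  no t-derivative.\<close>

definition KK :: "nat \<Rightarrow> nat \<Rightarrow> jvar set" where
 "KK N l = {jX, jT} \<union> jZ ` {..l} \<union> jW ` {..<N} \<union> jV ` {..<N}"

lemma KK_simps: "jX \<in> KK N l" "jT \<in> KK N l" "jZ i \<in> KK N l \<longleftrightarrow> i \<le> l" "jW i \<in> KK N l \<longleftrightarrow> i < N" "jV i \<in> KK N l \<longleftrightarrow> i < N"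
 by (auto simp: KK_def)

lemma KK_finite: "finite (KK N l)"
 by (simp add: KK_def)

lemma KK_exhaust:
 assumes "finite K" shows "\<exists>N l. K \<subseteq> KK N l"
 using assms
proof (induction K rule: finite_induct)
 case (insert y K)
 then obtain N l where N: "K \<subseteq> KK N l" by blast
 define m where "m = (case y of jZ i \<Rightarrow> i | jW i \<Rightarrow> i | jV i \<Rightarrow> i | _ \<Rightarrow> 0)"
 have "KK N l \<subseteq> KK (N + Suc m) (l + m)" by (auto simp: KK_def)
 moreover have "y \<in> KK (N + Suc m) (l + m)" by (cases y) (auto simp: KK_def m_def)
 ultimately show ?case using N by (intro exI[of _ "N + Suc m"] exI[of _ "l + m"]) auto
qed simp

section \<open>The Codazzi equations in the characteristic frame\<close>

context pss_jets
begin

definition cX :: "jvar \<Rightarrow> jet \<Rightarrow> real" where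
 "cX y p = (case y of jX \<Rightarrow> 1 | jT \<Rightarrow> 0 | jZ i \<Rightarrow> p (jZ (Suc i)) | jW j \<Rightarrow> p (jV j) | jV k \<Rightarrow> p (jW k) - (Dt lam G ^^ k) (rhs lam G) p)"

definition cT :: "jvar \<Rightarrow> jet \<Rightarrow> real" where
 "cT y p = (case y of jX \<Rightarrow> 0 | jT \<Rightarrow> 1 | jZ i \<Rightarrow> z_t lam G i p | jW j \<Rightarrow> p (jW (Suc j)) | jV k \<Rightarrow> p (jV (Suc k)))"

definition cY :: "jvar \<Rightarrow> jet \<Rightarrow> real" where
 "cY y p = cT y p + lam * p (jZ 0) * cX y p"

text \<open>\<open>Y\<close> is the derivative along the characteristics \<open>dx = lam u dt\<close>; unlike \<open>Dt\<close>, it does not raise the order in the \<open>z_i\<close>.\<close>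

abbreviation "X \<equiv> derivation cX"
abbreviation "Y \<equiv> derivation cY"

lemma Dx_X: "Dx lam G F p = X F p"
 unfolding Dx_def cX_def[abs_def] ..

lemma Dt_Y: "Dt lam G F p = Y F p - lam * p (jZ 0) * X F p"
proof -
 have "Dt lam G F p = derivation cT F p" unfolding Dt_def cT_def[abs_def] ..
 moreover have "Y F p = derivation cT F p + lam * p (jZ 0) * X F p"
  unfolding derivation_def cY_def by (simp add: distrib_right sum.distrib sum_distrib_left mult.assoc)
 ultimately show ?thesis by simp
qed

lemma X_low2:
 assumes "open B" "p \<in> B" "depends_on {jZ 0, jZ 1, jZ 2} B F"
 shows "X F p = pd (jZ 0) F p * p (jZ 1) + pd (jZ 1) F p * p (jZ 2) + pd (jZ 2) F p * p (jZ 3)"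
  "Y F p = pd (jZ 0) F p * (p (jW 0) + lam * p (jZ 0) * p (jZ 1)) + pd (jZ 1) F p * (p (jV 0) + lam * p (jZ 0) * p (jZ 2))
   + pd (jZ 2) F p * (p (jW 0) - G (p (jZ 0)) (p (jZ 1)) (p (jZ 2)))"
 unfolding derivation_eq_sum[OF assms(1,3) _ assms(2), simplified]
 by (simp_all add: cX_def cY_def cT_def rhs_def numeral_2_eq_2 numeral_3_eq_3 algebra_simps)

lemma X_low:
 assumes "open B" "p \<in> B" "depends_on {jZ 0, jZ 1} B F"
 shows "X F p = pd (jZ 0) F p * p (jZ 1) + pd (jZ 1) F p * p (jZ 2)"
  "Y F p = pd (jZ 0) F p * (p (jW 0) + lam * p (jZ 0) * p (jZ 1)) + pd (jZ 1) F p * (p (jV 0) + lam * p (jZ 0) * p (jZ 2))"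
proof -
 have d: "depends_on {jZ 0, jZ 1, jZ 2} B F" by (rule depends_on_mono[OF assms(3)]) auto
 have "pd (jZ 2) F p = 0" by (rule pd_zero_outside[OF assms(1,3,2)]) simp
 then show "X F p = pd (jZ 0) F p * p (jZ 1) + pd (jZ 1) F p * p (jZ 2)"
  "Y F p = pd (jZ 0) F p * (p (jW 0) + lam * p (jZ 0) * p (jZ 1)) + pd (jZ 1) F p * (p (jV 0) + lam * p (jZ 0) * p (jZ 2))"
  using X_low2[OF assms(1,2) d] by simp_all
qed

lemma XY_f1:
 assumes "p \<in> S" "i \<in> {1, 2, 3}"
 shows "X (f i 1) p = \<mu> i * h' p * (p (jZ 1) - p (jZ 3))" "Y (f i 1) p = \<mu> i * h' p * \<Gamma> p"
proof -
 note d = X_low2[OF S_open assms(1) f_depends_2[OF assms(2) I3(4)], unfolded f1_derivatives[OF assms]]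
 show "X (f i 1) p = \<mu> i * h' p * (p (jZ 1) - p (jZ 3))" unfolding d(1) by (simp add: algebra_simps)
 show "Y (f i 1) p = \<mu> i * h' p * \<Gamma> p" unfolding d(2) \<Gamma>_def by (simp add: algebra_simps)
qed

lemma Y_f1: "p \<in> S ==> i \<in> {1, 2, 3} ==> Y (f i 1) p = X (\<phi> i) p - lam * p (jZ 1) * f i 1 p - R i p"
 using structure_identity X_low(1)[OF S_open _ \<phi>_depends] XY_f1(2) by simp

lemma R_\<phi>: "R 1 p = f 3 1 p * \<phi> 2 p - f 2 1 p * \<phi> 3 p" "R 2 p = f 1 1 p * \<phi> 3 p - f 3 1 p * \<phi> 1 p"
  "R 3 p = f 1 1 p * \<phi> 2 p - f 2 1 p * \<phi> 1 p"
 by (simp_all add: R_def Delta_\<phi>)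

lemma fs_frame: "i \<in> {1, 2, 3} ==> B \<subseteq> S ==> fs B (f i 1)" "i \<in> {1, 2, 3} ==> B \<subseteq> S ==> fs B (\<phi> i)"
proof -
 assume i: "i \<in> {1, 2, 3}" "B \<subseteq> S"
 have "fs S (f i 1)" "fs S (\<phi> i)" unfolding fs_def
  using f_smooth[OF i(1) I3(4)] f_depends_2[OF i(1) I3(4)] \<phi>_smooth[OF i(1)] \<phi>_depends[OF i(1)] by (meson finite.intros)+
 then show "fs B (f i 1)" "fs B (\<phi> i)" using i(2) by (blast intro: fs_subset)+
qed

definition sff :: "jet set \<Rightarrow> (jet \<Rightarrow> real) \<Rightarrow> (jet \<Rightarrow> real) \<Rightarrow> (jet \<Rightarrow> real) \<Rightarrow> bool" where
 "sff B a b c \<longleftrightarrow> open B \<and> B \<subseteq> S \<and> fs B a \<and> fs B b \<and> fs B c \<and> (\<forall>p\<in>B.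
   a p * c p - (b p)\<^sup>2 = -1 \<and>
   f 1 1 p * Y a p + f 2 1 p * Y b p - \<phi> 1 p * X a p - \<phi> 2 p * X b p
    - 2 * b p * Delta f 1 3 p + (a p - c p) * Delta f 2 3 p = 0 \<and>
   f 1 1 p * Y b p + f 2 1 p * Y c p - \<phi> 1 p * X b p - \<phi> 2 p * X c p
    + (a p - c p) * Delta f 1 3 p + 2 * b p * Delta f 2 3 p = 0)"

lemma sffD:
 assumes "sff B a b c"
 shows "open B" "B \<subseteq> S" "fs B a" "fs B b" "fs B c"
  "\<And>p. p \<in> B ==> a p * c p - (b p)\<^sup>2 = -1"
  "\<And>p. p \<in> B ==> f 1 1 p * Y a p + f 2 1 p * Y b p - \<phi> 1 p * X a p - \<phi> 2 p * X b p
    - 2 * b p * Delta f 1 3 p + (a p - c p) * Delta f 2 3 p = 0"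
  "\<And>p. p \<in> B ==> f 1 1 p * Y b p + f 2 1 p * Y c p - \<phi> 1 p * X b p - \<phi> 2 p * X c p
    + (a p - c p) * Delta f 1 3 p + 2 * b p * Delta f 2 3 p = 0"
 using assms unfolding sff_def by blast+

lemma sff_subset: "sff B a b c ==> open B' ==> B' \<subseteq> B ==> sff B' a b c"
 unfolding sff_def by (meson fs_subset subset_iff)

lemma sff_gauss_pd:
 assumes s: "sff B a b c" and p: "p \<in> B"
 shows "c p * pd y a p + a p * pd y c p - 2 * b p * pd y b p = 0"
proof -
 have "pd y (\<lambda>p. a p * c p - (b p)\<^sup>2 + 1) p = 0" by (rule pd_zero_fun[OF sffD(1)[OF s] p]) (use sffD(6)[OF s] in simp)
 moreover have "pd y (\<lambda>p. a p * c p - (b p)\<^sup>2 + 1) p = c p * pd y a p + a p * pd y c p - 2 * b p * pd y b p"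
  by (rule pder_pd, (rule pder_intros pder_Ck[OF p] fs_Ck sffD[OF s])+) (simp add: algebra_simps)
 ultimately show ?thesis by simp
qed

text \<open>The equations d\<omega>_13 = \<omega>_12 \<and> \<omega>_23 and d\<omega>_23 =
  \<omega>_21 \<and> \<omega>_13, written for the coefficients of \<omega>_13 and \<omega>_23 in the
  characteristic coframe. This form suits the isotropic cases, where some of these coefficients are
  known.\<close>

lemma codazzi_forms:
 assumes s: "sff B a b c" and p: "p \<in> B"
 shows "Y (\<lambda>p. a p * f 1 1 p + b p * f 2 1 p) p - X (\<lambda>p. a p * \<phi> 1 p + b p * \<phi> 2 p) p
   = - lam * p (jZ 1) * (a p * f 1 1 p + b p * f 2 1 p) + \<phi> 3 p * (b p * f 1 1 p + c p * f 2 1 p) - f 3 1 p * (b p * \<phi> 1 p + c p * \<phi> 2 p)"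
  "Y (\<lambda>p. b p * f 1 1 p + c p * f 2 1 p) p - X (\<lambda>p. b p * \<phi> 1 p + c p * \<phi> 2 p) p
   = - lam * p (jZ 1) * (b p * f 1 1 p + c p * f 2 1 p) - \<phi> 3 p * (a p * f 1 1 p + b p * f 2 1 p) + f 3 1 p * (a p * \<phi> 1 p + b p * \<phi> 2 p)"
proof -
 note o = sffD(1)[OF s] and fr = fs_frame[OF _ sffD(2)[OF s]]
 have pS: "p \<in> S" using p sffD(2)[OF s] by blast
 have D: "derivation k (\<lambda>p. u p * v p + w p * z p) p = derivation k u p * v p + u p * derivation k v p + (derivation k w p * z p + w p * derivation k z p)"
  if "fs B u" "fs B v" "fs B w" "fs B z" for k u v w z
  using that by (simp add: derivation_add[OF o p] derivation_mult[OF o p] fs_mult[OF o])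
 note fr' = fr(1)[OF I3(1)] fr(1)[OF I3(2)] fr(2)[OF I3(1)] fr(2)[OF I3(2)]
 note D' = D[OF sffD(3)[OF s] fr'(1) sffD(4)[OF s] fr'(2)] D[OF sffD(3)[OF s] fr'(3) sffD(4)[OF s] fr'(4)]
  D[OF sffD(4)[OF s] fr'(1) sffD(5)[OF s] fr'(2)] D[OF sffD(4)[OF s] fr'(3) sffD(5)[OF s] fr'(4)]
 show "Y (\<lambda>p. a p * f 1 1 p + b p * f 2 1 p) p - X (\<lambda>p. a p * \<phi> 1 p + b p * \<phi> 2 p) p
   = - lam * p (jZ 1) * (a p * f 1 1 p + b p * f 2 1 p) + \<phi> 3 p * (b p * f 1 1 p + c p * f 2 1 p) - f 3 1 p * (b p * \<phi> 1 p + c p * \<phi> 2 p)"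
  using sffD(7)[OF s p] unfolding D' Y_f1[OF pS I3(1)] Y_f1[OF pS I3(2)] R_\<phi> Delta_\<phi> by (simp add: algebra_simps)
 show "Y (\<lambda>p. b p * f 1 1 p + c p * f 2 1 p) p - X (\<lambda>p. b p * \<phi> 1 p + c p * \<phi> 2 p) p
   = - lam * p (jZ 1) * (b p * f 1 1 p + c p * f 2 1 p) - \<phi> 3 p * (a p * f 1 1 p + b p * f 2 1 p) + f 3 1 p * (a p * \<phi> 1 p + b p * \<phi> 2 p)"
  using sffD(8)[OF s p] unfolding D' Y_f1[OF pS I3(1)] Y_f1[OF pS I3(2)] R_\<phi> Delta_\<phi> by (simp add: algebra_simps)
qed

text \<open>The variable \<open>y\<close> occurs neither in \<open>a, b, c\<close> nor in the frame,
  only in the coefficients of the derivations. Subtracting the equations at two values of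
  \<open>y\<close> keeps exactly the terms that move.\<close>

lemma codazzi_difference:
 assumes s: "sff B a b c" and K: "finite K" "depends_on K B a" "depends_on K B b" "depends_on K B c"
  and y: "y \<notin> K" "y \<notin> {jZ 0, jZ 1, jZ 2}" and p: "p \<in> B" and q: "q = p(y := s)" "q \<in> B"
 shows "f 1 1 p * (\<Sum>z\<in>K. (cY z q - cY z p) * pd z a p) + f 2 1 p * (\<Sum>z\<in>K. (cY z q - cY z p) * pd z b p)
   - \<phi> 1 p * (\<Sum>z\<in>K. (cX z q - cX z p) * pd z a p) - \<phi> 2 p * (\<Sum>z\<in>K. (cX z q - cX z p) * pd z b p) = 0"
  "f 1 1 p * (\<Sum>z\<in>K. (cY z q - cY z p) * pd z b p) + f 2 1 p * (\<Sum>z\<in>K. (cY z q - cY z p) * pd z c p)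
   - \<phi> 1 p * (\<Sum>z\<in>K. (cX z q - cX z p) * pd z b p) - \<phi> 2 p * (\<Sum>z\<in>K. (cX z q - cX z p) * pd z c p) = 0"
proof -
 note o = sffD(1)[OF s]
 have S: "p \<in> S" "q \<in> S" using p q(2) sffD(2)[OF s] by auto
 have inv: "F q = F p" if "depends_on K B F" for F
  unfolding q(1) by (rule slice_invariant[OF that p q(2)[unfolded q(1)] y(1)])
 have invS: "F q = F p" if "depends_on {jZ 0, jZ 1, jZ 2} S F" for F
  unfolding q(1) by (rule slice_invariant[OF that S(1) S(2)[unfolded q(1)] y(2)])
 have d: "(\<Sum>z\<in>K. (k z q - k z p) * pd z F p) = derivation k F q - derivation k F p" if "depends_on K B F" for k F
 proof -
  have "pd z F q = pd z F p" for z by (rule inv[OF depends_on_pd[OF o that]])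
  then show ?thesis
   unfolding derivation_eq_sum[OF o that K(1) p] derivation_eq_sum[OF o that K(1) q(2)]
   by (simp add: left_diff_distrib sum_subtractf)
 qed
 have F: "f i 1 q = f i 1 p" "\<phi> i q = \<phi> i p" if "i \<in> {1, 2, 3}" for i
  by (rule invS[OF f_depends_2[OF that I3(4)]], rule invS[OF depends_on_mono[OF \<phi>_depends[OF that]]]) auto
 have D: "Delta f i j q = Delta f i j p" if "i \<in> {1, 2, 3}" "j \<in> {1, 2, 3}" for i j
  unfolding Delta_\<phi> using F that by simp
 note e = F[OF I3(1)] F[OF I3(2)] D[OF I3(1,3)] D[OF I3(2,3)] inv[OF K(2)] inv[OF K(3)] inv[OF K(4)]
 show "f 1 1 p * (\<Sum>z\<in>K. (cY z q - cY z p) * pd z a p) + f 2 1 p * (\<Sum>z\<in>K. (cY z q - cY z p) * pd z b p)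
   - \<phi> 1 p * (\<Sum>z\<in>K. (cX z q - cX z p) * pd z a p) - \<phi> 2 p * (\<Sum>z\<in>K. (cX z q - cX z p) * pd z b p) = 0"
  unfolding d[OF K(2)] d[OF K(3)] using sffD(7)[OF s q(2)] sffD(7)[OF s p] unfolding e by (simp add: right_diff_distrib)
 show "f 1 1 p * (\<Sum>z\<in>K. (cY z q - cY z p) * pd z b p) + f 2 1 p * (\<Sum>z\<in>K. (cY z q - cY z p) * pd z c p)
   - \<phi> 1 p * (\<Sum>z\<in>K. (cX z q - cX z p) * pd z b p) - \<phi> 2 p * (\<Sum>z\<in>K. (cX z q - cX z p) * pd z c p) = 0"
  unfolding d[OF K(3)] d[OF K(4)] using sffD(8)[OF s q(2)] sffD(8)[OF s p] unfolding e by (simp add: right_diff_distrib)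
qed

text \<open>Second fundamental form on the x-direction, whose frame components are
  \<open>(f_11, f_21)\<close>. \<open>II_\<phi>\<close> is its value on the characteristic
  direction.\<close>

definition II_F :: "(jet \<Rightarrow> real) \<Rightarrow> (jet \<Rightarrow> real) \<Rightarrow> (jet \<Rightarrow> real) \<Rightarrow> jet \<Rightarrow> real" where
 "II_F a b c p = a p * (f 1 1 p)\<^sup>2 + 2 * b p * f 1 1 p * f 2 1 p + c p * (f 2 1 p)\<^sup>2"

definition II_\<phi> :: "(jet \<Rightarrow> real) \<Rightarrow> (jet \<Rightarrow> real) \<Rightarrow> (jet \<Rightarrow> real) \<Rightarrow> jet \<Rightarrow> real" where
 "II_\<phi> a b c p = a p * (\<phi> 1 p)\<^sup>2 + 2 * b p * \<phi> 1 p * \<phi> 2 p + c p * (\<phi> 2 p)\<^sup>2"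

definition zero_sum :: "jvar set \<Rightarrow> (jet \<Rightarrow> real) \<Rightarrow> jet \<Rightarrow> bool" where
 "zero_sum Z a p \<longleftrightarrow> (\<Sum>z\<in>Z. pd z a p) = 0"

lemma sff_gauss_sum:
 assumes s: "sff B a b c" and p: "p \<in> B"
 shows "c p * (\<Sum>z\<in>Z. pd z a p) + a p * (\<Sum>z\<in>Z. pd z c p) - 2 * b p * (\<Sum>z\<in>Z. pd z b p) = 0"
proof -
 have "(\<Sum>z\<in>Z. c p * pd z a p + a p * pd z c p - 2 * b p * pd z b p) = 0"
  by (rule sum.neutral) (use sff_gauss_pd[OF s p] in blast)
 then show ?thesis by (simp add: sum.distrib sum_subtractf sum_distrib_left)
qed

text \<open>Moving \<open>y\<close> changes either only \<open>Y\<close> or only \<open>X\<close>,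
  and only on the variables in \<open>Z\<close>. In the Codazzi equations \<open>Y\<close> is paired
  with \<open>(f_11, f_21)\<close> and \<open>X\<close> with \<open>(\<phi>_1, \<phi>_2)\<close>; if
  the vector concerned is not isotropic, the linear system has only the zero solution.\<close>

lemma codazzi_reduce:
 assumes s: "sff B a b c" and K: "finite K" "depends_on K B a" "depends_on K B b" "depends_on K B c"
  and y: "y \<notin> K" "y \<notin> {jZ 0, jZ 1, jZ 2}" and p: "p \<in> B" and Z: "Z \<subseteq> K"
  and coeff: "(II_F a b c p \<noteq> 0 \<and> (\<forall>s z. z \<in> K \<longrightarrow> cX z (p(y := s)) = cX z p \<and>
    cY z (p(y := s)) - cY z p = (if z \<in> Z then s - p y else 0))) \<or>
   (II_\<phi> a b c p \<noteq> 0 \<and> (\<forall>s z. z \<in> K \<longrightarrow> cY z (p(y := s)) = cY z p \<and>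
    cX z (p(y := s)) - cX z p = (if z \<in> Z then s - p y else 0)))"
 shows "zero_sum Z a p \<and> zero_sum Z b p \<and> zero_sum Z c p"
proof -
 obtain s where q: "s \<noteq> p y" "p(y := s) \<in> B" by (rule slice_other[OF sffD(1)[OF s] p])
 define A where "A F = (\<Sum>z\<in>Z. pd z F p)" for F
 have sum: "(\<Sum>z\<in>K. (if z \<in> Z then s - p y else 0) * pd z F p) = (s - p y) * A F" for F
 proof -
  have "(\<Sum>z\<in>K. (if z \<in> Z then s - p y else 0) * pd z F p) = (\<Sum>z\<in>K. if z \<in> Z then (s - p y) * pd z F p else 0)"
   by (rule sum.cong) auto
  also have "\<dots> = (\<Sum>z\<in>Z. (s - p y) * pd z F p)"
   using Z by (subst sum.inter_restrict[OF K(1), symmetric]) (simp add: Int_absorb1)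
  finally show ?thesis by (simp add: A_def sum_distrib_left)
 qed
 note d = codazzi_difference[OF s K y p refl q(2)]
 note g = sff_gauss_sum[OF s p, of Z, folded A_def]
 from coeff show ?thesis unfolding zero_sum_def A_def[symmetric]
 proof
  assume c: "II_F a b c p \<noteq> 0 \<and> (\<forall>s z. z \<in> K \<longrightarrow> cX z (p(y := s)) = cX z p \<and>
    cY z (p(y := s)) - cY z p = (if z \<in> Z then s - p y else 0))"
  have 1: "(\<Sum>z\<in>K. (cY z (p(y := s)) - cY z p) * pd z F p) = (s - p y) * A F" for F
   unfolding sum[symmetric] by (rule sum.cong) (use c in auto)
  have 2: "(\<Sum>z\<in>K. (cX z (p(y := s)) - cX z p) * pd z F p) = 0" for F
   by (rule sum.neutral) (use c in auto)
  have "(s - p y) * (f 1 1 p * A a + f 2 1 p * A b) = 0" "(s - p y) * (f 1 1 p * A b + f 2 1 p * A c) = 0"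
   using d unfolding 1 2 by (simp_all add: algebra_simps)
  then have "f 1 1 p * A a + f 2 1 p * A b = 0" "f 1 1 p * A b + f 2 1 p * A c = 0" using q(1) by simp_all
  from rank_one_zero[OF conjunct1[OF c, unfolded II_F_def] this g] show "A a = 0 \<and> A b = 0 \<and> A c = 0" by simp
 next
  assume c: "II_\<phi> a b c p \<noteq> 0 \<and> (\<forall>s z. z \<in> K \<longrightarrow> cY z (p(y := s)) = cY z p \<and>
    cX z (p(y := s)) - cX z p = (if z \<in> Z then s - p y else 0))"
  have 1: "(\<Sum>z\<in>K. (cX z (p(y := s)) - cX z p) * pd z F p) = (s - p y) * A F" for F
   unfolding sum[symmetric] by (rule sum.cong) (use c in auto)
  have 2: "(\<Sum>z\<in>K. (cY z (p(y := s)) - cY z p) * pd z F p) = 0" for F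
   by (rule sum.neutral) (use c in auto)
  have "(s - p y) * (\<phi> 1 p * A a + \<phi> 2 p * A b) = 0" "(s - p y) * (\<phi> 1 p * A b + \<phi> 2 p * A c) = 0"
   using d unfolding 1 2 by (simp_all add: algebra_simps)
  then have "\<phi> 1 p * A a + \<phi> 2 p * A b = 0" "\<phi> 1 p * A b + \<phi> 2 p * A c = 0" using q(1) by simp_all
  from rank_one_zero[OF conjunct1[OF c, unfolded II_\<phi>_def] this g] show "A a = 0 \<and> A b = 0 \<and> A c = 0" by simp
 qed
qed

section \<open>Elimination of the jet variables from \<open>a, b, c\<close>\<close>

lemma Dt_depends:
 assumes "depends_on (KK N l) S F"
 shows "depends_on (KK (Suc N) (Suc l)) S (Dt lam G F)"
 unfolding depends_on_def
proof (intro ballI impI)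
 fix p q assume pq: "p \<in> S" "q \<in> S" "\<forall>y\<in>KK (Suc N) (Suc l). p y = q y"
 have D: "Dt lam G F p = (\<Sum>y\<in>KK N l. cT y p * pd y F p)" if "p \<in> S" for p
  unfolding Dt_def cT_def by (rule derivation_eq_sum[OF S_open assms KK_finite that])
 have "pd y F p = pd y F q" for y
  by (rule depends_onD[OF depends_on_pd[OF S_open assms] pq(1,2)]) (use pq(3) in \<open>auto simp: KK_def\<close>)
 moreover have "cT y p = cT y q" if "y \<in> KK N l" for y
 proof (cases y)
  case (jZ i)
  have "z_t lam G i p = z_t lam G i q"
   by (rule depends_onD[OF z_t_depends pq(1,2)]) (use pq(3) that jZ in \<open>auto simp: KK_def\<close>)
  then show ?thesis by (simp add: cT_def jZ)
 qed (use pq(3) that in \<open>auto simp: KK_def cT_def\<close>)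
 ultimately show "Dt lam G F p = Dt lam G F q" unfolding D[OF pq(1)] D[OF pq(2)] by (intro sum.cong) auto
qed

text \<open>The x-derivative of \<open>jV k\<close> thus involves no t-derivative of index beyond
  \<open>k\<close>, so \<open>X\<close> does not raise the order in \<open>t\<close>.\<close>

lemma Dt_rhs_depends: "depends_on (KK k (k + 3)) S ((Dt lam G ^^ k) (rhs lam G))"
proof (induction k)
 case 0
 show ?case by (simp, rule depends_on_mono[OF rhs_depends]) (auto simp: KK_def)
next
 case (Suc k)
 then show ?case using Dt_depends[OF Suc.IH] by simp
qed

lemma cX_WV:
 assumes p: "p \<in> S" and z: "z \<in> KK N l" and y: "y \<in> {jW N, jV N}"
 shows "cX z (p(y := s)) = cX z p"
proof (cases z)
 case (jV k)
 have k: "k < N" using z by (simp add: jV KK_simps)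
 have "(Dt lam G ^^ k) (rhs lam G) (p(y := s)) = (Dt lam G ^^ k) (rhs lam G) p"
  by (rule slice_invariant[OF Dt_rhs_depends p S_upd[OF p]]) (use y k in \<open>auto simp: KK_simps\<close>)
 then show ?thesis using y k by (auto simp: cX_def jV)
qed (use y z in \<open>auto simp: cX_def KK_simps\<close>)

lemma cY_cT: "cX z q = cX z p ==> q (jZ 0) = p (jZ 0) ==> cY z q - cY z p = cT z q - cT z p"
 by (simp add: cY_def)

lemma cT_WV:
 assumes p: "p \<in> S" and z: "z \<in> KK (Suc N) l" and y: "y = (if w then jW (Suc N) else jV (Suc N))"
 shows "cT z (p(y := s)) - cT z p = (if z = (if w then jW N else jV N) then s - p y else 0)"
proof (cases z)
 case (jZ i)
 have "z_t lam G i (p(y := s)) = z_t lam G i p"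
  by (rule z_t_low[OF p _ S_upd[OF p]]) (use y in auto)
 then show ?thesis using y by (auto simp: cT_def jZ)
qed (use y z in \<open>auto simp: cT_def KK_simps\<close>)

text \<open>\<open>Y\<close> sends the topmost \<open>jW N\<close> or \<open>jV N\<close> to the
  next one of its family, which occurs nowhere else in the equations. Non-isotropy of
  \<open>(f_11, f_21)\<close> removes the dependence, and the descent leaves no
  t-derivatives.\<close>

lemma reduce_WV:
 assumes box: "jet_box B" and s: "sff B a b c" and Q: "\<And>p. p \<in> B ==> II_F a b c p \<noteq> 0"
  and K: "depends_on (KK N l) B a" "depends_on (KK N l) B b" "depends_on (KK N l) B c"
 shows "depends_on (KK 0 l) B a \<and> depends_on (KK 0 l) B b \<and> depends_on (KK 0 l) B c"
 using K
proof (induction N)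
 case (Suc N)
 have z: "zero_sum {z} a p \<and> zero_sum {z} b p \<and> zero_sum {z} c p" if p: "p \<in> B" and zz: "z \<in> {jW N, jV N}" for z p
 proof -
  obtain w where zw: "z = (if w then jW N else jV N)" using zz by (cases "z = jW N") (rule that[of True], simp, rule that[of False], simp)
  have pS: "p \<in> S" using p sffD(2)[OF s] by blast
  define y where "y = (if w then jW (Suc N) else jV (Suc N))"
  show ?thesis
  proof (rule codazzi_reduce[OF s KK_finite Suc.prems _ _ p])
   show "y \<notin> KK (Suc N) l" "y \<notin> {jZ 0, jZ 1, jZ 2}" "{z} \<subseteq> KK (Suc N) l" using zw by (auto simp: y_def KK_simps)
   have X: "cX x (p(y := s)) = cX x p" if "x \<in> KK (Suc N) l" for s x
    by (rule cX_WV[OF pS that]) (simp add: y_def)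
   have "cY x (p(y := s)) - cY x p = (if x \<in> {z} then s - p y else 0)" if "x \<in> KK (Suc N) l" for s x
    using cY_cT[OF X[OF that]] cT_WV[OF pS that y_def] zw by (simp add: y_def)
   with X Q[OF p] show "(II_F a b c p \<noteq> 0 \<and> (\<forall>s x. x \<in> KK (Suc N) l \<longrightarrow> cX x (p(y := s)) = cX x p \<and>
    cY x (p(y := s)) - cY x p = (if x \<in> {z} then s - p y else 0))) \<or>
   (II_\<phi> a b c p \<noteq> 0 \<and> (\<forall>s x. x \<in> KK (Suc N) l \<longrightarrow> cY x (p(y := s)) = cY x p \<and>
    cX x (p(y := s)) - cX x p = (if x \<in> {z} then s - p y else 0)))" by blast
  qed
 qed
 have e: "KK (Suc N) l = {jW N, jV N} \<union> KK N l" by (auto simp: KK_def less_Suc_eq)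
 have "depends_on (KK N l) B F" if "depends_on (KK (Suc N) l) B F" "fs B F" "\<And>p z. p \<in> B ==> z \<in> {jW N, jV N} ==> zero_sum {z} F p" for F
 proof (rule jet_box_drop_set[OF box fs_Ck[OF that(2)]])
  show "finite {jW N, jV N}" "depends_on ({jW N, jV N} \<union> KK N l) B F" using that(1) e by simp_all
  show "pd z F p = 0" if "p \<in> B" "z \<in> {jW N, jV N}" for p z
   using \<open>\<And>p z. p \<in> B ==> z \<in> {jW N, jV N} ==> zero_sum {z} F p\<close>[OF that] by (simp add: zero_sum_def)
 qed
 from Suc.IH[OF this[OF Suc.prems(1) sffD(3)[OF s]] this[OF Suc.prems(2) sffD(4)[OF s]] this[OF Suc.prems(3) sffD(5)[OF s]]] z
 show ?case by blast
qed simp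

text \<open>Once no t-derivatives remain in \<open>a, b, c\<close>, the variables \<open>u_t\<close>
  and \<open>u_xt\<close> occur only through the t-derivatives of the \<open>z_k\<close>, with
  coefficient 1 at even and at odd \<open>k\<close> respectively.\<close>

lemma parity_sums:
 fixes w :: bool
 assumes s: "sff B a b c" and Q: "\<And>p. p \<in> B ==> II_F a b c p \<noteq> 0"
  and K: "depends_on (KK 0 l) B a" "depends_on (KK 0 l) B b" "depends_on (KK 0 l) B c" and p: "p \<in> B"
 defines "Z \<equiv> jZ ` {k \<in> {..l}. even k = w}"
 shows "zero_sum Z a p \<and> zero_sum Z b p \<and> zero_sum Z c p"
proof -
 have pS: "p \<in> S" using p sffD(2)[OF s] by blast
 define y where "y = (if w then jW 0 else jV 0)"
 show ?thesis
 proof (rule codazzi_reduce[OF s KK_finite K _ _ p])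
  show "y \<notin> KK 0 l" "y \<notin> {jZ 0, jZ 1, jZ 2}" "Z \<subseteq> KK 0 l" by (auto simp: y_def KK_def Z_def)
  have X: "cX x (p(y := s)) = cX x p" if "x \<in> KK 0 l" for s x
   by (rule cX_WV[OF pS that]) (simp add: y_def)
  have "cT x (p(y := s)) - cT x p = (if x \<in> Z then s - p y else 0)" if "x \<in> KK 0 l" for s x
  proof (cases x)
   case (jZ i)
   then show ?thesis using z_t_W[OF pS y_def, of i s] that by (auto simp: cT_def Z_def KK_simps)
  qed (use that in \<open>auto simp: cT_def Z_def KK_simps\<close>)
  then have "cY x (p(y := s)) - cY x p = (if x \<in> Z then s - p y else 0)" if "x \<in> KK 0 l" for s x
   using cY_cT[OF X[OF that]] that by (simp add: y_def)
  with X Q[OF p] show "(II_F a b c p \<noteq> 0 \<and> (\<forall>s x. x \<in> KK 0 l \<longrightarrow> cX x (p(y := s)) = cX x p \<and>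
    cY x (p(y := s)) - cY x p = (if x \<in> Z then s - p y else 0))) \<or>
   (II_\<phi> a b c p \<noteq> 0 \<and> (\<forall>s x. x \<in> KK 0 l \<longrightarrow> cY x (p(y := s)) = cY x p \<and>
    cX x (p(y := s)) - cX x p = (if x \<in> Z then s - p y else 0)))" by blast
 qed
qed

text \<open>\<open>X\<close> sends the top variable \<open>z_(l+1)\<close> to
  \<open>z_(l+2)\<close>, while in \<open>Y\<close> the term \<open>- lam u z_(l+2)\<close> of its
  t-derivative cancels. The descent stops at \<open>z_1\<close>, because the moved variable must lie
  beyond the \<open>z_2\<close> of the frame.\<close>

lemma reduce_Z:
 assumes box: "jet_box B" and s: "sff B a b c" and Q: "\<And>p. p \<in> B ==> II_\<phi> a b c p \<noteq> 0"
  and K: "depends_on (KK 0 l) B a" "depends_on (KK 0 l) B b" "depends_on (KK 0 l) B c"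
 shows "depends_on (KK 0 1) B a \<and> depends_on (KK 0 1) B b \<and> depends_on (KK 0 1) B c"
 using K
proof (induction l)
 case 0
 have "KK 0 0 \<subseteq> KK 0 1" by (auto simp: KK_def)
 then show ?case using 0 depends_on_mono by blast
next
 case (Suc l)
 show ?case
 proof (cases "l = 0")
  case True
  then show ?thesis using Suc.prems by simp
 next
  case False
  define y where "y = jZ (Suc (Suc l))"
  have z: "zero_sum {jZ (Suc l)} a p \<and> zero_sum {jZ (Suc l)} b p \<and> zero_sum {jZ (Suc l)} c p" if p: "p \<in> B" for p
  proof -
   have pS: "p \<in> S" using p sffD(2)[OF s] by blast
   have pyS: "p(y := s) \<in> S" for s by (rule S_upd[OF pS]) (use False in \<open>auto simp: y_def\<close>)
   show ?thesis
   proof (rule codazzi_reduce[OF s KK_finite Suc.prems _ _ p])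
    show "y \<notin> KK 0 (Suc l)" "y \<notin> {jZ 0, jZ 1, jZ 2}" "{jZ (Suc l)} \<subseteq> KK 0 (Suc l)" using False by (auto simp: y_def KK_def)
    have X: "cX x (p(y := s)) - cX x p = (if x \<in> {jZ (Suc l)} then s - p y else 0)" if "x \<in> KK 0 (Suc l)" for s x
     using that by (cases x) (auto simp: cX_def y_def KK_simps)
    have T: "cT x (p(y := s)) - cT x p = (if x \<in> {jZ (Suc l)} then - lam * p (jZ 0) * (s - p y) else 0)" if "x \<in> KK 0 (Suc l)" for s x
    proof (cases x)
     case (jZ i)
     show ?thesis
     proof (cases "i = Suc l")
      case True
      then show ?thesis using z_t_top[OF pS, of i s] False by (simp add: cT_def jZ y_def)
     next
      case i: False
      have "z_t lam G i (p(y := s)) = z_t lam G i p"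
       by (rule z_t_low[OF pS _ pyS]) (use i jZ that in \<open>auto simp: y_def KK_simps\<close>)
      then show ?thesis using i by (simp add: cT_def jZ)
     qed
    qed (use that in \<open>auto simp: cT_def KK_simps\<close>)
    have z0: "(p(y := s)) (jZ 0) = p (jZ 0)" for s by (simp add: y_def)
    have Y: "cY x (p(y := s)) = cY x p" if "x \<in> KK 0 (Suc l)" for s x
    proof -
     have "cY x (p(y := s)) - cY x p = (cT x (p(y := s)) - cT x p) + lam * p (jZ 0) * (cX x (p(y := s)) - cX x p)"
      unfolding cY_def z0 by (simp add: algebra_simps)
     also have "\<dots> = 0" unfolding X[OF that] T[OF that] by simp
     finally show ?thesis by simp
    qed
    show "(II_F a b c p \<noteq> 0 \<and> (\<forall>s x. x \<in> KK 0 (Suc l) \<longrightarrow> cX x (p(y := s)) = cX x p \<and>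
     cY x (p(y := s)) - cY x p = (if x \<in> {jZ (Suc l)} then s - p y else 0))) \<or>
    (II_\<phi> a b c p \<noteq> 0 \<and> (\<forall>s x. x \<in> KK 0 (Suc l) \<longrightarrow> cY x (p(y := s)) = cY x p \<and>
     cX x (p(y := s)) - cX x p = (if x \<in> {jZ (Suc l)} then s - p y else 0)))" using X Y Q[OF p] by blast
   qed
  qed
  have e: "KK 0 (Suc l) = {jZ (Suc l)} \<union> KK 0 l" by (auto simp: KK_def atMost_Suc)
  have "depends_on (KK 0 l) B F" if "depends_on (KK 0 (Suc l)) B F" "fs B F" "\<And>p. p \<in> B ==> zero_sum {jZ (Suc l)} F p" for F
   
  proof (rule jet_box_drop_set[OF box fs_Ck[OF that(2)]])
   show "finite {jZ (Suc l)}" "depends_on ({jZ (Suc l)} \<union> KK 0 l) B F" using that(1) e by simp_all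
   show "pd z F p = 0" if "p \<in> B" "z \<in> {jZ (Suc l)}" for p z
    using \<open>\<And>p. p \<in> B ==> zero_sum {jZ (Suc l)} F p\<close>[OF that(1)] that(2) by (simp add: zero_sum_def)
  qed
  from Suc.IH[OF this[OF Suc.prems(1) sffD(3)[OF s]] this[OF Suc.prems(2) sffD(4)[OF s]] this[OF Suc.prems(3) sffD(5)[OF s]]] z
  show ?thesis by blast
 qed
qed

lemma sff_finite_order:
 assumes box: "jet_box B" and s: "sff B a b c" and Q: "\<And>p. p \<in> B ==> II_F a b c p \<noteq> 0"
 shows "\<exists>l. depends_on (KK 0 l) B a \<and> depends_on (KK 0 l) B b \<and> depends_on (KK 0 l) B c"
proof -
 obtain K1 K2 K3 where K: "finite K1" "depends_on K1 B a" "finite K2" "depends_on K2 B b" "finite K3" "depends_on K3 B c"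
  using sffD(3-5)[OF s] unfolding fs_def by blast
 obtain N l where N: "K1 \<union> K2 \<union> K3 \<subseteq> KK N l" using KK_exhaust[of "K1 \<union> K2 \<union> K3"] K by auto
 have "depends_on (KK N l) B a" "depends_on (KK N l) B b" "depends_on (KK N l) B c"
  using N by (intro depends_on_mono[OF K(2)] depends_on_mono[OF K(4)] depends_on_mono[OF K(6)]; auto)+
 from reduce_WV[OF box s Q this] show ?thesis by blast
qed

text \<open>With only \<open>z_0\<close> and \<open>z_1\<close> left, each parity class has a single
  member, so the parity sums are the remaining derivatives themselves.\<close>

lemma universal_box:
 assumes box: "jet_box B" and s: "sff B a b c"
  and Q: "\<And>p. p \<in> B ==> II_F a b c p \<noteq> 0" "\<And>p. p \<in> B ==> II_\<phi> a b c p \<noteq> 0"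
 shows "depends_on {jX, jT} B a \<and> depends_on {jX, jT} B b \<and> depends_on {jX, jT} B c"
proof -
 obtain l where l: "depends_on (KK 0 l) B a" "depends_on (KK 0 l) B b" "depends_on (KK 0 l) B c"
  using sff_finite_order[OF box s Q(1)] by blast
 have K: "depends_on (KK 0 1) B a" "depends_on (KK 0 1) B b" "depends_on (KK 0 1) B c"
  using reduce_Z[OF box s Q(2) l] by auto
 have Z: "jZ ` {k \<in> {..1}. even k = True} = {jZ 0}" "jZ ` {k \<in> {..1}. even k = False} = {jZ 1}"
  by (auto simp: le_Suc_eq)
 have "depends_on {jX, jT} B F" if "depends_on (KK 0 1) B F" "fs B F" "\<And>p. p \<in> B ==> zero_sum {jZ 0} F p" "\<And>p. p \<in> B ==> zero_sum {jZ 1} F p" for F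
 proof (rule jet_box_drop_set[OF box fs_Ck[OF that(2)], of "{jZ 0, jZ 1}"])
  have "KK 0 1 = {jZ 0, jZ 1} \<union> {jX, jT}" by (auto simp: KK_def le_Suc_eq)
  then show "depends_on ({jZ 0, jZ 1} \<union> {jX, jT}) B F" using that(1) by simp
  show "pd y F p = 0" if "p \<in> B" "y \<in> {jZ 0, jZ 1}" for p y
   using \<open>p \<in> B ==> zero_sum {jZ 0} F p\<close> \<open>p \<in> B ==> zero_sum {jZ 1} F p\<close> that by (auto simp: zero_sum_def)
 qed simp
 note T = this
 show ?thesis
  using T[OF K(1) sffD(3)[OF s]] T[OF K(2) sffD(4)[OF s]] T[OF K(3) sffD(5)[OF s]]
   parity_sums[OF s Q(1) K, where w = True, unfolded Z] parity_sums[OF s Q(1) K, where w = False, unfolded Z] by simp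
qed

end

section \<open>Degenerate second fundamental forms\<close>

lemma derivation_comb:
 assumes "open B" "p \<in> B" "fs B u" "fs B v" "fs B w" "fs B z"
 shows "derivation k (\<lambda>p. u p * v p + w p * z p) p = derivation k u p * v p + u p * derivation k v p + (derivation k w p * z p + w p * derivation k z p)"
 using assms by (simp add: derivation_add[OF assms(1,2)] derivation_mult[OF assms(1,2)] fs_mult)

lemma derivation_lin:
 assumes "open B" "p \<in> B" "fs B F" "fs B H"
 shows "derivation k (\<lambda>p. x * F p + y * H p) p = x * derivation k F p + y * derivation k H p"
 using derivation_comb[OF assms(1,2) fs_const[OF assms(1)] assms(3) fs_const[OF assms(1)] assms(4), of k x y] by (simp add: derivation_const)

lemma fs_lin: "open B ==> fs B F ==> fs B H ==> fs B (\<lambda>p. x * F p + y * H p)"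
 by (intro fs_add fs_mult fs_const)

lemma fs_comb: "open B ==> fs B u ==> fs B v ==> fs B w ==> fs B z ==> fs B (\<lambda>p. u p * v p + w p * z p)"
 by (intro fs_add fs_mult)

lemma nonzero_box:
 assumes "open V" "fs V F" "p \<in> V" "F p \<noteq> 0"
 shows "\<exists>B. jet_box B \<and> B \<noteq> {} \<and> B \<subseteq> V \<and> (\<forall>q\<in>B. F q \<noteq> 0)"
 using jet_box_exists[OF fs_open_nonzero[OF assms(1,2)], of p] assms(3,4) by blast

context pss_jets
begin

text \<open>As \<open>h'\<close> never vanishes, \<open>f_11\<close> is nonconstant on every
  nonempty open set, so an affine expression in it vanishes only with both coefficients.\<close>

lemma frame_zero:
 assumes "open B" "B \<noteq> {}" "B \<subseteq> S" "i \<in> {1, 2, 3}" "\<And>p. p \<in> B ==> f i 1 p = 0"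
 shows "\<mu> i = 0" "\<eta> i = 0"
proof -
 obtain p where p: "p \<in> B" "p \<in> S" using assms(2,3) by blast
 have "pd (jZ 0) (f i 1) p = 0" by (rule pd_zero_fun[OF assms(1) p(1) assms(5)])
 then show m: "\<mu> i = 0" using f1_derivatives(3)[OF p(2) assms(4)] h'_nonzero[OF p(2)] by simp
 show "\<eta> i = 0" using C[OF assms(4) p(2)] assms(5)[OF p(1)] m by simp
qed

text \<open>The \<open>f_i1\<close> are functions of \<open>u - u_xx\<close>, so the rigidity of
  total derivatives applies to constant combinations of them.\<close>

lemma frame_s_function:
 assumes B: "open B" "B \<subseteq> S" and H: "fs B H" "depends_on {jZ 0, jZ 1} B H"
  and eq: "\<And>p. p \<in> B ==> X H p = x * f 1 1 p + y * f 2 1 p + z * f 3 1 p" and p: "p \<in> B"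
 shows "x * f 1 1 p + y * f 2 1 p + z * f 3 1 p = 0" "pd (jZ 0) H p = 0" "pd (jZ 1) H p = 0"
proof -
 define M where "M p = x * f 1 1 p + y * f 2 1 p + z * f 3 1 p" for p
 have fF: "Ck k S (f i 1)" if "i \<in> {1, 2, 3}" for i k by (rule f_smooth[OF that I3(4)])
 have CM: "Ck k S M" for k unfolding M_def[abs_def] by (intro Ck_add Ck_mult Ck_const S_open fF I3)
 have pdM: "pd v M p = x * pd v (f 1 1) p + y * pd v (f 2 1) p + z * pd v (f 3 1) p" if p: "p \<in> S" for v p
  unfolding M_def[abs_def] by (rule pder_pd, (rule pder_intros pder_Ck[OF p] fF I3)+) simp
 have M1: "pd (jZ 1) M p = 0" "pd (jZ 0) M p + pd (jZ 2) M p = 0" if "p \<in> B" for p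
 proof -
  have p: "p \<in> S" using that B(2) by blast
  note d = f1_derivatives(1,2)[OF p I3(1)] f1_derivatives(1,2)[OF p I3(2)] f1_derivatives(1,2)[OF p I3(3)]
  show "pd (jZ 1) M p = 0" "pd (jZ 0) M p + pd (jZ 2) M p = 0" unfolding pdM[OF p] d by simp_all
 qed
 have HM: "pd (jZ 0) H p * p (jZ 1) + pd (jZ 1) H p * p (jZ 2) = M p" if "p \<in> B" for p
  using eq[OF that] X_low(1)[OF B(1) that H(2)] by (simp add: M_def)
 from total_derivative_of_s[OF B(1) fs_Ck[OF H(1)] H(2) Ck_subset[OF CM B(2)] M1 HM p]
 show "x * f 1 1 p + y * f 2 1 p + z * f 3 1 p = 0" "pd (jZ 0) H p = 0" "pd (jZ 1) H p = 0" by (simp_all add: M_def)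
qed

text \<open>The polar angle of \<open>(A, A')\<close> is a function of \<open>u, u_x\<close> whose total derivative is \<open>- f\<^sub>3\<^sub>1\<close>.\<close>

lemma rotation_zero:
 assumes B: "open B" "B \<noteq> {}" "B \<subseteq> S" and A: "fs B A" "depends_on {jZ 0, jZ 1} B A" and A': "fs B A'" "depends_on {jZ 0, jZ 1} B A'"
  and eq: "\<And>p. p \<in> B ==> X A p = f 3 1 p * A' p" "\<And>p. p \<in> B ==> X A' p = - f 3 1 p * A p"
  and nz: "\<And>p. p \<in> B ==> A p \<noteq> 0 \<or> A' p \<noteq> 0"
 shows "\<mu> 3 = 0 \<and> \<eta> 3 = 0"
proof (cases "\<forall>p\<in>B. A p = 0")
 case True
 have "f 3 1 p = 0" if p: "p \<in> B" for p
 proof -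
  have "X A p = 0" by (rule derivation_zero[OF B(1) p]) (use True in blast)
  then show ?thesis using eq(1)[OF p] nz[OF p] True p by simp
 qed
 then show ?thesis using frame_zero[OF B I3(3)] by blast
next
 case False
 \<comment> \<open>The angle is taken as an arctangent of the quotient, hence only where
   \<open>A\<close> is nonzero.\<close>
 define B' where "B' = {p \<in> B. A p \<noteq> 0}"
 have B': "open B'" "B' \<noteq> {}" "B' \<subseteq> B" unfolding B'_def using fs_open_nonzero[OF B(1) A(1)] False by auto
 have BS: "B' \<subseteq> S" using B'(3) B(3) by blast
 have nA: "A p \<noteq> 0" if "p \<in> B'" for p using that by (simp add: B'_def)
 note fA = fs_subset[OF A(1) B'(3)] fs_subset[OF A'(1) B'(3)]
 define H where "H p = arctan (A' p / A p)" for p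
 have q: "fs B' (\<lambda>p. A' p / A p)" by (rule fs_divide[OF B'(1) fA(2,1) nA])
 have fH: "fs B' H" unfolding H_def[abs_def] by (rule fs_arctan[OF B'(1) q])
 have dH: "depends_on {jZ 0, jZ 1} B' H" unfolding H_def[abs_def]
  by (rule depends_on_op2[OF depends_on_mono[OF A(2) order_refl B'(3)] depends_on_mono[OF A'(2) order_refl B'(3)], of "\<lambda>a b. arctan (b / a)"])
 have XH: "X H p = 0 * f 1 1 p + 0 * f 2 1 p + (-1) * f 3 1 p" if p: "p \<in> B'" for p
 proof -
  have pB: "p \<in> B" using p B'(3) by blast
  have d: "X (\<lambda>p. A' p / A p) p = (X A' p * A p - A' p * X A p) / (A p * A p)"
   by (rule derivation_divide[OF B'(1) p fA(2,1)]) (rule nA)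
  have "X H p = (X A' p * A p - A' p * X A p) / (A p * A p) / (1 + (A' p / A p)\<^sup>2)"
   unfolding H_def[abs_def] derivation_arctan[OF B'(1) p q] d ..
  also have "\<dots> = - (f 3 1 p * ((A p)\<^sup>2 + (A' p)\<^sup>2)) / ((A p)\<^sup>2 * (1 + (A' p / A p)\<^sup>2))"
   unfolding eq(1)[OF pB] eq(2)[OF pB] by (simp add: power2_eq_square algebra_simps)
  also have "(A p)\<^sup>2 * (1 + (A' p / A p)\<^sup>2) = (A p)\<^sup>2 + (A' p)\<^sup>2" using nA[OF p] by (simp add: field_simps power2_eq_square)
  also have "- (f 3 1 p * ((A p)\<^sup>2 + (A' p)\<^sup>2)) / ((A p)\<^sup>2 + (A' p)\<^sup>2) = - f 3 1 p" using nA[OF p] by (simp add: sum_power2_eq_zero_iff)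
  finally show ?thesis by simp
 qed
 have "f 3 1 p = 0" if "p \<in> B'" for p using frame_s_function(1)[OF B'(1) BS fH dH XH that] by simp
 then show ?thesis using frame_zero[OF B'(1,2) BS I3(3)] by blast
qed

text \<open>\<open>\<phi>_1\<close> and \<open>\<phi>_2\<close> are constant on a box, and with
  \<open>f_31 = 0\<close> the third structure equation makes the total derivative of
  \<open>\<phi>_3\<close> a constant combination of \<open>f_11\<close> and \<open>f_21\<close>.
  Rigidity makes it zero, but it is the coefficient of \<omega>_1 \<and> \<omega>_2.\<close>

lemma no_constant_frame:
 assumes B: "open B" "B \<noteq> {}" "B \<subseteq> S" and F3: "\<mu> 3 = 0" "\<eta> 3 = 0"
  and \<phi>: "\<And>p. p \<in> B ==> X (\<phi> 1) p = 0" "\<And>p. p \<in> B ==> X (\<phi> 2) p = 0"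
 shows False
proof -
 obtain p0 where "p0 \<in> B" using B(2) by blast
 then obtain D where D: "jet_box D" "p0 \<in> D" "D \<subseteq> B" using jet_box_exists[OF B(1)] by blast
 have DS: "D \<subseteq> S" using D(3) B(3) by blast
 note o = jet_box_open[OF D(1)]
 have dep: "depends_on {jZ 0, jZ 1} D (\<phi> i)" if "i \<in> {1, 2, 3}" for i by (rule depends_on_mono[OF \<phi>_depends[OF that] order_refl DS])
 have const: "\<phi> i p = \<phi> i p0" if i: "i \<in> {1, 2}" and p: "p \<in> D" for i p
 proof (rule jet_box_constant[OF D(1) _ _ p D(2)])
  have i3: "i \<in> {1, 2, 3}" using i by blast
  show "fs D (\<phi> i)" by (rule fs_frame(2)[OF i3 DS])
  fix q y assume q: "q \<in> D"
  have "X (\<phi> i) q = 0 * f 1 1 q + 0 * f 2 1 q + 0 * f 3 1 q" if "q \<in> D" for q using \<phi> that D(3) i by auto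
  note z = frame_s_function[OF o DS fs_frame(2)[OF i3 DS] dep[OF i3] this q]
  have "pd y (\<phi> i) q = 0" if "y \<notin> {jZ 0, jZ 1}" by (rule pd_zero_outside[OF o dep[OF i3] q that])
  then show "pd y (\<phi> i) q = 0" using z by blast
 qed
 have "X (\<phi> 3) p = \<phi> 2 p0 * f 1 1 p + (- \<phi> 1 p0) * f 2 1 p + 0 * f 3 1 p" if p: "p \<in> D" for p
 proof -
  have pS: "p \<in> S" using p DS by blast
  have "X (\<phi> 3) p = R 3 p" using Y_f1[OF pS I3(3)] XY_f1(2)[OF pS I3(3)] C[OF I3(3) pS] F3 by simp
  then show ?thesis using const[OF _ p, of 1] const[OF _ p, of 2] by (simp add: R_\<phi> algebra_simps)
 qed
 from frame_s_function(1)[OF o DS fs_frame(2)[OF I3(3) DS] dep[OF I3(3)] this D(2)]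
 have "R 3 p0 = 0" by (simp add: R_\<phi> algebra_simps)
 then show False using Delta12[of p0] D(2) DS by (auto simp: R_def)
qed

lemma no_zero_\<phi>3:
 assumes B: "open B" "p \<in> B" "B \<subseteq> S" and F3: "\<mu> 3 = 0" "\<eta> 3 = 0" and z: "\<And>p. p \<in> B ==> \<phi> 3 p = 0"
 shows False
proof -
 have pS: "p \<in> S" using B by blast
 have "X (\<phi> 3) p = 0" by (rule derivation_zero[OF B(1,2) z])
 then have "R 3 p = 0" using Y_f1[OF pS I3(3)] XY_f1(2)[OF pS I3(3)] C[OF I3(3) pS] F3 by simp
 then show False using Delta12[OF pS] by (simp add: R_def)
qed

lemma \<phi>_nonzero: "p \<in> S ==> \<phi> 1 p \<noteq> 0 \<or> \<phi> 2 p \<noteq> 0"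
 using Delta12[of p] by (auto simp: Delta_\<phi>)

section \<open>Second fundamental forms isotropic on the x-direction\<close>

lemma frame_agree:
 assumes "p \<in> S" "q \<in> S" "\<And>y. y \<in> {jZ 0, jZ 1, jZ 2} ==> p y = q y" and i: "i \<in> {1, 2, 3}"
 shows "f i 1 p = f i 1 q" "\<phi> i p = \<phi> i q" "X (\<phi> i) p = X (\<phi> i) q" "h' p = h' q"
proof -
 have e: "F p = F q" if "depends_on {jZ 0, jZ 1} S F" for F
  by (rule depends_onD[OF that assms(1,2)]) (use assms(3) in blast)
 show "f i 1 p = f i 1 q" by (rule depends_onD[OF f_depends_2[OF i I3(4)] assms(1,2)]) (use assms(3) in blast)
 show "\<phi> i p = \<phi> i q" by (rule e[OF \<phi>_depends[OF i]])
 have "p (jZ 1) = q (jZ 1)" "p (jZ 2) = q (jZ 2)" using assms(3) by blast+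
 then show "X (\<phi> i) p = X (\<phi> i) q"
  unfolding X_low(1)[OF S_open assms(1) \<phi>_depends[OF i]] X_low(1)[OF S_open assms(2) \<phi>_depends[OF i]]
  using e[OF depends_on_pd[OF S_open \<phi>_depends[OF i]]] by simp
 show "h' p = h' q" by (rule depends_onD[OF depends_on_pd[OF S_open f_depends_2[OF I3(1,4)]] assms(1,2)]) (use assms(3) in blast)
qed

text \<open>A symmetric form of determinant -1 maps an isotropic vector to plus or minus its
  rotation by a right angle, and the sign \<open>t\<close> is constant on a box. Subtracting
  \<open>t\<close> times the rotated vector from the image of \<open>(\<phi>_1, \<phi>_2)\<close>
  cancels the inhomogeneous terms of the Codazzi equations, so that (\<alpha>, \<beta>) rotates with
  velocity \<open>f_31\<close>.\<close>

lemma isotropic_data: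
 assumes box: "jet_box B" "B \<noteq> {}" and s: "sff B a b c" and Q: "\<And>p. p \<in> B ==> II_F a b c p = 0" and F1: "\<And>p. p \<in> B ==> f 1 1 p \<noteq> 0"
 shows "\<exists>t \<alpha> \<beta>. t\<^sup>2 = 1 \<and> fs B \<alpha> \<and> fs B \<beta> \<and> (\<forall>p\<in>B. X \<alpha> p = f 3 1 p * \<beta> p \<and> X \<beta> p = - f 3 1 p * \<alpha> p \<and>
  \<alpha> p * f 1 1 p + \<beta> p * f 2 1 p = - 2 * t * (f 1 1 p * \<phi> 2 p - f 2 1 p * \<phi> 1 p))"
proof -
 note o = sffD(1)[OF s] and fa = sffD(3-5)[OF s]
 note fr = fs_frame[OF I3(1) sffD(2)[OF s]] fs_frame[OF I3(2) sffD(2)[OF s]]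
 \<comment> \<open>A quotient of smooth functions, so smoothness is visible; the Gauss equation
   gives it square 1, hence zero gradient.\<close>
 define \<tau> where "\<tau> p = (b p * f 1 1 p + c p * f 2 1 p) / f 1 1 p" for p
 have \<tau>F: "b p * f 1 1 p + c p * f 2 1 p = \<tau> p * f 1 1 p" if "p \<in> B" for p using F1[OF that] by (simp add: \<tau>_def)
 have \<tau>1: "(\<tau> p)\<^sup>2 = 1" if p: "p \<in> B" for p
 proof -
  have "(\<tau> p * f 1 1 p)\<^sup>2 = ((b p)\<^sup>2 - a p * c p) * (f 1 1 p)\<^sup>2 + c p * II_F a b c p"
   unfolding \<tau>F[OF p, symmetric] II_F_def by (simp add: power2_eq_square algebra_simps)
  also have "(b p)\<^sup>2 - a p * c p = 1" using sffD(6)[OF s p] by simp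
  finally have "(\<tau> p * f 1 1 p)\<^sup>2 = (f 1 1 p)\<^sup>2" using Q[OF p] by simp
  then show ?thesis using F1[OF p] by (simp add: power_mult_distrib)
 qed
 have f\<tau>: "fs B \<tau>" unfolding \<tau>_def[abs_def] by (rule fs_divide[OF o fs_comb[OF o fa(2) fr(1) fa(3) fr(3)] fr(1) F1])
 have pd\<tau>: "pd y \<tau> p = 0" if p: "p \<in> B" for y p
 proof -
  have "pd y (\<lambda>p. (\<tau> p)\<^sup>2 - 1) p = 0" by (rule pd_zero_fun[OF o p]) (simp add: \<tau>1)
  moreover have "pd y (\<lambda>p. (\<tau> p)\<^sup>2 - 1) p = 2 * \<tau> p * pd y \<tau> p"
   by (rule pder_pd, (rule pder_intros pder_Ck[OF p] fs_Ck[OF f\<tau>])+) simp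
  ultimately show ?thesis using \<tau>1[OF p] by auto
 qed
 obtain p0 where p0: "p0 \<in> B" using box(2) by blast
 have const: "\<tau> p = \<tau> p0" if "p \<in> B" for p
  by (rule jet_box_constant[OF box(1) f\<tau> _ that p0]) (rule pd\<tau>)
 define t where "t = - \<tau> p0"
 have t2: "t\<^sup>2 = 1" using \<tau>1[OF p0] by (simp add: t_def)
 have t1: "b p * f 1 1 p + c p * f 2 1 p = - t * f 1 1 p" if "p \<in> B" for p
  unfolding \<tau>F[OF that] const[OF that] t_def by simp
 have t3: "a p * f 1 1 p + b p * f 2 1 p = t * f 2 1 p" if p: "p \<in> B" for p
 proof -
  have "f 1 1 p * (a p * f 1 1 p + b p * f 2 1 p) = II_F a b c p - f 2 1 p * (b p * f 1 1 p + c p * f 2 1 p)"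
   unfolding II_F_def by (simp add: power2_eq_square algebra_simps)
  also have "\<dots> = f 1 1 p * (t * f 2 1 p)" unfolding Q[OF p] t1[OF p] by simp
  finally show ?thesis using F1[OF p] by simp
 qed
 define \<alpha> where "\<alpha> p = (a p * \<phi> 1 p + b p * \<phi> 2 p) - t * \<phi> 2 p" for p
 define \<beta> where "\<beta> p = (b p * \<phi> 1 p + c p * \<phi> 2 p) - (- t) * \<phi> 1 p" for p
 note f\<pi> = fs_comb[OF o fa(1) fr(2) fa(2) fr(4)] fs_comb[OF o fa(2) fr(2) fa(3) fr(4)]
 note ft = fs_mult[OF o fs_const[OF o] fr(4), of t] fs_mult[OF o fs_const[OF o] fr(2), of "- t"]
 have fs: "fs B \<alpha>" "fs B \<beta>" unfolding \<alpha>_def[abs_def] \<beta>_def[abs_def] by (rule fs_diff[OF o f\<pi>(1) ft(1)], rule fs_diff[OF o f\<pi>(2) ft(2)])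
 have main: "X \<alpha> p = f 3 1 p * \<beta> p \<and> X \<beta> p = - f 3 1 p * \<alpha> p \<and>
  \<alpha> p * f 1 1 p + \<beta> p * f 2 1 p = - 2 * t * (f 1 1 p * \<phi> 2 p - f 2 1 p * \<phi> 1 p)" if p: "p \<in> B" for p
 proof (intro conjI)
  have pS: "p \<in> S" using p sffD(2)[OF s] by blast
  have c: "derivation k (\<lambda>p. x * F p) p = x * derivation k F p" if "fs B F" for k x F
   by (simp add: derivation_mult[OF o p fs_const[OF o] that] derivation_const)
  have X\<alpha>: "X \<alpha> p = X (\<lambda>p. a p * \<phi> 1 p + b p * \<phi> 2 p) p - t * X (\<phi> 2) p"
   unfolding \<alpha>_def[abs_def] derivation_diff[OF o p f\<pi>(1) ft(1)] c[OF fr(4)] ..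
  have X\<beta>: "X \<beta> p = X (\<lambda>p. b p * \<phi> 1 p + c p * \<phi> 2 p) p - (- t) * X (\<phi> 1) p"
   unfolding \<beta>_def[abs_def] derivation_diff[OF o p f\<pi>(2) ft(2)] c[OF fr(2)] ..
  have Y1: "Y (\<lambda>p. a p * f 1 1 p + b p * f 2 1 p) p = t * Y (f 2 1) p"
   unfolding c[OF fr(3), symmetric] by (rule derivation_cong[OF o p t3])
  have Y2: "Y (\<lambda>p. b p * f 1 1 p + c p * f 2 1 p) p = - t * Y (f 1 1) p"
   unfolding c[OF fr(1), symmetric] by (rule derivation_cong[OF o p t1])
  note e = codazzi_forms[OF s p, unfolded Y1 Y2 t1[OF p] t3[OF p] Y_f1[OF pS I3(1)] Y_f1[OF pS I3(2)] R_\<phi>]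
  show "X \<alpha> p = f 3 1 p * \<beta> p" using e(1) unfolding X\<alpha> \<beta>_def by (simp add: algebra_simps)
  show "X \<beta> p = - f 3 1 p * \<alpha> p" using e(2) unfolding X\<beta> \<alpha>_def by (simp add: algebra_simps)
  have "\<alpha> p * f 1 1 p + \<beta> p * f 2 1 p = \<phi> 1 p * (a p * f 1 1 p + b p * f 2 1 p) + \<phi> 2 p * (b p * f 1 1 p + c p * f 2 1 p)
    - t * \<phi> 2 p * f 1 1 p + t * \<phi> 1 p * f 2 1 p"
   unfolding \<alpha>_def \<beta>_def by (simp add: algebra_simps)
  also have "\<dots> = - 2 * t * (f 1 1 p * \<phi> 2 p - f 2 1 p * \<phi> 1 p)" unfolding t1[OF p] t3[OF p] by (simp add: algebra_simps)
  finally show "\<alpha> p * f 1 1 p + \<beta> p * f 2 1 p = - 2 * t * (f 1 1 p * \<phi> 2 p - f 2 1 p * \<phi> 1 p)" .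
 qed
 show ?thesis
  by (rule exI[of _ t], rule exI[of _ \<alpha>], rule exI[of _ \<beta>]) (use t2 fs main in blast)
qed

lemma f2_affine: "p \<in> S ==> f 2 1 p = \<mu> 2 * f 1 1 p + \<eta> 2"
 using C[of 2 p] by simp

text \<open>\<open>(f_11, f_21)\<close> has the fixed direction \<open>(1, \<mu> 2)\<close>.
  Dividing the constraint by \<open>f_11\<close> identifies the component of (\<alpha>, \<beta>)
  along it with a combination \<open>A\<close> of \<open>\<phi>_1\<close>, \<open>\<phi>_2\<close>;
  \<open>A'\<close> is the orthogonal component. The pair rotates, and once \<open>A'\<close> is
  known to depend on \<open>u\<close>, \<open>u_x\<close> only, the polar angle argument
  applies.\<close>

lemma no_isotropic_proportional:
 assumes box: "jet_box B" "B \<noteq> {}" "B \<subseteq> S" and fs: "fs B \<alpha>" "fs B \<beta>" and t: "t\<^sup>2 = 1" and \<eta>: "\<eta> 2 = 0"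
  and F1: "\<And>p. p \<in> B ==> f 1 1 p \<noteq> 0"
  and eq: "\<And>p. p \<in> B ==> X \<alpha> p = f 3 1 p * \<beta> p" "\<And>p. p \<in> B ==> X \<beta> p = - f 3 1 p * \<alpha> p"
   "\<And>p. p \<in> B ==> \<alpha> p * f 1 1 p + \<beta> p * f 2 1 p = - 2 * t * (f 1 1 p * \<phi> 2 p - f 2 1 p * \<phi> 1 p)"
 shows False
proof -
 note o = jet_box_open[OF box(1)]
 have t0: "t \<noteq> 0" using t by auto
 have BS: "p \<in> S" if "p \<in> B" for p using that box(3) by blast
 note fr = fs_frame[OF I3(1) box(3)] fs_frame[OF I3(2) box(3)] fs_frame[OF I3(3) box(3)]
 have F2: "f 2 1 p = \<mu> 2 * f 1 1 p" if "p \<in> B" for p using f2_affine[OF BS[OF that]] \<eta> by simp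
 define A where "A p = (2 * t * \<mu> 2) * \<phi> 1 p + (- 2 * t) * \<phi> 2 p" for p
 define A' where "A' p = (- \<mu> 2) * \<alpha> p + 1 * \<beta> p" for p
 have \<alpha>': "1 * \<alpha> p + \<mu> 2 * \<beta> p = A p" if p: "p \<in> B" for p
 proof -
  have "f 1 1 p * (1 * \<alpha> p + \<mu> 2 * \<beta> p) = f 1 1 p * A p"
   using eq(3)[OF p] unfolding F2[OF p] A_def by (simp add: algebra_simps)
  then show ?thesis using F1[OF p] by simp
 qed
 have XA: "X A p = f 3 1 p * A' p" if p: "p \<in> B" for p
 proof -
  have "X A p = X (\<lambda>p. 1 * \<alpha> p + \<mu> 2 * \<beta> p) p" by (rule derivation_cong[OF o p \<alpha>'[symmetric]])
  also have "\<dots> = 1 * X \<alpha> p + \<mu> 2 * X \<beta> p" by (rule derivation_lin[OF o p fs])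
  also have "\<dots> = f 3 1 p * A' p" unfolding eq(1)[OF p] eq(2)[OF p] A'_def by (simp add: algebra_simps)
  finally show ?thesis .
 qed
 have XA': "X A' p = - f 3 1 p * A p" if p: "p \<in> B" for p
 proof -
  have "X A' p = (- \<mu> 2) * X \<alpha> p + 1 * X \<beta> p" unfolding A'_def[abs_def] by (rule derivation_lin[OF o p fs])
  also have "\<dots> = - f 3 1 p * (1 * \<alpha> p + \<mu> 2 * \<beta> p)" unfolding eq(1)[OF p] eq(2)[OF p] by (simp add: algebra_simps)
  finally show ?thesis unfolding \<alpha>'[OF p] .
 qed
 \<comment> \<open>The total derivative of \<open>A\<close> computed in two ways. Where
   \<open>f_31\<close> is nonzero this shows that \<open>A'\<close> involves no jet variable beyond
   \<open>u_xx\<close>.\<close>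
 have A'_formula: "f 3 1 p * A' p = - 2 * t * (f 1 1 p * \<phi> 3 p * (1 + (\<mu> 2)\<^sup>2) - f 3 1 p * (\<phi> 1 p + \<mu> 2 * \<phi> 2 p))" if p: "p \<in> B" for p
 proof -
  note S = BS[OF p]
  have X\<phi>: "X (\<phi> i) p = Y (f i 1) p + lam * p (jZ 1) * f i 1 p + R i p" if "i \<in> {1, 2, 3}" for i using Y_f1[OF S that] by simp
  have "f 3 1 p * A' p = (2 * t * \<mu> 2) * X (\<phi> 1) p + (- 2 * t) * X (\<phi> 2) p"
   unfolding XA[OF p, symmetric] A_def[abs_def] by (rule derivation_lin[OF o p fr(2,4)])
  also have "\<dots> = - 2 * t * (R 2 p - \<mu> 2 * R 1 p)"
   unfolding X\<phi>[OF I3(1)] X\<phi>[OF I3(2)] XY_f1(2)[OF S I3(1)] XY_f1(2)[OF S I3(2)] F2[OF p] \<mu>1 by (simp add: algebra_simps)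
  finally show ?thesis unfolding R_\<phi> F2[OF p] by (simp add: algebra_simps power2_eq_square)
 qed
 obtain p0 where p0: "p0 \<in> B" using box(2) by blast
 show False
 proof (cases "\<forall>p\<in>B. f 3 1 p = 0")
  case True
  have z: "\<phi> 3 p = 0" if p: "p \<in> B" for p
  proof -
   have "1 + (\<mu> 2)\<^sup>2 \<noteq> 0" using zero_le_power2[of "\<mu> 2"] by linarith
   then show ?thesis using A'_formula[OF p] True p F1[OF p] t0 by simp
  qed
  have m: "\<mu> 3 = 0" "\<eta> 3 = 0" by (rule frame_zero[OF o box(2,3) I3(3)], use True in blast)+
  show False by (rule no_zero_\<phi>3[OF o p0 box(3) m z])
 next
  case False
  then obtain p1 where p1: "p1 \<in> B" "f 3 1 p1 \<noteq> 0" by blast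
  obtain D where D: "jet_box D" "D \<noteq> {}" "D \<subseteq> B" "\<forall>q\<in>D. f 3 1 q \<noteq> 0"
   using nonzero_box[OF o fr(5) p1] by blast
  note oD = jet_box_open[OF D(1)]
  have DB: "p \<in> B" if "p \<in> D" for p using that D(3) by blast
  have A'2: "depends_on {jZ 0, jZ 1, jZ 2} D A'"
   unfolding depends_on_def
  proof (intro ballI impI)
   fix p q assume pq: "p \<in> D" "q \<in> D" and e: "\<forall>y\<in>{jZ 0, jZ 1, jZ 2}. p y = q y"
   have ag: "f i 1 p = f i 1 q" "\<phi> i p = \<phi> i q" if "i \<in> {1, 2, 3}" for i
    by (rule frame_agree[OF BS[OF DB[OF pq(1)]] BS[OF DB[OF pq(2)]] _ that], rule bspec[OF e], assumption)+
   have "f 3 1 q * A' p = f 3 1 q * A' q"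
    using A'_formula[OF DB[OF pq(1)]] A'_formula[OF DB[OF pq(2)]]
    unfolding ag(1)[OF I3(1)] ag(1)[OF I3(3)] ag(2)[OF I3(1)] ag(2)[OF I3(2)] ag(2)[OF I3(3)] by simp
   then show "A' p = A' q" using D(4) pq(2) by simp
  qed
  have A2: "depends_on {jZ 0, jZ 1} B A" unfolding A_def[abs_def]
   by (rule depends_on_op2[OF depends_on_mono[OF \<phi>_depends[OF I3(1)] order_refl box(3)] depends_on_mono[OF \<phi>_depends[OF I3(2)] order_refl box(3)],
      of "\<lambda>x y. (2 * t * \<mu> 2) * x + (- 2 * t) * y"])
  have fA': "fs B A'" unfolding A'_def[abs_def] by (rule fs_lin[OF o fs])
  have fA: "fs B A" unfolding A_def[abs_def] by (rule fs_lin[OF o fr(2,4)])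
  \<comment> \<open>This derivative is the coefficient of \<open>u_xxx\<close> in
    \<open>X A'\<close>, and \<open>X A' = - f_31 A\<close> contains no
    \<open>u_xxx\<close>.\<close>
  have z2: "pd (jZ 2) A' p = 0" if p: "p \<in> D" for p
  proof -
   obtain s where s: "s \<noteq> p (jZ 3)" "p(jZ 3 := s) \<in> D" by (rule slice_other[OF oD p])
   let ?q = "p(jZ 3 := s)"
   have ag: "f i 1 ?q = f i 1 p" "\<phi> i ?q = \<phi> i p" if "i \<in> {1, 2, 3}" for i
    by (rule frame_agree[OF BS[OF DB[OF s(2)]] BS[OF DB[OF p]] _ that], force)+
   have "X A' ?q = X A' p"
    unfolding XA'[OF DB[OF p]] XA'[OF DB[OF s(2)]] A_def ag(1)[OF I3(3)] ag(2)[OF I3(1)] ag(2)[OF I3(2)] ..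
   moreover have "pd y A' ?q = pd y A' p" for y
    by (rule depends_onD[OF depends_on_pd[OF oD A'2] s(2) p]) auto
   ultimately have "pd (jZ 2) A' p * s = pd (jZ 2) A' p * p (jZ 3)"
    unfolding X_low2(1)[OF oD p A'2] X_low2(1)[OF oD s(2) A'2] by simp
   then show ?thesis using s(1) by simp
  qed
  have A'1: "depends_on {jZ 0, jZ 1} D A'"
   by (rule jet_box_drop[OF D(1) fs_Ck[OF fs_subset[OF fA' D(3)]] _ z2], rule depends_on_mono[OF A'2]) auto
  have DS: "D \<subseteq> S" using D(3) box(3) by blast
  have "\<mu> 3 = 0 \<and> \<eta> 3 = 0"
  proof (rule rotation_zero[OF oD D(2) DS fs_subset[OF fA D(3)] depends_on_mono[OF A2 order_refl D(3)] fs_subset[OF fA' D(3)] A'1])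
   fix p assume p: "p \<in> D"
   show "X A p = f 3 1 p * A' p" "X A' p = - f 3 1 p * A p" by (rule XA[OF DB[OF p]], rule XA'[OF DB[OF p]])
   show "A p \<noteq> 0 \<or> A' p \<noteq> 0"
   proof (rule ccontr)
    assume n: "\<not> (A p \<noteq> 0 \<or> A' p \<noteq> 0)"
    have e: "\<alpha> p = - \<mu> 2 * \<beta> p" using \<alpha>'[OF DB[OF p]] n by simp
    have "(1 + (\<mu> 2)\<^sup>2) * \<beta> p = 0" using n unfolding A'_def e by (simp add: algebra_simps power2_eq_square)
    moreover have "1 + (\<mu> 2)\<^sup>2 \<noteq> 0" using zero_le_power2[of "\<mu> 2"] by linarith
    ultimately have "\<beta> p = 0" "\<alpha> p = 0" using e by simp_all
    then have "R 3 p = 0" using eq(3)[OF DB[OF p]] t0 by (simp add: R_\<phi>)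
    then show False using Delta12[OF BS[OF DB[OF p]]] by (simp add: R_def)
   qed
  qed
  then show False using p1 C[OF I3(3) BS[OF p1(1)]] by simp
 qed
qed

text \<open>The constraint leaves one free function \<open>v\<close>. Differentiating it shows that
  \<open>v\<close> times an expression affine in \<open>u_xxx\<close>, with nonzero coefficient
  \<open>\<eta> 2 * h'\<close>, equals a function of \<open>u\<close>, \<open>u_x\<close>,
  \<open>u_xx\<close>. A nonzero \<open>v\<close> would then depend on \<open>u_xxx\<close>, whereas
  the formula for \<open>X v\<close> excludes this. With \<open>v = 0\<close> the vector
  \<open>(\<phi>_1, \<phi>_2)\<close> itself rotates with velocity \<open>f_31\<close>.\<close>

lemma no_isotropic_general:
 assumes box: "jet_box B" "B \<noteq> {}" "B \<subseteq> S" and fs: "fs B \<alpha>" "fs B \<beta>" and t: "t\<^sup>2 = 1" and \<eta>: "\<eta> 2 \<noteq> 0"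
  and F1: "\<And>p. p \<in> B ==> f 1 1 p \<noteq> 0"
  and eq: "\<And>p. p \<in> B ==> X \<alpha> p = f 3 1 p * \<beta> p" "\<And>p. p \<in> B ==> X \<beta> p = - f 3 1 p * \<alpha> p"
   "\<And>p. p \<in> B ==> \<alpha> p * f 1 1 p + \<beta> p * f 2 1 p = - 2 * t * (f 1 1 p * \<phi> 2 p - f 2 1 p * \<phi> 1 p)"
 shows False
proof -
 note o = jet_box_open[OF box(1)]
 have t0: "t \<noteq> 0" using t by auto
 have BS: "p \<in> S" if "p \<in> B" for p using that box(3) by blast
 note fr = fs_frame[OF I3(1) box(3)] fs_frame[OF I3(2) box(3)] fs_frame[OF I3(3) box(3)]
 define v where "v p = \<beta> p - (2 * t) * \<phi> 1 p" for p
 define N where "N p = - 2 * t * f 1 1 p * (f 3 1 p * (\<phi> 1 p * f 1 1 p + \<phi> 2 p * f 2 1 p) + f 1 1 p * X (\<phi> 2) p - f 2 1 p * X (\<phi> 1) p)" for p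
 define E where "E p = f 3 1 p * ((f 1 1 p)\<^sup>2 + (f 2 1 p)\<^sup>2) - \<eta> 2 * h' p * p (jZ 1)" for p
 have F2: "\<eta> 2 = f 2 1 p - \<mu> 2 * f 1 1 p" if "p \<in> B" for p using f2_affine[OF BS[OF that]] by simp
 have u: "(\<alpha> p + 2 * t * \<phi> 2 p) * f 1 1 p = - v p * f 2 1 p" if "p \<in> B" for p
  using eq(3)[OF that] unfolding v_def by (simp add: algebra_simps)
 have vN: "v p * (E p + \<eta> 2 * h' p * p (jZ 3)) = N p" if p: "p \<in> B" for p
 proof -
  note S = BS[OF p]
  define k where "k = h' p * (p (jZ 1) - p (jZ 3))"
  have XF: "X (f 1 1) p = k" "X (f 2 1) p = \<mu> 2 * k" using XY_f1(1)[OF S I3(1)] XY_f1(1)[OF S I3(2)] \<mu>1 by (simp_all add: k_def)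
  have "X (\<lambda>p. \<alpha> p * f 1 1 p + \<beta> p * f 2 1 p) p = X (\<lambda>p. (- 2 * t * \<phi> 2 p) * f 1 1 p + (2 * t * \<phi> 1 p) * f 2 1 p) p"
   by (rule derivation_cong[OF o p]) (use eq(3) in \<open>simp add: algebra_simps\<close>)
  then have e: "f 3 1 p * \<beta> p * f 1 1 p + \<alpha> p * k - f 3 1 p * \<alpha> p * f 2 1 p + \<beta> p * (\<mu> 2 * k)
    = - 2 * t * X (\<phi> 2) p * f 1 1 p - 2 * t * \<phi> 2 p * k + 2 * t * X (\<phi> 1) p * f 2 1 p + 2 * t * \<phi> 1 p * (\<mu> 2 * k)"
   unfolding derivation_comb[OF o p fs(1) fr(1) fs(2) fr(3)]
    derivation_comb[OF o p fs_mult[OF o fs_const[OF o] fr(4)] fr(1) fs_mult[OF o fs_const[OF o] fr(2)] fr(3)]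
    derivation_mult[OF o p fs_const[OF o] fr(4)] derivation_mult[OF o p fs_const[OF o] fr(2)] derivation_const XF eq(1)[OF p] eq(2)[OF p]
   by simp
  define w where "w = \<alpha> p + 2 * t * \<phi> 2 p"
  have \<alpha>\<beta>: "\<alpha> p = w - 2 * t * \<phi> 2 p" "\<beta> p = v p + 2 * t * \<phi> 1 p" by (simp_all add: w_def v_def)
  have wF: "w * f 1 1 p = - v p * f 2 1 p" using u[OF p] by (simp add: w_def)
  have "f 3 1 p * (v p * f 1 1 p - w * f 2 1 p) + k * (w + \<mu> 2 * v p)
   = - 2 * t * (f 3 1 p * (\<phi> 1 p * f 1 1 p + \<phi> 2 p * f 2 1 p) + f 1 1 p * X (\<phi> 2) p - f 2 1 p * X (\<phi> 1) p)"
   using e unfolding \<alpha>\<beta> by (simp add: algebra_simps)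
  then have "f 1 1 p * (f 3 1 p * (v p * f 1 1 p - w * f 2 1 p) + k * (w + \<mu> 2 * v p)) = N p"
   unfolding N_def by simp
  moreover have "f 1 1 p * (f 3 1 p * (v p * f 1 1 p - w * f 2 1 p) + k * (w + \<mu> 2 * v p))
   = f 3 1 p * (v p * f 1 1 p * f 1 1 p - (w * f 1 1 p) * f 2 1 p) + k * (w * f 1 1 p + \<mu> 2 * v p * f 1 1 p)"
   by (simp add: algebra_simps)
  moreover have "\<dots> = v p * (f 3 1 p * ((f 1 1 p)\<^sup>2 + (f 2 1 p)\<^sup>2) - \<eta> 2 * k)"
   unfolding wF F2[OF p] by (simp add: algebra_simps power2_eq_square)
  ultimately show ?thesis by (simp add: E_def k_def algebra_simps)
 qed
 have fv: "fs B v" unfolding v_def[abs_def] by (rule fs_diff[OF o fs(2) fs_mult[OF o fs_const[OF o] fr(2)]])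
 have Xv: "X v p = f 3 1 p * (v p * f 2 1 p / f 1 1 p + 2 * t * \<phi> 2 p) - 2 * t * X (\<phi> 1) p" if p: "p \<in> B" for p
 proof -
  have \<alpha>: "\<alpha> p = - v p * f 2 1 p / f 1 1 p - 2 * t * \<phi> 2 p" using u[OF p] F1[OF p] by (simp add: field_simps)
  have "X \<beta> p = f 3 1 p * (v p * f 2 1 p / f 1 1 p + 2 * t * \<phi> 2 p)" unfolding eq(2)[OF p] \<alpha> by (simp add: algebra_simps)
  moreover have "X v p = X \<beta> p - 2 * t * X (\<phi> 1) p"
   unfolding v_def[abs_def] derivation_diff[OF o p fs(2) fs_mult[OF o fs_const[OF o] fr(2)]] derivation_mult[OF o p fs_const[OF o] fr(2)]
   by (simp add: derivation_const)
  ultimately show ?thesis by simp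
 qed
 define D where "D p = E p + \<eta> 2 * h' p * p (jZ 3)" for p
 have agree: "f 1 1 p = f 1 1 q \<and> N p = N q \<and> E p = E q \<and> h' p = h' q \<and> (v p = v q \<longrightarrow> X v p = X v q)"
  if pq: "p \<in> B" "q \<in> B" "\<And>y. y \<in> {jZ 0, jZ 1, jZ 2} ==> p y = q y" for p q
 proof -
  have ag: "f i 1 p = f i 1 q" "\<phi> i p = \<phi> i q" "X (\<phi> i) p = X (\<phi> i) q" "h' p = h' q" if "i \<in> {1, 2, 3}" for i
   by (rule frame_agree[OF BS[OF pq(1)] BS[OF pq(2)] _ that], rule pq(3), assumption)+
  note e = ag(1)[OF I3(1)] ag(1)[OF I3(2)] ag(1)[OF I3(3)] ag(2)[OF I3(1)] ag(2)[OF I3(2)] ag(3)[OF I3(1)] ag(3)[OF I3(2)] ag(4)[OF I3(1)]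
  have "p (jZ 1) = q (jZ 1)" by (rule pq(3)) simp
  then show ?thesis unfolding N_def E_def Xv[OF pq(1)] Xv[OF pq(2)] e by simp
 qed
 have agree': "N (p(y := s)) = N p" "E (p(y := s)) = E p" "h' (p(y := s)) = h' p" "v (p(y := s)) = v p ==> X v (p(y := s)) = X v p"
  if py: "p \<in> B" "p(y := s) \<in> B" "y \<notin> {jZ 0, jZ 1, jZ 2}" for p y s
 proof -
  have "(p(y := s)) z = p z" if "z \<in> {jZ 0, jZ 1, jZ 2}" for z using that py(3) by auto
  note a = agree[OF py(2,1) this]
  show "N (p(y := s)) = N p" "E (p(y := s)) = E p" "h' (p(y := s)) = h' p" "v (p(y := s)) = v p ==> X v (p(y := s)) = X v p"
   using a by blast+
 qed
 have v0: "v p = 0" if p: "p \<in> B" for p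
 proof (rule ccontr)
  assume nz: "v p \<noteq> 0"
  obtain V where V: "jet_box V" "V \<noteq> {}" "V \<subseteq> B" "\<forall>q\<in>V. v q \<noteq> 0" using nonzero_box[OF o fv p nz] by blast
  note oV = jet_box_open[OF V(1)]
  obtain p1 where p1: "p1 \<in> V" using V(2) by blast
  obtain s where s: "s \<noteq> p1 (jZ 3)" "p1(jZ 3 := s) \<in> V" by (rule slice_other[OF oV p1])
  have h0: "\<eta> 2 * h' q \<noteq> 0" if "q \<in> B" for q using \<eta> h'_nonzero[OF BS[OF that]] by simp
  have VB: "q \<in> B" if "q \<in> V" for q using that V(3) by blast
  have n3: "jZ 3 \<notin> {jZ 0, jZ 1, jZ 2}" by simp
  have "D (p1(jZ 3 := s)) \<noteq> D p1"
   unfolding D_def agree'(2)[OF VB[OF p1] VB[OF s(2)] n3] agree'(3)[OF VB[OF p1] VB[OF s(2)] n3] using s(1) h0[OF VB[OF p1]] by simp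
  then obtain p2 where p2: "p2 \<in> V" "D p2 \<noteq> 0" using p1 s(2) by metis
  have dv: "depends_on {jZ 0, jZ 1, jZ 2, jZ 3} {q \<in> V. D q \<noteq> 0} v"
   unfolding depends_on_def
  proof (intro ballI impI)
   fix q r assume qr: "q \<in> {q \<in> V. D q \<noteq> 0}" "r \<in> {q \<in> V. D q \<noteq> 0}" and e: "\<forall>y\<in>{jZ 0, jZ 1, jZ 2, jZ 3}. q y = r y"
   have B: "q \<in> B" "r \<in> B" using qr VB by auto
   have ag: "N q = N r \<and> E q = E r \<and> h' q = h' r" using agree[OF B] e by blast
   then have "D q = D r" using e by (simp add: D_def)
   moreover have "v q * D q = N q" "v r * D r = N r" using vN[OF B(1)] vN[OF B(2)] by (simp_all add: D_def)
   ultimately have "v q * D r = v r * D r" using ag by simp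
   then show "v q = v r" using qr(2) by simp
  qed
  have fh: "fs B h'" "fs B E"
  proof -
   have "fs S h'" unfolding fs_def using Ck_Suc_pd[OF f_smooth[OF I3(1,4)]] depends_on_pd[OF S_open f_depends_2[OF I3(1,4)]] by (meson finite.intros)
   then show h: "fs B h'" by (rule fs_subset[OF _ box(3)])
   show "fs B E" unfolding E_def[abs_def] power2_eq_square by (intro fs_diff fs_mult fs_add fs_const fs_proj o h fr)
  qed
  have fD: "fs B D" unfolding D_def[abs_def] by (intro fs_add fs_mult fs_const fs_proj o fh)
  define W where "W = {q \<in> V. D q \<noteq> 0}"
  have oW: "open W" unfolding W_def by (rule fs_open_nonzero[OF oV fs_subset[OF fD V(3)]])
  have p2W: "p2 \<in> W" using p2 by (simp add: W_def)
  have WB: "q \<in> B" if "q \<in> W" for q using that VB by (simp add: W_def)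
  \<comment> \<open>In \<open>X v\<close> the fourth x-derivative is multiplied by exactly this
    derivative, while the formula for \<open>X v\<close> is free of it.\<close>
  have pd3: "pd (jZ 3) v q = 0" if q: "q \<in> W" for q
  proof -
   obtain s where s: "s \<noteq> q (jZ 4)" "q(jZ 4 := s) \<in> W" by (rule slice_other[OF oW q])
   let ?r = "q(jZ 4 := s)"
   note dW = dv[folded W_def]
   have r: "v ?r = v q" "pd y v ?r = pd y v q" for y
    by (rule depends_onD[OF dW s(2) q], force, rule depends_onD[OF depends_on_pd[OF oW dW] s(2) q], force)
   have Xe: "X v p = pd (jZ 0) v p * p (jZ 1) + pd (jZ 1) v p * p (jZ 2) + pd (jZ 2) v p * p (jZ 3) + pd (jZ 3) v p * p (jZ 4)" if "p \<in> W" for p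
    unfolding derivation_eq_sum[OF oW dW _ that, simplified]
    by (simp add: cX_def numeral_2_eq_2 numeral_3_eq_3 numeral_eq_Suc algebra_simps)
   have "X v ?r = X v q" by (rule agree'(4)[OF WB[OF q] WB[OF s(2)] _ r(1)]) simp
   then have "pd (jZ 3) v q * s = pd (jZ 3) v q * q (jZ 4)" unfolding Xe[OF q] Xe[OF s(2)] r(2) by simp
   then show ?thesis using s(1) by simp
  qed
  obtain s where s: "s \<noteq> p2 (jZ 3)" "p2(jZ 3 := s) \<in> W" by (rule slice_other[OF oW p2W])
  have "pd (jZ 3) (\<lambda>q. v q * D q - N q) p2 = 0" by (rule pd_zero_fun[OF oW p2W]) (use vN WB in \<open>simp add: D_def\<close>)
  moreover have "pd (jZ 3) (\<lambda>q. v q * D q - N q) p2 = v p2 * (\<eta> 2 * h' p2)"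
  proof (rule pder_pd)
   have ev: "\<forall>\<^sub>F s in nhds (p2 (jZ 3)). p2(jZ 3 := s) \<in> W" by (rule eventually_slice[OF oW p2W])
   have 3: "pder (jZ 3) F 0 p2" if "\<And>s. p2(jZ 3 := s) \<in> W ==> F (p2(jZ 3 := s)) = F p2" for F
   proof -
    have "\<forall>\<^sub>F s in nhds (p2 (jZ 3)). F (p2(jZ 3 := s)) = F p2" using ev by (rule eventually_mono) (rule that)
    then show ?thesis unfolding pder_def by (subst DERIV_cong_ev[OF refl _ refl, of _ "\<lambda>_. F p2"]) simp_all
   qed
   have 3: "pder (jZ 3) N 0 p2" "pder (jZ 3) E 0 p2" "pder (jZ 3) h' 0 p2"
    by (rule 3, rule agree'(1)[OF WB[OF p2W] WB], assumption, simp, rule 3, rule agree'(2)[OF WB[OF p2W] WB], assumption, simp,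
      rule 3, rule agree'(3)[OF WB[OF p2W] WB], assumption, simp)
   show "pder (jZ 3) (\<lambda>q. v q * D q - N q) (pd (jZ 3) v p2 * D p2 + v p2 * (0 + ((0 * h' p2 + \<eta> 2 * 0) * p2 (jZ 3) + \<eta> 2 * h' p2 * 1)) - 0) p2"
    unfolding D_def
    by (rule pder_diff pder_mult pder_add 3 pder_const pder_Ck[OF WB[OF p2W] fs_Ck[OF fv]] pder_eq[OF pder_proj])+ (simp, rule 3)
   show "pd (jZ 3) v p2 * D p2 + v p2 * (0 + ((0 * h' p2 + \<eta> 2 * 0) * p2 (jZ 3) + \<eta> 2 * h' p2 * 1)) - 0 = v p2 * (\<eta> 2 * h' p2)"
    using pd3[OF p2W] by simp
  qed
  ultimately show False using V(4) p2(1) h0[OF VB[OF p2(1)]] by simp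
 qed
 have \<alpha>\<beta>: "\<alpha> p = (- 2 * t) * \<phi> 2 p" "\<beta> p = (2 * t) * \<phi> 1 p" if p: "p \<in> B" for p
  using u[OF p] v0[OF p] F1[OF p] by (simp_all add: v_def)
 have c: "derivation k (\<lambda>p. x * F p) p = x * derivation k F p" if "fs B F" "p \<in> B" for k x F p
  by (simp add: derivation_mult[OF o that(2) fs_const[OF o] that(1)] derivation_const)
 have X1: "X (\<phi> 1) p = f 3 1 p * \<phi> 2 p" if p: "p \<in> B" for p
 proof -
  have "X \<beta> p = (2 * t) * X (\<phi> 1) p" unfolding c[OF fr(2) p, symmetric] by (rule derivation_cong[OF o p \<alpha>\<beta>(2)])
  then have "(2 * t) * X (\<phi> 1) p = (2 * t) * (f 3 1 p * \<phi> 2 p)" unfolding eq(2)[OF p] \<alpha>\<beta>(1)[OF p] by algebra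
  then show ?thesis using t0 by simp
 qed
 have X2: "X (\<phi> 2) p = - f 3 1 p * \<phi> 1 p" if p: "p \<in> B" for p
 proof -
  have "X \<alpha> p = (- 2 * t) * X (\<phi> 2) p" unfolding c[OF fr(4) p, symmetric] by (rule derivation_cong[OF o p \<alpha>\<beta>(1)])
  then have "(2 * t) * X (\<phi> 2) p = (2 * t) * (- f 3 1 p * \<phi> 1 p)" unfolding eq(1)[OF p] \<alpha>\<beta>(2)[OF p] by algebra
  then show ?thesis using t0 mult_left_cancel[of "2 * t" "X (\<phi> 2) p" "- f 3 1 p * \<phi> 1 p"] by simp
 qed
 note dep = depends_on_mono[OF \<phi>_depends[OF I3(1)] order_refl box(3)] depends_on_mono[OF \<phi>_depends[OF I3(2)] order_refl box(3)]
 have F3: "\<mu> 3 = 0 \<and> \<eta> 3 = 0"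
  by (rule rotation_zero[OF o box(2,3) fr(2) dep(1) fr(4) dep(2) X1 X2]) (use \<phi>_nonzero BS in blast)+
 have "f 3 1 p = 0" if "p \<in> B" for p using C[OF I3(3) BS[OF that]] F3 by simp
 then show False
  using no_constant_frame[OF o box(2,3) conjunct1[OF F3] conjunct2[OF F3]] X1 X2 by simp
qed

lemma no_isotropic_frame:
 assumes s: "sff V a b c" and V: "V \<noteq> {}" and Q: "\<And>p. p \<in> V ==> II_F a b c p = 0"
 shows False
proof -
 note VS = sffD(2)[OF s]
 have "\<not> (\<forall>p\<in>V. f 1 1 p = 0)" using frame_zero[OF sffD(1)[OF s] V VS I3(1)] \<mu>1 by auto
 then obtain p where p: "p \<in> V" "f 1 1 p \<noteq> 0" by blast
 obtain B where B: "jet_box B" "B \<noteq> {}" "B \<subseteq> V" "\<forall>q\<in>B. f 1 1 q \<noteq> 0"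
  using nonzero_box[OF sffD(1)[OF s] fs_frame(1)[OF I3(1) VS] p] by blast
 have sB: "sff B a b c" by (rule sff_subset[OF s jet_box_open[OF B(1)] B(3)])
 have "\<exists>t \<alpha> \<beta>. t\<^sup>2 = 1 \<and> fs B \<alpha> \<and> fs B \<beta> \<and> (\<forall>p\<in>B. X \<alpha> p = f 3 1 p * \<beta> p \<and> X \<beta> p = - f 3 1 p * \<alpha> p \<and>
  \<alpha> p * f 1 1 p + \<beta> p * f 2 1 p = - 2 * t * (f 1 1 p * \<phi> 2 p - f 2 1 p * \<phi> 1 p))"
  by (rule isotropic_data[OF B(1,2) sB]) (use Q B(3,4) in blast)+
 then obtain t \<alpha> \<beta> where d: "t\<^sup>2 = 1" "fs B \<alpha>" "fs B \<beta>" and e: "\<forall>p\<in>B. X \<alpha> p = f 3 1 p * \<beta> p" "\<forall>p\<in>B. X \<beta> p = - f 3 1 p * \<alpha> p"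
  "\<forall>p\<in>B. \<alpha> p * f 1 1 p + \<beta> p * f 2 1 p = - 2 * t * (f 1 1 p * \<phi> 2 p - f 2 1 p * \<phi> 1 p)" by blast
 note N = B(1,2) sffD(2)[OF sB] d(2,3,1) _ bspec[OF B(4)] bspec[OF e(1)] bspec[OF e(2)] bspec[OF e(3)]
 show False
  by (cases "\<eta> 2 = 0") (erule no_isotropic_proportional[OF B(1,2) sffD(2)[OF sB] d(2,3,1) _ bspec[OF B(4)] bspec[OF e(1)] bspec[OF e(2)] bspec[OF e(3)]],
   assumption+, erule no_isotropic_general[OF B(1,2) sffD(2)[OF sB] d(2,3,1) _ bspec[OF B(4)] bspec[OF e(1)] bspec[OF e(2)] bspec[OF e(3)]], assumption+)
qed

section \<open>Second fundamental forms isotropic on the characteristic direction\<close>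

lemma Y_low_difference:
 assumes "open D" "p \<in> D" "depends_on {jZ 0, jZ 1} D H" and y: "y = (if w then jW 0 else jV 0)" and q: "p(y := s) \<in> D"
 shows "Y H (p(y := s)) - Y H p = (if w then pd (jZ 0) H p else pd (jZ 1) H p) * (s - p y)"
proof -
 have pdq: "pd z H (p(y := s)) = pd z H p" for z
  by (rule depends_onD[OF depends_on_pd[OF assms(1,3)] q assms(2)]) (use y in auto)
 have z: "(p(y := s)) (jZ k) = p (jZ k)" "(p(y := s)) (jW 0) = (if w then s else p (jW 0))" "(p(y := s)) (jV 0) = (if w then p (jV 0) else s)" for k
  using y by auto
 show ?thesis
  unfolding X_low(2)[OF assms(1,2,3)] X_low(2)[OF assms(1) q assms(3)] pdq z using y by (cases w) (simp_all add: algebra_simps)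
qed

lemma WV_invariant:
 assumes p: "p \<in> S" and y: "y = (if w then jW 0 else jV 0)" and i: "i \<in> {1, 2, 3}"
 shows "f i 1 (p(y := s)) = f i 1 p" "\<phi> i (p(y := s)) = \<phi> i p" "X (\<phi> i) (p(y := s)) = X (\<phi> i) p" "Y (f i 1) (p(y := s)) = Y (f i 1) p"
  "(p(y := s)) (jZ k) = p (jZ k)"
proof -
 have q: "p(y := s) \<in> S" by (rule S_upd[OF p]) (use y in auto)
 have z: "(p(y := s)) (jZ k) = p (jZ k)" for k using y by auto
 have e: "\<And>v. v \<in> {jZ 0, jZ 1, jZ 2} ==> (p(y := s)) v = p v" using z by blast
 show "f i 1 (p(y := s)) = f i 1 p" "\<phi> i (p(y := s)) = \<phi> i p" "X (\<phi> i) (p(y := s)) = X (\<phi> i) p"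
  by (rule frame_agree[OF q p _ i], rule e, assumption)+
 have h: "h' (p(y := s)) = h' p" by (rule frame_agree(4)[OF q p _ i], rule e, assumption)
 show "Y (f i 1) (p(y := s)) = Y (f i 1) p"
  unfolding XY_f1(2)[OF q i] XY_f1(2)[OF p i] h \<Gamma>_def z ..
 show "(p(y := s)) (jZ k) = p (jZ k)" by (rule z)
qed

text \<open>Again the isotropic vector is mapped to plus or minus its right-angle rotation. Either
  component may vanish somewhere on the box, so the sign is obtained by dividing by the squared
  length \<open>n\<close>.\<close>

lemma degenerate_data:
 assumes box: "jet_box B" "B \<noteq> {}" and s: "sff B a b c" and Q: "\<And>p. p \<in> B ==> II_\<phi> a b c p = 0"
 shows "\<exists>t. t\<^sup>2 = 1 \<and> (\<forall>p\<in>B. a p * \<phi> 1 p + b p * \<phi> 2 p = t * \<phi> 2 p \<and> b p * \<phi> 1 p + c p * \<phi> 2 p = - t * \<phi> 1 p)"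
proof -
 note o = sffD(1)[OF s] and fa = sffD(3-5)[OF s]
 note fr = fs_frame(2)[OF I3(1) sffD(2)[OF s]] fs_frame(2)[OF I3(2) sffD(2)[OF s]]
 define n where "n p = \<phi> 1 p * \<phi> 1 p + \<phi> 2 p * \<phi> 2 p" for p
 have n0: "n p \<noteq> 0" if "p \<in> B" for p
 proof -
  have "p \<in> S" using that sffD(2)[OF s] by blast
  then show ?thesis using \<phi>_nonzero[of p] sum_squares_eq_zero_iff[of "\<phi> 1 p" "\<phi> 2 p"] by (simp add: n_def)
 qed
 define u1 where "u1 p = a p * \<phi> 1 p + b p * \<phi> 2 p" for p
 define u2 where "u2 p = b p * \<phi> 1 p + c p * \<phi> 2 p" for p
 define \<tau> where "\<tau> p = (u1 p * \<phi> 2 p - u2 p * \<phi> 1 p) / n p" for p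
 have \<tau>n: "\<tau> p * n p = u1 p * \<phi> 2 p - u2 p * \<phi> 1 p" if "p \<in> B" for p using n0[OF that] by (simp add: \<tau>_def)
 have u0: "u1 p * \<phi> 1 p + u2 p * \<phi> 2 p = 0" if "p \<in> B" for p
  using Q[OF that] by (simp add: II_\<phi>_def u1_def u2_def algebra_simps power2_eq_square)
 have e1: "u1 p = \<tau> p * \<phi> 2 p" if p: "p \<in> B" for p
 proof -
  have "n p * u1 p = \<phi> 1 p * (u1 p * \<phi> 1 p + u2 p * \<phi> 2 p) + \<phi> 2 p * (u1 p * \<phi> 2 p - u2 p * \<phi> 1 p)"
   unfolding n_def by (simp add: algebra_simps)
  also have "\<dots> = n p * (\<tau> p * \<phi> 2 p)" unfolding u0[OF p] \<tau>n[OF p, symmetric] by (simp add: algebra_simps)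
  finally show ?thesis using n0[OF p] by simp
 qed
 have e2: "u2 p = - \<tau> p * \<phi> 1 p" if p: "p \<in> B" for p
 proof -
  have "n p * u2 p = \<phi> 2 p * (u1 p * \<phi> 1 p + u2 p * \<phi> 2 p) - \<phi> 1 p * (u1 p * \<phi> 2 p - u2 p * \<phi> 1 p)"
   unfolding n_def by (simp add: algebra_simps)
  also have "\<dots> = n p * (- \<tau> p * \<phi> 1 p)" unfolding u0[OF p] \<tau>n[OF p, symmetric] by (simp add: algebra_simps)
  finally show ?thesis using n0[OF p] mult_left_cancel[of "n p" "u2 p" "- \<tau> p * \<phi> 1 p"] by blast
 qed
 have \<tau>1: "(\<tau> p)\<^sup>2 = 1" if p: "p \<in> B" for p
 proof -
  have "(a p * c p - (b p)\<^sup>2 + (\<tau> p)\<^sup>2) * n p =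
    (c p * \<phi> 1 p - (b p + \<tau> p) * \<phi> 2 p) * (u1 p - \<tau> p * \<phi> 2 p) + (a p * \<phi> 2 p - (b p - \<tau> p) * \<phi> 1 p) * (u2 p - (- \<tau> p * \<phi> 1 p))"
   unfolding n_def u1_def u2_def by (simp add: algebra_simps power2_eq_square)
  also have "\<dots> = 0" unfolding e1[OF p] e2[OF p] by simp
  finally show ?thesis using n0[OF p] sffD(6)[OF s p] by simp
 qed
 have fu: "fs B u1" "fs B u2" "fs B n" unfolding u1_def[abs_def] u2_def[abs_def] n_def[abs_def]
  by (rule fs_comb[OF o fa(1) fr(1) fa(2) fr(2)], rule fs_comb[OF o fa(2) fr(1) fa(3) fr(2)], rule fs_comb[OF o fr(1) fr(1) fr(2) fr(2)])
 have f\<tau>: "fs B \<tau>" unfolding \<tau>_def[abs_def]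
  by (rule fs_divide[OF o fs_diff[OF o fs_mult[OF o fu(1) fr(2)] fs_mult[OF o fu(2) fr(1)]] fu(3) n0])
 have pd\<tau>: "pd y \<tau> p = 0" if p: "p \<in> B" for y p
 proof -
  have "pd y (\<lambda>p. (\<tau> p)\<^sup>2 - 1) p = 0" by (rule pd_zero_fun[OF o p]) (simp add: \<tau>1)
  moreover have "pd y (\<lambda>p. (\<tau> p)\<^sup>2 - 1) p = 2 * \<tau> p * pd y \<tau> p"
   by (rule pder_pd, (rule pder_intros pder_Ck[OF p] fs_Ck[OF f\<tau>])+) simp
  ultimately show ?thesis using \<tau>1[OF p] by auto
 qed
 obtain p0 where p0: "p0 \<in> B" using box(2) by blast
 have const: "\<tau> p = \<tau> p0" if "p \<in> B" for p
  by (rule jet_box_constant[OF box(1) f\<tau> _ that p0]) (rule pd\<tau>)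
 have "a p * \<phi> 1 p + b p * \<phi> 2 p = \<tau> p0 * \<phi> 2 p \<and> b p * \<phi> 1 p + c p * \<phi> 2 p = - \<tau> p0 * \<phi> 1 p" if "p \<in> B" for p
  using e1[OF that] e2[OF that] unfolding u1_def u2_def const[OF that] by blast
 then show ?thesis using \<tau>1[OF p0] by blast
qed

text \<open>\<open>H\<close> is the squared sine of the angle between
  \<open>(\<phi>_1, \<phi>_2)\<close> and its value at \<open>p0\<close>; it is smooth without
  choosing a branch of the angle. The derivatives of the vector are parallel to it, so
  \<open>H\<close> is constant, and it is zero at \<open>p0\<close>.\<close>

lemma constant_direction:
 assumes box: "jet_box B" "B \<noteq> {}" "B \<subseteq> S" and par: "\<And>p y. p \<in> B ==> y \<in> {jZ 0, jZ 1} ==> \<phi> 1 p * pd y (\<phi> 2) p = \<phi> 2 p * pd y (\<phi> 1) p"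
 shows "\<exists>\<kappa> \<nu>. \<kappa>\<^sup>2 + \<nu>\<^sup>2 = 1 \<and> (\<forall>p\<in>B. \<kappa> * \<phi> 2 p - \<nu> * \<phi> 1 p = 0)"
proof -
 note o = jet_box_open[OF box(1)]
 note fr = fs_frame(2)[OF I3(1) box(3)] fs_frame(2)[OF I3(2) box(3)]
 note dep = depends_on_mono[OF \<phi>_depends[OF I3(1)] order_refl box(3)] depends_on_mono[OF \<phi>_depends[OF I3(2)] order_refl box(3)]
 obtain p0 where p0: "p0 \<in> B" using box(2) by blast
 define r where "r = sqrt ((\<phi> 1 p0)\<^sup>2 + (\<phi> 2 p0)\<^sup>2)"
 have n0: "(\<phi> 1 p)\<^sup>2 + (\<phi> 2 p)\<^sup>2 \<noteq> 0" if "p \<in> B" for p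
  using \<phi>_nonzero[of p] that box(3) by (auto simp: sum_power2_eq_zero_iff)
 have r2: "r\<^sup>2 = (\<phi> 1 p0)\<^sup>2 + (\<phi> 2 p0)\<^sup>2" by (simp add: r_def)
 have r0: "r \<noteq> 0" using r2 n0[OF p0] by auto
 define \<kappa> where "\<kappa> = \<phi> 1 p0 / r"
 define \<nu> where "\<nu> = \<phi> 2 p0 / r"
 have unit: "\<kappa>\<^sup>2 + \<nu>\<^sup>2 = 1"
  using r0 n0[OF p0] unfolding \<kappa>_def \<nu>_def power_divide r2 by (simp add: add_divide_distrib[symmetric])
 define g where "g p = \<kappa> * \<phi> 2 p + (- \<nu>) * \<phi> 1 p" for p
 define H where "H p = (g p * g p) / ((\<phi> 1 p)\<^sup>2 + (\<phi> 2 p)\<^sup>2)" for p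
 have fg: "fs B g" unfolding g_def[abs_def] by (rule fs_lin[OF o fr(2,1)])
 have fn: "fs B (\<lambda>p. (\<phi> 1 p)\<^sup>2 + (\<phi> 2 p)\<^sup>2)" unfolding power2_eq_square by (rule fs_comb[OF o fr(1) fr(1) fr(2) fr(2)])
 have fH: "fs B H" unfolding H_def[abs_def] by (rule fs_divide[OF o fs_mult[OF o fg fg] fn n0])
 have pdH: "pd y H p = 0" if p: "p \<in> B" for y p
 proof -
  let ?d1 = "pd y (\<phi> 1) p" and ?d2 = "pd y (\<phi> 2) p"
  have par': "\<phi> 1 p * ?d2 = \<phi> 2 p * ?d1"
  proof (cases "y \<in> {jZ 0, jZ 1}")
   case False
   have "?d1 = 0" "?d2 = 0" by (rule pd_zero_outside[OF o dep(1) p False], rule pd_zero_outside[OF o dep(2) p False])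
   then show ?thesis by simp
  qed (rule par[OF p])
  have pg: "pder y g (\<kappa> * ?d2 + (- \<nu>) * ?d1) p"
   unfolding g_def[abs_def] by (rule pder_eq, (rule pder_intros pder_Ck[OF p] fs_Ck fr)+) simp
  have pn: "pder y (\<lambda>p. (\<phi> 1 p)\<^sup>2 + (\<phi> 2 p)\<^sup>2) (2 * \<phi> 1 p * ?d1 + 2 * \<phi> 2 p * ?d2) p"
   by (rule pder_eq, (rule pder_intros pder_Ck[OF p] fs_Ck fr)+) simp
  let ?num = "((\<kappa> * ?d2 + (- \<nu>) * ?d1) * g p + g p * (\<kappa> * ?d2 + (- \<nu>) * ?d1)) * ((\<phi> 1 p)\<^sup>2 + (\<phi> 2 p)\<^sup>2) - (g p * g p) * (2 * \<phi> 1 p * ?d1 + 2 * \<phi> 2 p * ?d2)"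
  have "?num = 2 * g p * (\<kappa> * \<phi> 1 p + \<nu> * \<phi> 2 p) * (\<phi> 1 p * ?d2 - \<phi> 2 p * ?d1)"
   unfolding g_def by algebra
  then have "?num = 0" unfolding par' by simp
  then show ?thesis unfolding H_def[abs_def]
   by (intro pder_pd[OF pder_divide[OF pder_mult[OF pg pg] pn n0[OF p]]]) simp
 qed
 have "g p0 = 0" by (simp add: g_def \<kappa>_def \<nu>_def)
 then have H0: "H p0 = 0" by (simp add: H_def)
 have "\<kappa> * \<phi> 2 p - \<nu> * \<phi> 1 p = 0" if p: "p \<in> B" for p
 proof -
  have "H p = H p0" by (rule jet_box_constant[OF box(1) fH _ p p0]) (rule pdH)
  then have "H p = 0" using H0 by simp
  then have "g p = 0" using n0[OF p] unfolding H_def by auto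
  then show ?thesis by (simp add: g_def)
 qed
 then show ?thesis using unit by blast
qed

text \<open>With the roles of the two vectors exchanged, the corrected image \<open>(A, C)\<close>
  of \<open>(f_11, f_21)\<close> is rotated by \<open>Y\<close> with velocity
  \<open>\<phi>_3\<close>, apart from the factor \<open>- lam u_x\<close>. Since
  \<open>\<phi>_1\<close>, \<open>\<phi>_2\<close> depend on \<open>u\<close>, \<open>u_x\<close>,
  their \<open>Y\<close>-derivatives contain \<open>u_t\<close> and \<open>u_xt\<close>; comparing
  coefficients of these fixes the direction of \<open>(\<phi>_1, \<phi>_2)\<close>, and a constant
  rotation of the frame makes the contradiction explicit.\<close>

lemma no_degenerate_\<phi>:
 assumes s: "sff V a b c" and V: "V \<noteq> {}" and Q: "\<And>p. p \<in> V ==> II_F a b c p \<noteq> 0" and Q': "\<And>p. p \<in> V ==> II_\<phi> a b c p = 0"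
 shows False
proof -
 obtain v where "v \<in> V" using V by blast
 then obtain B where box: "jet_box B" "v \<in> B" "B \<subseteq> V" using jet_box_exists[OF sffD(1)[OF s]] by blast
 have Bne: "B \<noteq> {}" using box(2) by blast
 note o = jet_box_open[OF box(1)]
 have sB: "sff B a b c" by (rule sff_subset[OF s o box(3)])
 have BV: "p \<in> V" if "p \<in> B" for p using that box(3) by blast
 have BS: "p \<in> S" if "p \<in> B" for p using that sffD(2)[OF sB] by blast
 note BsubS = sffD(2)[OF sB] and fa = sffD(3-5)[OF sB]
 note fr = fs_frame[OF I3(1) BsubS] fs_frame[OF I3(2) BsubS] fs_frame[OF I3(3) BsubS]
 obtain t where t: "t\<^sup>2 = 1" and t': "\<forall>p\<in>B. a p * \<phi> 1 p + b p * \<phi> 2 p = t * \<phi> 2 p \<and> b p * \<phi> 1 p + c p * \<phi> 2 p = - t * \<phi> 1 p"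
  using degenerate_data[OF box(1) Bne sB Q'[OF BV]] by blast
 have t0: "t \<noteq> 0" using t by auto
 have u1: "a p * \<phi> 1 p + b p * \<phi> 2 p = t * \<phi> 2 p" and u2: "b p * \<phi> 1 p + c p * \<phi> 2 p = - t * \<phi> 1 p" if "p \<in> B" for p
  using t' that by blast+
 obtain l where l: "depends_on (KK 0 l) B a" "depends_on (KK 0 l) B b" "depends_on (KK 0 l) B c"
  using sff_finite_order[OF box(1) sB Q[OF BV]] by blast
 have c1: "derivation k (\<lambda>p. x * F p) p = x * derivation k F p" if "fs B F" "p \<in> B" for k x F p
  by (simp add: derivation_mult[OF o that(2) fs_const[OF o] that(1)] derivation_const)
 define P1 where "P1 p = a p * f 1 1 p + b p * f 2 1 p" for p
 define P2 where "P2 p = b p * f 1 1 p + c p * f 2 1 p" for p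
 define A where "A p = 1 * P1 p + (- t) * f 2 1 p" for p
 define C where "C p = 1 * P2 p + t * f 1 1 p" for p
 have fP: "fs B P1" "fs B P2" unfolding P1_def[abs_def] P2_def[abs_def]
  by (rule fs_comb[OF o fa(1) fr(1) fa(2) fr(3)], rule fs_comb[OF o fa(2) fr(1) fa(3) fr(3)])
 have fAC: "fs B A" "fs B C" unfolding A_def[abs_def] C_def[abs_def] by (rule fs_lin[OF o fP(1) fr(3)], rule fs_lin[OF o fP(2) fr(1)])
 have YP: "Y P1 p = t * X (\<phi> 2) p - lam * p (jZ 1) * P1 p + \<phi> 3 p * P2 p + f 3 1 p * (t * \<phi> 1 p)"
  "Y P2 p = - t * X (\<phi> 1) p - lam * p (jZ 1) * P2 p - \<phi> 3 p * P1 p + f 3 1 p * (t * \<phi> 2 p)" if p: "p \<in> B" for p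
 proof -
  have X1: "X (\<lambda>p. a p * \<phi> 1 p + b p * \<phi> 2 p) p = t * X (\<phi> 2) p"
   unfolding c1[OF fr(4) p, symmetric] by (rule derivation_cong[OF o p u1])
  have X2: "X (\<lambda>p. b p * \<phi> 1 p + c p * \<phi> 2 p) p = - t * X (\<phi> 1) p"
   unfolding c1[OF fr(2) p, symmetric] by (rule derivation_cong[OF o p u2])
  note cf = codazzi_forms[OF sB p, unfolded X1 X2 u1[OF p] u2[OF p]]
  show "Y P1 p = t * X (\<phi> 2) p - lam * p (jZ 1) * P1 p + \<phi> 3 p * P2 p + f 3 1 p * (t * \<phi> 1 p)"
   using cf(1) unfolding P1_def[symmetric] P2_def[symmetric] by (simp add: P1_def[abs_def, symmetric] P2_def[abs_def, symmetric])
  show "Y P2 p = - t * X (\<phi> 1) p - lam * p (jZ 1) * P2 p - \<phi> 3 p * P1 p + f 3 1 p * (t * \<phi> 2 p)"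
   using cf(2) unfolding P1_def[symmetric] P2_def[symmetric] by (simp add: P1_def[abs_def, symmetric] P2_def[abs_def, symmetric])
 qed
 have YA: "Y A p = - lam * p (jZ 1) * A p + \<phi> 3 p * C p" if p: "p \<in> B" for p
  unfolding A_def[abs_def] derivation_lin[OF o p fP(1) fr(3)] YP[OF p] Y_f1[OF BS[OF p] I3(2)] R_\<phi> C_def by (simp add: algebra_simps)
 have YC: "Y C p = - lam * p (jZ 1) * C p - \<phi> 3 p * A p" if p: "p \<in> B" for p
  unfolding C_def[abs_def] derivation_lin[OF o p fP(2) fr(1)] YP[OF p] Y_f1[OF BS[OF p] I3(1)] R_\<phi> A_def by (simp add: algebra_simps)
 have con: "A p * \<phi> 1 p + C p * \<phi> 2 p = (2 * t * \<phi> 2 p) * f 1 1 p + (- 2 * t * \<phi> 1 p) * f 2 1 p" if p: "p \<in> B" for p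
 proof -
  have "A p * \<phi> 1 p + C p * \<phi> 2 p = f 1 1 p * (a p * \<phi> 1 p + b p * \<phi> 2 p) + f 2 1 p * (b p * \<phi> 1 p + c p * \<phi> 2 p) - t * f 2 1 p * \<phi> 1 p + t * f 1 1 p * \<phi> 2 p"
   unfolding A_def C_def P1_def P2_def by (simp add: algebra_simps)
  then show ?thesis unfolding u1[OF p] u2[OF p] by (simp add: algebra_simps)
 qed
 have inv: "A (p(y := s)) = A p" "C (p(y := s)) = C p" if p: "p \<in> B" "p(y := s) \<in> B" and y: "y = (if w then jW 0 else jV 0)" for p y s w
 proof -
  have yK: "y \<notin> KK 0 l" using y by (auto simp: KK_def)
  have e: "a (p(y := s)) = a p" "b (p(y := s)) = b p" "c (p(y := s)) = c p"
   by (rule slice_invariant[OF l(1) p yK], rule slice_invariant[OF l(2) p yK], rule slice_invariant[OF l(3) p yK])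
  note F = WV_invariant(1)[OF BS[OF p(1)] y I3(1)] WV_invariant(1)[OF BS[OF p(1)] y I3(2)]
  show "A (p(y := s)) = A p" "C (p(y := s)) = C p" unfolding A_def C_def P1_def P2_def e F by simp_all
 qed
 note dep = depends_on_mono[OF \<phi>_depends[OF I3(1)] order_refl BsubS] depends_on_mono[OF \<phi>_depends[OF I3(2)] order_refl BsubS]
  depends_on_mono[OF \<phi>_depends[OF I3(3)] order_refl BsubS]
 \<comment> \<open>The \<open>Y\<close>-derivative of the constraint \<open>con\<close> is affine in
   \<open>u_t\<close> and \<open>u_xt\<close>. Together with \<open>con\<close> its coefficients say
   that one vector is orthogonal both to \<open>(\<phi>_1, \<phi>_2)\<close> and to its derivative;
   that vector is nonzero because \<open>II_F\<close> is.\<close>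
 have par: "\<phi> 1 p * pd z (\<phi> 2) p = \<phi> 2 p * pd z (\<phi> 1) p" if p: "p \<in> B" and z: "z \<in> {jZ 0, jZ 1}" for p z
 proof -
  define w where "w = (z = jZ 0)"
  define y where "y = (if w then jW 0 else jV 0)"
  obtain s where s: "s \<noteq> p y" "p(y := s) \<in> B" by (rule slice_other[OF o p])
  let ?q = "p(y := s)"
  define T where "T p = (Y A p * \<phi> 1 p + A p * Y (\<phi> 1) p + (Y C p * \<phi> 2 p + C p * Y (\<phi> 2) p))
   - ((2 * t * Y (\<phi> 2) p) * f 1 1 p + (2 * t * \<phi> 2 p) * Y (f 1 1) p + ((- 2 * t * Y (\<phi> 1) p) * f 2 1 p + (- 2 * t * \<phi> 1 p) * Y (f 2 1) p))" for p
  have T0: "T p = 0" if p: "p \<in> B" for p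
  proof -
   have "Y (\<lambda>p. A p * \<phi> 1 p + C p * \<phi> 2 p) p = Y (\<lambda>p. (2 * t * \<phi> 2 p) * f 1 1 p + (- 2 * t * \<phi> 1 p) * f 2 1 p) p"
    by (rule derivation_cong[OF o p con])
   then show ?thesis
    unfolding derivation_comb[OF o p fAC(1) fr(2) fAC(2) fr(4)]
     derivation_comb[OF o p fs_mult[OF o fs_const[OF o] fr(4)] fr(1) fs_mult[OF o fs_const[OF o] fr(2)] fr(3)]
     c1[OF fr(4) p] c1[OF fr(2) p] T_def by simp
  qed
  note i1 = WV_invariant[OF BS[OF p] y_def I3(1), of s] and i2 = WV_invariant[OF BS[OF p] y_def I3(2), of s] and i3 = WV_invariant[OF BS[OF p] y_def I3(3), of s]
  note iAC = inv[OF p s(2) y_def]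
  have YACq: "Y A ?q = Y A p" "Y C ?q = Y C p" unfolding YA[OF p] YA[OF s(2)] YC[OF p] YC[OF s(2)] iAC i1(5) i3(2) by simp_all
  have d: "Y (\<phi> 1) ?q = Y (\<phi> 1) p + pd z (\<phi> 1) p * (s - p y)" "Y (\<phi> 2) ?q = Y (\<phi> 2) p + pd z (\<phi> 2) p * (s - p y)"
   using Y_low_difference[OF o p dep(1) y_def s(2)] Y_low_difference[OF o p dep(2) y_def s(2)] z by (auto simp: w_def)
  have "T ?q - T p = (s - p y) * ((A p + 2 * t * f 2 1 p) * pd z (\<phi> 1) p + (C p - 2 * t * f 1 1 p) * pd z (\<phi> 2) p)"
   unfolding T_def YACq iAC i1(1,2,4) i2(1,2,4) d by (simp add: algebra_simps)
  then have e2: "(A p + 2 * t * f 2 1 p) * pd z (\<phi> 1) p + (C p - 2 * t * f 1 1 p) * pd z (\<phi> 2) p = 0"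
   using T0[OF p] T0[OF s(2)] s(1) by simp
  have e1: "(A p + 2 * t * f 2 1 p) * \<phi> 1 p + (C p - 2 * t * f 1 1 p) * \<phi> 2 p = 0"
   using con[OF p] by (simp add: algebra_simps)
  have nz: "A p + 2 * t * f 2 1 p \<noteq> 0 \<or> C p - 2 * t * f 1 1 p \<noteq> 0"
  proof (rule ccontr)
   assume "\<not> ?thesis"
   then have "P1 p = - t * f 2 1 p" "P2 p = t * f 1 1 p" by (simp_all add: A_def C_def)
   moreover have "II_F a b c p = f 1 1 p * P1 p + f 2 1 p * P2 p" by (simp add: II_F_def P1_def P2_def algebra_simps power2_eq_square)
   ultimately show False using Q[OF BV[OF p]] by simp
  qed
  have "(A p + 2 * t * f 2 1 p) * (\<phi> 1 p * pd z (\<phi> 2) p - \<phi> 2 p * pd z (\<phi> 1) p) = 0"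
   "(C p - 2 * t * f 1 1 p) * (\<phi> 1 p * pd z (\<phi> 2) p - \<phi> 2 p * pd z (\<phi> 1) p) = 0"
   using e1 e2 by algebra+
  then show ?thesis using nz by auto
 qed
 obtain \<kappa> \<nu> where unit: "\<kappa>\<^sup>2 + \<nu>\<^sup>2 = 1" and dir': "\<forall>p\<in>B. \<kappa> * \<phi> 2 p - \<nu> * \<phi> 1 p = 0"
  using constant_direction[OF box(1) Bne BsubS par] by blast
 have dir: "\<kappa> * \<phi> 2 p = \<nu> * \<phi> 1 p" if "p \<in> B" for p using dir' that by simp
 define \<rho> where "\<rho> p = \<kappa> * \<phi> 1 p + \<nu> * \<phi> 2 p" for p
 have \<phi>\<rho>: "\<phi> 1 p = \<kappa> * \<rho> p" "\<phi> 2 p = \<nu> * \<rho> p" if p: "p \<in> B" for p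
 proof -
  show "\<phi> 1 p = \<kappa> * \<rho> p" "\<phi> 2 p = \<nu> * \<rho> p" unfolding \<rho>_def using unit dir[OF p] by algebra+
 qed
 have f\<rho>: "fs B \<rho>" unfolding \<rho>_def[abs_def] by (rule fs_lin[OF o fr(2,4)])
 \<comment> \<open>Frame rotated by a constant angle: \<open>(\<phi>_1, \<phi>_2)\<close> becomes
   \<rho> times the first unit vector.\<close>
 define F1 where "F1 p = \<kappa> * f 1 1 p + \<nu> * f 2 1 p" for p
 define F2 where "F2 p = (- \<nu>) * f 1 1 p + \<kappa> * f 2 1 p" for p
 define A' where "A' p = \<kappa> * A p + \<nu> * C p" for p
 define C' where "C' p = (- \<nu>) * A p + \<kappa> * C p" for p
 have fF: "fs B F1" "fs B F2" unfolding F1_def[abs_def] F2_def[abs_def] by (rule fs_lin[OF o fr(1,3)])+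
 have \<delta>: "f 1 1 p * \<phi> 2 p - f 2 1 p * \<phi> 1 p = - \<rho> p * F2 p" if p: "p \<in> B" for p
  unfolding \<phi>\<rho>[OF p] F2_def by (simp add: algebra_simps)
 have \<rho>F: "\<rho> p * F2 p \<noteq> 0" if p: "p \<in> B" for p
 proof
  assume "\<rho> p * F2 p = 0"
  then have "f 1 1 p * \<phi> 2 p - f 2 1 p * \<phi> 1 p = 0" unfolding \<delta>[OF p] by simp
  then show False using Delta12[OF BS[OF p]] unfolding Delta_\<phi> by blast
 qed
 have A'F: "A' p = (- 2 * t) * F2 p" if p: "p \<in> B" for p
 proof -
  have "\<rho> p * A' p = A p * \<phi> 1 p + C p * \<phi> 2 p" unfolding \<phi>\<rho>[OF p] A'_def by (simp add: algebra_simps)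
  also have "\<dots> = \<rho> p * ((- 2 * t) * F2 p)" unfolding con[OF p] unfolding \<phi>\<rho>[OF p] F2_def by (simp add: algebra_simps)
  finally show ?thesis using \<rho>F[OF p] mult_left_cancel[of "\<rho> p" "A' p" "(- 2 * t) * F2 p"] by fastforce
 qed
 have YA': "Y A' p = - lam * p (jZ 1) * A' p + \<phi> 3 p * C' p" if p: "p \<in> B" for p
  unfolding A'_def[abs_def] derivation_lin[OF o p fAC] YA[OF p] YC[OF p] C'_def by (simp add: algebra_simps)
 have YC': "Y C' p = - lam * p (jZ 1) * C' p - \<phi> 3 p * A' p" if p: "p \<in> B" for p
  unfolding C'_def[abs_def] derivation_lin[OF o p fAC] YA[OF p] YC[OF p] A'_def by (simp add: algebra_simps)
 have X\<rho>: "X \<rho> p = \<kappa> * X (\<phi> 1) p + \<nu> * X (\<phi> 2) p" if p: "p \<in> B" for p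
  unfolding \<rho>_def[abs_def] by (rule derivation_lin[OF o p fr(2,4)])
 have Xdir: "\<kappa> * X (\<phi> 2) p = \<nu> * X (\<phi> 1) p" if p: "p \<in> B" for p
  unfolding c1[OF fr(4) p, symmetric] c1[OF fr(2) p, symmetric] by (rule derivation_cong[OF o p dir])
 have YF1: "Y F1 p = X \<rho> p - lam * p (jZ 1) * F1 p + \<phi> 3 p * F2 p" if p: "p \<in> B" for p
 proof -
  have "Y F1 p = \<kappa> * Y (f 1 1) p + \<nu> * Y (f 2 1) p" unfolding F1_def[abs_def] by (rule derivation_lin[OF o p fr(1,3)])
  also have "\<dots> = X \<rho> p - lam * p (jZ 1) * F1 p + \<phi> 3 p * F2 p - f 3 1 p * (\<kappa> * \<phi> 2 p - \<nu> * \<phi> 1 p)"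
   unfolding Y_f1[OF BS[OF p] I3(1)] Y_f1[OF BS[OF p] I3(2)] R_\<phi> X\<rho>[OF p] F1_def F2_def by (simp add: algebra_simps)
  finally show ?thesis using dir[OF p] by simp
 qed
 have YF2: "Y F2 p = - lam * p (jZ 1) * F2 p - \<phi> 3 p * F1 p + f 3 1 p * \<rho> p" if p: "p \<in> B" for p
 proof -
  have "Y F2 p = (- \<nu>) * Y (f 1 1) p + \<kappa> * Y (f 2 1) p" unfolding F2_def[abs_def] by (rule derivation_lin[OF o p fr(1,3)])
  also have "\<dots> = (\<kappa> * X (\<phi> 2) p - \<nu> * X (\<phi> 1) p) - lam * p (jZ 1) * F2 p - \<phi> 3 p * F1 p + f 3 1 p * \<rho> p"
   unfolding Y_f1[OF BS[OF p] I3(1)] Y_f1[OF BS[OF p] I3(2)] R_\<phi> \<rho>_def F1_def F2_def by (simp add: algebra_simps)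
  finally show ?thesis using Xdir[OF p] by simp
 qed
 have YF3: "Y (f 3 1) p = X (\<phi> 3) p - lam * p (jZ 1) * f 3 1 p + \<rho> p * F2 p" if p: "p \<in> B" for p
  unfolding Y_f1[OF BS[OF p] I3(3)] R_\<phi> \<delta>[OF p] by simp
 \<comment> \<open>The constraint determines \<open>A'\<close>. Applying \<open>Y\<close> to that
   expression and using the rotation of \<open>(A', C')\<close> determines \<open>C'\<close> up to
   the factor \<open>\<phi>_3\<close>.\<close>
 have star: "\<phi> 3 p * C' p = 2 * t * (\<phi> 3 p * F1 p - f 3 1 p * \<rho> p)" if p: "p \<in> B" for p
 proof -
  have "Y A' p = (- 2 * t) * Y F2 p" unfolding c1[OF fF(2) p, symmetric] by (rule derivation_cong[OF o p A'F])
  then show ?thesis unfolding YA'[OF p] YF2[OF p] A'F[OF p] by (simp add: algebra_simps)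
 qed
 have \<rho>0: "\<rho> p \<noteq> 0" if "p \<in> B" for p using \<rho>F[OF that] by auto
 show False
 proof (cases "\<forall>p\<in>B. f 3 1 p = 0")
  case True
  have m: "\<mu> 3 = 0" "\<eta> 3 = 0" by (rule frame_zero[OF o Bne BsubS I3(3)], use True in blast)+
  have "\<not> (\<forall>p\<in>B. \<phi> 3 p = 0)" using no_zero_\<phi>3[OF o box(2) BsubS m] by blast
  then obtain p1 where p1: "p1 \<in> B" "\<phi> 3 p1 \<noteq> 0" by blast
  obtain D where D: "jet_box D" "D \<noteq> {}" "D \<subseteq> B" "\<forall>q\<in>D. \<phi> 3 q \<noteq> 0" using nonzero_box[OF o fr(6) p1] by blast
  note oD = jet_box_open[OF D(1)]
  have DB: "p \<in> B" if "p \<in> D" for p using that D(3) by blast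
  \<comment> \<open>With \<open>f_31 = 0\<close> the second component is known as well; its
    \<open>Y\<close>-derivative gives that \<rho> has zero total derivative, so the frame is
    constant.\<close>
  have C'F: "C' p = (2 * t) * F1 p" if p: "p \<in> D" for p
   using star[OF DB[OF p]] True DB[OF p] D(4) p by simp
  have X\<rho>0: "X \<rho> p = 0" if p: "p \<in> D" for p
  proof -
   note pB = DB[OF p]
   have "Y C' p = (2 * t) * Y F1 p" unfolding c1[OF fF(1) pB, symmetric] by (rule derivation_cong[OF oD p C'F])
   then have "(2 * t) * X \<rho> p = 0" unfolding YC'[OF pB] YF1[OF pB] A'F[OF pB] C'F[OF p] by (simp add: algebra_simps)
   then show ?thesis using t0 by simp
  qed
  have X\<phi>: "X (\<phi> 1) p = 0" "X (\<phi> 2) p = 0" if p: "p \<in> D" for p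
  proof -
   note pB = DB[OF p]
   have "X (\<phi> 1) p = \<kappa> * X \<rho> p" unfolding c1[OF f\<rho> pB, symmetric] by (rule derivation_cong[OF o pB \<phi>\<rho>(1)])
   then show "X (\<phi> 1) p = 0" using X\<rho>0[OF p] by simp
   have "X (\<phi> 2) p = \<nu> * X \<rho> p" unfolding c1[OF f\<rho> pB, symmetric] by (rule derivation_cong[OF o pB \<phi>\<rho>(2)])
   then show "X (\<phi> 2) p = 0" using X\<rho>0[OF p] by simp
  qed
  have DS: "D \<subseteq> S" using D(3) BsubS by blast
  show False by (rule no_constant_frame[OF oD D(2) DS m X\<phi>])
 next
  case False
  then obtain p1 where p1: "p1 \<in> B" "f 3 1 p1 \<noteq> 0" by blast
  obtain D1 where D1: "jet_box D1" "D1 \<noteq> {}" "D1 \<subseteq> B" "\<forall>q\<in>D1. f 3 1 q \<noteq> 0" using nonzero_box[OF o fr(5) p1] by blast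
  obtain p2 where p2: "p2 \<in> D1" using D1(2) by blast
  have p2B: "p2 \<in> B" using p2 D1(3) by blast
  have "\<phi> 3 p2 \<noteq> 0"
  proof
   assume "\<phi> 3 p2 = 0"
   then have "f 3 1 p2 * \<rho> p2 = 0" using star[OF p2B] t0 by simp
   then show False using \<rho>0[OF p2B] D1(4) p2 by simp
  qed
  then obtain D where D: "jet_box D" "D \<noteq> {}" "D \<subseteq> D1" "\<forall>q\<in>D. \<phi> 3 q \<noteq> 0"
   using nonzero_box[OF jet_box_open[OF D1(1)] fs_subset[OF fr(6) D1(3)] p2] by blast
  note oD = jet_box_open[OF D(1)]
  have DsB: "D \<subseteq> B" using D(3) D1(3) by blast
  have DB: "p \<in> B" if "p \<in> D" for p using that DsB by blast
  have nz: "\<phi> 3 p \<noteq> 0" "f 3 1 p \<noteq> 0" if "p \<in> D" for p using that D(3,4) D1(4) by blast+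
  \<comment> \<open>This ratio is what \<open>C'\<close> involves beyond the frame. In the
    \<open>Y\<close>-derivative of the formula for \<open>C'\<close>, \<open>u_t\<close> and
    \<open>u_xt\<close> occur only through \<open>Y k\<close>, so the gradient of \<open>k\<close>
    vanishes; the rest of the equation then says that \<open>k\<close> times a nonzero function is
    zero.\<close>
  define k where "k p = \<rho> p / \<phi> 3 p" for p
  have fk: "fs D k" unfolding k_def[abs_def] by (rule fs_divide[OF oD fs_subset[OF f\<rho> DsB] fs_subset[OF fr(6) DsB] nz(1)])
  have dk: "depends_on {jZ 0, jZ 1} D k"
  proof -
   have "depends_on {jZ 0, jZ 1} B \<rho>" unfolding \<rho>_def[abs_def] by (rule depends_on_op2[OF dep(1,2), of "\<lambda>x y. \<kappa> * x + \<nu> * y"])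
   from depends_on_op2[OF this dep(3), of "\<lambda>x y. x / y"] have "depends_on {jZ 0, jZ 1} B k" unfolding k_def[abs_def] .
   then show ?thesis by (rule depends_on_mono[OF _ order_refl DsB])
  qed
  have \<rho>k: "\<rho> p = k p * \<phi> 3 p" if "p \<in> D" for p using nz(1)[OF that] by (simp add: k_def)
  have C'k: "C' p = (2 * t) * F1 p + (- 2 * t) * (f 3 1 p * k p)" if p: "p \<in> D" for p
  proof -
   have "\<phi> 3 p * C' p = \<phi> 3 p * ((2 * t) * F1 p + (- 2 * t) * (f 3 1 p * k p))"
    unfolding star[OF DB[OF p]] \<rho>k[OF p] by (simp add: algebra_simps)
   then show ?thesis using nz(1)[OF p] by simp
  qed
  note fF3 = fs_subset[OF fr(5) DsB] and fF1 = fs_subset[OF fF(1) DsB]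
  have YC'k: "- lam * p (jZ 1) * C' p - \<phi> 3 p * A' p = (2 * t) * Y F1 p + (- 2 * t) * (Y (f 3 1) p * k p + f 3 1 p * Y k p)" if p: "p \<in> D" for p
  proof -
   have "Y C' p = Y (\<lambda>p. (2 * t) * F1 p + (- 2 * t) * (f 3 1 p * k p)) p" by (rule derivation_cong[OF oD p C'k])
   then show ?thesis unfolding derivation_lin[OF oD p fF1 fs_mult[OF oD fF3 fk]] derivation_mult[OF oD p fF3 fk] YC'[OF DB[OF p]] .
  qed
  have k0: "pd z k p = 0" if p: "p \<in> D" and z: "z \<in> {jZ 0, jZ 1}" for p z
  proof -
   define w where "w = (z = jZ 0)"
   define y where "y = (if w then jW 0 else jV 0)"
   obtain s where s: "s \<noteq> p y" "p(y := s) \<in> D" by (rule slice_other[OF oD p])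
   let ?q = "p(y := s)"
   note pB = DB[OF p] and qB = DB[OF s(2)]
   note i1 = WV_invariant[OF BS[OF pB] y_def I3(1), of s] and i2 = WV_invariant[OF BS[OF pB] y_def I3(2), of s] and i3 = WV_invariant[OF BS[OF pB] y_def I3(3), of s]
   have kq: "k ?q = k p" unfolding k_def \<rho>_def i1(2) i2(2) i3(2) ..
   have iAC: "A' ?q = A' p" "C' ?q = C' p" unfolding A'_def C'_def inv[OF pB qB y_def] by simp_all
   have YF1q: "Y F1 ?q = Y F1 p" unfolding F1_def[abs_def] derivation_lin[OF o pB fr(1,3)] derivation_lin[OF o qB fr(1,3)] i1(4) i2(4) ..
   have d: "Y k ?q = Y k p + pd z k p * (s - p y)" using Y_low_difference[OF oD p dk y_def s(2)] z by (auto simp: w_def)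
   have "2 * t * f 3 1 p * pd z k p * (s - p y) = 0"
    using YC'k[OF p] YC'k[OF s(2)] unfolding iAC YF1q i3(1,2,4) i1(5) kq d by (simp add: algebra_simps)
   then show ?thesis using t0 nz(2)[OF p] s(1) by simp
  qed
  obtain p where p: "p \<in> D" using D(2) by blast
  note pB = DB[OF p]
  have Yk: "Y k p = 0" "X k p = 0" unfolding X_low[OF oD p dk] using k0[OF p] by simp_all
  have "X \<rho> p = X (\<lambda>p. k p * \<phi> 3 p) p" by (rule derivation_cong[OF oD p \<rho>k])
  then have X\<rho>k: "X \<rho> p = k p * X (\<phi> 3) p" unfolding derivation_mult[OF oD p fk fs_subset[OF fr(6) DsB]] Yk by simp
  have "(2 * t) * (k p * (\<rho> p * F2 p)) = 0"
   using YC'k[OF p] unfolding Yk YF1[OF pB] YF3[OF pB] A'F[OF pB] C'k[OF p] X\<rho>k by (simp add: algebra_simps)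
  then have "k p = 0" using t0 \<rho>F[OF pB] by simp
  then show False using \<rho>k[OF p] \<rho>0[OF pB] by simp
 qed
qed

end

section \<open>Universal second fundamental forms\<close>

lemma pd_zero_slice:
 assumes "open B" "p \<in> B" "\<And>s. p(y := s) \<in> B ==> F (p(y := s)) = F p"
 shows "pd y F p = 0"
proof -
 have "\<forall>\<^sub>F s in nhds (p y). F (p(y := s)) = F p"
  using eventually_slice[OF assms(1,2), of y] by (rule eventually_mono) (rule assms(3))
 then show ?thesis by (intro pd_eqI) (subst DERIV_cong_ev[OF refl _ refl, of _ "\<lambda>_. F p"], simp_all)
qed

context pss_jets
begin

text \<open>\<open>f_11\<close> varies with \<open>u_xx\<close> because \<open>h'\<close> is
  nonzero, so an identity affine in \<open>f_11\<close> with coefficients free of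
  \<open>u_xx\<close> splits.\<close>

lemma affine_in_h:
 assumes B: "open B" "B \<subseteq> S" and p: "p \<in> B" and eq: "\<And>q. q \<in> B ==> f 1 1 q * M q + N q = 0"
  and inv: "\<And>s. p(jZ 2 := s) \<in> B ==> M (p(jZ 2 := s)) = M p \<and> N (p(jZ 2 := s)) = N p"
 shows "M p = 0" "N p = 0"
proof -
 have pS: "p \<in> S" using p B(2) by blast
 have "\<not> (\<forall>s. p(jZ 2 := s) \<in> B \<longrightarrow> f 1 1 (p(jZ 2 := s)) = f 1 1 p)"
 proof
  assume "\<forall>s. p(jZ 2 := s) \<in> B \<longrightarrow> f 1 1 (p(jZ 2 := s)) = f 1 1 p"
  then have "pd (jZ 2) (f 1 1) p = 0" by (intro pd_zero_slice[OF B(1) p]) blast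
  then show False using f1_derivatives(2)[OF pS I3(1)] h'_nonzero[OF pS] by simp
 qed
 then obtain s where s: "p(jZ 2 := s) \<in> B" "f 1 1 (p(jZ 2 := s)) \<noteq> f 1 1 p" by blast
 have "f 1 1 (p(jZ 2 := s)) * M p + N p = 0" using eq[OF s(1)] inv[OF s(1)] by simp
 then have "(f 1 1 (p(jZ 2 := s)) - f 1 1 p) * M p = 0" using eq[OF p] unfolding left_diff_distrib by linarith
 then show "M p = 0" using s(2) by simp
 then show "N p = 0" using eq[OF p] by simp
qed

text \<open>For \<open>a, b, c\<close> depending on \<open>x\<close>, \<open>t\<close> alone, the
  Codazzi equations are affine in \<open>f_11\<close> and split. \<open>D1\<close>,
  \<open>D2\<close>, \<open>w\<close> are the coefficients of \<open>f_11\<close> in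
  \<open>Delta f 1 3\<close>, \<open>Delta f 2 3\<close>, \<open>Delta f 1 2\<close>; their total
  derivatives are free of \<Gamma>, so the structure equations for these combinations split
  too.\<close>

lemma universal_relations:
 assumes B: "open B" "B \<noteq> {}" and s: "sff B a b c" and u: "depends_on {jX, jT} B a" "depends_on {jX, jT} B b" "depends_on {jX, jT} B c"
 shows "1 + (\<mu> 2)\<^sup>2 = (\<mu> 3)\<^sup>2 \<and> \<mu> 2 * \<eta> 2 = \<mu> 3 * \<eta> 3"
proof -
 note BsubS = sffD(2)[OF s]
 have BS: "p \<in> S" if "p \<in> B" for p using that BsubS by blast
 have XY: "X F p = pd jX F p" "Y F p = pd jT F p + lam * p (jZ 0) * pd jX F p" if "depends_on {jX, jT} B F" "p \<in> B" for F p
  unfolding derivation_eq_sum[OF B(1) that(1) _ that(2), simplified] by (simp_all add: cX_def cY_def cT_def)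
 define h where "h p = f 1 1 p" for p
 have F2: "f 2 1 p = \<mu> 2 * h p + \<eta> 2" and F3: "f 3 1 p = \<mu> 3 * h p + \<eta> 3" if "p \<in> B" for p
  using C[OF I3(2) BS[OF that]] C[OF I3(3) BS[OF that]] by (simp_all add: h_def)
 define D1 where "D1 p = 1 * \<phi> 3 p + (- \<mu> 3) * \<phi> 1 p" for p
 define D2 where "D2 p = \<mu> 2 * \<phi> 3 p + (- \<mu> 3) * \<phi> 2 p" for p
 define w where "w p = 1 * \<phi> 2 p + (- \<mu> 2) * \<phi> 1 p" for p
 note fr = fs_frame[OF I3(1) BsubS] fs_frame[OF I3(2) BsubS] fs_frame[OF I3(3) BsubS]
 note dep = depends_on_mono[OF \<phi>_depends[OF I3(1)] order_refl BsubS] depends_on_mono[OF \<phi>_depends[OF I3(2)] order_refl BsubS]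
  depends_on_mono[OF \<phi>_depends[OF I3(3)] order_refl BsubS]
 have fD: "fs B D1" "fs B D2" "fs B w" unfolding D1_def[abs_def] D2_def[abs_def] w_def[abs_def]
  by (rule fs_lin[OF B(1) fr(6,2)], rule fs_lin[OF B(1) fr(6,4)], rule fs_lin[OF B(1) fr(4,2)])
 have dD: "depends_on {jZ 0, jZ 1} B D1" "depends_on {jZ 0, jZ 1} B D2" "depends_on {jZ 0, jZ 1} B w"
  unfolding D1_def[abs_def] D2_def[abs_def] w_def[abs_def]
  by (rule depends_on_op2[OF dep(3,1), of "\<lambda>x y. 1 * x + (- \<mu> 3) * y"], rule depends_on_op2[OF dep(3,2), of "\<lambda>x y. \<mu> 2 * x + (- \<mu> 3) * y"],
    rule depends_on_op2[OF dep(2,1), of "\<lambda>x y. 1 * x + (- \<mu> 2) * y"])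
 define U1 where "U1 p = pd jT a p + lam * p (jZ 0) * pd jX a p + \<mu> 2 * (pd jT b p + lam * p (jZ 0) * pd jX b p) - 2 * b p * D1 p + (a p - c p) * D2 p" for p
 define U2 where "U2 p = pd jT b p + lam * p (jZ 0) * pd jX b p + \<mu> 2 * (pd jT c p + lam * p (jZ 0) * pd jX c p) + (a p - c p) * D1 p + 2 * b p * D2 p" for p
 define V1 where "V1 p = \<eta> 2 * (pd jT b p + lam * p (jZ 0) * pd jX b p) - \<phi> 1 p * pd jX a p - \<phi> 2 p * pd jX b p
   + 2 * b p * \<eta> 3 * \<phi> 1 p + (a p - c p) * (\<eta> 2 * \<phi> 3 p - \<eta> 3 * \<phi> 2 p)" for p
 define V2 where "V2 p = \<eta> 2 * (pd jT c p + lam * p (jZ 0) * pd jX c p) - \<phi> 1 p * pd jX b p - \<phi> 2 p * pd jX c p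
   - (a p - c p) * \<eta> 3 * \<phi> 1 p + 2 * b p * (\<eta> 2 * \<phi> 3 p - \<eta> 3 * \<phi> 2 p)" for p
 have e1: "f 1 1 p * U1 p + V1 p = 0" if p: "p \<in> B" for p
  using sffD(7)[OF s p] unfolding XY[OF u(1) p] XY[OF u(2) p] Delta_\<phi> F2[OF p] F3[OF p] h_def U1_def V1_def D1_def D2_def
  by (simp add: algebra_simps)
 have e2: "f 1 1 p * U2 p + V2 p = 0" if p: "p \<in> B" for p
  using sffD(8)[OF s p] unfolding XY[OF u(2) p] XY[OF u(3) p] Delta_\<phi> F2[OF p] F3[OF p] h_def U2_def V2_def D1_def D2_def
  by (simp add: algebra_simps)
 have inv: "F (p(y := s)) = F p" "pd v F (p(y := s)) = pd v F p" if "depends_on {jX, jT} B F" "p \<in> B" "p(y := s) \<in> B" "y \<in> {jZ 0, jZ 1, jZ 2}" for F p y s v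
 proof -
  have y: "y \<notin> {jX, jT}" using that(4) by auto
  show "F (p(y := s)) = F p" by (rule slice_invariant[OF that(1,2,3) y])
  show "pd v F (p(y := s)) = pd v F p" by (rule slice_invariant[OF depends_on_pd[OF B(1) that(1)] that(2,3) y])
 qed
 have inv2: "F (p(jZ 2 := s)) = F p" "pd v F (p(jZ 2 := s)) = pd v F p" if "depends_on {jZ 0, jZ 1} B F" "p \<in> B" "p(jZ 2 := s) \<in> B" for F p s v
  by (rule slice_invariant[OF that], simp, rule slice_invariant[OF depends_on_pd[OF B(1) that(1)] that(2,3)], simp)
 have y3: "jZ 0 \<in> {jZ 0, jZ 1, jZ 2}" "jZ 1 \<in> {jZ 0, jZ 1, jZ 2}" "jZ 2 \<in> {jZ 0, jZ 1, jZ 2}" by auto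
 have z2: "(p(jZ 2 := s)) (jZ 0) = p (jZ 0)" "(p(jZ 2 := s)) (jZ 1) = p (jZ 1)" for p :: jet and s by simp_all
 have UV: "U1 p = 0" "V1 p = 0" "U2 p = 0" "V2 p = 0" if p: "p \<in> B" for p
 proof -
  have i: "U1 (p(jZ 2 := s)) = U1 p \<and> V1 (p(jZ 2 := s)) = V1 p" "U2 (p(jZ 2 := s)) = U2 p \<and> V2 (p(jZ 2 := s)) = V2 p" if q: "p(jZ 2 := s) \<in> B" for s
   unfolding U1_def V1_def U2_def V2_def z2 inv[OF u(1) p q y3(3)] inv[OF u(2) p q y3(3)] inv[OF u(3) p q y3(3)]
    inv2(1)[OF dep(1) p q] inv2(1)[OF dep(2) p q] inv2(1)[OF dep(3) p q] inv2(1)[OF dD(1) p q] inv2(1)[OF dD(2) p q] by simp_all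
  show "U1 p = 0" by (rule affine_in_h(1)[OF B(1) BsubS p e1 i(1)])
  show "V1 p = 0" by (rule affine_in_h(2)[OF B(1) BsubS p e1 i(1)])
  show "U2 p = 0" by (rule affine_in_h(1)[OF B(1) BsubS p e2 i(2)])
  show "V2 p = 0" by (rule affine_in_h(2)[OF B(1) BsubS p e2 i(2)])
 qed
 \<comment> \<open>Up to sign the determinant of the linear system for \<open>D1\<close>,
   \<open>D2\<close>. By the Gauss equation it equals \<open>(a + c)^2 + 4\<close> and never
   vanishes, so \<open>D1\<close> and \<open>D2\<close> do not vary with \<open>u_x\<close>.\<close>
 define k where "k p = 4 * (b p)\<^sup>2 + (a p - c p)\<^sup>2" for p
 have k0: "k p \<noteq> 0" if p: "p \<in> B" for p
 proof -
  have "k p = (a p + c p)\<^sup>2 + 4"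
   using sffD(6)[OF s p] unfolding k_def by (simp add: power2_eq_square algebra_simps)
  then show ?thesis using zero_le_power2[of "a p + c p"] by linarith
 qed
 have kD: "k p * D1 p = 2 * b p * (pd jT a p + lam * p (jZ 0) * pd jX a p + \<mu> 2 * (pd jT b p + lam * p (jZ 0) * pd jX b p))
    - (a p - c p) * (pd jT b p + lam * p (jZ 0) * pd jX b p + \<mu> 2 * (pd jT c p + lam * p (jZ 0) * pd jX c p))"
   "k p * D2 p = - (a p - c p) * (pd jT a p + lam * p (jZ 0) * pd jX a p + \<mu> 2 * (pd jT b p + lam * p (jZ 0) * pd jX b p))
    - 2 * b p * (pd jT b p + lam * p (jZ 0) * pd jX b p + \<mu> 2 * (pd jT c p + lam * p (jZ 0) * pd jX c p))" if p: "p \<in> B" for p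
  using UV(1)[OF p] UV(3)[OF p] unfolding U1_def U2_def k_def by algebra+
 have z1: "(p(jZ 1 := s)) (jZ 0) = p (jZ 0)" for p :: jet and s by simp
 have D_inv: "D1 (p(jZ 1 := s)) = D1 p" "D2 (p(jZ 1 := s)) = D2 p" if p: "p \<in> B" and q: "p(jZ 1 := s) \<in> B" for p s
 proof -
  note i = inv[OF u(1) p q y3(2)] inv[OF u(2) p q y3(2)] inv[OF u(3) p q y3(2)]
  have "k (p(jZ 1 := s)) = k p" unfolding k_def i ..
  then have "k p * D1 (p(jZ 1 := s)) = k p * D1 p" "k p * D2 (p(jZ 1 := s)) = k p * D2 p"
   using kD[OF q] kD[OF p] unfolding i z1 by simp_all
  then show "D1 (p(jZ 1 := s)) = D1 p" "D2 (p(jZ 1 := s)) = D2 p" using k0[OF p] by simp_all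
 qed
 have D_1: "pd (jZ 1) D1 p = 0" "pd (jZ 1) D2 p = 0" if p: "p \<in> B" for p
  by (rule pd_zero_slice[OF B(1) p], rule D_inv(1)[OF p], assumption, rule pd_zero_slice[OF B(1) p], rule D_inv(2)[OF p], assumption)
 have XD: "X D1 p = pd (jZ 0) D1 p * p (jZ 1)" "X D2 p = pd (jZ 0) D2 p * p (jZ 1)" if p: "p \<in> B" for p
  unfolding X_low(1)[OF B(1) p dD(1)] X_low(1)[OF B(1) p dD(2)] D_1[OF p] by simp_all
 have X\<phi>: "X (\<phi> i) p = \<mu> i * h' p * \<Gamma> p + lam * p (jZ 1) * f i 1 p + R i p" if "p \<in> B" "i \<in> {1, 2, 3}" for i p
  using Y_f1[OF BS[OF that(1)] that(2)] XY_f1(2)[OF BS[OF that(1)] that(2)] by simp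
 define N3 where "N3 p = lam * p (jZ 1) * \<eta> 3 + (- \<eta> 2 * \<phi> 1 p - \<mu> 3 * \<eta> 3 * \<phi> 2 p + \<mu> 3 * \<eta> 2 * \<phi> 3 p)" for p
 define N2 where "N2 p = lam * p (jZ 1) * \<eta> 2 + (\<mu> 2 * \<eta> 2 * \<phi> 3 p - \<eta> 3 * \<phi> 1 p - \<mu> 2 * \<eta> 3 * \<phi> 2 p)" for p
 have Xw: "X w p = f 1 1 p * (D1 p + \<mu> 2 * D2 p) + N2 p" if p: "p \<in> B" for p
  unfolding w_def[abs_def] derivation_lin[OF B(1) p fr(4,2)] X\<phi>[OF p I3(1)] X\<phi>[OF p I3(2)] R_\<phi> F2[OF p] F3[OF p] h_def N2_def D1_def D2_def \<mu>1
  by (simp add: algebra_simps)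
 have XD1: "X D1 p = f 1 1 p * (w p + \<mu> 3 * D2 p) + N3 p" if p: "p \<in> B" for p
  unfolding D1_def[abs_def] derivation_lin[OF B(1) p fr(6,2)] X\<phi>[OF p I3(1)] X\<phi>[OF p I3(3)] R_\<phi> F2[OF p] F3[OF p] h_def N3_def w_def D2_def \<mu>1
  by (simp add: algebra_simps)
 have N_inv: "N2 (p(jZ 2 := s)) = N2 p" "N3 (p(jZ 2 := s)) = N3 p" if p: "p \<in> B" and q: "p(jZ 2 := s) \<in> B" for p s
  unfolding N2_def N3_def z2 inv2(1)[OF dep(1) p q] inv2(1)[OF dep(2) p q] inv2(1)[OF dep(3) p q] by simp_all
 \<comment> \<open>The total derivative of \<open>D1\<close> is computed twice: from the structure
   equations, where it is affine in \<open>f_11\<close>, and from independence of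
   \<open>u_x\<close>, where it is free of \<open>f_11\<close>.\<close>
 have w3: "w p + \<mu> 3 * D2 p = 0" "N3 p - pd (jZ 0) D1 p * p (jZ 1) = 0" if p: "p \<in> B" for p
 proof -
  have e: "f 1 1 q * (w q + \<mu> 3 * D2 q) + (N3 q - pd (jZ 0) D1 q * q (jZ 1)) = 0" if "q \<in> B" for q
   using XD1[OF that] XD(1)[OF that] by simp
  have i: "w (p(jZ 2 := s)) + \<mu> 3 * D2 (p(jZ 2 := s)) = w p + \<mu> 3 * D2 p \<and>
   N3 (p(jZ 2 := s)) - pd (jZ 0) D1 (p(jZ 2 := s)) * (p(jZ 2 := s)) (jZ 1) = N3 p - pd (jZ 0) D1 p * p (jZ 1)" if q: "p(jZ 2 := s) \<in> B" for s
   unfolding N_inv[OF p q] z2 inv2[OF dD(1) p q] inv2[OF dD(2) p q] inv2[OF dD(3) p q] by simp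
  show "w p + \<mu> 3 * D2 p = 0" by (rule affine_in_h(1)[OF B(1) BsubS p e i])
  show "N3 p - pd (jZ 0) D1 p * p (jZ 1) = 0" by (rule affine_in_h(2)[OF B(1) BsubS p e i])
 qed
 have c1: "derivation K (\<lambda>p. x * F p) p = x * derivation K F p" if "fs B F" "p \<in> B" for K x F p
  by (simp add: derivation_mult[OF B(1) that(2) fs_const[OF B(1)] that(1)] derivation_const)
 have Xw': "X w p = - \<mu> 3 * (pd (jZ 0) D2 p * p (jZ 1))" if p: "p \<in> B" for p
 proof -
  have "X w p = X (\<lambda>p. - \<mu> 3 * D2 p) p" by (rule derivation_cong[OF B(1) p]) (use w3(1) in \<open>simp add: eq_neg_iff_add_eq_0\<close>)
  then show ?thesis unfolding c1[OF fD(2) p] XD[OF p] .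
 qed
 have D12: "D1 p + \<mu> 2 * D2 p = 0" "N2 p + \<mu> 3 * (pd (jZ 0) D2 p * p (jZ 1)) = 0" if p: "p \<in> B" for p
 proof -
  have e: "f 1 1 q * (D1 q + \<mu> 2 * D2 q) + (N2 q + \<mu> 3 * (pd (jZ 0) D2 q * q (jZ 1))) = 0" if "q \<in> B" for q
   using Xw[OF that] Xw'[OF that] by simp
  have i: "D1 (p(jZ 2 := s)) + \<mu> 2 * D2 (p(jZ 2 := s)) = D1 p + \<mu> 2 * D2 p \<and>
   N2 (p(jZ 2 := s)) + \<mu> 3 * (pd (jZ 0) D2 (p(jZ 2 := s)) * (p(jZ 2 := s)) (jZ 1)) = N2 p + \<mu> 3 * (pd (jZ 0) D2 p * p (jZ 1))" if q: "p(jZ 2 := s) \<in> B" for s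
   unfolding N_inv[OF p q] z2 inv2[OF dD(1) p q] inv2[OF dD(2) p q] by simp
  show "D1 p + \<mu> 2 * D2 p = 0" by (rule affine_in_h(1)[OF B(1) BsubS p e i])
  show "N2 p + \<mu> 3 * (pd (jZ 0) D2 p * p (jZ 1)) = 0" by (rule affine_in_h(2)[OF B(1) BsubS p e i])
 qed
 have N3': "N3 p + \<mu> 2 * (pd (jZ 0) D2 p * p (jZ 1)) = 0" if p: "p \<in> B" for p
 proof -
  have "pd (jZ 0) D1 p = pd (jZ 0) (\<lambda>p. - \<mu> 2 * D2 p) p"
   by (rule pd_cong[OF B(1) p]) (use D12(1) in \<open>simp add: eq_neg_iff_add_eq_0\<close>)
  also have "\<dots> = - \<mu> 2 * pd (jZ 0) D2 p"
   by (rule pder_pd, (rule pder_mult pder_const pder_Ck[OF p] fs_Ck[OF fD(2)])+) simp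
  finally show ?thesis using w3(2)[OF p] by simp
 qed
 have \<phi>23: "\<phi> 2 p = \<mu> 2 * \<phi> 1 p - \<mu> 3 * D2 p" "\<phi> 3 p = \<mu> 3 * \<phi> 1 p - \<mu> 2 * D2 p" if p: "p \<in> B" for p
  using w3(1)[OF p] D12(1)[OF p] by (simp_all add: w_def D1_def)
 \<comment> \<open>In the definition of \<open>D2\<close> the functions \<open>\<phi>_2\<close>,
   \<open>\<phi>_3\<close> are replaced by their expressions in \<open>\<phi>_1\<close> and
   \<open>D2\<close>; \<open>\<phi>_1\<close> drops out.\<close>
 have D2eq: "(1 + (\<mu> 2)\<^sup>2 - (\<mu> 3)\<^sup>2) * D2 p = 0" if p: "p \<in> B" for p
 proof -
  have "D2 p = \<mu> 2 * (\<mu> 3 * \<phi> 1 p - \<mu> 2 * D2 p) + (- \<mu> 3) * (\<mu> 2 * \<phi> 1 p - \<mu> 3 * D2 p)"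
   unfolding \<phi>23[OF p, symmetric] by (rule D2_def)
  then show ?thesis by (simp add: algebra_simps power2_eq_square)
 qed
 obtain p0 where p0: "p0 \<in> B" using B(2) by blast
 show ?thesis
 proof (cases "\<forall>p\<in>B. D2 p = 0")
  case False
  then obtain p where p: "p \<in> B" "D2 p \<noteq> 0" by blast
  have m: "1 + (\<mu> 2)\<^sup>2 = (\<mu> 3)\<^sup>2" using D2eq[OF p(1)] p(2) by simp
  \<comment> \<open>Were \<kappa> nonzero, \<open>D2\<close> would be \<open>- lam u_x\<close>; but
    \<open>D2\<close> does not vary with \<open>u_x\<close> and is nonzero at
    \<open>p\<close>.\<close>
  define \<kappa> where "\<kappa> = \<mu> 3 * \<eta> 3 - \<mu> 2 * \<eta> 2"
  have \<kappa>D: "\<kappa> * (D2 q + lam * q (jZ 1)) = 0" if q: "q \<in> B" for q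
  proof -
   have "N2 q = lam * q (jZ 1) * \<eta> 2 - \<kappa> * \<phi> 3 q" unfolding N2_def \<kappa>_def \<phi>23[OF q] using m by algebra
   then have 1: "\<kappa> * \<phi> 3 q = q (jZ 1) * (lam * \<eta> 2 + \<mu> 3 * pd (jZ 0) D2 q)" using D12(2)[OF q] by (simp add: algebra_simps)
   have "N3 q = lam * q (jZ 1) * \<eta> 3 - \<kappa> * \<phi> 2 q" unfolding N3_def \<kappa>_def \<phi>23[OF q] using m by algebra
   then have 2: "\<kappa> * \<phi> 2 q = q (jZ 1) * (lam * \<eta> 3 + \<mu> 2 * pd (jZ 0) D2 q)" using N3'[OF q] by (simp add: algebra_simps)
   have "\<kappa> * D2 q = \<mu> 2 * (\<kappa> * \<phi> 3 q) - \<mu> 3 * (\<kappa> * \<phi> 2 q)" by (simp add: D2_def algebra_simps)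
   then show ?thesis unfolding 1 2 by (simp add: \<kappa>_def algebra_simps)
  qed
  have "\<kappa> = 0"
  proof (rule ccontr)
   assume \<kappa>: "\<kappa> \<noteq> 0"
   have e: "D2 q = - lam * q (jZ 1)" if "q \<in> B" for q using \<kappa>D[OF that] \<kappa> by (simp add: add_eq_0_iff2)
   obtain s where s: "s \<noteq> p (jZ 1)" "p(jZ 1 := s) \<in> B" by (rule slice_other[OF B(1) p(1)])
   have "lam * s = lam * p (jZ 1)" using D_inv(2)[OF p(1) s(2)] unfolding e[OF p(1)] e[OF s(2)] by simp
   then have "lam = 0" using s(1) by simp
   then show False using e[OF p(1)] p(2) by simp
  qed
  then show ?thesis using m by (simp add: \<kappa>_def)
 next
  case True
  have \<phi>: "\<phi> 2 p = \<mu> 2 * \<phi> 1 p" "\<phi> 3 p = \<mu> 3 * \<phi> 1 p" "D1 p = 0" "D2 p = 0" "pd (jZ 0) D2 p = 0" if p: "p \<in> B" for p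
  proof -
   show d: "D2 p = 0" using True p by blast
   show "\<phi> 2 p = \<mu> 2 * \<phi> 1 p" "\<phi> 3 p = \<mu> 3 * \<phi> 1 p" "D1 p = 0" using \<phi>23[OF p] D12(1)[OF p] d by simp_all
   show "pd (jZ 0) D2 p = 0" by (rule pd_zero_fun[OF B(1) p]) (use True in blast)
  qed
  have nz: "\<eta> 2 \<noteq> 0" "\<phi> 1 p \<noteq> 0" if p: "p \<in> B" for p
  proof -
   have "Delta f 1 2 p = - \<eta> 2 * \<phi> 1 p" unfolding Delta_\<phi> \<phi>(1)[OF p] F2[OF p] h_def by (simp add: algebra_simps)
   then show "\<eta> 2 \<noteq> 0" "\<phi> 1 p \<noteq> 0" using Delta12[OF BS[OF p]] by auto
  qed
  have I: "lam * p (jZ 1) * \<eta> 2 + \<phi> 1 p * (\<mu> 2 * \<mu> 3 * \<eta> 2 - \<eta> 3 * (1 + (\<mu> 2)\<^sup>2)) = 0" if p: "p \<in> B" for p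
   using D12(2)[OF p] unfolding N2_def \<phi>[OF p] by (simp add: algebra_simps power2_eq_square)
  have II: "lam * p (jZ 1) * \<eta> 3 + \<phi> 1 p * (((\<mu> 3)\<^sup>2 - 1) * \<eta> 2 - \<mu> 2 * \<mu> 3 * \<eta> 3) = 0" if p: "p \<in> B" for p
   using N3'[OF p] unfolding N3_def \<phi>[OF p] by (simp add: algebra_simps power2_eq_square)
  show ?thesis
  proof (cases "lam = 0")
   case True
   have i: "\<mu> 2 * \<mu> 3 * \<eta> 2 = \<eta> 3 * (1 + (\<mu> 2)\<^sup>2)" and ii: "((\<mu> 3)\<^sup>2 - 1) * \<eta> 2 = \<mu> 2 * \<mu> 3 * \<eta> 3"
    using I[OF p0] II[OF p0] nz(2)[OF p0] True by simp_all
   have "(1 + (\<mu> 2)\<^sup>2 - (\<mu> 3)\<^sup>2) * \<eta> 2 = 0" using i ii by algebra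
   then have m: "1 + (\<mu> 2)\<^sup>2 = (\<mu> 3)\<^sup>2" using nz(1)[OF p0] by simp
   have "\<mu> 3 * (\<mu> 2 * \<eta> 2 - \<mu> 3 * \<eta> 3) = 0" using i unfolding m by (simp add: algebra_simps power2_eq_square)
   moreover have "\<mu> 3 \<noteq> 0"
   proof
    assume "\<mu> 3 = 0"
    then have "1 + (\<mu> 2)\<^sup>2 = 0" using m by simp
    then show False using zero_le_power2[of "\<mu> 2"] by linarith
   qed
   ultimately show ?thesis using m by simp
  next
   case False
   \<comment> \<open>For nonzero \<open>lam\<close>, moving \<open>u\<close> isolates the
     x-derivatives in \<open>U1\<close>, \<open>U2\<close>, and moving \<open>u_x\<close> changes
     \<open>\<phi>_1\<close> and splits \<open>V1\<close>, \<open>V2\<close> once more. This yields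
     \<open>\<eta> 3 = 0\<close> and \<open>\<mu> 3 = 0\<close>, which the identity
     \<open>II\<close> excludes.\<close>
   obtain s0 where s0: "s0 \<noteq> p0 (jZ 0)" "p0(jZ 0 := s0) \<in> B" by (rule slice_other[OF B(1) p0])
   obtain s1 where s1: "s1 \<noteq> p0 (jZ 1)" "p0(jZ 1 := s1) \<in> B" by (rule slice_other[OF B(1) p0])
   have u0: "pd jX a p0 + \<mu> 2 * pd jX b p0 = 0" "pd jX b p0 + \<mu> 2 * pd jX c p0 = 0"
   proof -
    note i = inv[OF u(1) p0 s0(2) y3(1)] inv[OF u(2) p0 s0(2) y3(1)] inv[OF u(3) p0 s0(2) y3(1)]
    have s00: "(p0(jZ 0 := s0)) (jZ 0) = s0" by simp
    have "lam * (s0 - p0 (jZ 0)) * (pd jX a p0 + \<mu> 2 * pd jX b p0) = 0" "lam * (s0 - p0 (jZ 0)) * (pd jX b p0 + \<mu> 2 * pd jX c p0) = 0"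
     using UV(1)[OF p0] UV(1)[OF s0(2)] UV(3)[OF p0] UV(3)[OF s0(2)]
     unfolding U1_def U2_def \<phi>(3,4)[OF p0] \<phi>(3,4)[OF s0(2)] i s00 by (simp_all add: algebra_simps)
    then show "pd jX a p0 + \<mu> 2 * pd jX b p0 = 0" "pd jX b p0 + \<mu> 2 * pd jX c p0 = 0" using False s0(1) by simp_all
   qed
   let ?q = "p0(jZ 1 := s1)"
   note i = inv[OF u(1) p0 s1(2) y3(2)] inv[OF u(2) p0 s1(2) y3(2)] inv[OF u(3) p0 s1(2) y3(2)]
   have q1: "?q (jZ 1) = s1" by simp
   have \<phi>q: "\<phi> 1 ?q \<noteq> \<phi> 1 p0"
   proof
    assume e: "\<phi> 1 ?q = \<phi> 1 p0"
    have "lam * s1 * \<eta> 2 = lam * p0 (jZ 1) * \<eta> 2" using I[OF p0] I[OF s1(2)] unfolding e q1 by linarith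
    then show False using False nz(1)[OF p0] s1(1) by simp
   qed
   define \<zeta> where "\<zeta> = \<eta> 2 * \<mu> 3 - \<eta> 3 * \<mu> 2"
   have v: "\<eta> 2 * (pd jT b p0 + lam * p0 (jZ 0) * pd jX b p0) + r * (2 * b p0 * \<eta> 3 + (a p0 - c p0) * \<zeta>) = 0
     \<and> \<eta> 2 * (pd jT c p0 + lam * p0 (jZ 0) * pd jX c p0) + r * (- (a p0 - c p0) * \<eta> 3 + 2 * b p0 * \<zeta>) = 0" if r: "r \<in> {\<phi> 1 p0, \<phi> 1 ?q}" for r
   proof -
    have e1: "V1 p0 = \<eta> 2 * (pd jT b p0 + lam * p0 (jZ 0) * pd jX b p0) + \<phi> 1 p0 * (2 * b p0 * \<eta> 3 + (a p0 - c p0) * \<zeta>) - \<phi> 1 p0 * (pd jX a p0 + \<mu> 2 * pd jX b p0)"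
     "V1 ?q = \<eta> 2 * (pd jT b p0 + lam * p0 (jZ 0) * pd jX b p0) + \<phi> 1 ?q * (2 * b p0 * \<eta> 3 + (a p0 - c p0) * \<zeta>) - \<phi> 1 ?q * (pd jX a p0 + \<mu> 2 * pd jX b p0)"
     unfolding V1_def \<phi>(1,2)[OF p0] \<phi>(1,2)[OF s1(2)] i z1 \<zeta>_def by (simp_all add: algebra_simps)
    have e2: "V2 p0 = \<eta> 2 * (pd jT c p0 + lam * p0 (jZ 0) * pd jX c p0) + \<phi> 1 p0 * (- (a p0 - c p0) * \<eta> 3 + 2 * b p0 * \<zeta>) - \<phi> 1 p0 * (pd jX b p0 + \<mu> 2 * pd jX c p0)"
     "V2 ?q = \<eta> 2 * (pd jT c p0 + lam * p0 (jZ 0) * pd jX c p0) + \<phi> 1 ?q * (- (a p0 - c p0) * \<eta> 3 + 2 * b p0 * \<zeta>) - \<phi> 1 ?q * (pd jX b p0 + \<mu> 2 * pd jX c p0)"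
     unfolding V2_def \<phi>(1,2)[OF p0] \<phi>(1,2)[OF s1(2)] i z1 \<zeta>_def by (simp_all add: algebra_simps)
    have z: "V1 p0 = 0" "V1 ?q = 0" "V2 p0 = 0" "V2 ?q = 0" using UV[OF p0] UV[OF s1(2)] by blast+
    from r show ?thesis
    proof
     assume "r = \<phi> 1 p0"
     then show ?thesis using e1(1) e2(1) unfolding z u0 by simp
    next
     assume "r \<in> {\<phi> 1 ?q}"
     then have "r = \<phi> 1 ?q" by (rule singletonD)
     then show ?thesis using e1(2) e2(2) unfolding z u0 by simp
    qed
   qed
   have lin: "y = 0" if "x + \<phi> 1 p0 * y = 0" "x + \<phi> 1 ?q * y = 0" for x y :: real
   proof -
    have "(\<phi> 1 ?q - \<phi> 1 p0) * y = 0" using that by (simp only: left_diff_distrib)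
    then show ?thesis using \<phi>q by simp
   qed
   have l1: "2 * b p0 * \<eta> 3 + (a p0 - c p0) * \<zeta> = 0" by (rule lin) (use v in blast)+
   have l2: "- (a p0 - c p0) * \<eta> 3 + 2 * b p0 * \<zeta> = 0" by (rule lin) (use v in blast)+
   have "k p0 * \<eta> 3 = 0" "k p0 * \<zeta> = 0" using l1 l2 unfolding k_def by algebra+
   then have "\<eta> 3 = 0" "\<zeta> = 0" using k0[OF p0] by simp_all
   then have "\<eta> 3 = 0" "\<mu> 3 = 0" using nz(1)[OF p0] by (simp_all add: \<zeta>_def)
   then show ?thesis using II[OF p0] nz[OF p0] by simp
  qed
 qed
qed

text \<open>Each of the two isotropic cases is impossible on a nonempty open set, and non-isotropy
  is an open condition; so both conditions hold on a small enough box.\<close>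

lemma universal_dense:
 assumes s: "sff V a b c" and V: "V \<noteq> {}"
 shows "\<exists>B. jet_box B \<and> B \<noteq> {} \<and> B \<subseteq> V \<and> depends_on {jX, jT} B a \<and> depends_on {jX, jT} B b \<and> depends_on {jX, jT} B c"
proof -
 note o = sffD(1)[OF s] and VS = sffD(2)[OF s] and fa = sffD(3-5)[OF s]
 note fr = fs_frame[OF I3(1) VS] fs_frame[OF I3(2) VS]
 have fII: "fs V (II_F a b c)" "fs V (II_\<phi> a b c)"
  unfolding II_F_def[abs_def] II_\<phi>_def[abs_def] power2_eq_square
  by (intro fs_add fs_mult fs_const o fa fr)+
 have "\<not> (\<forall>p\<in>V. II_F a b c p = 0)" using no_isotropic_frame[OF s V] by blast
 then obtain p1 where p1: "p1 \<in> V" "II_F a b c p1 \<noteq> 0" by blast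
 obtain B1 where B1: "jet_box B1" "B1 \<noteq> {}" "B1 \<subseteq> V" "\<forall>q\<in>B1. II_F a b c q \<noteq> 0" using nonzero_box[OF o fII(1) p1] by blast
 have s1: "sff B1 a b c" by (rule sff_subset[OF s jet_box_open[OF B1(1)] B1(3)])
 have "\<not> (\<forall>p\<in>B1. II_\<phi> a b c p = 0)" using no_degenerate_\<phi>[OF s1 B1(2)] B1(4) by blast
 then obtain p2 where p2: "p2 \<in> B1" "II_\<phi> a b c p2 \<noteq> 0" by blast
 obtain B2 where B2: "jet_box B2" "B2 \<noteq> {}" "B2 \<subseteq> B1" "\<forall>q\<in>B2. II_\<phi> a b c q \<noteq> 0"
  using nonzero_box[OF jet_box_open[OF B1(1)] fs_subset[OF fII(2) B1(3)] p2] by blast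
 have s2: "sff B2 a b c" by (rule sff_subset[OF s1 jet_box_open[OF B2(1)] B2(3)])
 have "depends_on {jX, jT} B2 a \<and> depends_on {jX, jT} B2 b \<and> depends_on {jX, jT} B2 c"
  by (rule universal_box[OF B2(1) s2]) (use B1(4) B2(3,4) in blast)+
 then show ?thesis using B1(3) B2(1-3) by (intro exI[of _ B2]) blast
qed

text \<open>Partial derivatives other than those in \<open>x\<close> and \<open>t\<close> vanish on
  a dense set, hence everywhere by continuity. So \<open>F\<close> is locally constant on each fibre
  over \<open>(x, t)\<close>, and constant there because the fibres are connected.\<close>

lemma function_of_xt_if_dense:
 assumes o: "open \<Omega>" and F: "fs \<Omega> F" and conn: "\<forall>x t. connected {p \<in> \<Omega>. p jX = x \<and> p jT = t}"
  and dense: "\<And>V. open V ==> V \<subseteq> \<Omega> ==> V \<noteq> {} ==> \<exists>B. jet_box B \<and> B \<noteq> {} \<and> B \<subseteq> V \<and> depends_on {jX, jT} B F"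
 shows "function_of_xt \<Omega> F"
proof -
 have pd0: "pd y F p = 0" if p: "p \<in> \<Omega>" and y: "y \<notin> {jX, jT}" for y p
 proof (rule ccontr)
  assume nz: "pd y F p \<noteq> 0"
  have "continuous_on \<Omega> (pd y F)" using Ck_Suc_pd[OF fs_Ck[OF F, of "Suc 0"], of y] by (rule Ck_continuous)
  then have "open (\<Omega> \<inter> pd y F -` (- {0}))" by (rule continuous_open_preimage[OF _ o]) (intro open_Compl closed_singleton)
  moreover have "\<Omega> \<inter> pd y F -` (- {0}) \<noteq> {}" using p nz by blast
  ultimately obtain B where B: "jet_box B" "B \<noteq> {}" "B \<subseteq> \<Omega> \<inter> pd y F -` (- {0})" "depends_on {jX, jT} B F"
   using dense[of "\<Omega> \<inter> pd y F -` (- {0})"] by blast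
  obtain q where q: "q \<in> B" using B(2) by blast
  have "pd y F q = 0" by (rule pd_zero_outside[OF jet_box_open[OF B(1)] B(4) q y])
  then show False using B(3) q by blast
 qed
 obtain K where K: "finite K" "depends_on K \<Omega> F" using F unfolding fs_def by blast
 have eq: "F p = F q" if pq: "p \<in> \<Omega>" "q \<in> \<Omega>" "p jX = q jX" "p jT = q jT" for p q
 proof -
  define L where "L = {r \<in> \<Omega>. r jX = p jX \<and> r jT = p jT}"
  have "connected L" unfolding L_def using conn by blast
  moreover have "p \<in> L" "q \<in> L" using pq by (simp_all add: L_def)
  moreover have "\<forall>r\<in>L. \<forall>\<^sub>F r' in at r within L. F r = F r'"
  proof
   fix r assume r: "r \<in> L"
   then have r\<Omega>: "r \<in> \<Omega>" by (simp add: L_def)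
   obtain D where D: "jet_box D" "r \<in> D" "D \<subseteq> \<Omega>" using jet_box_exists[OF o r\<Omega>] by blast
   have dD: "depends_on {jX, jT} D F"
   proof (rule jet_box_drop_set[OF D(1) Ck_subset[OF fs_Ck[OF F] D(3)], of "K - {jX, jT}"])
    show "finite (K - {jX, jT})" using K(1) by simp
    show "depends_on (K - {jX, jT} \<union> {jX, jT}) D F" by (rule depends_on_mono[OF K(2) _ D(3)]) blast
    show "pd y F p = 0" if "p \<in> D" "y \<in> K - {jX, jT}" for p y by (rule pd0) (use that D(3) in blast)+
   qed
   have "F r = F r'" if "r' \<in> D" "r' \<in> L" for r'
    by (rule depends_onD[OF dD D(2) that(1)]) (use that(2) r in \<open>auto simp: L_def\<close>)
   then show "\<forall>\<^sub>F r' in at r within L. F r = F r'"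
    unfolding eventually_at_topological using jet_box_open[OF D(1)] D(2) by blast
  qed
  ultimately show ?thesis by (rule connected_local_const)
 qed
 define \<alpha> where "\<alpha> x t = F (SOME p. p \<in> \<Omega> \<and> p jX = x \<and> p jT = t)" for x t
 have "F p = \<alpha> (p jX) (p jT)" if p: "p \<in> \<Omega>" for p
 proof -
  have "(SOME q. q \<in> \<Omega> \<and> q jX = p jX \<and> q jT = p jT) \<in> \<Omega> \<and> (SOME q. q \<in> \<Omega> \<and> q jX = p jX \<and> q jT = p jT) jX = p jX \<and>
   (SOME q. q \<in> \<Omega> \<and> q jX = p jX \<and> q jT = p jT) jT = p jT"
   by (rule someI[of "\<lambda>q. q \<in> \<Omega> \<and> q jX = p jX \<and> q jT = p jT" p]) (use p in simp)
  then show ?thesis unfolding \<alpha>_def by (intro eq[OF p]) auto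
 qed
 then show ?thesis unfolding function_of_xt_def by blast
qed

lemma classification:
 assumes \<Omega>: "open \<Omega>" "\<Omega> \<noteq> {}" "\<Omega> \<subseteq> S" "\<forall>x t. connected {p \<in> \<Omega>. p jX = x \<and> p jT = t}"
  and f: "fs \<Omega> a" "fs \<Omega> b" "fs \<Omega> c" and I: "second_fundamental_form \<Omega> lam G f a b c"
 shows "(family_A U lam G \<or> family_B U lam G) \<and> function_of_xt \<Omega> a \<and> function_of_xt \<Omega> b \<and> function_of_xt \<Omega> c"
proof -
 have s: "sff \<Omega> a b c"
  unfolding sff_def
 proof (intro conjI ballI \<Omega> f)
  fix p assume "p \<in> \<Omega>"
  note e = bspec[OF I[unfolded second_fundamental_form_def] this]
  show "a p * c p - (b p)\<^sup>2 = -1" using e by blast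
  show "f 1 1 p * Y a p + f 2 1 p * Y b p - \<phi> 1 p * X a p - \<phi> 2 p * X b p
    - 2 * b p * Delta f 1 3 p + (a p - c p) * Delta f 2 3 p = 0"
   using conjunct1[OF conjunct2[OF e]] unfolding Dt_Y Dx_X f2_eq by (simp add: algebra_simps)
  show "f 1 1 p * Y b p + f 2 1 p * Y c p - \<phi> 1 p * X b p - \<phi> 2 p * X c p
    + (a p - c p) * Delta f 1 3 p + 2 * b p * Delta f 2 3 p = 0"
   using conjunct2[OF conjunct2[OF e]] unfolding Dt_Y Dx_X f2_eq by (simp add: algebra_simps)
 qed
 have dense: "\<exists>B. jet_box B \<and> B \<noteq> {} \<and> B \<subseteq> V \<and> depends_on {jX, jT} B a \<and> depends_on {jX, jT} B b \<and> depends_on {jX, jT} B c"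
  if "open V" "V \<subseteq> \<Omega>" "V \<noteq> {}" for V
  by (rule universal_dense[OF sff_subset[OF s that(1,2)] that(3)])
 obtain B where B: "jet_box B" "B \<noteq> {}" "B \<subseteq> \<Omega>" "depends_on {jX, jT} B a" "depends_on {jX, jT} B b" "depends_on {jX, jT} B c"
  using dense[OF \<Omega>(1) order_refl \<Omega>(2)] by blast
 note oB = jet_box_open[OF B(1)]
 have rel: "1 + (\<mu> 2)\<^sup>2 = (\<mu> 3)\<^sup>2 \<and> \<mu> 2 * \<eta> 2 = \<mu> 3 * \<eta> 3"
  by (rule universal_relations[OF oB B(2) sff_subset[OF s oB B(3)] B(4-6)])
 obtain p where "p \<in> S" using \<Omega>(2,3) by blast
 then have "U \<noteq> {}" by (auto simp: S_def jets_over_def)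
 then have "family_A U lam G \<or> family_B U lam G" using exceptional_family rel by blast
 moreover have "function_of_xt \<Omega> a" by (rule function_of_xt_if_dense[OF \<Omega>(1) f(1) \<Omega>(4)]) (use dense in blast)
 moreover have "function_of_xt \<Omega> b" by (rule function_of_xt_if_dense[OF \<Omega>(1) f(2) \<Omega>(4)]) (use dense in blast)
 moreover have "function_of_xt \<Omega> c" by (rule function_of_xt_if_dense[OF \<Omega>(1) f(3) \<Omega>(4)]) (use dense in blast)
 ultimately show ?thesis by blast
qed

end

lemma finite_jet_function_fs:
 assumes "finite_jet_function \<Omega> a"
 shows "fs \<Omega> a"
proof -
 obtain l m n where d: "depends_on ({jX, jT} \<union> jZ ` {..l} \<union> jW ` {..<m} \<union> jV ` {..<n}) \<Omega> a"
  using assms unfolding finite_jet_function_def by blast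
 have fin: "finite ({jX, jT} \<union> jZ ` {..l} \<union> jW ` {..<m} \<union> jV ` {..<n})" by simp
 have "smooth_on \<Omega> a" using assms unfolding finite_jet_function_def by (rule conjunct1)
 then have C: "\<forall>k. Ck k \<Omega> a" by (rule iffD1[OF smooth_on_iff_Ck])
 show ?thesis unfolding fs_def by (rule conjI[OF C], rule exI, rule conjI[OF fin d])
qed

theorem theorem1p1:
 fixes U :: "(real \<times> real \<times> real) set"
  and lam :: real
  and G :: "real \<Rightarrow> real \<Rightarrow> real \<Rightarrow> real"
  and f :: "nat \<Rightarrow> nat \<Rightarrow> jet \<Rightarrow> real"
  and \<mu> \<eta> :: "nat \<Rightarrow> real"
  and \<Omega> :: "jet set"
  and a b c :: "jet \<Rightarrow> real"
 assumes U: "open U" "convex U"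
  and G_smooth: "smooth_on (jets_over U) (\<lambda>p. G (p (jZ 0)) (p (jZ 1)) (p (jZ 2)))"
  and G_nonzero: "\<exists>(z0,z1,z2)\<in>U. G z0 z1 z2 \<noteq> 0"
  and pss: "describes_pss U lam G f"
  and C: "\<forall>i\<in>{2,3}. \<forall>p\<in>jets_over U. f i 1 p = \<mu> i * f 1 1 p + \<eta> i"
  and Delta: "\<forall>p\<in>jets_over U. (Delta f 1 3 p)\<^sup>2 + (Delta f 2 3 p)\<^sup>2 \<noteq> 0"
  and \<Omega>: "open \<Omega>" "\<Omega> \<noteq> {}" "\<Omega> \<subseteq> jets_over U"
   "\<forall>x t. connected {p \<in> \<Omega>. p jX = x \<and> p jT = t}"
  and finite_jet: "finite_jet_function \<Omega> a" "finite_jet_function \<Omega> b"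
   "finite_jet_function \<Omega> c"
  and immersion: "second_fundamental_form \<Omega> lam G f a b c"
 shows "(family_A U lam G \<or> family_B U lam G) \<and>
  function_of_xt \<Omega> a \<and> function_of_xt \<Omega> b \<and> function_of_xt \<Omega> c"
proof -
 \<comment> \<open>The trivial values at index 1 extend (C) to all three forms.\<close>
 define \<mu>' where "\<mu>' i = (if i = 1 then 1 else \<mu> i)" for i :: nat
 define \<eta>' where "\<eta>' i = (if i = 1 then 0 else \<eta> i)" for i :: nat
 note P = pss[unfolded describes_pss_def]
 have dep: "\<exists>l. \<forall>i\<in>{1, 2, 3}. \<forall>j\<in>{1, 2}. depends_on (jZ ` {..l}) (jets_over U) (f i j)"
 proof -
  have "\<forall>i\<in>{1, 2, 3}. \<forall>j\<in>{1, 2}. \<exists>l. depends_on (jZ ` {..l}) (jets_over U) (f i j)" using P by blast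
  then obtain l where l: "\<forall>i\<in>{1, 2, 3}. \<forall>j\<in>{1, 2}. depends_on (jZ ` {..l i j}) (jets_over U) (f i j)" by metis
  have "depends_on (jZ ` {..l 1 1 + l 1 2 + l 2 1 + l 2 2 + l 3 1 + l 3 2}) (jets_over U) (f i j)" if "i \<in> {1, 2, 3}" "j \<in> {1, 2}" for i j
  proof (rule depends_on_mono[OF bspec[OF bspec[OF l that(1)] that(2)] image_mono order_refl])
   show "{..l i j} \<subseteq> {..l 1 1 + l 1 2 + l 2 1 + l 2 2 + l 3 1 + l 3 2}" using that by auto
  qed
  then show ?thesis by blast
 qed
 interpret pss_jets U lam G "jets_over U" f \<mu>' \<eta>'
 proof unfold_locales
  show "open U" "convex U" by (rule U)+
  show "Ck k (jets_over U) (\<lambda>p. G (p (jZ 0)) (p (jZ 1)) (p (jZ 2)))" for k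
   using G_smooth unfolding smooth_on_iff_Ck by blast
  show "Ck k (jets_over U) (f i j)" if "i \<in> {1, 2, 3}" "j \<in> {1, 2}" for i j k
   using P that unfolding smooth_on_iff_Ck by blast
  show "\<exists>l. \<forall>i\<in>{1, 2, 3}. \<forall>j\<in>{1, 2}. depends_on (jZ ` {..l}) (jets_over U) (f i j)" by (rule dep)
  show "f i 1 p = \<mu>' i * f 1 1 p + \<eta>' i" if "i \<in> {1, 2, 3}" "p \<in> jets_over U" for i p
   using C that by (auto simp: \<mu>'_def \<eta>'_def)
  show "\<mu>' 1 = 1" "\<eta>' 1 = 0" by (simp_all add: \<mu>'_def \<eta>'_def)
  show "Delta f 1 2 p \<noteq> 0" if "p \<in> jets_over U" for p using P that by blast
  fix D u
  assume D: "open D" "\<forall>k. Ck k {p. (p jX, p jT) \<in> D} (\<lambda>p. u (p jX) (p jT))"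
   and uU: "\<And>x t. (x, t) \<in> D ==> (u x t, dx u x t, dx (dx u) x t) \<in> U"
  have "Delta f 1 2 (jet_of u x t) \<noteq> 0" if "(x, t) \<in> D" for x t
  proof -
   have "jet_of u x t \<in> jets_over U" using uU[OF that] by (simp add: jets_over_def jet_of_def numeral_2_eq_2)
   then show ?thesis using P by blast
  qed
  moreover have "(\<forall>(x, t)\<in>D. structure_eqs f u x t) \<longleftrightarrow> (\<forall>(x, t)\<in>D. equation_T lam G u x t \<and> Delta f 1 2 (jet_of u x t) \<noteq> 0)"
   by (rule mp[OF spec[OF spec[OF conjunct2[OF conjunct2[OF P]], of D], of u]]) (use D uU in \<open>auto simp: smooth_on_iff_Ck\<close>)
  ultimately show "(\<forall>(x, t)\<in>D. structure_eqs f u x t) \<longleftrightarrow> (\<forall>(x, t)\<in>D. equation_T lam G u x t)" by auto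
 qed
 show ?thesis
  by (rule classification[OF \<Omega> finite_jet_function_fs[OF finite_jet(1)] finite_jet_function_fs[OF finite_jet(2)] finite_jet_function_fs[OF finite_jet(3)] immersion])
qed

end
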